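(* Let $\mathcal{A}(c)=\mathbb{C}[L^{c,c^{-1}}]$, with its structure of a (complexified) cluster algebra with principal coefficients at the initial seed with cluster $\mathbf{x}=(x_{\omega_i;c}:i\in I)$, coefficient tuple $(y_{i;c}:i\in I)$ and exchange matrix $B(c)$. For every $\gamma\in\Pi(c)$, the $F$-polynomial $F_{z;\mathbf{x}}$ of the cluster variable $z=x_{\gamma;c}$ has constant term $1$.
   Context: Root data. $G$ is a simply connected semisimple complex group with Cartan matrix $A=(a_{i,j})_{i,j\in I}$, $I=\{1,\dots,n\}$, simple roots $\alpha_i$, simple coroots $\alpha_i^\vee$, $a_{i,j}=\alpha_j(\alpha_i^\vee)$, fundamental weights $\omega_i$ ($\alpha_j=\sum_i a_{i,j}\omega_i$), and Weyl group $W$ generated by simple reflections $s_i$, with longest element $w_\circ$; $\omega_{i^\star}=-w_\circ\omega_i$. The index set is numbered so that the fixed Coxeter element is $c=s_1\cdots s_n$. Write $i\prec_c j$ if $a_{i,j}\ne0$ and $i<j$. $B(c)=(b_{i,j})$: $b_{i,j}=-a_{i,j}$ if $i\prec_c j$, $b_{i,j}=a_{i,j}$ if $j\prec_c i$, $b_{i,j}=0$ otherwise. Order weights by $\gamma\ge\delta$ iff $\gamma-\delta$ is a nonnegative integer combination of simple roots; $h(i;c)$ is the (unique) positive integer with $\omega_i>c\omega_i>\cdots>c^{h(i;c)}\omega_i=-\omega_{i^\star}$; $\Pi(c)=\{c^m\omega_i:i\in I,\,0\le m\le h(i;c)\}$. Group. Let $\varphi_i:SL_2\to G$ be the canonical embedding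 for $\alpha_i$, $x_i(t)=\varphi_i\begin{pmatrix}1&t\\0&1\end{pmatrix}$, $x_{\bar i}(t)=\varphi_i\begin{pmatrix}1&0\\t&1\end{pmatrix}$, $\overline{s_i}=\varphi_i\begin{pmatrix}0&-1\\1&0\end{pmatrix}$. $N$ (resp. $N_-$) is generated by all $x_i(t)$ (resp. $x_{\bar i}(t)$), $H$ is the maximal torus, $B_-=HN_-$. $\overline{w}=\overline{s_{i_1}}\cdots\overline{s_{i_\ell}}$ for any reduced word of $w\in W$. Each $x\in N_-HN$ is uniquely $[x]_-[x]_0[x]_+$ with factors in $N_-,H,N$; a weight $\gamma$ is a character $a\mapsto a^\gamma$ of $H$. The generalized minor $\Delta_{u\omega_i,v\omega_i}$ ($u,v\in W$) is the regular function on $G$ restricting to $x\mapsto([\overline{u}^{-1}x\overline{v}]_0)^{\omega_i}$ on $\overline{u}N_-HN\overline{v}^{-1}$; it depends only on $u\omega_i,v\omega_i$. $L^{c,c^{-1}}=N\overline{c}N\cap B_-c^{-1}B_-$. $x_{\gamma;c}$ is the restriction of $\Delta_{\gamma,\gamma}$ to $L^{c,c^{-1}}$; each $\Delta_{\omega_i,c\omega_i}$ vanishes nowhere on $L^{c,c^{-1}}$, and $y_{j;c}$ is the restriction of $\Delta_{\omega_j,c\omega_j}\prod_{i\prec_c j}\Delta_{\omega_i,c\omega_i}^{a_{i,j}}$. Cluster algebras. $\mathrm{Trop}(u_j:j\in J)$ is the free abelian multiplicative group on the $u_j$ with $\prod u_j^{a_j}\oplus\prod u_j^{b_j}=\prod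 u_j^{\min(a_j,b_j)}$. Here the coefficient semifield is $\mathbb{P}=\mathrm{Trop}(y_{i;c}:i\in I)$ (principal coefficients) and the ambient field is the fraction field of $\mathbb{C}[L^{c,c^{-1}}]$, generated over $\mathbb{C}$ by the algebraically independent elements $x_{\omega_i;c},y_{i;c}$. A seed is $(\mathbf{x},\mathbf{y},B)$ with cluster $\mathbf{x}$, coefficient tuple $\mathbf{y}$ in $\mathbb{P}$, and exchange matrix $B$. With $[b]_+=\max(b,0)$, the mutation $\mu_k$ gives $(\mathbf{x}',\mathbf{y}',B')$: $b'_{i,j}=-b_{i,j}$ if $i=k$ or $j=k$, otherwise $b'_{i,j}=b_{i,j}+[b_{i,k}]_+[b_{k,j}]_+-[-b_{i,k}]_+[-b_{k,j}]_+$; $y'_k=y_k^{-1}$, $y'_j=y_jy_k^{[b_{k,j}]_+}(y_k\oplus1)^{-b_{k,j}}$ for $j\ne k$; $x'_j=x_j$ for $j\ne k$, $x_kx'_k=\dfrac{y_k\prod_i x_i^{[b_{i,k}]_+}+\prod_i x_i^{[-b_{i,k}]_+}}{y_k\oplus1}$. Cluster variables are all elements of clusters of seeds obtained from the initial seed by sequences of mutations; they are exactly the $x_{\gamma;c}$ with $\gamma\in\Pi(c)$. $F$-polynomials. Write the initial seed as $(x_1,\dots,x_n)$, $(y_1,\dots,y_n)$, $B(c)=(b_{i,j})$ and set $\widehat y_j=y_j\prod_{i=1}^n x_i^{b_{i,j}}$. Every cluster variable $z$ can be uniquely written as $z=x_1^{g_1}\cdots x_n^{g_n}F_{z;\mathbf{x}}(\widehat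 y_1,\dots,\widehat y_n)$ with $(g_1,\dots,g_n)\in\mathbb{Z}^n$ and $F_{z;\mathbf{x}}\in\mathbb{Z}[u_1,\dots,u_n]$ a polynomial not divisible by any $u_i$; $F_{z;\mathbf{x}}$ is the $F$-polynomial of $z$. *)

theory Defs
  imports "HOL-Analysis.Analysis" "HOL-Algebra.Generated_Groups" "HOL-Library.Poly_Mapping"
begin

section \<open>Root data\<close>

text \<open>
  The index set \<open>I = {1,\<dots>,n}\<close> is a finite linearly ordered type \<open>'i\<close>; the order is the numbering
  for which the Coxeter element is the product of the simple reflections in increasing order.
  Weights are integer vectors of coordinates with respect to the fundamental weights, so that
  \<open>\<gamma> $ i\<close> is the value of \<open>\<gamma>\<close> on the simple coroot \<open>\<alpha>\<^sub>i\<^sup>\<or>\<close>.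
\<close>

type_synonym 'i weight = "(int, 'i) vec"
type_synonym 'i int_matrix = "((int, 'i) vec, 'i) vec"

definition cartan_matrix :: "'i::finite int_matrix \<Rightarrow> bool" where
  "cartan_matrix A \<longleftrightarrow>
     (\<forall>i. A $ i $ i = 2) \<and>
     (\<forall>i j. i \<noteq> j \<longrightarrow> A $ i $ j \<le> 0) \<and>
     (\<forall>i j. A $ i $ j = 0 \<longrightarrow> A $ j $ i = 0) \<and>
     (\<exists>d :: 'i \<Rightarrow> real. (\<forall>i. d i > 0) \<and>
        (\<forall>i j. d i * of_int (A $ i $ j) = d j * of_int (A $ j $ i)) \<and>
        (\<forall>v :: real^'i. v \<noteq> 0 \<longrightarrow>
           (\<Sum>i\<in>UNIV. \<Sum>j\<in>UNIV. d i * of_int (A $ i $ j) * v $ i * v $ j) > 0))"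

definition fund_weight :: "'i::finite \<Rightarrow> 'i weight" where
  "fund_weight i = axis i 1"

definition simple_root :: "'i int_matrix \<Rightarrow> 'i::finite \<Rightarrow> 'i weight" where
  "simple_root A j = (\<chi> i. A $ i $ j)"

definition simple_reflection :: "'i int_matrix \<Rightarrow> 'i::finite \<Rightarrow> 'i weight \<Rightarrow> 'i weight" where
  "simple_reflection A i \<gamma> = \<gamma> - (\<gamma> $ i) *s simple_root A i"

text \<open>The Weyl group is identified with its (faithful) action on the weight lattice.\<close>

definition word_action :: "'i int_matrix \<Rightarrow> 'i::finite list \<Rightarrow> 'i weight \<Rightarrow> 'i weight" where
  "word_action A ws = foldr (\<lambda>i f. simple_reflection A i \<circ> f) ws id"

definition weyl_group :: "'i int_matrix \<Rightarrow> ('i::finite weight \<Rightarrow> 'i weight) set" where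
  "weyl_group A = range (word_action A)"

definition weyl_length :: "'i int_matrix \<Rightarrow> ('i::finite weight \<Rightarrow> 'i weight) \<Rightarrow> nat" where
  "weyl_length A w = (LEAST k. \<exists>ws. word_action A ws = w \<and> length ws = k)"

definition reduced_word :: "'i int_matrix \<Rightarrow> ('i::finite weight \<Rightarrow> 'i weight) \<Rightarrow> 'i list \<Rightarrow> bool" where
  "reduced_word A w ws \<longleftrightarrow> word_action A ws = w \<and> length ws = weyl_length A w"

definition longest_element :: "'i int_matrix \<Rightarrow> 'i::finite weight \<Rightarrow> 'i weight" where
  "longest_element A =
     (THE w. w \<in> weyl_group A \<and> (\<forall>v \<in> weyl_group A. weyl_length A v \<le> weyl_length A w))"

definition weight_ge :: "'i int_matrix \<Rightarrow> 'i::finite weight \<Rightarrow> 'i weight \<Rightarrow> bool" where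
  "weight_ge A \<gamma> \<delta> \<longleftrightarrow> (\<exists>m :: 'i \<Rightarrow> nat. \<gamma> - \<delta> = (\<Sum>i\<in>UNIV. int (m i) *s simple_root A i))"

definition weight_gt :: "'i int_matrix \<Rightarrow> 'i::finite weight \<Rightarrow> 'i weight \<Rightarrow> bool" where
  "weight_gt A \<gamma> \<delta> \<longleftrightarrow> weight_ge A \<gamma> \<delta> \<and> \<gamma> \<noteq> \<delta>"

definition index_list :: "'i::{finite,linorder} list" where
  "index_list = sorted_list_of_set UNIV"

definition coxeter_element :: "'i int_matrix \<Rightarrow> 'i::{finite,linorder} weight \<Rightarrow> 'i weight" where
  "coxeter_element A = word_action A index_list"

text \<open>Note that \<open>-\<omega>\<^bsub>i\<^sup>\<star>\<^esub> = w\<^sub>\<circ> \<omega>\<^sub>i\<close>.\<close>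

definition coxeter_h :: "'i int_matrix \<Rightarrow> 'i::{finite,linorder} \<Rightarrow> nat" where
  "coxeter_h A i = (THE h. h > 0 \<and>
     (\<forall>m<h. weight_gt A ((coxeter_element A ^^ m) (fund_weight i))
                        ((coxeter_element A ^^ Suc m) (fund_weight i))) \<and>
     (coxeter_element A ^^ h) (fund_weight i) = longest_element A (fund_weight i))"

definition Pi_c :: "'i int_matrix \<Rightarrow> 'i::{finite,linorder} weight set" where
  "Pi_c A = {(coxeter_element A ^^ m) (fund_weight i) | i m. m \<le> coxeter_h A i}"

definition prec :: "'i int_matrix \<Rightarrow> 'i::{finite,linorder} \<Rightarrow> 'i \<Rightarrow> bool" where
  "prec A i j \<longleftrightarrow> A $ i $ j \<noteq> 0 \<and> i < j"

definition B_matrix :: "'i::{finite,linorder} int_matrix \<Rightarrow> 'i int_matrix" where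
  "B_matrix A = (\<chi> i j. if prec A i j then - (A $ i $ j) else if prec A j i then A $ i $ j else 0)"

section \<open>Regular functions and function fields\<close>

inductive_set polynomial_functions :: "(complex^'n^'m \<Rightarrow> complex) set" where
  const: "(\<lambda>_. a) \<in> polynomial_functions"
| entry: "(\<lambda>x. x $ i $ j) \<in> polynomial_functions"
| add: "p \<in> polynomial_functions \<Longrightarrow> q \<in> polynomial_functions \<Longrightarrow> (\<lambda>x. p x + q x) \<in> polynomial_functions"
| mult: "p \<in> polynomial_functions \<Longrightarrow> q \<in> polynomial_functions \<Longrightarrow> (\<lambda>x. p x * q x) \<in> polynomial_functions"

text \<open>
  Regular functions on a locally closed subset \<open>S\<close> of affine space: near every point (in the Zariski
  topology) a quotient of two polynomials. Functions are total; only their values on \<open>S\<close> matter.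
\<close>

definition regular_on :: "(complex^'n^'m) set \<Rightarrow> (complex^'n^'m \<Rightarrow> complex) \<Rightarrow> bool" where
  "regular_on S f \<longleftrightarrow> (\<forall>x\<in>S. \<exists>p\<in>polynomial_functions. \<exists>q\<in>polynomial_functions.
     q x \<noteq> 0 \<and> (\<forall>y\<in>S. q y \<noteq> 0 \<longrightarrow> f y = p y / q y))"

text \<open>
  The map \<open>\<iota>\<close> exhibits the field \<open>'f\<close> as the fraction field of the ring \<open>\<complex>[S]\<close> of regular functions:
  it is a ring homomorphism whose kernel consists of the functions vanishing on \<open>S\<close> (hence it is
  injective on functions on \<open>S\<close>), and each element of \<open>'f\<close> is a quotient of elements in the image.
\<close>

definition is_function_field ::
  "(complex^'n^'m) set \<Rightarrow> ((complex^'n^'m \<Rightarrow> complex) \<Rightarrow> 'f::field) \<Rightarrow> bool" where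
  "is_function_field S \<iota> \<longleftrightarrow>
     \<iota> (\<lambda>_. 1) = 1 \<and>
     (\<forall>f g. regular_on S f \<and> regular_on S g \<longrightarrow>
        \<iota> (\<lambda>x. f x + g x) = \<iota> f + \<iota> g \<and> \<iota> (\<lambda>x. f x * g x) = \<iota> f * \<iota> g) \<and>
     (\<forall>f. regular_on S f \<longrightarrow> (\<iota> f = 0 \<longleftrightarrow> (\<forall>x\<in>S. f x = 0))) \<and>
     (\<forall>r. \<exists>f g. regular_on S f \<and> regular_on S g \<and> \<iota> g \<noteq> 0 \<and> r = \<iota> f / \<iota> g)"

section \<open>The group\<close>

definition GL :: "(complex^'m^'m) monoid" where
  "GL = \<lparr>carrier = {g. invertible g}, mult = (**), one = mat 1\<rparr>"

definition SL2 :: "(complex^2^2) set" where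
  "SL2 = {g. det g = 1}"

definition mat22 :: "complex \<Rightarrow> complex \<Rightarrow> complex \<Rightarrow> complex \<Rightarrow> complex^2^2" where
  "mat22 a b c d = vector [vector [a, b], vector [c, d]]"

definition mat_prod :: "(complex^'m^'m) list \<Rightarrow> complex^'m^'m" where
  "mat_prod gs = foldr (**) gs (mat 1)"

text \<open>Throughout, \<open>\<phi> i\<close> is the embedding of \<open>SL2\<close> for the simple root \<open>\<alpha>\<^sub>i\<close>.\<close>

definition x_pos :: "('i \<Rightarrow> complex^2^2 \<Rightarrow> complex^'m^'m) \<Rightarrow> 'i \<Rightarrow> complex \<Rightarrow> complex^'m^'m" where
  "x_pos \<phi> i t = \<phi> i (mat22 1 t 0 1)"

definition x_neg :: "('i \<Rightarrow> complex^2^2 \<Rightarrow> complex^'m^'m) \<Rightarrow> 'i \<Rightarrow> complex \<Rightarrow> complex^'m^'m" where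
  "x_neg \<phi> i t = \<phi> i (mat22 1 0 t 1)"

definition coroot :: "('i \<Rightarrow> complex^2^2 \<Rightarrow> complex^'m^'m) \<Rightarrow> 'i \<Rightarrow> complex \<Rightarrow> complex^'m^'m" where
  "coroot \<phi> i t = \<phi> i (mat22 t 0 0 (inverse t))"

definition torus_elem ::
  "('i::{finite,linorder} \<Rightarrow> complex^2^2 \<Rightarrow> complex^'m^'m) \<Rightarrow> ('i \<Rightarrow> complex) \<Rightarrow> complex^'m^'m" where
  "torus_elem \<phi> t = mat_prod (map (\<lambda>i. coroot \<phi> i (t i)) index_list)"

definition group_G :: "('i \<Rightarrow> complex^2^2 \<Rightarrow> complex^'m^'m) \<Rightarrow> (complex^'m^'m) set" where
  "group_G \<phi> = generate GL (\<Union>i. \<phi> i ` SL2)"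

definition group_N :: "('i \<Rightarrow> complex^2^2 \<Rightarrow> complex^'m^'m) \<Rightarrow> (complex^'m^'m) set" where
  "group_N \<phi> = generate GL (\<Union>i. range (x_pos \<phi> i))"

definition group_N_minus :: "('i \<Rightarrow> complex^2^2 \<Rightarrow> complex^'m^'m) \<Rightarrow> (complex^'m^'m) set" where
  "group_N_minus \<phi> = generate GL (\<Union>i. range (x_neg \<phi> i))"

definition torus_H :: "('i::{finite,linorder} \<Rightarrow> complex^2^2 \<Rightarrow> complex^'m^'m) \<Rightarrow> (complex^'m^'m) set" where
  "torus_H \<phi> = {torus_elem \<phi> t | t. \<forall>i. t i \<noteq> 0}"

definition borel_minus :: "('i::{finite,linorder} \<Rightarrow> complex^2^2 \<Rightarrow> complex^'m^'m) \<Rightarrow> (complex^'m^'m) set" where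
  "borel_minus \<phi> = {h ** n | h n. h \<in> torus_H \<phi> \<and> n \<in> group_N_minus \<phi>}"

text \<open>
  A simply connected semisimple complex group with Cartan matrix \<open>A\<close>, as a linear algebraic group
  together with its canonical embeddings \<open>\<phi> i\<close> of \<open>SL2\<close>. By differentiation, the commutation
  relations say that the images of the standard generators of the Lie algebras of the copies of
  \<open>SL2\<close> satisfy the Chevalley relations \<open>[h\<^sub>i, h\<^sub>j] = 0\<close>, \<open>[h\<^sub>i, e\<^sub>j] = a\<^sub>i\<^sub>j e\<^sub>j\<close>, \<open>[h\<^sub>i, f\<^sub>j] = - a\<^sub>i\<^sub>j f\<^sub>j\<close>,
  \<open>[e\<^sub>i, f\<^sub>j] = 0\<close> for \<open>i \<noteq> j\<close> (the Serre relations are automatic in finite dimension). Hence \<open>group_G \<phi>\<close>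
  is the connected semisimple algebraic group with Cartan matrix \<open>A\<close>, maximal torus \<open>torus_H \<phi>\<close>,
  simple coroots \<open>coroot \<phi> i\<close>, and simple roots given by \<open>\<alpha>\<^sub>j(\<alpha>\<^sub>i\<^sup>\<or>(s)) = s\<^bsup>a\<^sub>i\<^sub>j\<^esup>\<close>. The last condition says that the
  simple coroots form a basis of the cocharacter lattice of the torus, that is, that the weight
  lattice is the character lattice: the group is simply connected. Conversely, each simply
  connected semisimple complex group has a faithful matrix representation, and arises in this way.
\<close>

definition simply_connected_semisimple ::
  "'i int_matrix \<Rightarrow> ('i::{finite,linorder} \<Rightarrow> complex^2^2 \<Rightarrow> complex^'m^'m) \<Rightarrow> bool" where
  "simply_connected_semisimple A \<phi> \<longleftrightarrow>
     cartan_matrix A \<and>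
     (\<forall>i. \<phi> i (mat 1) = mat 1 \<and>
          (\<forall>g\<in>SL2. \<forall>h\<in>SL2. \<phi> i (g ** h) = \<phi> i g ** \<phi> i h) \<and>
          (\<forall>k l. regular_on SL2 (\<lambda>g. \<phi> i g $ k $ l))) \<and>
     (\<forall>i j s t. s \<noteq> 0 \<and> t \<noteq> 0 \<longrightarrow> coroot \<phi> i s ** coroot \<phi> j t = coroot \<phi> j t ** coroot \<phi> i s) \<and>
     (\<forall>i j s t. s \<noteq> 0 \<longrightarrow>
        coroot \<phi> i s ** x_pos \<phi> j t ** coroot \<phi> i (inverse s) = x_pos \<phi> j (s powi (A $ i $ j) * t) \<and>
        coroot \<phi> i s ** x_neg \<phi> j t ** coroot \<phi> i (inverse s) = x_neg \<phi> j (s powi (- (A $ i $ j)) * t)) \<and>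
     (\<forall>i j s t. i \<noteq> j \<longrightarrow> x_pos \<phi> i s ** x_neg \<phi> j t = x_neg \<phi> j t ** x_pos \<phi> i s) \<and>
     inj_on (torus_elem \<phi>) {t. \<forall>i. t i \<noteq> 0}"

definition s_bar :: "('i \<Rightarrow> complex^2^2 \<Rightarrow> complex^'m^'m) \<Rightarrow> 'i \<Rightarrow> complex^'m^'m" where
  "s_bar \<phi> i = \<phi> i (mat22 0 (- 1) 1 0)"

text \<open>The representative does not depend on the choice of the reduced word.\<close>

definition weyl_bar ::
  "'i int_matrix \<Rightarrow> ('i::finite \<Rightarrow> complex^2^2 \<Rightarrow> complex^'m^'m) \<Rightarrow> ('i weight \<Rightarrow> 'i weight) \<Rightarrow> complex^'m^'m" where
  "weyl_bar A \<phi> w = mat_prod (map (s_bar \<phi>) (SOME ws. reduced_word A w ws))"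

definition torus_coords ::
  "('i::{finite,linorder} \<Rightarrow> complex^2^2 \<Rightarrow> complex^'m^'m) \<Rightarrow> complex^'m^'m \<Rightarrow> 'i \<Rightarrow> complex" where
  "torus_coords \<phi> a = (THE t. (\<forall>i. t i \<noteq> 0) \<and> torus_elem \<phi> t = a)"

text \<open>The character \<open>a \<mapsto> a\<^sup>\<gamma>\<close>: on \<open>a = \<Prod>\<^sub>i \<alpha>\<^sub>i\<^sup>\<or>(t\<^sub>i)\<close> it is \<open>\<Prod>\<^sub>i t\<^sub>i\<close> to the power \<open>\<gamma>(\<alpha>\<^sub>i\<^sup>\<or>)\<close>.\<close>

definition weight_char ::
  "('i::{finite,linorder} \<Rightarrow> complex^2^2 \<Rightarrow> complex^'m^'m) \<Rightarrow> 'i weight \<Rightarrow> complex^'m^'m \<Rightarrow> complex" where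
  "weight_char \<phi> \<gamma> a = (\<Prod>i\<in>UNIV. torus_coords \<phi> a i powi (\<gamma> $ i))"

definition gauss_cell :: "('i::{finite,linorder} \<Rightarrow> complex^2^2 \<Rightarrow> complex^'m^'m) \<Rightarrow> (complex^'m^'m) set" where
  "gauss_cell \<phi> = {n' ** h ** n | n' h n. n' \<in> group_N_minus \<phi> \<and> h \<in> torus_H \<phi> \<and> n \<in> group_N \<phi>}"

definition gauss_diag ::
  "('i::{finite,linorder} \<Rightarrow> complex^2^2 \<Rightarrow> complex^'m^'m) \<Rightarrow> complex^'m^'m \<Rightarrow> complex^'m^'m" where
  "gauss_diag \<phi> x = (THE h. h \<in> torus_H \<phi> \<and> (\<exists>n'\<in>group_N_minus \<phi>. \<exists>n\<in>group_N \<phi>. x = n' ** h ** n))"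

text \<open>
  \<open>\<Delta> \<gamma> \<delta>\<close> is the generalized minor \<open>\<Delta>\<^bsub>\<gamma>,\<delta>\<^esub>\<close>, for all \<open>\<gamma> = u \<omega>\<^sub>i\<close> and \<open>\<delta> = v \<omega>\<^sub>i\<close>: it is regular on the group and is
  given by the stated formula on a translate of the Gauss cell. As the translate is dense, this
  determines \<open>\<Delta> \<gamma> \<delta>\<close> on the group; that the same function serves all \<open>u\<close>, \<open>v\<close> giving the same weights is
  the fact that the minor depends only on these weights.
\<close>

definition generalized_minors ::
  "'i int_matrix \<Rightarrow> ('i::{finite,linorder} \<Rightarrow> complex^2^2 \<Rightarrow> complex^'m^'m) \<Rightarrow>
   ('i weight \<Rightarrow> 'i weight \<Rightarrow> complex^'m^'m \<Rightarrow> complex) \<Rightarrow> bool" where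
  "generalized_minors A \<phi> \<Delta> \<longleftrightarrow>
     (\<forall>i. \<forall>u\<in>weyl_group A. \<forall>v\<in>weyl_group A.
        regular_on (group_G \<phi>) (\<Delta> (u (fund_weight i)) (v (fund_weight i))) \<and>
        (\<forall>x. matrix_inv (weyl_bar A \<phi> u) ** x ** weyl_bar A \<phi> v \<in> gauss_cell \<phi> \<longrightarrow>
           \<Delta> (u (fund_weight i)) (v (fund_weight i)) x =
           weight_char \<phi> (fund_weight i)
             (gauss_diag \<phi> (matrix_inv (weyl_bar A \<phi> u) ** x ** weyl_bar A \<phi> v))))"

definition reduced_double_cell ::
  "'i int_matrix \<Rightarrow> ('i::{finite,linorder} \<Rightarrow> complex^2^2 \<Rightarrow> complex^'m^'m) \<Rightarrow> (complex^'m^'m) set" where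
  "reduced_double_cell A \<phi> =
     {n1 ** weyl_bar A \<phi> (coxeter_element A) ** n2 | n1 n2. n1 \<in> group_N \<phi> \<and> n2 \<in> group_N \<phi>} \<inter>
     {b1 ** weyl_bar A \<phi> (inv_into UNIV (coxeter_element A)) ** b2 | b1 b2. b1 \<in> borel_minus \<phi> \<and> b2 \<in> borel_minus \<phi>}"

text \<open>
  The elements \<open>x\<^bsub>\<gamma>;c\<^esub>\<close> and \<open>y\<^bsub>j;c\<^esub>\<close> of the fraction field of the coordinate ring of the reduced double
  cell; \<open>\<iota>\<close> only sees the restrictions of functions to the cell.
\<close>

definition x_elem ::
  "((complex^'m^'m \<Rightarrow> complex) \<Rightarrow> 'f) \<Rightarrow> ('i weight \<Rightarrow> 'i weight \<Rightarrow> complex^'m^'m \<Rightarrow> complex) \<Rightarrow> 'i::finite weight \<Rightarrow> 'f" where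
  "x_elem \<iota> \<Delta> \<gamma> = \<iota> (\<Delta> \<gamma> \<gamma>)"

definition y_elem ::
  "'i int_matrix \<Rightarrow> ((complex^'m^'m \<Rightarrow> complex) \<Rightarrow> 'f) \<Rightarrow>
   ('i weight \<Rightarrow> 'i weight \<Rightarrow> complex^'m^'m \<Rightarrow> complex) \<Rightarrow> 'i::{finite,linorder} \<Rightarrow> 'f" where
  "y_elem A \<iota> \<Delta> j = \<iota> (\<lambda>g.
     \<Delta> (fund_weight j) (coxeter_element A (fund_weight j)) g *
     (\<Prod>i\<in>{i. prec A i j}. \<Delta> (fund_weight i) (coxeter_element A (fund_weight i)) g powi (A $ i $ j)))"

section \<open>Cluster algebras over a tropical semifield\<close>

text \<open>
  The tropical semifield \<open>Trop(u\<^sub>j : j \<in> I)\<close>, with \<open>\<Prod>\<^sub>j u\<^sub>j\<^bsup>a\<^sub>j\<^esup>\<close> written additively as its exponent vector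
  \<open>a\<close>: multiplication is vector addition, the unit is \<open>0\<close>, and \<open>\<oplus>\<close> is the componentwise minimum.
  A seed has a cluster in the ambient field, a coefficient tuple of exponent vectors, and an
  exchange matrix; \<open>trop_eval u\<close> embeds the coefficient group in the ambient field.
\<close>

definition trop_add :: "'i::finite weight \<Rightarrow> 'i weight \<Rightarrow> 'i weight" where
  "trop_add a b = (\<chi> j. min (a $ j) (b $ j))"

definition trop_eval :: "('i::finite \<Rightarrow> 'f::field) \<Rightarrow> 'i weight \<Rightarrow> 'f" where
  "trop_eval u a = (\<Prod>j\<in>UNIV. u j powi (a $ j))"

definition pos_part :: "int \<Rightarrow> int" where
  "pos_part b = max b 0"

type_synonym ('i, 'f) seed = "('i \<Rightarrow> 'f) \<times> ('i \<Rightarrow> 'i weight) \<times> ('i int_matrix)"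

definition mutate_B :: "'i::finite \<Rightarrow> 'i int_matrix \<Rightarrow> 'i int_matrix" where
  "mutate_B k B = (\<chi> i j. if i = k \<or> j = k then - (B $ i $ j)
     else B $ i $ j + pos_part (B $ i $ k) * pos_part (B $ k $ j)
          - pos_part (- (B $ i $ k)) * pos_part (- (B $ k $ j)))"

definition mutate_y :: "'i::finite \<Rightarrow> 'i int_matrix \<Rightarrow> ('i \<Rightarrow> 'i weight) \<Rightarrow> 'i \<Rightarrow> 'i weight" where
  "mutate_y k B y = (\<lambda>j. if j = k then - y k
     else y j + pos_part (B $ k $ j) *s y k - (B $ k $ j) *s trop_add (y k) 0)"

definition mutate_x ::
  "('i \<Rightarrow> 'f) \<Rightarrow> 'i \<Rightarrow> 'i int_matrix \<Rightarrow> ('i \<Rightarrow> 'i weight) \<Rightarrow> ('i::finite \<Rightarrow> 'f::field) \<Rightarrow> 'i \<Rightarrow> 'f" where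
  "mutate_x u k B y x = x(k :=
     (trop_eval u (y k) * (\<Prod>i\<in>UNIV. x i powi pos_part (B $ i $ k)) +
        (\<Prod>i\<in>UNIV. x i powi pos_part (- (B $ i $ k))))
     / (trop_eval u (trop_add (y k) 0) * x k))"

definition mutate :: "('i::finite \<Rightarrow> 'f::field) \<Rightarrow> 'i \<Rightarrow> ('i, 'f) seed \<Rightarrow> ('i, 'f) seed" where
  "mutate u k S = (case S of (x, y, B) \<Rightarrow> (mutate_x u k B y x, mutate_y k B y, mutate_B k B))"

inductive_set reachable_seeds ::
    "('i::finite \<Rightarrow> 'f::field) \<Rightarrow> ('i, 'f) seed \<Rightarrow> ('i, 'f) seed set" for u S0 where
  initial: "S0 \<in> reachable_seeds u S0"
| mutation: "S \<in> reachable_seeds u S0 \<Longrightarrow> mutate u k S \<in> reachable_seeds u S0"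

definition cluster_variables :: "('i::finite \<Rightarrow> 'f::field) \<Rightarrow> ('i, 'f) seed \<Rightarrow> 'f set" where
  "cluster_variables u S0 = {x i | x y B i. (x, y, B) \<in> reachable_seeds u S0}"

text \<open>Principal coefficients: the initial coefficient tuple consists of the generators of \<open>Trop\<close>.\<close>

definition principal_seed :: "('i::finite \<Rightarrow> 'f) \<Rightarrow> 'i int_matrix \<Rightarrow> ('i, 'f) seed" where
  "principal_seed x B = (x, \<lambda>j. axis j 1, B)"

section \<open>F-polynomials\<close>

text \<open>The ring \<open>\<int>[u\<^sub>i : i \<in> I]\<close>: finitely supported maps from exponents to integer coefficients.\<close>

type_synonym 'i int_mpoly = "('i \<Rightarrow>\<^sub>0 nat) \<Rightarrow>\<^sub>0 int"

definition mpoly_var :: "'i \<Rightarrow> 'i int_mpoly" where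
  "mpoly_var i = Poly_Mapping.single (Poly_Mapping.single i 1) 1"

definition mpoly_eval :: "('i::finite \<Rightarrow> 'f::field) \<Rightarrow> 'i int_mpoly \<Rightarrow> 'f" where
  "mpoly_eval u F = (\<Sum>m\<in>Poly_Mapping.keys F.
     of_int (Poly_Mapping.lookup F m) * (\<Prod>i\<in>UNIV. u i ^ Poly_Mapping.lookup m i))"

definition constant_term :: "'i int_mpoly \<Rightarrow> int" where
  "constant_term F = Poly_Mapping.lookup F 0"

definition y_hat :: "('i::finite \<Rightarrow> 'f::field) \<Rightarrow> ('i \<Rightarrow> 'f) \<Rightarrow> 'i int_matrix \<Rightarrow> 'i \<Rightarrow> 'f" where
  "y_hat x u B j = u j * (\<Prod>i\<in>UNIV. x i powi (B $ i $ j))"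

definition F_polynomial ::
  "('i::finite \<Rightarrow> 'f::field) \<Rightarrow> ('i \<Rightarrow> 'f) \<Rightarrow> 'i int_matrix \<Rightarrow> 'f \<Rightarrow> 'i int_mpoly" where
  "F_polynomial x u B z = (THE F. (\<forall>i. \<not> mpoly_var i dvd F) \<and>
     (\<exists>g :: 'i weight. z = (\<Prod>i\<in>UNIV. x i powi (g $ i)) * mpoly_eval (y_hat x u B) F))"

end

theory Submission
  imports Defs "HOL-Computational_Algebra.Fundamental_Theorem_Algebra"
begin

text \<open>
  On the open part of the cell where no \<open>\<Delta>\<^bsub>\<omega>\<^sub>i,\<omega>\<^sub>i\<^esub>\<close> vanishes, each element is a product \<open>v h n\<close> with
  \<open>n = \<Prod> x\<^sub>i(t\<^sub>i)\<close> and \<open>v\<close>, \<open>h\<close> monomial in the values \<open>r\<^sub>i\<close> of these minors, and each \<open>(r, t)\<close> with non-zero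
  entries occurs. Conjugating by the torus gives \<open>\<Delta>\<^bsub>\<gamma>,\<gamma>\<^esub> = r\<^sup>\<gamma> F(y\<^sub>1', \<dots>, y\<^sub>n')\<close>, where the \<open>y\<^sub>j'\<close> are the values of
  the hatted coefficients and \<open>F\<close> is a polynomial; contracting \<open>v\<close> and \<open>n\<close> to the identity along a one-parameter
  subgroup of the torus gives \<open>F(0) = 1\<close>. It remains to see that \<open>F\<close>, a priori with complex coefficients, is the
  \<open>F\<close>-polynomial. The leading exponents of the hatted coefficients stay linearly independent under mutation, so the
  two exchange monomials never have the same leading term, and each cluster variable is a quotient of two
  integral Laurent polynomials with leading coefficient \<open>1\<close>. Comparing top terms makes the coefficients of \<open>F\<close>
  integral, and uniqueness follows from the independence of the Laurent monomials.
\<close>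

section \<open>Matrix products and subgroups\<close>

text \<open>The hypotheses give only relations between the copies of \<open>SL2\<close>, and
  \<open>N\<close> is just the group generated by the \<open>X i t\<close>: neither its closedness
  nor non-simple root subgroups are at hand. Yet every factorization of the cell requires that
  \<open>S k\<close> conjugates \<open>X i t\<close> into \<open>N\<close> for
  \<open>i \<noteq> k\<close>. This obstacle shapes the section on the closure of \<open>N\<close>.
  It is overcome by letting \<open>N\<close> act on the grading element \<open>rho\<close>: the
  orbit is the affine space \<open>rho + nn\<close>, so membership in \<open>N\<close> is tested by
  the effect on \<open>rho\<close> and a limit along the one-parameter subgroup \<open>mu\<close>.
  Identities that are derived only where some denominator is non-zero are extended by restriction to
  polynomial curves, on which continuity suffices. On the algebraic side, mutation divides by
  cluster variables and the Laurent property is not presupposed, so leading terms are attached to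
  quotients. Leading coefficient \<open>1\<close> survives a sum only if the two leads differ;
  principal coefficients provide this at the initial seed, where the hatted exponents have unit
  vectors as second components.\<close>

lemmas matrix_mul_assoc' = matrix_mul_assoc[symmetric]

lemma mat_prod_simps [simp]:
  "mat_prod [] = mat 1" "mat_prod (g # gs) = g ** mat_prod gs"
  by (simp_all add: mat_prod_def)

lemma mat_prod_append [simp]: "mat_prod (xs @ ys) = mat_prod xs ** mat_prod ys"
  by (induction xs) (simp_all add: matrix_mul_assoc matrix_mul_lid)

declare matrix_mul_lid [simp] matrix_mul_rid [simp]

lemma mat_mult_cancel_middle:
  fixes g :: "complex^'m^'m"
  assumes "h ** h' = mat 1" shows "(g ** h) ** (h' ** k) = g ** k"
  using assms by (metis matrix_mul_assoc matrix_mul_lid)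

lemma matrix_inv_eqI:
  fixes g :: "complex^'m^'m"
  assumes "g ** h = mat 1" shows "matrix_inv g = h"
proof -
  have hg: "h ** g = mat 1" using assms by (simp add: matrix_left_right_inverse)
  have *: "g ** matrix_inv g = mat 1 \<and> matrix_inv g ** g = mat 1"
    unfolding matrix_inv_def by (rule someI[where x = h]) (use assms hg in auto)
  have "matrix_inv g = (h ** g) ** matrix_inv g" by (simp add: hg)
  also have "\<dots> = h" using * by (simp add: matrix_mul_assoc')
  finally show ?thesis .
qed

lemma group_GL: "group (GL :: (complex^'m^'m) monoid)"
proof (rule groupI)
  fix x y :: "complex^'m^'m"
  assume "x \<in> carrier GL" "y \<in> carrier GL"
  then show "x \<otimes>\<^bsub>GL\<^esub> y \<in> carrier GL" by (simp add: GL_def invertible_mult)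
next
  show "\<one>\<^bsub>GL\<^esub> \<in> carrier (GL :: (complex^'m^'m) monoid)"
    by (auto simp: GL_def invertible_def intro: exI[of _ "mat 1"])
next
  fix x :: "complex^'m^'m"
  assume "x \<in> carrier GL"
  then show "\<exists>y\<in>carrier GL. y \<otimes>\<^bsub>GL\<^esub> x = \<one>\<^bsub>GL\<^esub>"
    by (auto simp: GL_def invertible_def)
qed (simp_all add: GL_def matrix_mul_assoc)

lemma GL_inv:
  fixes g :: "complex^'m^'m"
  assumes "g ** h = mat 1" shows "inv\<^bsub>GL\<^esub> g = h"
proof -
  have hg: "h ** g = mat 1" using assms by (simp add: matrix_left_right_inverse)
  interpret group "GL :: (complex^'m^'m) monoid" by (rule group_GL)
  show ?thesis
    by (rule inv_equality) (use assms hg in \<open>auto simp: GL_def invertible_def\<close>)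
qed

text \<open>As \<open>S\<close> contains inverses, the generated group is the generated monoid, and
  peeling off one generator at a time from the left suffices. This is the induction principle behind
  \<open>N_induct\<close> and \<open>G_mono_closed\<close>.\<close>

lemma generate_GL_mono_closed:
  fixes S :: "(complex^'m^'m) set"
  assumes "mat 1 \<in> K" "\<And>g h. g \<in> S \<Longrightarrow> h \<in> K \<Longrightarrow> g ** h \<in> K"
    and "\<And>g. g \<in> S \<Longrightarrow> \<exists>g'\<in>S. g ** g' = mat 1"
  shows "generate GL S \<subseteq> K"
proof
  have invS: "inv\<^bsub>GL\<^esub> g \<in> S" if "g \<in> S" for g
  proof -
    from assms(3)[OF that] obtain g' where g': "g' \<in> S" "g ** g' = mat 1" by blast
    from GL_inv[OF g'(2)] g'(1) show ?thesis by (rule ssubst)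
  qed
  fix x assume "x \<in> generate GL S"
  \<comment> \<open>\<open>K\<close> need not be closed under products, so the claim is strengthened
    to left multiplication by \<open>x\<close>, which composes in the product case of
    \<open>generate\<close>.\<close>
  then have "\<forall>k\<in>K. x ** k \<in> K"
  proof induction
    case one then show ?case by (simp add: GL_def)
  next
    case (incl h) then show ?case by (intro ballI assms(2))
  next
    case (inv h) then have "inv\<^bsub>GL\<^esub> h \<in> S" by (rule invS)
    then show ?case by (intro ballI assms(2))
  next
    case (eng h1 h2)
    show ?case
    proof
      fix k assume "k \<in> K"
      then have "h1 ** (h2 ** k) \<in> K" using eng by blast
      then show "(h1 \<otimes>\<^bsub>GL\<^esub> h2) ** k \<in> K" by (simp add: GL_def matrix_mul_assoc)
    qed
  qed
  with assms(1) have "x ** mat 1 \<in> K" by blast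
  then show "x \<in> K" by simp
qed

lemma generate_GL_one: "mat 1 \<in> generate GL S"
  using generate.one[of GL S] by (simp add: GL_def)

lemma generate_GL_mult: "g \<in> generate GL S \<Longrightarrow> h \<in> generate GL S \<Longrightarrow> g ** h \<in> generate GL S"
  using generate.eng[of g GL S h] by (simp add: GL_def)

section \<open>The embeddings of \<open>SL2\<close>\<close>

lemma mat22_mult:
  "mat22 a b c d ** mat22 a' b' c' d' = mat22 (a*a' + b*c') (a*b' + b*d') (c*a' + d*c') (c*b' + d*d')"
  unfolding mat22_def by (simp add: vec_eq_iff matrix_matrix_mult_def forall_2 UNIV_2 sum_2)

lemma mat22_one: "mat22 1 0 0 1 = mat 1"
  unfolding mat22_def by (simp add: vec_eq_iff forall_2 mat_def)

lemma mat22_nth [simp]: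
  "mat22 a b c d $ 1 $ 1 = a" "mat22 a b c d $ 1 $ 2 = b"
  "mat22 a b c d $ 2 $ 1 = c" "mat22 a b c d $ 2 $ 2 = d"
  by (simp_all add: mat22_def)

lemma mat22_in_SL2 [simp]: "mat22 a b c d \<in> SL2 \<longleftrightarrow> a*d - b*c = 1"
  by (simp add: SL2_def det_2)

lemma SL2_cases:
  assumes "g \<in> SL2"
  obtains a b c d where "g = mat22 a b c d" "a*d - b*c = 1"
proof
  show "g = mat22 (g$1$1) (g$1$2) (g$2$1) (g$2$2)"
    by (simp add: vec_eq_iff forall_2)
  show "g$1$1 * g$2$2 - g$1$2 * g$2$1 = 1"
    using assms by (simp add: SL2_def det_2)
qed

text \<open>Conjugation by the permutation matrix exchanges upper and lower triangular matrices, and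
  plays the part of the Chevalley involution: \<open>flip \<phi>\<close> satisfies the same
  relations with \<open>group_N\<close> and \<open>group_N_minus\<close> exchanged, so each fact
  about one yields a fact about the other.\<close>

definition flip :: "('i \<Rightarrow> complex^2^2 \<Rightarrow> complex^'m^'m) \<Rightarrow> 'i \<Rightarrow> complex^2^2 \<Rightarrow> complex^'m^'m" where
  "flip \<phi> i g = \<phi> i (mat22 0 1 1 0 ** g ** mat22 0 1 1 0)"

lemma mat22_flip: "mat22 0 1 1 0 ** mat22 a b c d ** mat22 0 1 1 0 = mat22 d c b a"
  by (simp add: mat22_mult)

lemma flip_mat22: "flip \<phi> i (mat22 a b c d) = \<phi> i (mat22 d c b a)"
  by (simp add: flip_def mat22_flip)

lemma flip_simps [simp]:
  "x_pos (flip \<phi>) = x_neg \<phi>" "x_neg (flip \<phi>) = x_pos \<phi>"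
  by (auto simp: fun_eq_iff x_pos_def x_neg_def flip_mat22)

lemma coroot_flip: "t \<noteq> 0 \<Longrightarrow> coroot (flip \<phi>) i t = coroot \<phi> i (inverse t)"
  by (simp add: coroot_def flip_mat22)

lemma group_N_flip [simp]: "group_N (flip \<phi>) = group_N_minus \<phi>" "group_N_minus (flip \<phi>) = group_N \<phi>"
  by (simp_all add: group_N_def group_N_minus_def)

lemma torus_elem_flip:
  fixes t :: "'i::{finite,linorder} \<Rightarrow> complex"
  assumes "\<forall>i. t i \<noteq> 0"
  shows "torus_elem (flip \<phi>) t = torus_elem \<phi> (\<lambda>i. inverse (t i))"
  using assms by (simp add: torus_elem_def coroot_flip)

lemma torus_H_flip [simp]:
  fixes \<phi> :: "'i::{finite,linorder} \<Rightarrow> complex^2^2 \<Rightarrow> complex^'m^'m"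
  shows "torus_H (flip \<phi>) = torus_H \<phi>"
proof -
  have "torus_elem (flip \<phi>) t \<in> torus_H \<phi> \<and> torus_elem \<phi> t \<in> torus_H (flip \<phi>)" if "\<forall>i. t i \<noteq> 0" for t
    using that torus_elem_flip[of t \<phi>] torus_elem_flip[of "\<lambda>i. inverse (t i)" \<phi>]
    by (auto simp: torus_H_def intro!: exI[of _ "\<lambda>i. inverse (t i)"])
  then show ?thesis by (auto simp: torus_H_def)
qed

lemma index_list_props: "distinct (index_list :: 'i::{finite,linorder} list)" "set (index_list :: 'i list) = UNIV"
  "sorted_wrt (<) (index_list :: 'i list)"
  by (simp_all add: index_list_def)

lemma prod_list_index_list:
  "prod_list (map f (index_list :: 'i::{finite,linorder} list)) = (\<Prod>i\<in>UNIV. f i :: 'b::comm_monoid_mult)"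
  using prod.distinct_set_conv_list[of "index_list :: 'i list" f] index_list_props by metis

lemma polynomial_functions_comp_linear:
  assumes "p \<in> polynomial_functions" "\<And>k l. (\<lambda>x. L x $ k $ l) \<in> polynomial_functions"
  shows "(\<lambda>x. p (L x)) \<in> polynomial_functions"
  using assms(1)
proof induction
  case (const a) then show ?case by (rule polynomial_functions.const)
next
  case (entry i j) then show ?case by (rule assms(2))
next
  case (add p q) then show ?case by (intro polynomial_functions.add)
next
  case (mult p q) then show ?case by (intro polynomial_functions.mult)
qed

lemma flip_entry: "(mat22 0 1 1 0 ** g ** mat22 0 1 1 0) $ k $ l = g $ (if k = 1 then 2 else 1) $ (if l = 1 then 2 else 1)"
  using exhaust_2[of k] exhaust_2[of l]
  by (auto simp: matrix_matrix_mult_def sum_2)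

lemma regular_on_comp:
  assumes "regular_on S f" and L: "\<And>x. x \<in> S' \<Longrightarrow> L x \<in> S"
    and E: "\<And>k l. (\<lambda>x. L x $ k $ l) \<in> polynomial_functions"
  shows "regular_on S' (\<lambda>x. f (L x))"
  unfolding regular_on_def
proof
  fix x assume "x \<in> S'"
  then have "L x \<in> S" by (rule L)
  with assms(1) obtain p q where pq: "p \<in> polynomial_functions" "q \<in> polynomial_functions" "q (L x) \<noteq> 0"
    "\<forall>y\<in>S. q y \<noteq> 0 \<longrightarrow> f y = p y / q y"
    unfolding regular_on_def by blast
  have "(\<lambda>x. p (L x)) \<in> polynomial_functions" "(\<lambda>x. q (L x)) \<in> polynomial_functions"
    using polynomial_functions_comp_linear E pq by blast+
  with pq show "\<exists>p\<in>polynomial_functions. \<exists>q\<in>polynomial_functions.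
     q x \<noteq> 0 \<and> (\<forall>y\<in>S'. q y \<noteq> 0 \<longrightarrow> f (L y) = p y / q y)"
    using L by (intro bexI[where x = "\<lambda>x. p (L x)"] bexI[where x = "\<lambda>x. q (L x)"]) auto
qed

lemma regular_on_flip:
  assumes "regular_on SL2 f" shows "regular_on SL2 (\<lambda>g. f (mat22 0 1 1 0 ** g ** mat22 0 1 1 0))"
proof -
  define L :: "complex^2^2 \<Rightarrow> complex^2^2" where "L g = mat22 0 1 1 0 ** g ** mat22 0 1 1 0" for g
  have L: "L g \<in> SL2" if "g \<in> SL2" for g
    unfolding L_def using that by (metis SL2_cases mat22_flip mat22_in_SL2 mult.commute)
  have "(\<lambda>x. L x $ k $ l) = (\<lambda>x. x $ (if k = 1 then 2 else 1) $ (if l = 1 then 2 else 1))" for k l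
    unfolding L_def flip_entry ..
  then have "(\<lambda>x. L x $ k $ l) \<in> polynomial_functions" for k l
    by (metis polynomial_functions.entry)
  from regular_on_comp[OF assms L this] show ?thesis unfolding L_def .
qed

section \<open>Relations in the group that follow from computations with two by two matrices\<close>

locale chevalley =
  fixes A :: "'i::{finite,linorder} int_matrix" and \<phi> :: "'i \<Rightarrow> complex^2^2 \<Rightarrow> complex^'m^'m"
  assumes scs: "simply_connected_semisimple A \<phi>"
begin

abbreviation "X \<equiv> x_pos \<phi>"
abbreviation "Y \<equiv> x_neg \<phi>"
abbreviation "K \<equiv> coroot \<phi>"
abbreviation "T \<equiv> torus_elem \<phi>"
abbreviation "S \<equiv> s_bar \<phi>"
abbreviation "N \<equiv> group_N \<phi>"
abbreviation "N' \<equiv> group_N_minus \<phi>"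
abbreviation "H \<equiv> torus_H \<phi>"
abbreviation "G \<equiv> group_G \<phi>"

lemma cartan: "cartan_matrix A"
  using scs by (simp add: simply_connected_semisimple_def)

lemma phi_one: "\<phi> i (mat 1) = mat 1"
  using scs by (simp add: simply_connected_semisimple_def)

lemma phi_mult: "g \<in> SL2 \<Longrightarrow> h \<in> SL2 \<Longrightarrow> \<phi> i (g ** h) = \<phi> i g ** \<phi> i h"
  using scs by (simp add: simply_connected_semisimple_def)

lemma phi_regular: "regular_on SL2 (\<lambda>g. \<phi> i g $ k $ l)"
  using scs by (simp add: simply_connected_semisimple_def)

lemma phi22_mult:
  "a*d - b*c = 1 \<Longrightarrow> a'*d' - b'*c' = 1 \<Longrightarrow>
   \<phi> i (mat22 a b c d) ** \<phi> i (mat22 a' b' c' d') =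
   \<phi> i (mat22 (a*a' + b*c') (a*b' + b*d') (c*a' + d*c') (c*b' + d*d'))"
  using phi_mult[of "mat22 a b c d" "mat22 a' b' c' d'"] by (simp add: mat22_mult)

lemma phi22_inverse: "a*d - b*c = 1 \<Longrightarrow> \<phi> i (mat22 a b c d) ** \<phi> i (mat22 d (-b) (-c) a) = mat 1"
  by (subst phi22_mult) (simp_all add: mat22_one phi_one algebra_simps)

lemma coroot_commute: "s \<noteq> 0 \<Longrightarrow> t \<noteq> 0 \<Longrightarrow> K i s ** K j t = K j t ** K i s"
  using scs by (simp add: simply_connected_semisimple_def)

lemma coroot_mult: "s \<noteq> 0 \<Longrightarrow> t \<noteq> 0 \<Longrightarrow> K i s ** K i t = K i (s * t)"
  unfolding coroot_def by (subst phi22_mult) (simp_all)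

lemma coroot_one [simp]: "K i 1 = mat 1"
  unfolding coroot_def by (simp add: mat22_one phi_one)

lemma coroot_inverse: "s \<noteq> 0 \<Longrightarrow> K i s ** K i (inverse s) = mat 1" "s \<noteq> 0 \<Longrightarrow> K i (inverse s) ** K i s = mat 1"
  by (simp_all add: coroot_mult)

lemma coroot_x_pos: "s \<noteq> 0 \<Longrightarrow> K i s ** X j t = X j (s powi (A$i$j) * t) ** K i s"
proof -
  assume s: "s \<noteq> 0"
  have "K i s ** X j t = K i s ** X j t ** K i (inverse s) ** K i s"
    using s by (simp add: matrix_mul_assoc' coroot_inverse)
  also have "K i s ** X j t ** K i (inverse s) = X j (s powi (A$i$j) * t)"
    using scs s by (simp add: simply_connected_semisimple_def)
  finally show ?thesis .
qed

lemma coroot_x_neg: "s \<noteq> 0 \<Longrightarrow> K i s ** Y j t = Y j (s powi (- (A$i$j)) * t) ** K i s"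
proof -
  assume s: "s \<noteq> 0"
  have "K i s ** Y j t = K i s ** Y j t ** K i (inverse s) ** K i s"
    using s by (simp add: matrix_mul_assoc' coroot_inverse)
  also have "K i s ** Y j t ** K i (inverse s) = Y j (s powi (- (A$i$j)) * t)"
    using scs s by (simp add: simply_connected_semisimple_def)
  finally show ?thesis .
qed

lemma x_pos_neg_commute: "i \<noteq> j \<Longrightarrow> X i s ** Y j t = Y j t ** X i s"
  using scs by (simp add: simply_connected_semisimple_def)

lemma torus_inj: "inj_on T {t. \<forall>i. t i \<noteq> 0}"
  using scs by (simp add: simply_connected_semisimple_def)

lemma x_pos_add: "X i s ** X i t = X i (s + t)"
  unfolding x_pos_def by (subst phi22_mult) (simp_all add: add.commute)

lemma x_neg_add: "Y i s ** Y i t = Y i (s + t)"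
  unfolding x_neg_def by (subst phi22_mult) (simp_all add: add.commute)

lemma x_zero [simp]: "X i 0 = mat 1" "Y i 0 = mat 1"
  by (simp_all add: x_pos_def x_neg_def mat22_one phi_one)

lemma x_inverse [simp]:
  "X i t ** X i (-t) = mat 1" "X i (-t) ** X i t = mat 1" "Y i t ** Y i (-t) = mat 1" "Y i (-t) ** Y i t = mat 1"
  by (simp_all add: x_pos_add x_neg_add)

lemma x_pos_x_neg:
  assumes "1 + s * t \<noteq> 0"
  shows "X i s ** Y i t = Y i (t / (1 + s*t)) ** K i (1 + s*t) ** X i (s / (1 + s*t))"
proof -
  define d where "d = 1 + s * t"
  have d: "d \<noteq> 0" "s * t = d - 1" using assms by (auto simp: d_def)
  have "Y i (t / d) ** K i d = \<phi> i (mat22 d 0 t (inverse d))"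
    unfolding x_neg_def coroot_def using d by (simp add: phi22_mult)
  then have "Y i (t / d) ** K i d ** X i (s / d) = \<phi> i (mat22 d s t (s * t / d + inverse d))"
    unfolding x_pos_def using d by (simp add: phi22_mult mult.commute)
  also have "s * t / d + inverse d = 1" using d by (simp add: field_simps)
  also have "\<phi> i (mat22 d s t 1) = X i s ** Y i t"
    unfolding x_pos_def x_neg_def by (simp add: phi22_mult d_def)
  finally show ?thesis by (simp add: d_def)
qed

lemma x_neg_x_pos:
  assumes "1 + s * t \<noteq> 0"
  shows "Y i s ** X i t = X i (t / (1 + s*t)) ** K i (inverse (1 + s*t)) ** Y i (s / (1 + s*t))"
proof -
  define d where "d = 1 + s * t"
  have d: "d \<noteq> 0" "s * t = d - 1" using assms by (auto simp: d_def)
  have "X i (t / d) ** K i (inverse d) = \<phi> i (mat22 (inverse d) t 0 d)"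
    unfolding x_pos_def coroot_def using d by (simp add: phi22_mult)
  then have "X i (t / d) ** K i (inverse d) ** Y i (s / d) = \<phi> i (mat22 (inverse d + s * t / d) t s d)"
    unfolding x_neg_def using d by (simp add: phi22_mult mult.commute)
  also have "inverse d + s * t / d = 1" using d by (simp add: field_simps)
  also have "\<phi> i (mat22 1 t s d) = Y i s ** X i t"
    unfolding x_pos_def x_neg_def by (simp add: phi22_mult d_def add.commute)
  finally show ?thesis by (simp add: d_def)
qed

lemma s_bar_eq: "S i = X i (-1) ** Y i 1 ** X i (-1)"
  unfolding x_pos_def x_neg_def s_bar_def by (simp add: phi22_mult)

definition "S' i = \<phi> i (mat22 0 1 (-1) 0)"

lemma S'_eq: "S' i = X i 1 ** Y i (-1) ** X i 1"
  unfolding x_pos_def x_neg_def S'_def by (simp add: phi22_mult)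

lemma S_S' [simp]: "S i ** S' i = mat 1" "S' i ** S i = mat 1"
  unfolding s_bar_def S'_def by (simp_all add: phi22_mult mat22_one phi_one)

lemma S'_eq_S: "S' i = K i (-1) ** S i" "S' i = S i ** K i (-1)"
  unfolding s_bar_def S'_def coroot_def by (simp_all add: phi22_mult)

lemma x_pos_s_bar: "r \<noteq> 0 \<Longrightarrow> X i r ** S i = Y i (inverse r) ** K i r ** X i (- inverse r)"
  unfolding x_pos_def x_neg_def s_bar_def coroot_def by (simp add: phi22_mult)

lemma s_bar_x_pos: "r \<noteq> 0 \<Longrightarrow> S i ** X i r = X i (- inverse r) ** K i (inverse r) ** Y i (inverse r)"
  unfolding x_pos_def x_neg_def s_bar_def coroot_def by (simp add: phi22_mult)

lemma x_neg_bruhat: "u \<noteq> 0 \<Longrightarrow> Y i u = X i (inverse u) ** K i (inverse u) ** S i ** X i (inverse u)"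
  unfolding x_pos_def x_neg_def s_bar_def coroot_def by (simp add: phi22_mult)

text \<open>The cases are \<open>d \<noteq> 0\<close> and \<open>d = 0\<close> for the lower right
  entry \<open>d\<close>. They reduce questions about the whole image of \<open>\<phi> i\<close> to
  \<open>X i\<close>, \<open>Y i\<close>, \<open>K i\<close> and \<open>S i\<close>.\<close>

lemma SL2_bruhat:
  assumes "g \<in> SL2"
  obtains (big) r s t where "s \<noteq> 0" "\<phi> i g = X i r ** K i s ** Y i t"
  | (small) s t where "s \<noteq> 0" "\<phi> i g = S i ** K i s ** Y i t"
proof -
  from assms obtain a b c d where g: "g = mat22 a b c d" "a*d - b*c = 1" by (rule SL2_cases)
  show ?thesis
  proof (cases "d = 0")
    case False
    have "X i (b/d) ** K i (inverse d) = \<phi> i (mat22 (inverse d) b 0 d)"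
      unfolding x_pos_def coroot_def using False by (simp add: phi22_mult)
    then have "X i (b/d) ** K i (inverse d) ** Y i (c/d) = \<phi> i (mat22 (inverse d + b * c / d) b c d)"
      unfolding x_neg_def using False by (simp add: phi22_mult)
    also have "inverse d + b * c / d = a" using g(2) False by (simp add: field_simps)
    finally have "\<phi> i g = X i (b/d) ** K i (inverse d) ** Y i (c/d)" by (simp add: g(1))
    with False show ?thesis using big[of "inverse d" "b/d" "c/d"] by simp
  next
    case True
    with g have bc: "b * c = -1" by (simp add: algebra_simps neg_eq_iff_add_eq_0 add_eq_0_iff)
    then have c: "c \<noteq> 0" by auto
    with bc have b: "b = - inverse c" by (simp add: field_simps eq_neg_iff_add_eq_0)
    have "\<phi> i g = S i ** K i c ** Y i (- a * c)"
      unfolding x_pos_def x_neg_def coroot_def s_bar_def using g b c True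
      by (simp add: phi22_mult mult.left_commute)
    with c show ?thesis using small[of c "- a * c"] by simp
  qed
qed

lemma torus_list_mult:
  assumes "\<forall>i. t i \<noteq> 0" "\<forall>i. t' i \<noteq> 0"
  shows "mat_prod (map (\<lambda>i. K i (t i)) us) ** mat_prod (map (\<lambda>i. K i (t' i)) us) =
         mat_prod (map (\<lambda>i. K i (t i * t' i)) us)"
proof (induction us)
  case (Cons u us)
  have c: "mat_prod (map (\<lambda>i. K i (t i)) vs) ** K u (t' u) = K u (t' u) ** mat_prod (map (\<lambda>i. K i (t i)) vs)" for vs
  proof (induction vs)
    case (Cons v vs)
    have "mat_prod (map (\<lambda>i. K i (t i)) (v # vs)) ** K u (t' u) = K v (t v) ** (mat_prod (map (\<lambda>i. K i (t i)) vs) ** K u (t' u))"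
      by (simp add: matrix_mul_assoc)
    also have "\<dots> = (K v (t v) ** K u (t' u)) ** mat_prod (map (\<lambda>i. K i (t i)) vs)"
      by (simp only: Cons matrix_mul_assoc)
    also have "K v (t v) ** K u (t' u) = K u (t' u) ** K v (t v)"
      using assms by (simp add: coroot_commute)
    finally show ?case by (simp add: matrix_mul_assoc)
  qed simp
  have "mat_prod (map (\<lambda>i. K i (t i)) (u # us)) ** mat_prod (map (\<lambda>i. K i (t' i)) (u # us)) =
    K u (t u) ** (mat_prod (map (\<lambda>i. K i (t i)) us) ** K u (t' u)) ** mat_prod (map (\<lambda>i. K i (t' i)) us)"
    by (simp add: matrix_mul_assoc)
  also have "\<dots> = (K u (t u) ** K u (t' u)) ** (mat_prod (map (\<lambda>i. K i (t i)) us) ** mat_prod (map (\<lambda>i. K i (t' i)) us))"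
    by (simp only: c matrix_mul_assoc)
  finally show ?case using assms by (simp add: coroot_mult Cons)
qed simp

lemma torus_mult: "\<forall>i. t i \<noteq> 0 \<Longrightarrow> \<forall>i. t' i \<noteq> 0 \<Longrightarrow> T t ** T t' = T (\<lambda>i. t i * t' i)"
  unfolding torus_elem_def by (rule torus_list_mult)

lemma torus_one [simp]: "T (\<lambda>_. 1) = mat 1"
proof -
  have "mat_prod (map (\<lambda>i. K i 1) us) = mat 1" for us by (induction us) simp_all
  then show ?thesis by (simp add: torus_elem_def)
qed

lemma torus_inverse [simp]:
  assumes "\<forall>i. t i \<noteq> 0"
  shows "T t ** T (\<lambda>i. inverse (t i)) = mat 1" "T (\<lambda>i. inverse (t i)) ** T t = mat 1"
  using assms torus_mult[of t "\<lambda>i. inverse (t i)"] torus_mult[of "\<lambda>i. inverse (t i)" t] by simp_all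

lemma coroot_torus:
  assumes "s \<noteq> 0" shows "K i s = T ((\<lambda>_. 1)(i := s))"
proof -
  have "mat_prod (map (\<lambda>j. K j (((\<lambda>_. 1)(i := s)) j)) us) = (if i \<in> set us then K i s else mat 1)"
    if "distinct us" for us
    using that by (induction us) (auto)
  from this[of index_list] show ?thesis
    by (simp add: torus_elem_def index_list_props)
qed

lemma torus_in_H: "\<forall>i. t i \<noteq> 0 \<Longrightarrow> T t \<in> H"
  by (auto simp: torus_H_def)

lemma coroot_in_H: "s \<noteq> 0 \<Longrightarrow> K i s \<in> H"
  by (simp add: coroot_torus torus_in_H)

lemma H_mult: "h \<in> H \<Longrightarrow> h' \<in> H \<Longrightarrow> h ** h' \<in> H"
proof -
  assume "h \<in> H" "h' \<in> H"
  then obtain t t' where "h = T t" "h' = T t'" "\<forall>i. t i \<noteq> 0" "\<forall>i. t' i \<noteq> 0"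
    unfolding torus_H_def by blast
  then show ?thesis by (simp add: torus_mult torus_in_H)
qed

lemma H_one: "mat 1 \<in> H"
  using torus_in_H[of "\<lambda>_. 1"] by simp

lemma torus_x_pos:
  assumes "\<forall>i. t i \<noteq> 0"
  shows "T t ** X j s = X j ((\<Prod>i\<in>UNIV. t i powi (A$i$j)) * s) ** T t"
proof -
  have "mat_prod (map (\<lambda>i. K i (t i)) us) ** X j s =
      X j (prod_list (map (\<lambda>i. t i powi (A$i$j)) us) * s) ** mat_prod (map (\<lambda>i. K i (t i)) us)" for us
  proof (induction us)
    case (Cons u us)
    have "mat_prod (map (\<lambda>i. K i (t i)) (u # us)) ** X j s =
      K u (t u) ** (mat_prod (map (\<lambda>i. K i (t i)) us) ** X j s)" by (simp add: matrix_mul_assoc)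
    also have "\<dots> = (K u (t u) ** X j (prod_list (map (\<lambda>i. t i powi (A$i$j)) us) * s)) ** mat_prod (map (\<lambda>i. K i (t i)) us)"
      using Cons by (simp add: matrix_mul_assoc)
    finally show ?case using assms by (simp add: coroot_x_pos matrix_mul_assoc mult.assoc)
  qed simp
  then show ?thesis unfolding torus_elem_def by (simp add: prod_list_index_list)
qed

lemma torus_x_neg:
  assumes "\<forall>i. t i \<noteq> 0"
  shows "T t ** Y j s = Y j ((\<Prod>i\<in>UNIV. t i powi (- (A$i$j))) * s) ** T t"
proof -
  have "mat_prod (map (\<lambda>i. K i (t i)) us) ** Y j s =
      Y j (prod_list (map (\<lambda>i. t i powi (-(A$i$j))) us) * s) ** mat_prod (map (\<lambda>i. K i (t i)) us)" for us
  proof (induction us)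
    case (Cons u us)
    have "mat_prod (map (\<lambda>i. K i (t i)) (u # us)) ** Y j s =
      K u (t u) ** (mat_prod (map (\<lambda>i. K i (t i)) us) ** Y j s)" by (simp add: matrix_mul_assoc)
    also have "\<dots> = (K u (t u) ** Y j (prod_list (map (\<lambda>i. t i powi (-(A$i$j))) us) * s)) ** mat_prod (map (\<lambda>i. K i (t i)) us)"
      using Cons by (simp add: matrix_mul_assoc)
    finally show ?case using assms by (simp add: coroot_x_neg matrix_mul_assoc mult.assoc)
  qed simp
  then show ?thesis unfolding torus_elem_def by (simp add: prod_list_index_list)
qed

end

text \<open>Exchanging the diagonal entries inverts the coroots, and exchanging \<open>X\<close> and
  \<open>Y\<close> negates the roots. The two signs cancel in the Cartan integers, so the same
  \<open>A\<close> serves.\<close>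

lemma chevalley_flip:
  fixes \<phi> :: "'i::{finite,linorder} \<Rightarrow> complex^2^2 \<Rightarrow> complex^'m^'m"
  assumes "chevalley A \<phi>" shows "chevalley A (flip \<phi>)"
proof -
  interpret chevalley A \<phi> by (rule assms)
  have L: "mat22 0 1 1 0 ** g ** mat22 0 1 1 0 \<in> SL2" if "g \<in> SL2" for g
    using that by (metis SL2_cases mat22_flip mat22_in_SL2 mult.commute)
  have "mat22 0 1 1 0 ** mat22 0 1 1 0 = (mat 1 :: complex^2^2)" by (simp add: mat22_mult mat22_one)
  then have PP: "mat22 0 1 1 0 ** (g ** h) ** mat22 0 1 1 0 =
      (mat22 0 1 1 0 ** g ** mat22 0 1 1 0) ** (mat22 0 1 1 0 ** h ** mat22 0 1 1 0)" for g h
    using mat_mult_cancel_middle[of "mat22 0 1 1 0" "mat22 0 1 1 0" "mat22 0 1 1 0 ** g" "h ** mat22 0 1 1 0"]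
    by (simp only: matrix_mul_assoc)
  have hom: "flip \<phi> i (g ** h) = flip \<phi> i g ** flip \<phi> i h" if "g \<in> SL2" "h \<in> SL2" for g h i
    unfolding flip_def PP using that by (intro phi_mult L)
  have one: "flip \<phi> i (mat 1) = mat 1" for i
    using flip_mat22[of \<phi> i 1 0 0 1] by (simp add: mat22_one phi_one)
  have inj: "inj_on (torus_elem (flip \<phi>)) {t. \<forall>i. t i \<noteq> 0}"
  proof (rule inj_onI, simp)
    fix t t' :: "'i \<Rightarrow> complex"
    assume *: "\<forall>i. t i \<noteq> 0" "\<forall>i. t' i \<noteq> 0" "torus_elem (flip \<phi>) t = torus_elem (flip \<phi>) t'"
    then have "T (\<lambda>i. inverse (t i)) = T (\<lambda>i. inverse (t' i))" by (simp add: torus_elem_flip)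
    with * have "(\<lambda>i. inverse (t i)) = (\<lambda>i. inverse (t' i))"
      by (intro inj_onD[OF torus_inj]) auto
    then show "t = t'" by (auto simp: fun_eq_iff)
  qed
  show ?thesis
    unfolding chevalley_def simply_connected_semisimple_def
  proof (intro conjI allI impI ballI)
    fix i :: 'i and k l
    show "regular_on SL2 (\<lambda>g. flip \<phi> i g $ k $ l)"
      unfolding flip_def by (rule regular_on_flip) (rule phi_regular)
  next
    fix i j :: 'i and s t :: complex
    assume "s \<noteq> 0 \<and> t \<noteq> 0"
    then show "coroot (flip \<phi>) i s ** coroot (flip \<phi>) j t = coroot (flip \<phi>) j t ** coroot (flip \<phi>) i s"
      by (simp add: coroot_flip coroot_commute)
  next
    fix i j :: 'i and s t :: complex
    assume s: "s \<noteq> 0"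
    then show "coroot (flip \<phi>) i s ** x_pos (flip \<phi>) j t ** coroot (flip \<phi>) i (inverse s) = x_pos (flip \<phi>) j (s powi A $ i $ j * t)"
      by (simp add: coroot_flip coroot_x_neg matrix_mul_assoc' coroot_inverse power_int_minus power_int_inverse)
    show "coroot (flip \<phi>) i s ** x_neg (flip \<phi>) j t ** coroot (flip \<phi>) i (inverse s) = x_neg (flip \<phi>) j (s powi - (A $ i $ j) * t)"
      using s by (simp add: coroot_flip coroot_x_pos matrix_mul_assoc' coroot_inverse power_int_minus power_int_inverse)
  next
    fix i j :: 'i and s t :: complex
    assume "i \<noteq> j"
    then show "x_pos (flip \<phi>) i s ** x_neg (flip \<phi>) j t = x_neg (flip \<phi>) j t ** x_pos (flip \<phi>) i s"
      by (simp add: x_pos_neg_commute)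
  qed (use cartan hom one inj in auto)
qed

lemma power_int_prod: "(\<Prod>i\<in>I. f i :: 'a::field) powi n = (\<Prod>i\<in>I. f i powi n)"
  by (induction I rule: infinite_finite_induct) (simp_all add: power_int_mult_distrib)

lemma invertible_right_inverse: "g ** h = mat 1 \<Longrightarrow> invertible (g :: complex^'m^'m)"
  by (metis invertible_def matrix_left_right_inverse)

lemma matrix_inv_right [simp]: "invertible (g :: complex^'m^'m) \<Longrightarrow> g ** matrix_inv g = mat 1"
  unfolding invertible_def using matrix_inv_eqI by metis

lemma matrix_inv_left [simp]: "invertible (g :: complex^'m^'m) \<Longrightarrow> matrix_inv g ** g = mat 1"
  using matrix_inv_right matrix_left_right_inverse by blast

lemma matrix_inv_invertible [simp]: "invertible (g :: complex^'m^'m) \<Longrightarrow> invertible (matrix_inv g)"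
  using matrix_inv_left invertible_right_inverse by blast

lemma matrix_inv_matrix_inv [simp]: "invertible (g :: complex^'m^'m) \<Longrightarrow> matrix_inv (matrix_inv g) = g"
  by (rule matrix_inv_eqI) simp

lemma matrix_inv_mult:
  fixes g h :: "complex^'m^'m"
  assumes "invertible g" "invertible h"
  shows "matrix_inv (g ** h) = matrix_inv h ** matrix_inv g"
proof (rule matrix_inv_eqI)
  have "g ** h ** (matrix_inv h ** matrix_inv g) = g ** matrix_inv g"
    by (rule mat_mult_cancel_middle) (simp add: assms)
  then show "g ** h ** (matrix_inv h ** matrix_inv g) = mat 1" using assms by simp
qed

lemma invertible_one [simp]: "invertible (mat 1 :: complex^'m^'m)"
  by (rule invertible_right_inverse[of _ "mat 1"]) simp

lemma matrix_inv_one [simp]: "matrix_inv (mat 1 :: complex^'m^'m) = mat 1"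
  by (rule matrix_inv_eqI) simp

lemma matrix_cancel_left:
  fixes g :: "complex^'m^'m"
  assumes "invertible g" "g ** a = g ** b" shows "a = b"
proof -
  have "matrix_inv g ** g ** a = matrix_inv g ** g ** b"
    by (simp only: matrix_mul_assoc' assms(2))
  then show ?thesis using assms(1) by simp
qed

lemma matrix_cancel_right:
  fixes g :: "complex^'m^'m"
  assumes "invertible g" "a ** g = b ** g" shows "a = b"
proof -
  have "a ** (g ** matrix_inv g) = b ** (g ** matrix_inv g)"
    by (simp only: matrix_mul_assoc assms(2))
  then show ?thesis using assms(1) by simp
qed

lemma invertible_mat_prod: "(\<And>g. g \<in> set gs \<Longrightarrow> invertible g) \<Longrightarrow> invertible (mat_prod gs :: complex^'m^'m)"
  by (induction gs) (simp_all add: invertible_mult)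

section \<open>Regular functions along polynomial curves\<close>

text \<open>No point of the plane is isolated, so continuity recovers the values at finitely many
  exceptions. This stands in for Zariski density: an identity derived for non-zero denominators is
  extended along a curve.\<close>

lemma continuous_eq_off_finite:
  fixes f g :: "complex \<Rightarrow> 'b::t2_space"
  assumes "continuous_on UNIV f" "continuous_on UNIV g" "finite F" "\<And>s. s \<notin> F \<Longrightarrow> f s = g s"
  shows "f = g"
proof
  fix s
  have F: "\<forall>\<^sub>F x in at s. f x = g x"
    using islimpt_finite[OF assms(3), of s] assms(4)
    unfolding islimpt_iff_eventually by (auto elim: eventually_mono)
  have "(f \<longlongrightarrow> f s) (at s)" "(g \<longlongrightarrow> g s) (at s)"
    using assms(1,2) by (auto simp: continuous_on_def)
  with F show "f s = g s"
    by (metis tendsto_cong tendsto_unique trivial_limit_at)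
qed

text \<open>A root of \<open>q\<close> is a root of \<open>p\<close>, so a linear factor cancels,
  and continuity of \<open>h\<close> restores the equation at that root. The degree bound serves the
  interpolation in \<open>locally_rational_slice\<close>.\<close>

lemma poly_quotient_continuous:
  fixes h :: "complex \<Rightarrow> complex"
  assumes "continuous_on UNIV h" "\<And>s. h s * poly q s = poly p s" "q \<noteq> 0"
  shows "\<exists>r. (\<forall>s. h s = poly r s) \<and> degree r \<le> degree p"
  using assms(2,3)
proof (induction "degree q" arbitrary: p q rule: less_induct)
  case less
  show ?case
  proof (cases "degree q = 0")
    case True
    then obtain c where q: "q = [:c:]" using degree_eq_zeroE by blast
    with less.prems have "c \<noteq> 0" by auto
    moreover have "h s * c = poly p s" for s using less.prems(1)[of s] q by simp
    ultimately have "h s = poly (smult (inverse c) p) s" for s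
      by (metis (no_types) mult.commute mult.left_commute mult.right_neutral poly_smult right_inverse)
    then show ?thesis by (intro exI[of _ "smult (inverse c) p"]) auto
  next
    case False
    then obtain z where z: "poly q z = 0"
      using fundamental_theorem_of_algebra constant_degree by metis
    then have "poly p z = 0" using less.prems(1)[of z] by simp
    with z obtain q' p' where qp: "q = [:-z, 1:] * q'" "p = [:-z, 1:] * p'"
      by (meson dvdE poly_eq_0_iff_dvd)
    with less.prems have q': "q' \<noteq> 0" by auto
    have "(\<lambda>s. h s * poly q' s) = poly p'"
    proof (rule continuous_eq_off_finite[of _ _ "{z}"])
      fix s assume "s \<notin> {z}"
      then have "s - z \<noteq> 0" by simp
      have "h s * ((s - z) * poly q' s) = (s - z) * poly p' s"
        using less.prems(1)[of s] unfolding qp by (simp add: left_diff_distrib del: right_diff_distrib)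
      then have "(s - z) * (h s * poly q' s) = (s - z) * poly p' s" by (simp only: mult.left_commute)
      then show "h s * poly q' s = poly p' s" using \<open>s - z \<noteq> 0\<close> by (simp only: mult_cancel_left)  simp
    qed (auto intro!: continuous_intros assms(1))
    then have "\<And>s. h s * poly q' s = poly p' s" by (auto simp: fun_eq_iff)
    moreover have "degree q' < degree q" using q' unfolding qp by (subst degree_mult_eq) auto
    ultimately obtain r where "\<forall>s. h s = poly r s" "degree r \<le> degree p'"
      using less.hyps q' by blast
    moreover have "degree p' \<le> degree p" unfolding qp by (cases "p' = 0") (auto simp: degree_mult_eq simp del: mult_pCons_left)
    ultimately show ?thesis by force
  qed
qed

text \<open>A function that is polynomial both in \<open>s\<close> and in \<open>1/s\<close> is
  regular on the projective line, hence constant. Multiplied by a power of \<open>s\<close>, the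
  right side becomes a reflected polynomial, whose degree leaves no room for
  \<open>p\<close>.\<close>

lemma poly_inverse_constant:
  fixes p q :: "complex poly"
  assumes "\<And>s. s \<noteq> 0 \<Longrightarrow> poly p s = poly q (inverse s)"
  shows "degree p = 0" "poly p 0 = poly q 0"
proof -
  have "poly (monom 1 (degree q) * p) s = poly (reflect_poly q) s" if "s \<noteq> 0" for s
    using assms[OF that] that by (simp add: poly_monom poly_reflect_poly_nz)
  then have "UNIV - {0} \<subseteq> {s. poly (monom 1 (degree q) * p - reflect_poly q) s = 0}" by auto
  moreover have "infinite (UNIV - {0::complex})" by (simp add: infinite_UNIV_char_0)
  ultimately have "monom 1 (degree q) * p - reflect_poly q = 0"
    using poly_roots_finite finite_subset by blast
  then have *: "monom 1 (degree q) * p = reflect_poly q" by simp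
  show d: "degree p = 0"
  proof (cases "p = 0")
    case False
    then have "degree q + degree p = degree (reflect_poly q)"
      using * by (metis degree_monom_eq degree_mult_eq monom_eq_0_iff zero_neq_one)
    also have "\<dots> \<le> degree q" by (rule degree_reflect_poly_le)
    finally show ?thesis by simp
  qed simp
  then obtain c where p: "p = [:c:]" using degree_eq_zeroE by blast
  have "infinite (UNIV - {0::complex})" by (simp add: infinite_UNIV_char_0)
  moreover have "UNIV - {0} \<subseteq> {s. poly (q - p) s = 0}"
  proof
    fix s :: complex assume "s \<in> UNIV - {0}"
    then show "s \<in> {s. poly (q - p) s = 0}" using assms[of "inverse s"] by (simp add: p)
  qed
  ultimately have "q - p = 0" using poly_roots_finite finite_subset by blast
  then show "poly p 0 = poly q 0" by simp
qed

definition poly_curve :: "(complex \<Rightarrow> complex^'n^'m) \<Rightarrow> bool" where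
  "poly_curve c \<longleftrightarrow> (\<forall>k l. \<exists>p. \<forall>t. c t $ k $ l = poly p t)"

lemma poly_fun_closed:
  fixes f g :: "complex \<Rightarrow> complex"
  shows "\<exists>p. \<forall>t. (a::complex) = poly p t" "\<exists>p. \<forall>t. t = poly p (t::complex)"
    and "\<exists>p. \<forall>t. f t = poly p t \<Longrightarrow> \<exists>p. \<forall>t. g t = poly p t \<Longrightarrow> \<exists>p. \<forall>t. f t + g t = poly p t"
    and "\<exists>p. \<forall>t. f t = poly p t \<Longrightarrow> \<exists>p. \<forall>t. g t = poly p t \<Longrightarrow> \<exists>p. \<forall>t. f t * g t = poly p t"
    and "\<exists>p. \<forall>t. f t = poly p t \<Longrightarrow> \<exists>p. \<forall>t. f (b * t) = poly p t"
proof -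
  show "\<exists>p. \<forall>t. a = poly p t" by (rule exI[of _ "[:a:]"]) simp
  show "\<exists>p. \<forall>t. t = poly p (t::complex)" by (rule exI[of _ "[:0,1:]"]) simp
  show "\<exists>p. \<forall>t. f t = poly p t \<Longrightarrow> \<exists>p. \<forall>t. g t = poly p t \<Longrightarrow> \<exists>p. \<forall>t. f t + g t = poly p t"
    by (metis poly_add)
  show "\<exists>p. \<forall>t. f t = poly p t \<Longrightarrow> \<exists>p. \<forall>t. g t = poly p t \<Longrightarrow> \<exists>p. \<forall>t. f t * g t = poly p t"
    by (metis poly_mult)
  show "\<exists>p. \<forall>t. f (b * t) = poly p t" if "\<exists>p. \<forall>t. f t = poly p t"
  proof -
    from that obtain p where "\<forall>t. f t = poly p t" by blast
    then have "f (b * t) = poly (pcompose p [:0, b:]) t" for t by (simp add: poly_pcompose mult.commute)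
    then show ?thesis by blast
  qed
qed

lemma poly_fun_sum:
  assumes "\<And>k. k \<in> F \<Longrightarrow> \<exists>p. \<forall>t. f k t = poly p (t::complex)"
  shows "\<exists>p. \<forall>t. (\<Sum>k\<in>F. f k t) = poly p t"
proof -
  from assms obtain p where "\<And>k. k \<in> F \<Longrightarrow> \<forall>t. f k t = poly (p k) t" by metis
  then have "\<forall>t. (\<Sum>k\<in>F. f k t) = poly (\<Sum>k\<in>F. p k) t" by (simp add: poly_sum)
  then show ?thesis by blast
qed

lemma poly_curve_const: "poly_curve (\<lambda>_. g)"
  unfolding poly_curve_def by (intro allI poly_fun_closed)

lemma poly_curve_mult: "poly_curve a \<Longrightarrow> poly_curve b \<Longrightarrow> poly_curve (\<lambda>t. a t ** b t)"
  unfolding poly_curve_def matrix_matrix_mult_def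
  by (simp, intro allI poly_fun_sum poly_fun_closed) auto

lemma poly_curve_scale: "poly_curve a \<Longrightarrow> poly_curve (\<lambda>t. a (b * t))"
  unfolding poly_curve_def
proof (intro allI)
  fix k l assume "\<forall>k l. \<exists>p. \<forall>t. a t $ k $ l = poly p t"
  then have "\<exists>p. \<forall>t. (\<lambda>t. a t $ k $ l) t = poly p t" by blast
  from poly_fun_closed(5)[OF this] show "\<exists>p. \<forall>t. a (b * t) $ k $ l = poly p t" by simp
qed

lemma poly_curve_continuous: "poly_curve a \<Longrightarrow> continuous_on UNIV a"
proof -
  assume a: "poly_curve a"
  have "continuous_on UNIV (\<lambda>t. a t $ k $ l)" for k l
  proof -
    from a obtain p where "\<forall>t. a t $ k $ l = poly p t" unfolding poly_curve_def by blast
    then show ?thesis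
      using continuous_on_eq[OF continuous_on_poly[OF continuous_on_id], of UNIV p "\<lambda>t. a t $ k $ l"] by simp
  qed
  then have "continuous_on UNIV (\<lambda>t. \<chi> k. \<chi> l. a t $ k $ l)"
    by (intro continuous_on_vec_lambda)
  moreover have "(\<lambda>t. \<chi> k. \<chi> l. a t $ k $ l) = a" by (simp add: fun_eq_iff vec_eq_iff)
  ultimately show ?thesis by (simp only:)
qed

lemma polynomial_function_poly_curve:
  assumes "p \<in> polynomial_functions" "poly_curve c"
  shows "\<exists>q. \<forall>t. p (c t) = poly q t"
  using assms(1)
proof induction
  case (entry i j) then show ?case using assms(2) by (simp add: poly_curve_def)
qed (simp_all add: poly_fun_closed)

lemma polynomial_function_continuous:
  assumes "p \<in> polynomial_functions" shows "continuous_on UNIV p"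
  using assms by induction (auto intro!: continuous_intros)

lemma regular_on_continuous:
  assumes "regular_on S f" shows "continuous_on S f"
  unfolding continuous_on_eq_continuous_within
proof
  fix x assume x: "x \<in> S"
  with assms obtain p q where pq: "p \<in> polynomial_functions" "q \<in> polynomial_functions" "q x \<noteq> 0"
    "\<forall>y\<in>S. q y \<noteq> 0 \<longrightarrow> f y = p y / q y"
    unfolding regular_on_def by blast
  have c: "continuous (at x within S) p" "continuous (at x within S) q"
    using polynomial_function_continuous[OF pq(1)] polynomial_function_continuous[OF pq(2)]
    by (auto simp: continuous_on_eq_continuous_within intro: continuous_within_subset)
  then have "((\<lambda>y. p y / q y) \<longlongrightarrow> p x / q x) (at x within S)"
    using pq(3) by (auto simp: continuous_within intro: tendsto_divide)
  moreover have "\<forall>\<^sub>F y in at x within S. p y / q y = f y"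
  proof -
    have "\<forall>\<^sub>F y in at x within S. q y \<noteq> 0"
      using c(2) pq(3) unfolding continuous_within by (rule tendsto_imp_eventually_ne)
    moreover have "\<forall>\<^sub>F y in at x within S. y \<in> S" by (simp add: eventually_at_filter)
    ultimately show ?thesis by eventually_elim (use pq(4) in auto)
  qed
  ultimately have "(f \<longlongrightarrow> p x / q x) (at x within S)" by (rule Lim_transform_eventually)
  then show "continuous (at x within S) f"
    using pq(3,4) x by (simp add: continuous_within)
qed

text \<open>Regularity provides quotients only locally. The quotient around \<open>c 0\<close> gives
  an equation off finitely many parameters, continuity extends it to all of them, and
  \<open>poly_quotient_continuous\<close> divides.\<close>

lemma regular_on_poly_curve:
  assumes "regular_on S f" "poly_curve c" "\<And>t. c t \<in> S"
  shows "\<exists>r. \<forall>t. f (c t) = poly r t"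
proof -
  from assms(1) assms(3)[of 0] obtain p q where pq: "p \<in> polynomial_functions" "q \<in> polynomial_functions" "q (c 0) \<noteq> 0"
    "\<forall>y\<in>S. q y \<noteq> 0 \<longrightarrow> f y = p y / q y"
    unfolding regular_on_def by blast
  obtain P Q where PQ: "\<forall>t. p (c t) = poly P t" "\<forall>t. q (c t) = poly Q t"
    using polynomial_function_poly_curve[OF pq(1) assms(2)] polynomial_function_poly_curve[OF pq(2) assms(2)] by blast
  have Q: "Q \<noteq> 0" using PQ(2) pq(3) by (metis poly_0)
  have cont: "continuous_on UNIV (\<lambda>t. f (c t))"
    using continuous_on_compose2[OF regular_on_continuous[OF assms(1)] poly_curve_continuous[OF assms(2)]] assms(3) by auto
  have "(\<lambda>t. f (c t) * poly Q t) = poly P"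
  proof (rule continuous_eq_off_finite[of _ _ "{t. poly Q t = 0}"])
    show "finite {t. poly Q t = 0}" using Q by (rule poly_roots_finite)
    fix t assume "t \<notin> {t. poly Q t = 0}"
    then have "q (c t) \<noteq> 0" using PQ(2) by simp
    with pq(4) assms(3) have "f (c t) = p (c t) / q (c t)" by blast
    with \<open>q (c t) \<noteq> 0\<close> show "f (c t) * poly Q t = poly P t" using PQ by simp
  qed (auto intro!: continuous_intros cont)
  then have "\<And>t. f (c t) * poly Q t = poly P t" by (auto simp: fun_eq_iff)
  with poly_quotient_continuous[OF cont this Q] show ?thesis by blast
qed

section \<open>Torus characters and words in the unipotent generators\<close>

definition char :: "('i::finite \<Rightarrow> complex) \<Rightarrow> 'i weight \<Rightarrow> complex" where
  "char t \<gamma> = (\<Prod>i\<in>UNIV. t i powi (\<gamma> $ i))"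

text \<open>The common factor \<open>s\<close> is a contraction parameter: conjugation by
  \<open>mu c\<close> multiplies it by \<open>exp c\<close>, and \<open>s = 0\<close> gives the
  identity.\<close>

definition x_word :: "('i \<Rightarrow> complex^2^2 \<Rightarrow> complex^'m^'m) \<Rightarrow> complex \<Rightarrow> ('i \<times> complex) list \<Rightarrow> complex^'m^'m" where
  "x_word \<phi> s ws = mat_prod (map (\<lambda>(i, t). x_pos \<phi> i (s * t)) ws)"

lemma x_word_simps [simp]:
  "x_word \<phi> s [] = mat 1" "x_word \<phi> s ((i, t) # ws) = x_pos \<phi> i (s * t) ** x_word \<phi> s ws"
  by (simp_all add: x_word_def)

context chevalley
begin

lemma poly_curve_mat22: "poly_curve (\<lambda>t. mat22 1 t 0 1)" "poly_curve (\<lambda>t. mat22 1 0 t 1)"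
proof -
  show "poly_curve (\<lambda>t. mat22 1 t 0 1)" unfolding poly_curve_def
    using poly_fun_closed(1)[of 1] poly_fun_closed(1)[of 0] poly_fun_closed(2) by (simp add: forall_2)
  show "poly_curve (\<lambda>t. mat22 1 0 t 1)" unfolding poly_curve_def
    using poly_fun_closed(1)[of 1] poly_fun_closed(1)[of 0] poly_fun_closed(2) by (simp add: forall_2)
qed

lemma poly_curve_x: "poly_curve (X i)" "poly_curve (Y i)"
proof -
  show "poly_curve (X i)" unfolding poly_curve_def x_pos_def
    by (intro allI regular_on_poly_curve[OF phi_regular poly_curve_mat22(1)]) simp
  show "poly_curve (Y i)" unfolding poly_curve_def x_neg_def
    by (intro allI regular_on_poly_curve[OF phi_regular poly_curve_mat22(2)]) simp
qed

lemma poly_curve_x_word: "poly_curve (\<lambda>s. x_word \<phi> s ws)"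
proof (induction ws)
  case (Cons w ws)
  obtain i t where w: "w = (i, t)" by force
  have "poly_curve (\<lambda>s. X i (t * s))" by (rule poly_curve_scale) (rule poly_curve_x)
  then show ?case using Cons by (simp add: w poly_curve_mult mult.commute)
qed (simp add: poly_curve_const)

lemma x_word_zero [simp]: "x_word \<phi> 0 ws = mat 1"
  by (induction ws) auto

lemma N_one [simp, intro]: "mat 1 \<in> N" and N_mult: "n \<in> N \<Longrightarrow> n' \<in> N \<Longrightarrow> n ** n' \<in> N"
  unfolding group_N_def by (rule generate_GL_one, rule generate_GL_mult)

lemma x_in_N [simp, intro]: "X i t \<in> N"
  unfolding group_N_def by (rule generate.incl) blast

lemma N_induct [consumes 1, case_names one step]:
  assumes "n \<in> N" "P (mat 1)" "\<And>i t n. n \<in> N \<Longrightarrow> P n \<Longrightarrow> P (X i t ** n)"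
  shows "P n"
proof -
  have "N \<subseteq> {n \<in> N. P n}"
    unfolding group_N_def
  proof (rule generate_GL_mono_closed, fold group_N_def)
    fix g assume "g \<in> (\<Union>i. range (X i))"
    then obtain i t where "g = X i t" by blast
    then show "\<exists>g'\<in>\<Union>i. range (X i). g ** g' = mat 1"
      by (intro bexI[of _ "X i (-t)"]) auto
  qed (use assms in \<open>auto intro: N_mult\<close>)
  with assms(1) show ?thesis by blast
qed

lemma N_word: "n \<in> N \<longleftrightarrow> (\<exists>ws. n = x_word \<phi> 1 ws)"
proof
  assume "n \<in> N" then show "\<exists>ws. n = x_word \<phi> 1 ws"
  proof (induction rule: N_induct)
    case one show ?case by (rule exI[of _ "[]"]) simp
  next
    case (step i t n)
    then obtain ws where "n = x_word \<phi> 1 ws" by blast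
    then show ?case by (intro exI[of _ "(i,t) # ws"]) simp
  qed
next
  have "x_word \<phi> 1 ws \<in> N" for ws
  proof (induction ws)
    case (Cons w ws)
    then show ?case by (cases w) (simp add: N_mult)
  qed simp
  then show "\<exists>ws. n = x_word \<phi> 1 ws \<Longrightarrow> n \<in> N" by blast
qed

lemma x_invertible [simp]: "invertible (X i t)" "invertible (Y i t)"
  using x_inverse invertible_right_inverse by blast+

lemma x_matrix_inv [simp]: "matrix_inv (X i t) = X i (-t)" "matrix_inv (Y i t) = Y i (-t)"
  by (rule matrix_inv_eqI, simp)+

lemma S_invertible [simp]: "invertible (S i)" "invertible (S' i)"
  using S_S' invertible_right_inverse by blast+

lemma S_matrix_inv [simp]: "matrix_inv (S i) = S' i" "matrix_inv (S' i) = S i"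
  by (rule matrix_inv_eqI, simp)+

lemma N_invertible: "n \<in> N \<Longrightarrow> invertible n"
  by (induction rule: N_induct) (auto intro: invertible_mult)

lemma N_inv: "n \<in> N \<Longrightarrow> matrix_inv n \<in> N"
  by (induction rule: N_induct) (auto simp: matrix_inv_mult N_invertible intro: N_mult)

lemma torus_invertible [simp]: "\<forall>i. t i \<noteq> 0 \<Longrightarrow> invertible (T t)"
  using torus_inverse(1) invertible_right_inverse by blast

lemma torus_matrix_inv: "\<forall>i. t i \<noteq> 0 \<Longrightarrow> matrix_inv (T t) = T (\<lambda>i. inverse (t i))"
  by (rule matrix_inv_eqI) simp

lemma H_cases: "h \<in> H \<Longrightarrow> (\<And>t. h = T t \<Longrightarrow> \<forall>i. t i \<noteq> 0 \<Longrightarrow> P) \<Longrightarrow> P"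
  unfolding torus_H_def by blast

lemma H_invertible: "h \<in> H \<Longrightarrow> invertible h"
  by (auto elim!: H_cases)

lemma H_matrix_inv: "h \<in> H \<Longrightarrow> matrix_inv h \<in> H"
  by (elim H_cases) (simp add: torus_matrix_inv torus_in_H)

lemma char_simple_root: "char t (simple_root A j) = (\<Prod>i\<in>UNIV. t i powi (A$i$j))"
  by (simp add: char_def simple_root_def)

lemma torus_x: 
  assumes "\<forall>i. t i \<noteq> 0"
  shows "T t ** X j s = X j (char t (simple_root A j) * s) ** T t"
    "T t ** Y j s = Y j (inverse (char t (simple_root A j)) * s) ** T t"
  using torus_x_pos[OF assms] torus_x_neg[OF assms]
  by (simp_all add: char_simple_root power_int_minus prod_inversef[symmetric])

lemma H_commute: "h \<in> H \<Longrightarrow> h' \<in> H \<Longrightarrow> h ** h' = h' ** h"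
  by (auto elim!: H_cases simp: torus_mult mult.commute)

lemma H_N: "h \<in> H \<Longrightarrow> n \<in> N \<Longrightarrow> \<exists>n'\<in>N. h ** n = n' ** h"
proof (elim H_cases)
  fix t assume t: "h = T t" "\<forall>i. t i \<noteq> 0" and "n \<in> N"
  from this(3) show ?thesis
  proof (induction rule: N_induct)
    case one then show ?case by (intro bexI[of _ "mat 1"]) auto
  next
    case (step i s n)
    then obtain n' where n': "n' \<in> N" "h ** n = n' ** h" by blast
    have "h ** (X i s ** n) = X i (char t (simple_root A i) * s) ** (h ** n)"
      using torus_x(1)[OF t(2), of i s] t(1) by (simp add: matrix_mul_assoc)
    also have "\<dots> = (X i (char t (simple_root A i) * s) ** n') ** h"
      by (simp add: n' matrix_mul_assoc)
    finally show ?case using N_mult[OF x_in_N n'(1)] by blast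
  qed
qed

lemma H_N_conj: "h \<in> H \<Longrightarrow> n \<in> N \<Longrightarrow> h ** n ** matrix_inv h \<in> N"
proof -
  assume "h \<in> H" "n \<in> N"
  then obtain n' where "n' \<in> N" "h ** n = n' ** h" using H_N by blast
  moreover have "n' ** h ** matrix_inv h = n'" using H_invertible[OF \<open>h \<in> H\<close>] by (simp add: matrix_mul_assoc')
  ultimately show ?thesis by simp
qed

lemma N_H: "h \<in> H \<Longrightarrow> n \<in> N \<Longrightarrow> \<exists>n'\<in>N. n ** h = h ** n'"
proof -
  assume h: "h \<in> H" and n: "n \<in> N"
  have "matrix_inv h ** n ** h \<in> N"
    using H_N_conj[OF H_matrix_inv[OF h] n] H_invertible[OF h] by simp
  moreover have "n ** h = h ** (matrix_inv h ** n ** h)"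
    using H_invertible[OF h] by (simp add: matrix_mul_assoc)
  ultimately show ?thesis by blast
qed

lemma flip_chevalley: "chevalley A (flip \<phi>)"
  by (rule chevalley_flip) unfold_locales

end

context chevalley
begin

lemma N'_props:
  "mat 1 \<in> N'" "n \<in> N' \<Longrightarrow> n' \<in> N' \<Longrightarrow> n ** n' \<in> N'" "Y i t \<in> N'"
  "n \<in> N' \<Longrightarrow> invertible n" "n \<in> N' \<Longrightarrow> matrix_inv n \<in> N'"
  "h \<in> H \<Longrightarrow> n \<in> N' \<Longrightarrow> h ** n ** matrix_inv h \<in> N'"
  "h \<in> H \<Longrightarrow> n \<in> N' \<Longrightarrow> \<exists>n'\<in>N'. h ** n = n' ** h"
  "h \<in> H \<Longrightarrow> n \<in> N' \<Longrightarrow> \<exists>n'\<in>N'. n ** h = h ** n'"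
proof -
  interpret flip: chevalley A "flip \<phi>" by (rule flip_chevalley)
  show "mat 1 \<in> N'" "n \<in> N' \<Longrightarrow> n' \<in> N' \<Longrightarrow> n ** n' \<in> N'" "Y i t \<in> N'"
  "n \<in> N' \<Longrightarrow> invertible n" "n \<in> N' \<Longrightarrow> matrix_inv n \<in> N'"
  "h \<in> H \<Longrightarrow> n \<in> N' \<Longrightarrow> h ** n ** matrix_inv h \<in> N'"
  "h \<in> H \<Longrightarrow> n \<in> N' \<Longrightarrow> \<exists>n'\<in>N'. h ** n = n' ** h"
  "h \<in> H \<Longrightarrow> n \<in> N' \<Longrightarrow> \<exists>n'\<in>N'. n ** h = h ** n'"
    using flip.N_one flip.N_mult flip.x_in_N flip.N_invertible flip.N_inv flip.H_N_conj flip.H_N flip.N_H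
    by simp_all
qed

lemmas N'_one [simp, intro] = N'_props(1) and N'_mult = N'_props(2) and x_in_N' [simp, intro] = N'_props(3)
  and N'_invertible = N'_props(4) and N'_inv = N'_props(5) and H_N'_conj = N'_props(6)
  and H_N' = N'_props(7) and N'_H = N'_props(8)

section \<open>A regular one-parameter subgroup and the Gauss decomposition\<close>

text \<open>Positive definiteness of the symmetrized form makes \<open>A\<close> injective, hence
  invertible over the reals. The solution is not integral in general, which is why torus elements
  are built from it with \<open>exp\<close> and \<open>Ln\<close> rather than with powers.\<close>

lemma exists_real_coweight: "\<exists>m :: 'i \<Rightarrow> real. \<forall>j. (\<Sum>i\<in>UNIV. m i * of_int (A$i$j)) = b j"
proof -
  define R :: "((real, 'i) vec, 'i) vec" where "R = (\<chi> i j. of_int (A$i$j))"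
  from cartan have "\<exists>d :: 'i \<Rightarrow> real. (\<forall>i. d i > 0) \<and>
        (\<forall>i j. d i * of_int (A $ i $ j) = d j * of_int (A $ j $ i)) \<and>
        (\<forall>v :: (real, 'i) vec. v \<noteq> 0 \<longrightarrow>
           (\<Sum>i\<in>UNIV. \<Sum>j\<in>UNIV. d i * of_int (A $ i $ j) * v $ i * v $ j) > 0)"
    unfolding cartan_matrix_def by (elim conjE)
  then obtain d :: "'i \<Rightarrow> real" where d: "\<forall>v :: (real, 'i) vec. v \<noteq> 0 \<longrightarrow>
           (\<Sum>i\<in>UNIV. \<Sum>j\<in>UNIV. d i * of_int (A $ i $ j) * v $ i * v $ j) > 0"
    by (elim exE conjE)
  have "v = 0" if "R *v v = 0" for v
  proof (rule ccontr)
    assume "v \<noteq> 0"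
    have "(\<Sum>i\<in>UNIV. \<Sum>j\<in>UNIV. d i * of_int (A $ i $ j) * v $ i * v $ j) = (\<Sum>i\<in>UNIV. d i * v $ i * (R *v v) $ i)"
      by (simp add: R_def matrix_vector_mult_def sum_distrib_left mult_ac)
    moreover have "(\<Sum>i\<in>UNIV. \<Sum>j\<in>UNIV. d i * of_int (A $ i $ j) * v $ i * v $ j) > 0"
      by (rule d[rule_format, OF \<open>v \<noteq> 0\<close>])
    ultimately show False using that by simp
  qed
  then have "invertible R" using matrix_left_invertible_ker invertible_left_inverse by blast
  then have "invertible (transpose R)" by (simp add: transpose_invertible)
  then obtain M where "transpose R ** M = mat 1" unfolding invertible_def by blast
  then have "transpose R *v (M *v vec_lambda b) = vec_lambda b" by (simp add: matrix_vector_mul_assoc)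
  moreover have "(transpose R *v w) $ j = (\<Sum>i\<in>UNIV. w $ i * of_int (A$i$j))" for w j
    by (simp add: transpose_def R_def matrix_vector_mult_def mult.commute)
  ultimately have "(\<Sum>i\<in>UNIV. (M *v vec_lambda b) $ i * of_int (A$i$j)) = b j" for j
    by (metis vec_lambda_beta)
  then show ?thesis by blast
qed

lemma simple_roots_independent:
  assumes "(\<Sum>k\<in>UNIV. p k *s simple_root A k) = 0" shows "p k = (0::int)"
proof -
  obtain m :: "'i \<Rightarrow> real" where m: "\<forall>j. (\<Sum>i\<in>UNIV. m i * of_int (A$i$j)) = (if j = k then 1 else 0)"
    using exists_real_coweight[of "\<lambda>j. if j = k then 1 else 0"] by blast
  have z: "(\<Sum>l\<in>UNIV. p l * A$i$l) = 0" for i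
    using arg_cong[OF assms, of "\<lambda>v. v $ i"] by (simp add: simple_root_def)
  have "0 = (\<Sum>i\<in>UNIV. m i * of_int (\<Sum>l\<in>UNIV. p l * A$i$l))" by (simp add: z)
  also have "\<dots> = (\<Sum>i\<in>UNIV. \<Sum>l\<in>UNIV. of_int (p l) * (m i * of_int (A$i$l)))"
    by (simp add: sum_distrib_left mult_ac)
  also have "\<dots> = (\<Sum>l\<in>UNIV. of_int (p l) * (\<Sum>i\<in>UNIV. m i * of_int (A$i$l)))"
    unfolding sum_distrib_left by (rule sum.swap)
  also have "\<dots> = of_int (p k)" by (simp add: m if_distrib cong: if_cong)
  finally show ?thesis by simp
qed

text \<open>Coordinates along the simple coroots of the sum of the fundamental coweights, on which
  every simple root takes the value \<open>1\<close>.\<close>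

definition coweight :: "'i \<Rightarrow> real" where
  "coweight = (SOME m. \<forall>j. (\<Sum>i\<in>UNIV. m i * of_int (A$i$j)) = 1)"

lemma coweight: "(\<Sum>i\<in>UNIV. coweight i * of_int (A$i$j)) = 1"
  using someI_ex[OF exists_real_coweight[of "\<lambda>_. 1"]] unfolding coweight_def by blast

text \<open>The principal one-parameter subgroup: it scales all simple root directions by the same
  factor \<open>exp c\<close>. The parameter is complex so that any non-zero factor \<open>s\<close>
  is reached, at \<open>Ln s\<close>.\<close>

definition mu :: "complex \<Rightarrow> complex^'m^'m" where
  "mu c = T (\<lambda>i. exp (of_real (coweight i) * c))"

lemma mu_zero [simp]: "mu 0 = mat 1"
  by (simp add: mu_def)

lemma mu_add: "mu (a + b) = mu a ** mu b"
  by (simp add: mu_def torus_mult exp_add ring_distribs)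

lemma mu_inverse [simp]: "mu a ** mu (-a) = mat 1" "mu (-a) ** mu a = mat 1"
  using mu_add[of a "-a"] mu_add[of "-a" a] by simp_all

lemma mu_in_H: "mu a \<in> H"
  by (simp add: mu_def torus_in_H)

lemma mu_invertible [simp]: "invertible (mu a)"
  by (simp add: H_invertible mu_in_H)

lemma mu_matrix_inv [simp]: "matrix_inv (mu a) = mu (-a)"
  by (rule matrix_inv_eqI) simp

lemma char_exp:
  "char (\<lambda>i. exp (of_real (m i) * c)) \<gamma> = exp (of_real (\<Sum>i\<in>UNIV. m i * of_int (\<gamma>$i)) * c)"
proof -
  have "char (\<lambda>i. exp (of_real (m i) * c)) \<gamma> = (\<Prod>i\<in>UNIV. exp (of_int (\<gamma>$i) * (of_real (m i) * c)))"
    by (simp add: char_def exp_power_int)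
  also have "\<dots> = exp (\<Sum>i\<in>UNIV. of_int (\<gamma>$i) * (of_real (m i) * c))" by (simp add: exp_sum)
  finally show ?thesis by (simp add: sum_distrib_left mult_ac)
qed

lemma mu_char_root: "char (\<lambda>i. exp (of_real (coweight i) * c)) (simple_root A j) = exp c"
  using coweight[of j] by (simp add: char_exp simple_root_def)

lemma mu_x: "mu c ** X j s = X j (exp c * s) ** mu c" "mu c ** Y j s = Y j (exp (-c) * s) ** mu c"
  unfolding mu_def using torus_x mu_char_root by (simp_all add: exp_minus)

lemma mu_x_word: "mu c ** x_word \<phi> s ws = x_word \<phi> (exp c * s) ws ** mu c"
proof (induction ws)
  case (Cons w ws)
  obtain i t where w: "w = (i, t)" by force
  have "mu c ** x_word \<phi> s (w # ws) = (mu c ** X i (s * t)) ** x_word \<phi> s ws"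
    by (simp add: w matrix_mul_assoc)
  also have "\<dots> = X i (exp c * s * t) ** (mu c ** x_word \<phi> s ws)"
    by (simp add: mu_x matrix_mul_assoc mult.assoc)
  finally show ?case by (simp add: Cons w matrix_mul_assoc)
qed simp

lemma mu_x_word_flip: "mu c ** x_word (flip \<phi>) s ws = x_word (flip \<phi>) (exp (-c) * s) ws ** mu c"
proof (induction ws)
  case (Cons w ws)
  obtain i t where w: "w = (i, t)" by force
  have "mu c ** x_word (flip \<phi>) s (w # ws) = (mu c ** Y i (s * t)) ** x_word (flip \<phi>) s ws"
    by (simp add: w matrix_mul_assoc)
  also have "\<dots> = Y i (exp (-c) * s * t) ** (mu c ** x_word (flip \<phi>) s ws)"
    by (simp add: mu_x matrix_mul_assoc mult.assoc)
  finally show ?case by (simp add: Cons w matrix_mul_assoc)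
qed simp

lemma poly_curve_inverse_constant:
  assumes "poly_curve a" "poly_curve b" "\<And>s. s \<noteq> 0 \<Longrightarrow> a s = b (inverse s)"
  shows "a s = a 0" "a 0 = b 0"
proof -
  have "a s $ k $ l = a 0 $ k $ l \<and> a 0 $ k $ l = b 0 $ k $ l" for k l
  proof -
    from assms(1,2) obtain p q where pq: "\<forall>t. a t $ k $ l = poly p t" "\<forall>t. b t $ k $ l = poly q t"
      unfolding poly_curve_def by meson
    have *: "\<And>s. s \<noteq> 0 \<Longrightarrow> poly p s = poly q (inverse s)" using assms(3) pq by metis
    obtain c where "p = [:c:]" using degree_eq_zeroE[OF poly_inverse_constant(1)[OF *]] by blast
    then show ?thesis using poly_inverse_constant(2)[OF *] pq by simp
  qed
  then show "a s = a 0" "a 0 = b 0" by (simp_all add: vec_eq_iff)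
qed

lemma poly_curve_x_word_flip: "poly_curve (\<lambda>s. x_word (flip \<phi>) s ws)"
  by (rule chevalley.poly_curve_x_word[OF flip_chevalley])

lemma N'_word: "n \<in> N' \<longleftrightarrow> (\<exists>ws. n = x_word (flip \<phi>) 1 ws)"
  using chevalley.N_word[OF flip_chevalley, of n] by simp

text \<open>Conjugation by \<open>mu (Ln s)\<close> turns \<open>n\<close> into a polynomial curve
  in \<open>s\<close> and \<open>n'\<close> into one in \<open>1/s\<close>, and leaves
  \<open>h\<close> alone. By \<open>poly_curve_inverse_constant\<close> the common curve is
  constant, and at parameter \<open>0\<close> both words are the identity.\<close>

lemma N'_H_N_trivial:
  assumes "n' \<in> N'" "h \<in> H" "n \<in> N" "n' ** h = n"
  shows "n' = mat 1" "h = mat 1" "n = mat 1"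
proof -
  obtain ws where ws: "n = x_word \<phi> 1 ws" using assms(3) N_word by blast
  obtain ws' where ws': "n' = x_word (flip \<phi>) 1 ws'" using assms(1) N'_word by blast
  have eq: "x_word \<phi> s ws = x_word (flip \<phi>) (inverse s) ws' ** h" if s: "s \<noteq> 0" for s
  proof (rule matrix_cancel_right)
    show "invertible (mu (Ln s))" by simp
    have "x_word \<phi> s ws ** mu (Ln s) = mu (Ln s) ** n" using s by (simp add: ws mu_x_word)
    also have "\<dots> = (mu (Ln s) ** n') ** h" using assms(4) by (simp add: matrix_mul_assoc')
    also have "mu (Ln s) ** n' = x_word (flip \<phi>) (inverse s) ws' ** mu (Ln s)"
      using s by (simp add: ws' mu_x_word_flip exp_minus)
    also have "\<dots> ** h = x_word (flip \<phi>) (inverse s) ws' ** h ** mu (Ln s)"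
      using H_commute[OF mu_in_H assms(2)] by (simp add: matrix_mul_assoc')
    finally show "x_word \<phi> s ws ** mu (Ln s) = x_word (flip \<phi>) (inverse s) ws' ** h ** mu (Ln s)" .
  qed
  have pc: "poly_curve (\<lambda>s. x_word \<phi> s ws)" "poly_curve (\<lambda>s. x_word (flip \<phi>) s ws' ** h)"
    by (rule poly_curve_x_word) (rule poly_curve_mult[OF poly_curve_x_word_flip poly_curve_const])
  note c = poly_curve_inverse_constant[OF pc eq]
  show n: "n = mat 1" using c(1)[of 1] by (simp add: ws)
  have "x_word (flip \<phi>) 0 ws' = mat 1"
    by (rule chevalley.x_word_zero[OF flip_chevalley])
  then show h: "h = mat 1" using c(2) by simp
  show "n' = mat 1" using assms(4) n h by simp
qed

lemma gauss_unique:
  assumes "n1' \<in> N'" "h1 \<in> H" "n1 \<in> N" "n2' \<in> N'" "h2 \<in> H" "n2 \<in> N"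
    and eq: "n1' ** h1 ** n1 = n2' ** h2 ** n2"
  shows "n1' = n2'" "h1 = h2" "n1 = n2"
proof -
  note inv = N'_invertible[OF assms(1)] H_invertible[OF assms(2)] N_invertible[OF assms(3)]
    N'_invertible[OF assms(4)] H_invertible[OF assms(5)] N_invertible[OF assms(6)]
  have "matrix_inv n2' ** (n1' ** h1 ** n1) ** matrix_inv n1 ** matrix_inv h2 =
    matrix_inv n2' ** (n2' ** h2 ** n2) ** matrix_inv n1 ** matrix_inv h2"
    by (simp only: eq)
  moreover have "matrix_inv n2' ** (n1' ** h1 ** n1) ** matrix_inv n1 = matrix_inv n2' ** n1' ** h1"
    using inv(3) by (simp add: matrix_mul_assoc')
  moreover have "matrix_inv n2' ** (n2' ** h2 ** n2) = h2 ** n2"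
    using inv(4) by (simp add: matrix_mul_assoc)
  ultimately have *: "(matrix_inv n2' ** n1') ** (h1 ** matrix_inv h2) = h2 ** (n2 ** matrix_inv n1) ** matrix_inv h2"
    by (simp add: matrix_mul_assoc)
  have "matrix_inv n2' ** n1' \<in> N'" "h1 ** matrix_inv h2 \<in> H" "h2 ** (n2 ** matrix_inv n1) ** matrix_inv h2 \<in> N"
    using assms by (auto intro: N'_mult N'_inv H_mult H_matrix_inv H_N_conj N_mult N_inv)
  note t = N'_H_N_trivial[OF this *]
  have "n2' ** (matrix_inv n2' ** n1') = n2'" by (simp add: t)
  then show n': "n1' = n2'" using inv(4) by (simp add: matrix_mul_assoc)
  have "(h1 ** matrix_inv h2) ** h2 = h2" by (simp add: t)
  then show h: "h1 = h2" using inv(5) by (simp add: matrix_mul_assoc')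
  show "n1 = n2"
  proof (rule matrix_cancel_left)
    show "invertible (n2' ** h2)" using inv by (simp add: invertible_mult)
    show "n2' ** h2 ** n1 = n2' ** h2 ** n2" using eq n' h by simp
  qed
qed

section \<open>Commutation and the action of the Weyl group on the torus\<close>

text \<open>For \<open>r \<noteq> 0\<close>, \<open>X i r\<close> is a product of
  \<open>Y i\<close>, \<open>S' i\<close> and \<open>K i\<close> with entries in \<open>1/r\<close>.
  Now \<open>Y i\<close> commutes with \<open>X j\<close>, and \<open>K i\<close> does so when the
  Cartan integer is \<open>0\<close>. So the conjugate of \<open>X j t\<close> by
  \<open>X i r\<close> is polynomial in \<open>1/r\<close> as well as in \<open>r\<close>, and
  equals its value at \<open>r = 0\<close>.\<close>

lemma x_pos_commute:
  assumes "i \<noteq> j" "A$i$j = 0"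
  shows "X i r ** X j t = X j t ** X i r"
proof -
  define Z where "Z = S' i ** X j t ** S i"
  have KS: "K i r ** S' i = S' i ** K i (inverse r)" if "r \<noteq> 0" for r
    using that unfolding coroot_def S'_def by (simp add: phi22_mult)
  have dec: "X i r = Y i (inverse r) ** (S' i ** K i (inverse r)) ** Y i (inverse r)" if "r \<noteq> 0" for r
    using that unfolding coroot_def S'_def x_pos_def x_neg_def by (simp add: phi22_mult)
  have *: "X i r ** X j t ** X i (-r) = Y i (inverse r) ** Z ** Y i (- inverse r)" if r: "r \<noteq> 0" for r
  proof -
    have dec': "X i (-r) = Y i (- inverse r) ** (K i r ** S i) ** Y i (- inverse r)"
      using r unfolding coroot_def s_bar_def x_pos_def x_neg_def by (simp add: phi22_mult)
    have Yj: "Y i (inverse r) ** X j t ** Y i (- inverse r) = X j t"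
      using x_pos_neg_commute[of j i t "inverse r", symmetric] assms(1) by (simp add: matrix_mul_assoc'[of "X j t"])
    have Kj: "K i (inverse r) ** X j t ** K i r = X j t"
      using coroot_x_pos[of "inverse r" i j t] r assms(2) by (simp add: matrix_mul_assoc' coroot_inverse)
    have "X i r ** X j t ** X i (-r) = Y i (inverse r) ** (S' i ** (K i (inverse r) **
       (Y i (inverse r) ** X j t ** Y i (- inverse r)) ** K i r) ** S i) ** Y i (- inverse r)"
      by (simp only: dec[OF r] dec' matrix_mul_assoc)
    also have "\<dots> = Y i (inverse r) ** Z ** Y i (- inverse r)"
      by (simp only: Yj Kj Z_def)
    finally show ?thesis .
  qed
  have pc: "poly_curve (\<lambda>r. X i r ** X j t ** X i (-r))" "poly_curve (\<lambda>r. Y i r ** Z ** Y i (-r))"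
    using poly_curve_scale[OF poly_curve_x(1), of i "-1"] poly_curve_scale[OF poly_curve_x(2), of i "-1"]
    by (auto intro!: poly_curve_mult poly_curve_const poly_curve_x)
  have "X i r ** X j t ** X i (-r) = X j t"
    using poly_curve_inverse_constant(1)[OF pc *, of r] by simp
  then have "X i r ** X j t ** X i (-r) ** X i r = X j t ** X i r" by simp
  then show ?thesis by (simp add: matrix_mul_assoc')
qed

lemma x_neg_commute:
  assumes "i \<noteq> j" "A$i$j = 0"
  shows "Y i r ** Y j t = Y j t ** Y i r"
  using chevalley.x_pos_commute[OF flip_chevalley assms] by simp

lemma s_bar_commute:
  assumes "i \<noteq> j" "A$i$j = 0"
  shows "S i ** S j = S j ** S i"
proof -
  have A: "A$j$i = 0" using assms cartan by (simp add: cartan_matrix_def)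
  have comm: "g ** (X k a ** Y k b ** X k a) = (X k a ** Y k b ** X k a) ** g"
    if "g ** X k a = X k a ** g" "g ** Y k b = Y k b ** g" for g a b k
    by (metis (no_types) that matrix_mul_assoc)
  have "X i r ** S j = S j ** X i r" for r
    unfolding s_bar_eq using assms by (intro comm x_pos_commute x_pos_neg_commute)
  moreover have "Y i r ** S j = S j ** Y i r" for r
    unfolding s_bar_eq using assms by (intro comm x_neg_commute x_pos_neg_commute[symmetric]) auto
  ultimately have "S j ** S i = S i ** S j"
    unfolding s_bar_eq[of i] by (intro comm) auto
  then show ?thesis ..
qed

lemma coroot_s_bar:
  assumes "s \<noteq> 0" shows "K j s ** S i = S i ** K i (s powi (- (A$j$i))) ** K j s"
proof -
  define c where "c = s powi (A$j$i)"
  have c: "c \<noteq> 0" using assms by (simp add: c_def)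
  have "K j s ** S i = (K j s ** X i (-1)) ** Y i 1 ** X i (-1)" by (simp add: s_bar_eq matrix_mul_assoc)
  also have "\<dots> = X i (-c) ** (K j s ** Y i 1) ** X i (-1)"
    using assms by (simp add: coroot_x_pos c_def matrix_mul_assoc)
  also have "\<dots> = X i (-c) ** Y i (inverse c) ** (K j s ** X i (-1))"
    using assms by (simp add: coroot_x_neg c_def matrix_mul_assoc power_int_minus)
  also have "\<dots> = (X i (-c) ** Y i (inverse c) ** X i (-c)) ** K j s"
    using assms by (simp add: coroot_x_pos c_def matrix_mul_assoc)
  also have "X i (-c) ** Y i (inverse c) ** X i (-c) = S i ** K i (inverse c)"
    unfolding x_pos_def x_neg_def s_bar_def coroot_def using c by (simp add: phi22_mult)
  finally show ?thesis by (simp add: c_def power_int_minus)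
qed

text \<open>In coordinates along the coroots, the simple reflection of a torus element changes only
  the entry \<open>i\<close>, dividing it by the value of the root \<open>i\<close>. The factor is
  collected from \<open>coroot_s_bar\<close> letter by letter.\<close>

lemma torus_s_bar:
  assumes t: "\<forall>i. t i \<noteq> 0"
  shows "T t ** S i = S i ** T (t(i := t i * inverse (char t (simple_root A i))))"
proof -
  have "mat_prod (map (\<lambda>j. K j (t j)) us) ** S i =
    S i ** K i (prod_list (map (\<lambda>j. t j powi (- (A$j$i))) us)) ** mat_prod (map (\<lambda>j. K j (t j)) us)" for us
  proof (induction us)
    case (Cons u us)
    let ?p = "prod_list (map (\<lambda>j. t j powi (- (A$j$i))) us)"
    have p: "?p \<noteq> 0" using t by (induction us) auto
    have "mat_prod (map (\<lambda>j. K j (t j)) (u # us)) ** S i = K u (t u) ** (mat_prod (map (\<lambda>j. K j (t j)) us) ** S i)"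
      by (simp add: matrix_mul_assoc)
    also have "\<dots> = (K u (t u) ** S i) ** K i ?p ** mat_prod (map (\<lambda>j. K j (t j)) us)"
      by (simp only: Cons matrix_mul_assoc)
    also have "\<dots> = S i ** K i (t u powi (- (A$u$i))) ** (K u (t u) ** K i ?p) ** mat_prod (map (\<lambda>j. K j (t j)) us)"
      using t by (simp add: coroot_s_bar matrix_mul_assoc)
    also have "K u (t u) ** K i ?p = K i ?p ** K u (t u)" using t p by (intro coroot_commute) auto
    also have "S i ** K i (t u powi (- (A$u$i))) ** (K i ?p ** K u (t u)) ** mat_prod (map (\<lambda>j. K j (t j)) us) =
      S i ** (K i (t u powi (- (A$u$i))) ** K i ?p) ** mat_prod (map (\<lambda>j. K j (t j)) (u # us))"
      by (simp add: matrix_mul_assoc)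
    finally show ?case using t p by (simp add: coroot_mult)
  qed simp
  then have "T t ** S i = S i ** K i (inverse (char t (simple_root A i))) ** T t"
    unfolding torus_elem_def
    by (simp add: prod_list_index_list char_simple_root power_int_minus prod_inversef[symmetric])
  moreover have "char t (simple_root A i) \<noteq> 0" using t by (simp add: char_def)
  moreover have "K i c ** T t = T (t(i := t i * c))" if "c \<noteq> 0" for c
  proof -
    have "K i c ** T t = T (\<lambda>j. ((\<lambda>_. 1)(i := c)) j * t j)"
      unfolding coroot_torus[OF that] using that t by (intro torus_mult) auto
    also have "(\<lambda>j. ((\<lambda>_. 1)(i := c)) j * t j) = t(i := t i * c)" by (auto simp: fun_eq_iff)
    finally show ?thesis .
  qed
  ultimately show ?thesis by (simp add: matrix_mul_assoc')
qed

lemma char_reflection: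
  assumes t: "\<forall>i. t i \<noteq> 0"
  shows "char (t(i := t i * inverse (char t (simple_root A i)))) \<gamma> = char t (simple_reflection A i \<gamma>)"
proof -
  let ?c = "char t (simple_root A i)"
  have "char (t(i := t i * inverse ?c)) \<gamma> =
    (\<Prod>k\<in>UNIV. t k powi (\<gamma>$k) * (if k = i then (inverse ?c) powi (\<gamma>$i) else 1))"
    unfolding char_def by (intro prod.cong) (auto simp: power_int_mult_distrib)
  also have "\<dots> = char t \<gamma> * (inverse ?c) powi (\<gamma>$i)"
    by (simp add: prod.distrib char_def)
  also have "(inverse ?c) powi (\<gamma>$i) = (\<Prod>k\<in>UNIV. t k powi (- (\<gamma>$i * A$k$i)))"
  proof -
    have "t k powi (- (\<gamma>$i * A$k$i)) = (inverse (t k powi (A$k$i))) powi (\<gamma>$i)" for k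
    proof -
      have "t k powi (- (\<gamma>$i * A$k$i)) = inverse ((t k powi (A$k$i)) powi (\<gamma>$i))"
        by (simp only: power_int_minus mult.commute[of "\<gamma>$i"] power_int_mult)
      then show ?thesis by (simp only: power_int_inverse)
    qed
    moreover have "inverse ?c = (\<Prod>k\<in>UNIV. inverse (t k powi (A$k$i)))"
      unfolding char_simple_root by (rule prod_inversef[unfolded o_def, symmetric])
    ultimately show ?thesis by (simp only: power_int_prod)
  qed
  also have "char t \<gamma> * \<dots> = char t (simple_reflection A i \<gamma>)"
    unfolding char_def prod.distrib[symmetric] simple_reflection_def simple_root_def
    by (intro prod.cong refl) (use t in \<open>simp add: power_int_add[symmetric]\<close>)
  finally show ?thesis .
qed

lemma torus_word:
  assumes "\<And>k. k \<in> set us \<Longrightarrow> f k = S k \<or> f k = S' k" "\<forall>i. t i \<noteq> 0"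
  shows "\<exists>t'. (\<forall>i. t' i \<noteq> 0) \<and> T t ** mat_prod (map f us) = mat_prod (map f us) ** T t' \<and>
    (\<forall>\<gamma>. char t' \<gamma> = char t (word_action A us \<gamma>))"
  using assms
proof (induction us arbitrary: t)
  case Nil then show ?case by (auto simp: word_action_def)
next
  case (Cons u us)
  define t1 where "t1 = t(u := t u * inverse (char t (simple_root A u)))"
  have t1: "\<forall>i. t1 i \<noteq> 0" using Cons.prems(2) by (auto simp: t1_def char_def)
  have S: "T t ** S u = S u ** T t1" unfolding t1_def by (rule torus_s_bar[OF Cons.prems(2)])
  have "T t ** f u = f u ** T t1"
  proof (cases "f u = S u")
    case False
    then have fu: "f u = S u ** K u (-1)" using Cons.prems(1)[of u] S'_eq_S by auto
    have "T t ** f u = (T t ** S u) ** K u (-1)" by (simp add: fu matrix_mul_assoc)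
    also have "\<dots> = S u ** (T t1 ** K u (-1))" by (simp add: S matrix_mul_assoc)
    also have "T t1 ** K u (-1) = K u (-1) ** T t1"
      by (rule H_commute) (use t1 in \<open>auto intro: torus_in_H coroot_in_H\<close>)
    finally show ?thesis by (simp add: fu matrix_mul_assoc)
  qed (simp add: S)
  moreover obtain t' where t': "\<forall>i. t' i \<noteq> 0" "T t1 ** mat_prod (map f us) = mat_prod (map f us) ** T t'"
    "\<forall>\<gamma>. char t' \<gamma> = char t1 (word_action A us \<gamma>)"
    using Cons.IH[OF _ t1] Cons.prems(1) by auto
  ultimately have "T t ** mat_prod (map f (u # us)) = mat_prod (map f (u # us)) ** T t'"
    by (simp add: matrix_mul_assoc) (simp add: matrix_mul_assoc')
  moreover have "char t1 \<gamma> = char t (simple_reflection A u \<gamma>)" for \<gamma>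
    unfolding t1_def by (rule char_reflection[OF Cons.prems(2)])
  ultimately show ?case using t' by (intro exI[of _ t']) (simp add: word_action_def)
qed

end

section \<open>Closure of the unipotent group\<close>

lemma matrix_mult_scaleR:
  fixes A B :: "complex^'m^'m"
  shows "(r *\<^sub>R A) ** B = r *\<^sub>R (A ** B)" "A ** (r *\<^sub>R B) = r *\<^sub>R (A ** B)"
  by (simp_all add: vec_eq_iff matrix_matrix_mult_def scaleR_sum_right)

lemma matrix_mult_distribs:
  fixes A B C :: "complex^'m^'m"
  shows "(A + B) ** C = A ** C + B ** C" "A ** (B + C) = A ** B + A ** C"
    "(A - B) ** C = A ** C - B ** C" "A ** (B - C) = A ** B - A ** C"
    "0 ** C = 0" "C ** 0 = 0" "(- A) ** C = - (A ** C)" "A ** (- C) = - (A ** C)"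
  by (simp_all add: vec_eq_iff matrix_matrix_mult_def ring_distribs sum.distrib sum_subtractf sum_negf)

lemma bounded_bilinear_matrix_mult: "bounded_bilinear ((**) :: complex^'m^'m \<Rightarrow> complex^'m^'m \<Rightarrow> complex^'m^'m)"
  unfolding bilinear_conv_bounded_bilinear[symmetric] bilinear_def
  by (auto intro!: linearI simp: matrix_mult_distribs matrix_mult_scaleR)

lemmas mult_vder = bounded_bilinear.has_vector_derivative[OF bounded_bilinear_matrix_mult]
lemmas mult_deriv = bounded_bilinear.FDERIV[OF bounded_bilinear_matrix_mult]
lemmas mult_tendsto = bounded_bilinear.tendsto[OF bounded_bilinear_matrix_mult]
lemmas mult_continuous_on = bounded_bilinear.continuous_on[OF bounded_bilinear_matrix_mult]

lemma vec2_differentiable: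
  fixes f :: "real \<Rightarrow> complex^'n^'m"
  assumes "\<And>k l. (\<lambda>x. f x $ k $ l) differentiable (at x)"
  shows "f differentiable (at x)"
proof -
  have "(\<lambda>x. f x \<bullet> b) differentiable (at x)" if b: "b \<in> Basis" for b
  proof -
    from b obtain k u where b1: "b = axis k u" "u \<in> Basis" unfolding Basis_vec_def by blast
    then obtain l v where u: "u = axis l v" unfolding Basis_vec_def by blast
    have "(\<lambda>x. f x \<bullet> b) = (\<lambda>x. f x $ k $ l \<bullet> v)" by (simp add: b1 u inner_axis)
    then show ?thesis using assms[of k l] by (auto intro: differentiable_inner)
  qed
  then show ?thesis using differentiable_componentwise_within[of f x UNIV] by simp
qed

definition Ad :: "complex^'m^'m \<Rightarrow> complex^'m^'m \<Rightarrow> complex^'m^'m" where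
  "Ad g M = g ** M ** matrix_inv g"

lemma linear_Ad: "linear (Ad g)"
  by (rule linearI) (simp_all add: Ad_def matrix_mult_distribs matrix_mult_scaleR)

lemma Ad_mult: "invertible g \<Longrightarrow> invertible h \<Longrightarrow> Ad (g ** h) M = Ad g (Ad h M)"
  by (simp add: Ad_def matrix_inv_mult matrix_mul_assoc)

lemma Ad_one [simp]: "Ad (mat 1) M = M"
  by (simp add: Ad_def)

lemma Ad_inverse [simp]:
  assumes "invertible g" shows "Ad (matrix_inv g) (Ad g M) = M" "Ad g (Ad (matrix_inv g) M) = M"
  using assms by (simp_all add: Ad_mult[symmetric])

lemma Ad_eqI: "invertible g \<Longrightarrow> g ** M = M' ** g \<Longrightarrow> Ad g M = M'"
  by (simp add: Ad_def matrix_mul_assoc')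

lemma Ad_vder:
  assumes "(c has_vector_derivative D) (at x)" shows "((\<lambda>t. Ad g (c t)) has_vector_derivative Ad g D) (at x)"
  using bounded_linear.has_vector_derivative[OF linear_conv_bounded_linear[THEN iffD1, OF linear_Ad] assms] .

lemma Ad_fixed_iff:
  assumes g: "invertible g" shows "Ad g M = M \<longleftrightarrow> g ** M = M ** g"
proof
  assume *: "Ad g M = M"
  have "Ad g M ** g = g ** M" using g by (simp add: Ad_def matrix_mul_assoc')
  then show "g ** M = M ** g" by (simp add: *)
qed (rule Ad_eqI[OF g])

text \<open>The difference quotients lie in \<open>V\<close>, which is closed because the dimension
  is finite.\<close>

lemma subspace_derivative:
  fixes c :: "real \<Rightarrow> 'a::euclidean_space"
  assumes "subspace V" "\<And>t. c t \<in> V" "(c has_vector_derivative D) (at x)"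
  shows "D \<in> V"
proof (rule Lim_in_closed_set)
  show "closed V" using assms(1) by (rule closed_subspace)
  show "\<forall>\<^sub>F h in at 0. (c (x + h) - c x) /\<^sub>R h \<in> V"
    using assms by (intro always_eventually allI subspace_scale subspace_diff)
  have "((\<lambda>h. norm (c (x + h) - c x - h *\<^sub>R D) / norm h) \<longlongrightarrow> 0) (at 0)"
    using assms(3) by (simp add: has_vector_derivative_def has_derivative_at)
  moreover have "\<forall>\<^sub>F h in at 0. norm (c (x + h) - c x - h *\<^sub>R D) / norm h = norm ((c (x + h) - c x) /\<^sub>R h - D)"
  proof (rule eventually_at_topological[THEN iffD2], intro exI[of _ UNIV] conjI ballI impI)
    fix h :: real assume "h \<noteq> 0"
    then have "(c (x + h) - c x) /\<^sub>R h - D = (c (x + h) - c x - h *\<^sub>R D) /\<^sub>R h"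
      by (simp add: scaleR_diff_right)
    then show "norm (c (x + h) - c x - h *\<^sub>R D) / norm h = norm ((c (x + h) - c x) /\<^sub>R h - D)"
      by (simp add: divide_inverse mult.commute)
  qed auto
  ultimately have "((\<lambda>h. norm ((c (x + h) - c x) /\<^sub>R h - D)) \<longlongrightarrow> 0) (at 0)"
    by (rule Lim_transform_eventually)
  then show "((\<lambda>h. (c (x + h) - c x) /\<^sub>R h) \<longlongrightarrow> D) (at 0)"
    by (simp add: tendsto_norm_zero_iff LIM_zero_iff)
qed simp

section \<open>Tangent vectors of \<open>N\<close> and the grading element\<close>

context chevalley
begin

text \<open>Tangent vectors are taken along real parameters, so the complex scalar \<open>c\<close>
  sits inside the curve; \<open>ex_scale\<close> pulls out real multiples.\<close>

definition ex :: "'i \<Rightarrow> complex \<Rightarrow> complex^'m^'m" where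
  "ex j c = vector_derivative (\<lambda>t. X j (c * of_real t)) (at 0)"

lemma ex_vder: "((\<lambda>t. X j (c * of_real t)) has_vector_derivative ex j c) (at 0)"
proof -
  have "(\<lambda>t. X j (c * of_real t)) differentiable (at 0)"
  proof (rule vec2_differentiable)
    fix k l
    obtain p where p: "\<And>t. X j t $ k $ l = poly p t" using poly_curve_x(1)[of j] unfolding poly_curve_def by meson
    show "(\<lambda>t. X j (c * of_real t) $ k $ l) differentiable (at 0)"
      unfolding p differentiable_def
      by (rule exI, rule has_derivative_compose[where g = "poly p", OF has_derivative_mult_right[OF has_derivative_of_real[OF has_derivative_ident]]
            poly_DERIV[unfolded has_field_derivative_def]])
  qed
  then show ?thesis unfolding ex_def by (simp add: vector_derivative_works)
qed

lemma ex_unique: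
  assumes "(c has_vector_derivative D) (at 0)" "\<And>t. c t = X j (b * of_real t)"
  shows "D = ex j b"
proof -
  have "c = (\<lambda>t. X j (b * of_real t))" using assms(2) by auto
  then show ?thesis using vector_derivative_unique_at[OF assms(1)] ex_vder by metis
qed

lemma ex_scale: "ex j (of_real r * c) = r *\<^sub>R ex j c"
proof -
  have "((\<lambda>t. X j (c * of_real t)) \<circ> (\<lambda>t. r * t) has_vector_derivative r *\<^sub>R ex j c) (at 0)"
    by (rule vector_diff_chain_at) (auto intro!: derivative_eq_intros ex_vder)
  then show ?thesis by (rule ex_unique[symmetric]) (simp add: mult_ac)
qed

lemma Ad_ex:
  assumes "invertible g" "\<And>t. g ** X j t = X j (a * t) ** g"
  shows "Ad g (ex j c) = ex j (a * c)"
proof (rule ex_unique)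
  show "((\<lambda>t. Ad g (X j (c * of_real t))) has_vector_derivative Ad g (ex j c)) (at 0)"
    by (rule Ad_vder[OF ex_vder])
  show "Ad g (X j (c * of_real t)) = X j (a * c * of_real t)" for t
    using assms by (intro Ad_eqI) (simp_all add: mult.assoc)
qed

lemma Ad_mu_ex: "Ad (mu (of_real t)) (ex j c) = exp t *\<^sub>R ex j c"
  using Ad_ex[of "mu (of_real t)" j "exp (of_real t)" c] ex_scale[of j "exp t" c]
  by (simp add: mu_x exp_of_real)

lemma Ad_x_neg_ex: "k \<noteq> i \<Longrightarrow> Ad (Y k s) (ex i c) = ex i c"
  using Ad_ex[of "Y k s" i 1 c] x_pos_neg_commute[of i k] by simp

lemma coroot_invertible [simp]: "s \<noteq> 0 \<Longrightarrow> invertible (K k s)"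
  using H_invertible coroot_in_H by blast

lemma Ad_coroot_ex: "s \<noteq> 0 \<Longrightarrow> Ad (K k s) (ex i c) = ex i (s powi (A$k$i) * c)"
  using Ad_ex[of "K k s" i "s powi (A$k$i)" c] coroot_x_pos by simp

text \<open>The span of the conjugates of the \<open>ex j c\<close> serves as the Lie algebra of \<open>N\<close>.\<close>

definition nn :: "(complex^'m^'m) set" where
  "nn = span {Ad n (ex j c) | n j c. n \<in> N}"

lemma nn_subspace: "subspace nn"
  by (simp add: nn_def)

lemma Ad_ex_nn: "n \<in> N \<Longrightarrow> Ad n (ex j c) \<in> nn"
  unfolding nn_def by (rule span_base) blast

lemma linear_nn:
  assumes "linear f" "subspace V" "\<And>n j c. n \<in> N \<Longrightarrow> f (Ad n (ex j c)) \<in> V" "Z \<in> nn"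
  shows "f Z \<in> V"
proof -
  have "f ` nn = span (f ` {Ad n (ex j c) | n j c. n \<in> N})"
    unfolding nn_def by (rule linear_span_image[OF assms(1), symmetric])
  also have "\<dots> \<subseteq> V" using assms(2,3) by (intro span_minimal) auto
  finally show ?thesis using assms(4) by blast
qed

lemma Ad_N_nn: "n \<in> N \<Longrightarrow> Z \<in> nn \<Longrightarrow> Ad n Z \<in> nn"
  by (rule linear_nn[OF linear_Ad nn_subspace])
    (simp_all add: Ad_mult[symmetric] N_invertible Ad_ex_nn N_mult)

lemma mu_N_conj: "n \<in> N \<Longrightarrow> mu t ** n ** mu (-t) \<in> N"
  using H_N_conj[OF mu_in_H, of n t] by simp

lemma Ad_mu_conj:
  assumes "invertible n" shows "Ad (mu t) (Ad n Z) = Ad (mu t ** n ** mu (-t)) (Ad (mu t) Z)"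
proof -
  have "mu t ** n = mu t ** n ** mu (-t) ** mu t" by (simp add: matrix_mul_assoc')
  then have "Ad (mu t ** n) Z = Ad (mu t ** n ** mu (-t) ** mu t) Z" by simp
  then show ?thesis using assms by (simp add: Ad_mult invertible_mult)
qed

lemma Ad_mu_Ad_ex:
  "n \<in> N \<Longrightarrow> Ad (mu (of_real t)) (Ad n (ex j c)) = exp t *\<^sub>R Ad (mu (of_real t) ** n ** mu (- of_real t)) (ex j c)"
  by (simp add: Ad_mu_conj N_invertible Ad_mu_ex linear_scale[OF linear_Ad])

lemma Ad_mu_nn: "Z \<in> nn \<Longrightarrow> Ad (mu (of_real t)) Z \<in> nn"
  by (rule linear_nn[OF linear_Ad nn_subspace])
    (simp_all add: Ad_mu_Ad_ex Ad_ex_nn mu_N_conj subspace_scale[OF nn_subspace])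

text \<open>The curves \<open>X i\<close> and \<open>Y i\<close> are the ones known to be
  polynomial. Written through them, a coroot can be differentiated in \<open>rho_vder\<close> and
  reached from the generators in \<open>G_mono_closed\<close>.\<close>

lemma coroot_product:
  "s \<noteq> 0 \<Longrightarrow> K i s = X i s ** Y i (- inverse s) ** X i s ** S i"
  unfolding x_pos_def x_neg_def s_bar_def coroot_def by (simp add: phi22_mult)

text \<open>The grading element. The curve \<open>mu\<close> fixes it, while \<open>N\<close> moves
  it inside \<open>rho + nn\<close>, so that membership in \<open>N\<close> can be read off from the
  effect on \<open>rho\<close>; see \<open>in_N_criterion\<close>.\<close>

definition rho :: "complex^'m^'m" where
  "rho = vector_derivative (\<lambda>t. mu (of_real t)) (at 0)"

lemma rho_vder: "((\<lambda>t. mu (of_real t)) has_vector_derivative rho) (at 0)"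
proof -
  have poly: "(\<lambda>t. P (f t)) differentiable (at (0::real))"
    if P: "poly_curve P" and f: "(f has_vector_derivative f') (at 0)" for P :: "complex \<Rightarrow> complex^'m^'m" and f f'
  proof (rule vec2_differentiable)
    fix k l
    obtain p where p: "\<And>t. P t $ k $ l = poly p t" using P unfolding poly_curve_def by meson
    show "(\<lambda>t. P (f t) $ k $ l) differentiable (at 0)"
      unfolding p differentiable_def
      by (rule exI, rule has_derivative_compose[where g = "poly p", OF f[unfolded has_vector_derivative_def]
            poly_DERIV[unfolded has_field_derivative_def]])
  qed
  have mult: "(\<lambda>t. a t ** b t) differentiable (at (0::real))"
    if "a differentiable (at 0)" "b differentiable (at 0)" for a b :: "real \<Rightarrow> complex^'m^'m"
  proof -
    from that obtain a' b' where "(a has_derivative a') (at 0)" "(b has_derivative b') (at 0)"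
      unfolding differentiable_def by blast
    from mult_deriv[OF this] show ?thesis unfolding differentiable_def by blast
  qed
  have K: "(\<lambda>t. K i (exp (of_real m * of_real t))) differentiable (at 0)" for i m
  proof -
    have eq: "K i (exp (of_real m * of_real t)) = X i (exp (of_real m * of_real t)) **
       Y i (- exp (- (of_real m * of_real t))) ** X i (exp (of_real m * of_real t)) ** S i" for t
      by (subst coroot_product) (simp_all add: exp_minus)
    have "((\<lambda>t. complex_of_real (exp (m * t))) has_vector_derivative of_real m) (at 0)"
      by (rule has_vector_derivative_of_real) (auto intro!: derivative_eq_intros)
    then have e1: "((\<lambda>t. exp (of_real m * of_real t) :: complex) has_vector_derivative of_real m) (at 0)"
      by (simp add: exp_of_real[symmetric])
    have "((\<lambda>t. complex_of_real (- exp (- (m * t)))) has_vector_derivative of_real m) (at 0)"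
      by (rule has_vector_derivative_of_real) (auto intro!: derivative_eq_intros)
    then have e2: "((\<lambda>t. - exp (- (of_real m * of_real t)) :: complex) has_vector_derivative of_real m) (at 0)"
      by (simp add: exp_of_real[symmetric])
    show ?thesis unfolding eq
      by (intro mult poly[OF poly_curve_x(1) e1] poly[OF poly_curve_x(2) e2]) simp
  qed
  have "(\<lambda>t. mat_prod (map (\<lambda>i. K i (exp (of_real (coweight i) * of_real t))) us)) differentiable (at 0)" for us
    by (induction us) (auto intro: mult K)
  then have "(\<lambda>t. mu (of_real t)) differentiable (at 0)"
    unfolding mu_def torus_elem_def .
  then show ?thesis unfolding rho_def by (simp add: vector_derivative_works)
qed

lemma mu_vder: "((\<lambda>t. mu (of_real t)) has_vector_derivative mu (of_real x) ** rho) (at x)"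
proof -
  have "((\<lambda>t. mu (of_real t)) \<circ> (\<lambda>t. t - x) has_vector_derivative 1 *\<^sub>R rho) (at x)"
    by (rule vector_diff_chain_at) (auto intro!: derivative_eq_intros rho_vder)
  from mult_vder[OF has_vector_derivative_const[of "mu (of_real x)"] this]
  show ?thesis by (simp add: o_def mu_add[symmetric] matrix_mult_distribs)
qed

lemma mu_rho: "Ad (mu (of_real x)) rho = rho"
proof -
  have "((\<lambda>t. Ad (mu (of_real x)) (mu (of_real t))) has_vector_derivative Ad (mu (of_real x)) rho) (at 0)"
    by (rule Ad_vder[OF rho_vder])
  moreover have "(\<lambda>t. Ad (mu (of_real x)) (mu (of_real t))) = (\<lambda>t. mu (of_real t))"
    by (simp add: fun_eq_iff Ad_fixed_iff mu_add[symmetric] add.commute)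
  ultimately have "((\<lambda>t. mu (of_real t)) has_vector_derivative Ad (mu (of_real x)) rho) (at 0)"
    by (simp only:)
  from vector_derivative_unique_at[OF this rho_vder] show ?thesis .
qed

text \<open>The derivative of the conjugation curve is a conjugate of the commutator of
  \<open>rho\<close> and \<open>q\<close>, which vanishes; so the curve keeps its value at
  \<open>0\<close>.\<close>

lemma commute_rho_mu:
  assumes "rho ** q = q ** rho"
  shows "mu (of_real t) ** q ** mu (- of_real t) = q"
proof -
  let ?f = "\<lambda>t. mu (of_real t) ** q ** mu (of_real (-t))"
  have d: "((\<lambda>t. mu (of_real (-t))) has_vector_derivative - (mu (of_real (-x)) ** rho)) (at x)" for x
  proof -
    have "((\<lambda>t. mu (of_real t)) \<circ> (\<lambda>t. - t) has_vector_derivative (-1) *\<^sub>R (mu (of_real (-x)) ** rho)) (at x)"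
      by (rule vector_diff_chain_at[OF _ mu_vder]) (auto intro!: derivative_eq_intros)
    then show ?thesis by (simp add: o_def)
  qed
  have mr: "mu (of_real x) ** rho = rho ** mu (of_real x)" for x
    using mu_rho[of x] by (simp add: Ad_fixed_iff)
  have "(?f has_vector_derivative 0) (at x)" for x
  proof -
    have "(?f has_vector_derivative (mu (of_real x) ** q ** - (mu (of_real (-x)) ** rho) +
      (mu (of_real x) ** 0 + mu (of_real x) ** rho ** q) ** mu (of_real (-x)))) (at x)"
      by (intro mult_vder mu_vder d has_vector_derivative_const)
    moreover have "mu (of_real x) ** q ** (mu (of_real (-x)) ** rho) = mu (of_real x) ** rho ** q ** mu (of_real (-x))"
    proof -
      have "mu (of_real x) ** q ** (mu (of_real (-x)) ** rho) = mu (of_real x) ** q ** (rho ** mu (of_real (-x)))"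
        by (simp only: mr)
      also have "\<dots> = mu (of_real x) ** (q ** rho) ** mu (of_real (-x))" by (simp only: matrix_mul_assoc)
      also have "\<dots> = mu (of_real x) ** (rho ** q) ** mu (of_real (-x))" by (simp only: assms)
      finally show ?thesis by (simp only: matrix_mul_assoc)
    qed
    ultimately show ?thesis by (simp add: matrix_mult_distribs)
  qed
  then obtain C where C: "\<And>x. x \<in> UNIV \<Longrightarrow> ?f x = C"
    using has_vector_derivative_zero_constant[of UNIV ?f] convex_UNIV by blast
  have "?f t = ?f 0" using C[of t] C[of 0] by (simp only: UNIV_I)
  then show ?thesis by simp
qed

lemma exp_of_real_at_bot: "((\<lambda>t. exp (of_real t) :: complex) \<longlongrightarrow> 0) at_bot"
proof -
  have "((\<lambda>t. of_real (exp t) :: complex) \<longlongrightarrow> of_real 0) at_bot"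
    by (intro tendsto_of_real exp_at_bot)
  then show ?thesis by (simp add: exp_of_real)
qed

lemma poly_curve_at_bot: "poly_curve c \<Longrightarrow> ((\<lambda>t. c (exp (of_real t))) \<longlongrightarrow> c 0) at_bot"
proof -
  assume "poly_curve c"
  then have "isCont c 0" using poly_curve_continuous continuous_on_eq_continuous_at open_UNIV by blast
  then show ?thesis using exp_of_real_at_bot by (rule isCont_tendsto_compose)
qed

text \<open>Conjugation scales every argument of a word for \<open>n\<close> by
  \<open>exp t\<close>, which tends to \<open>0\<close>.\<close>

lemma mu_N_at_bot: "n \<in> N \<Longrightarrow> ((\<lambda>t. mu (of_real t) ** n ** mu (- of_real t)) \<longlongrightarrow> mat 1) at_bot"
proof -
  assume "n \<in> N"
  then obtain ws where ws: "n = x_word \<phi> 1 ws" using N_word by blast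
  have "mu (of_real t) ** n ** mu (- of_real t) = x_word \<phi> (exp (of_real t)) ws" for t
    by (simp add: ws mu_x_word matrix_mul_assoc')
  then show ?thesis using poly_curve_at_bot[OF poly_curve_x_word, of ws] by simp
qed

lemma Ad_mu_nn_at_bot: "Z \<in> nn \<Longrightarrow> ((\<lambda>t. Ad (mu (of_real t)) Z) \<longlongrightarrow> 0) at_bot"
  unfolding nn_def
proof (induction rule: span_induct_alt)
  case base show ?case by (simp add: linear_0[OF linear_Ad])
next
  case (step r b Z)
  then obtain n j c where b: "b = Ad n (ex j c)" "n \<in> N" by blast
  have eq: "Ad (mu (of_real t)) b = exp t *\<^sub>R ((mu (of_real t) ** n ** mu (- of_real t)) ** ex j c **
      (mu (of_real t) ** matrix_inv n ** mu (- of_real t)))" for t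
  proof -
    have i: "matrix_inv (mu (of_real t) ** n ** mu (- of_real t)) = mu (of_real t) ** matrix_inv n ** mu (- of_real t)"
      using N_invertible[OF b(2)] by (simp add: matrix_inv_mult invertible_mult matrix_mul_assoc)
    show ?thesis using Ad_mu_Ad_ex[OF b(2)] by (simp add: b(1) Ad_def[of "_ ** _"] i)
  qed
  have "((\<lambda>t. Ad (mu (of_real t)) b) \<longlongrightarrow> 0 *\<^sub>R (mat 1 ** ex j c ** mat 1)) at_bot"
    unfolding eq by (intro tendsto_scaleR mult_tendsto mu_N_at_bot b N_inv tendsto_const exp_at_bot)
  then have "((\<lambda>t. r *\<^sub>R Ad (mu (of_real t)) b + Ad (mu (of_real t)) Z) \<longlongrightarrow> r *\<^sub>R 0 + 0) at_bot"
    by (intro tendsto_add tendsto_scaleR tendsto_const step) simp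
  then show ?case by (simp add: linear_add[OF linear_Ad] linear_scale[OF linear_Ad])
qed

text \<open>Such a \<open>Z\<close> is fixed by the contraction, whose limit on \<open>nn\<close> is
  \<open>0\<close>. This is the injectivity behind the open mapping argument for the orbit of
  \<open>rho\<close>.\<close>

lemma commute_rho_nn:
  assumes "Z \<in> nn" "Z ** rho = rho ** Z" shows "Z = 0"
proof -
  have "Ad (mu (of_real t)) Z = Z" for t
    using commute_rho_mu[of Z t] assms(2) by (simp add: Ad_def)
  then have "((\<lambda>t::real. Z) \<longlongrightarrow> 0) at_bot" using Ad_mu_nn_at_bot[OF assms(1)] by simp
  then show ?thesis by (simp add: tendsto_const_iff)
qed

lemma bracket_rho_nn:
  assumes "Z \<in> nn" shows "Z ** rho - rho ** Z \<in> nn"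
proof -
  have "((\<lambda>t. mu (of_real (-t))) has_vector_derivative - rho) (at 0)"
  proof -
    have "((\<lambda>t. mu (of_real t)) \<circ> (\<lambda>t. - t) has_vector_derivative (-1) *\<^sub>R rho) (at 0)"
      by (rule vector_diff_chain_at) (auto intro!: derivative_eq_intros rho_vder)
    then show ?thesis by (simp add: o_def)
  qed
  then have d: "((\<lambda>t. mu (of_real t) ** Z ** mu (of_real (-t))) has_vector_derivative
      (mu (of_real 0) ** Z ** - rho + (mu (of_real 0) ** 0 + rho ** Z) ** mu (of_real (-0)))) (at 0)"
    by (intro mult_vder rho_vder has_vector_derivative_const)
  have "mu (of_real 0) ** Z ** - rho + (mu (of_real 0) ** 0 + rho ** Z) ** mu (of_real (-0)) \<in> nn"
  proof (rule subspace_derivative[OF nn_subspace _ d])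
    fix t show "mu (of_real t) ** Z ** mu (of_real (-t)) \<in> nn"
      using Ad_mu_nn[OF assms, of t] by (simp add: Ad_def)
  qed
  then have "rho ** Z - Z ** rho \<in> nn" by (simp add: matrix_mult_distribs)
  from subspace_neg[OF nn_subspace this] show ?thesis by simp
qed

lemma Ad_N_rho: "n \<in> N \<Longrightarrow> Ad n rho - rho \<in> nn"
proof (induction rule: N_induct)
  case one then show ?case by (simp add: subspace_0[OF nn_subspace])
next
  case (step i s n)
  have x: "Ad (X i s) rho = rho - ex i s"
  proof -
    \<comment> \<open>Moving \<open>mu t\<close> past \<open>X i (-s)\<close> shows that the
      conjugate of \<open>mu t\<close> by \<open>X i s\<close> is
      \<open>X i (s (1 - exp t)) ** mu t\<close>, and \<open>1 - exp t\<close> has derivative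
      \<open>-1\<close> at \<open>0\<close>.\<close>
    have "((\<lambda>t. X i (s * of_real t)) \<circ> (\<lambda>t. 1 - exp t) has_vector_derivative (-1) *\<^sub>R ex i s) (at 0)"
    proof (rule vector_diff_chain_at)
      show "((\<lambda>t::real. 1 - exp t) has_vector_derivative -1) (at 0)"
        unfolding has_real_derivative_iff_has_vector_derivative[symmetric]
        by (auto intro!: derivative_eq_intros)
    qed (simp add: ex_vder)
    then have "((\<lambda>t. X i (s * of_real (1 - exp t)) ** mu (of_real t)) has_vector_derivative
        (X i (s * of_real (1 - exp 0)) ** rho + ((-1) *\<^sub>R ex i s) ** mu (of_real 0))) (at 0)"
      by (intro mult_vder rho_vder) (simp add: o_def)
    moreover have "X i (s * of_real (1 - exp t)) ** mu (of_real t) = Ad (X i s) (mu (of_real t))" for t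
    proof (rule Ad_eqI[symmetric])
      have "X i (s * of_real (1 - exp t)) ** mu (of_real t) ** X i s =
        X i (s * of_real (1 - exp t)) ** X i (exp (of_real t) * s) ** mu (of_real t)"
        by (simp add: mu_x matrix_mul_assoc')
      then show "X i s ** mu (of_real t) = X i (s * of_real (1 - exp t)) ** mu (of_real t) ** X i s"
        by (simp add: x_pos_add exp_of_real algebra_simps)
    qed simp
    ultimately have "((\<lambda>t. Ad (X i s) (mu (of_real t))) has_vector_derivative rho - ex i s) (at 0)"
      by simp
    from vector_derivative_unique_at[OF Ad_vder[OF rho_vder] this] show ?thesis .
  qed
  have "Ad (X i s ** n) rho - rho = Ad (X i s) (Ad n rho - rho) + (Ad (X i s) rho - rho)"
    by (simp add: Ad_mult N_invertible step linear_diff[OF linear_Ad])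
  moreover have "Ad (X i s) rho - rho \<in> nn"
    using x Ad_ex_nn[OF N_one, of i s] subspace_neg[OF nn_subspace] by simp
  ultimately show ?case
    using subspace_add[OF nn_subspace Ad_N_nn[OF x_in_N step(2)]] by (simp only:)
qed

end

lemma mat_prod_has_derivative:
  fixes f :: "'b \<Rightarrow> 'c::real_normed_vector \<Rightarrow> complex^'m^'m"
  assumes "\<And>b. b \<in> set bs \<Longrightarrow> (f b has_derivative f' b) (at x)" "\<And>b. b \<in> set bs \<Longrightarrow> f b x = mat 1"
  shows "((\<lambda>v. mat_prod (map (\<lambda>b. f b v) bs)) has_derivative (\<lambda>v. \<Sum>b\<leftarrow>bs. f' b v)) (at x)"
  using assms
proof (induction bs)
  case Nil then show ?case by simp
next
  case (Cons b bs)
  have one: "mat_prod (map (\<lambda>b. f b x) bs) = mat 1" using Cons.prems(2) by (induction bs) auto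
  have "((\<lambda>v. f b v ** mat_prod (map (\<lambda>b. f b v) bs)) has_derivative
      (\<lambda>v. f b x ** (\<Sum>b\<leftarrow>bs. f' b v) + f' b v ** mat_prod (map (\<lambda>b. f b x) bs))) (at x)"
    using Cons by (intro mult_deriv) auto
  then show ?case using Cons.prems(2) by (simp add: one add.commute)
qed

lemma mat_prod_continuous_on:
  fixes f :: "'b \<Rightarrow> 'c::topological_space \<Rightarrow> complex^'m^'m"
  assumes "\<And>b. b \<in> set bs \<Longrightarrow> continuous_on U (f b)"
  shows "continuous_on U (\<lambda>v. mat_prod (map (\<lambda>b. f b v) bs))"
  using assms by (induction bs) (auto intro: mult_continuous_on)

section \<open>The orbit of the grading element under \<open>N\<close>\<close>

context chevalley
begin

text \<open>The last clause gives the inverse of a product of such curves as another explicit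
  product, so that \<open>matrix_inv\<close> never has to be differentiated.\<close>

lemma nn_generator_curve:
  assumes "b \<in> {Ad n (ex j c) | n j c. n \<in> N}"
  shows "\<exists>u :: real \<Rightarrow> complex^'m^'m. (\<forall>t. u t \<in> N) \<and> u 0 = mat 1 \<and> (u has_vector_derivative b) (at 0) \<and>
    continuous_on UNIV u \<and> (\<forall>t. u t ** u (-t) = mat 1)"
proof -
  from assms obtain n j c where b: "b = Ad n (ex j c)" "n \<in> N" by blast
  define u where "u t = Ad n (X j (c * of_real t))" for t :: real
  have "(u has_vector_derivative b) (at 0)"
    unfolding u_def b(1) by (rule Ad_vder[OF ex_vder])
  moreover have "u t \<in> N" for t
    unfolding u_def Ad_def using b(2) by (intro N_mult N_inv) auto
  moreover have "u 0 = mat 1" using N_invertible[OF b(2)] by (simp add: u_def Ad_def)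
  moreover have "u t ** u (-t) = mat 1" for t
    unfolding u_def Ad_def
    using mat_mult_cancel_middle[of "matrix_inv n" n "n ** X j (c * of_real t)" "X j (c * of_real (-t)) ** matrix_inv n"]
      N_invertible[OF b(2)] by (simp add: matrix_mul_assoc) (simp add: matrix_mul_assoc')
  moreover have "continuous_on UNIV u"
  proof -
    have "continuous_on UNIV (\<lambda>t. X j (c * of_real t))"
      by (rule continuous_on_compose2[OF poly_curve_continuous[OF poly_curve_x(1)]])
        (auto intro!: continuous_intros)
    then show ?thesis unfolding u_def Ad_def by (intro mult_continuous_on continuous_on_const)
  qed
  ultimately show ?thesis by blast
qed

text \<open>Let \<open>Q v\<close> be a product of curves in \<open>N\<close> along a basis of
  \<open>nn\<close>, and \<open>q\<close> the projection to a complement of \<open>nn\<close>. The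
  map \<open>Ad (Q v) rho - rho + q v\<close> has as derivative at \<open>0\<close> the bracket with
  \<open>rho\<close> on \<open>nn\<close> plus \<open>q\<close>. This is injective since no non-zero
  element of \<open>nn\<close> commutes with \<open>rho\<close>, so the map is open at
  \<open>0\<close>.\<close>

lemma N_orbit_rho_locally_open:
  "\<exists>e>0. \<forall>Z\<in>nn. norm Z < e \<longrightarrow> (\<exists>n\<in>N. Ad n rho = rho + Z)"
proof -
  define gens where "gens = {Ad n (ex j c) | n j c. n \<in> N}"
  obtain B where B: "B \<subseteq> gens" "independent B" "gens \<subseteq> span B" by (rule maximal_independent_subset)
  have spanB: "span B = nn"
  proof
    show "span B \<subseteq> nn" unfolding nn_def gens_def[symmetric] by (rule span_mono[OF B(1)])
    show "nn \<subseteq> span B" unfolding nn_def gens_def[symmetric] by (rule span_minimal[OF B(3)]) simp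
  qed
  obtain B' where B'0: "B \<subseteq> B'" "B' \<subseteq> UNIV" "independent B'" "UNIV \<subseteq> span B'"
    by (rule maximal_independent_subset_extend[OF subset_UNIV B(2)])
  then have B': "B \<subseteq> B'" "independent B'" "span B' = UNIV" by (simp_all add: top.extremum_unique)
  have fin: "finite B'" "finite B" using B' B(2) independent_imp_finite by auto
  define coef where "coef v b = representation B' v b" for v b
  have coef_bl: "bounded_linear (\<lambda>v. coef v b)" for b
    unfolding coef_def by (rule bounded_linear_representation[OF B'(2,3)])
  have coef_lin: "linear (\<lambda>v. coef v b)" for b
    by (rule bounded_linear.linear[OF coef_bl])
  have coef_sum: "(\<Sum>b\<in>B'. coef v b *\<^sub>R b) = v" for v
    unfolding coef_def using B'(2,3) fin(1) by (intro real_vector.sum_representation_eq) auto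
  have coef_nn: "coef v b = 0" if "v \<in> nn" "b \<notin> B" for v b
  proof -
    have "representation B' v = representation B v"
      using B' that(1) spanB by (intro real_vector.representation_extend) auto
    then show ?thesis unfolding coef_def using that(2) real_vector.representation_ne_zero[of B v b] by auto
  qed
  have "\<forall>b\<in>B. \<exists>u :: real \<Rightarrow> complex^'m^'m. (\<forall>t. u t \<in> N) \<and> u 0 = mat 1 \<and> (u has_vector_derivative b) (at 0) \<and>
    continuous_on UNIV u \<and> (\<forall>t. u t ** u (-t) = mat 1)"
    using nn_generator_curve B(1) unfolding gens_def by blast
  then obtain u :: "complex^'m^'m \<Rightarrow> real \<Rightarrow> complex^'m^'m" where
    u: "\<forall>b\<in>B. (\<forall>t. u b t \<in> N) \<and> u b 0 = mat 1 \<and> (u b has_vector_derivative b) (at 0) \<and>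
      continuous_on UNIV (u b) \<and> (\<forall>t. u b t ** u b (-t) = mat 1)"
    by (rule bchoice[THEN exE])
  obtain bs where bs: "set bs = B" "distinct bs" using fin(2) finite_distinct_list by blast
  define Q where "Q v = mat_prod (map (\<lambda>b. u b (coef v b)) bs)" for v
  define Qi where "Qi v = mat_prod (map (\<lambda>b. u b (- coef v b)) (rev bs))" for v
  define p where "p v = (\<Sum>b\<in>B. coef v b *\<^sub>R b)" for v
  define q where "q v = (\<Sum>b\<in>B' - B. coef v b *\<^sub>R b)" for v
  have pq: "p v + q v = v" for v
    using coef_sum[of v] sum.subset_diff[OF B'(1) fin(1), of "\<lambda>b. coef v b *\<^sub>R b"] by (simp add: p_def q_def add.commute)
  have p_nn: "p v \<in> nn" for v
    unfolding p_def spanB[symmetric] by (intro span_sum span_scale span_base)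
  have q0: "q v = 0" if "v \<in> nn" for v
    unfolding q_def using coef_nn[OF that] by (intro sum.neutral) auto
  have q_lin: "linear q"
    unfolding q_def by (intro linear_compose_sum ballI bounded_linear.linear[OF bounded_linear_scaleR_const[OF coef_bl]])
  have qq: "q (q v) = q v" for v
    using pq[of v] q0[OF p_nn, of v] linear_add[OF q_lin, of "p v" "q v"] by simp
  have QN: "Q v \<in> N" for v
  proof -
    have "set us \<subseteq> B \<Longrightarrow> mat_prod (map (\<lambda>b. u b (coef v b)) us) \<in> N" for us
      using u by (induction us) (simp_all add: N_mult)
    then show ?thesis unfolding Q_def using bs by blast
  qed
  have QQi: "Q v ** Qi v = mat 1" for v
  proof -
    have "set us \<subseteq> B \<Longrightarrow> mat_prod (map (\<lambda>b. u b (coef v b)) us) ** mat_prod (map (\<lambda>b. u b (- coef v b)) (rev us)) = mat 1" for us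
    proof (induction us)
      case (Cons b us)
      have "mat_prod (map (\<lambda>b. u b (coef v b)) (b # us)) ** mat_prod (map (\<lambda>b. u b (- coef v b)) (rev (b # us)))
        = u b (coef v b) ** (mat_prod (map (\<lambda>b. u b (coef v b)) us) ** mat_prod (map (\<lambda>b. u b (- coef v b)) (rev us))) ** u b (- coef v b)"
        by (simp add: matrix_mul_assoc)
      also have "\<dots> = mat 1" using Cons u by simp
      finally show ?case .
    qed simp
    then show ?thesis unfolding Q_def Qi_def using bs by blast
  qed
  have coef0: "coef 0 b = 0" for b using linear_0[OF coef_lin] .
  have du: "((\<lambda>v. u b (r * coef v b)) has_derivative (\<lambda>v. (r * coef v b) *\<^sub>R b)) (at 0)" if "b \<in> B" for b r
  proof -
    have g: "(u b has_derivative (\<lambda>t. t *\<^sub>R b)) (at (r * coef 0 b))"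
      using u that by (simp add: coef0 has_vector_derivative_def)
    have f: "((\<lambda>v. r * coef v b) has_derivative (\<lambda>v. r * coef v b)) (at 0)"
      by (intro has_derivative_mult_right bounded_linear_imp_has_derivative coef_bl)
    show ?thesis using has_derivative_compose[OF f g] .
  qed
  have dQ: "(Q has_derivative p) (at 0)"
  proof -
    have "(Q has_derivative (\<lambda>v. \<Sum>b\<leftarrow>bs. coef v b *\<^sub>R b)) (at 0)"
      unfolding Q_def by (rule mat_prod_has_derivative) (use du[of _ 1] bs u coef0 in auto)
    also have "(\<lambda>v. \<Sum>b\<leftarrow>bs. coef v b *\<^sub>R b) = p"
      unfolding p_def using bs by (simp add: sum_list_distinct_conv_sum_set)
    finally show ?thesis .
  qed
  have dQi: "(Qi has_derivative (\<lambda>v. - p v)) (at 0)"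
  proof -
    have "(Qi has_derivative (\<lambda>v. \<Sum>b\<leftarrow>rev bs. (- coef v b) *\<^sub>R b)) (at 0)"
      unfolding Qi_def by (rule mat_prod_has_derivative) (use du[of _ "-1"] bs u coef0 in auto)
    also have "(\<lambda>v. \<Sum>b\<leftarrow>rev bs. (- coef v b) *\<^sub>R b) = (\<lambda>v. - p v)"
      unfolding p_def using bs by (simp add: sum_list_distinct_conv_sum_set sum_negf)
    finally show ?thesis .
  qed
  have Q0: "Q 0 = mat 1" "Qi 0 = mat 1"
  proof -
    have "set us \<subseteq> B \<Longrightarrow> mat_prod (map (\<lambda>b. u b 0) us) = mat 1" for us
      using u by (induction us) auto
    from this[of bs] this[of "rev bs"] show "Q 0 = mat 1" "Qi 0 = mat 1"
      unfolding Q_def Qi_def using bs by (simp_all add: coef0)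
  qed
  \<comment> \<open>The summand \<open>q v\<close> completes the orbit map to a self-map of the
    whole matrix space, so that an injective derivative is bijective.\<close>
  define F where "F v = Q v ** rho ** Qi v - rho + q v" for v
  define F' where "F' v = p v ** rho - rho ** p v + q v" for v
  have dF: "(F has_derivative F') (at 0)"
  proof -
    have "(F has_derivative (\<lambda>v. (Q 0 ** rho) ** (- p v) + (Q 0 ** 0 + p v ** rho) ** Qi 0 - 0 + q v)) (at 0)"
      unfolding F_def
      by (intro has_derivative_add has_derivative_diff mult_deriv dQ dQi has_derivative_const
          bounded_linear_imp_has_derivative linear_conv_bounded_linear[THEN iffD1, OF q_lin])
    then show ?thesis by (simp add: F'_def[abs_def] Q0 matrix_mult_distribs)
  qed
  have "linear F'" using has_derivative_linear[OF dF] .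
  have inj: "inj F'"
  proof -
    have "v = 0" if v: "F' v = 0" for v
    proof -
      have br: "p v ** rho - rho ** p v \<in> nn" by (rule bracket_rho_nn[OF p_nn])
      have "q (F' v) = q v" unfolding F'_def
        using linear_add[OF q_lin] q0[OF br] by (simp add: qq)
      then have "q v = 0" using v linear_0[OF q_lin] by simp
      moreover from this v have "p v ** rho = rho ** p v" by (simp add: F'_def)
      then have "p v = 0" by (rule commute_rho_nn[OF p_nn])
      ultimately show "v = 0" using pq[of v] by simp
    qed
    then show ?thesis using \<open>linear F'\<close> linear_injective_0 by blast
  qed
  then obtain g' where g': "linear g'" "F' \<circ> g' = id"
    using linear_injective_isomorphism[OF \<open>linear F'\<close>] by (auto simp: fun_eq_iff)
  have contF: "continuous_on UNIV F"
  proof -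
    have cu: "continuous_on UNIV (\<lambda>v. u b (r * coef v b))" if "b \<in> B" for b r
    proof (rule continuous_on_compose2[of UNIV "u b"])
      show "continuous_on UNIV (\<lambda>v. r * coef v b)"
        by (intro continuous_intros linear_continuous_on coef_bl)
    qed (use u that in auto)
    have "continuous_on UNIV Q" unfolding Q_def
      by (rule mat_prod_continuous_on) (use cu[of _ 1] bs in auto)
    moreover have "continuous_on UNIV Qi" unfolding Qi_def
      by (rule mat_prod_continuous_on) (use cu[of _ "-1"] bs in auto)
    moreover have "continuous_on UNIV q"
      by (rule linear_continuous_on[OF linear_conv_bounded_linear[THEN iffD1, OF q_lin]])
    ultimately show ?thesis unfolding F_def
      by (intro continuous_on_add continuous_on_diff mult_continuous_on continuous_on_const)
  qed
  have "F 0 \<in> interior (F ` UNIV)"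
    by (rule sussmann_open_mapping[OF open_UNIV contF UNIV_I dF
          linear_conv_bounded_linear[THEN iffD1, OF g'(1)] g'(2)]) auto
  moreover have "F 0 = 0" by (simp add: F_def Q0 linear_0[OF q_lin])
  ultimately obtain e where e: "e > 0" "ball 0 e \<subseteq> range F"
    by (auto simp: mem_interior)
  have "\<exists>n\<in>N. Ad n rho = rho + Z" if Z: "Z \<in> nn" "norm Z < e" for Z
  proof -
    from e(2) Z(2) have "Z \<in> range F" by (auto simp: subset_iff)
    then obtain v where v: "Z = F v" by blast
    have Ad: "Q v ** rho ** Qi v = Ad (Q v) rho"
      using matrix_inv_eqI[OF QQi, of v] by (simp add: Ad_def)
    have nn: "Ad (Q v) rho - rho \<in> nn" by (rule Ad_N_rho[OF QN])
    \<comment> \<open>Both \<open>Z\<close> and the orbit part lie in \<open>nn\<close>, where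
      \<open>q\<close> vanishes. So the complementary component of \<open>v\<close> is
      \<open>0\<close>, and \<open>F v\<close> reduces to the orbit map.\<close>
    have "q Z = q v" using v unfolding F_def Ad using linear_add[OF q_lin] q0[OF nn] by (simp add: qq)
    then have "q v = 0" using q0[OF Z(1)] by simp
    then have "Ad (Q v) rho = rho + Z" using v by (simp add: F_def Ad)
    then show ?thesis using QN by blast
  qed
  with e(1) show ?thesis by blast
qed

text \<open>
  \<open>N\<close> acts transitively on \<open>rho + nn\<close>, locally by the open mapping theorem and then globally since
  conjugation by \<open>mu t\<close> contracts \<open>nn\<close> as \<open>t \<rightarrow> -\<infinity>\<close>; the stabilizer of \<open>rho\<close> commutes with \<open>mu t\<close> and contains
  no other contracted element than the identity.
\<close>

lemma in_N_criterion:
  assumes g: "invertible g" and Z: "Ad g rho - rho \<in> nn"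
    and lim: "((\<lambda>t. mu (of_real t) ** g ** mu (- of_real t)) \<longlongrightarrow> mat 1) at_bot"
  shows "g \<in> N"
proof -
  obtain e where e: "e > 0" "\<And>Z. Z \<in> nn \<Longrightarrow> norm Z < e \<Longrightarrow> \<exists>n\<in>N. Ad n rho = rho + Z"
    using N_orbit_rho_locally_open by blast
  have "\<forall>\<^sub>F t in at_bot. dist (Ad (mu (of_real t)) (Ad g rho - rho)) 0 < e"
    using Ad_mu_nn_at_bot[OF Z] e(1) by (rule tendstoD)
  then obtain t :: real where t: "norm (Ad (mu (of_real t)) (Ad g rho - rho)) < e"
    using eventually_happens[of _ "at_bot :: real filter"] by auto
  define gt where "gt = mu (of_real t) ** g ** mu (- of_real t)"
  have gt_inv: "invertible gt" using g by (simp add: gt_def invertible_mult)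
  have "Ad (mu (of_real t)) (Ad g rho - rho) = Ad gt rho - rho"
    using Ad_mu_conj[OF g, of "of_real t" rho] by (simp add: linear_diff[OF linear_Ad] mu_rho gt_def)
  then obtain n where n: "n \<in> N" "Ad n rho = Ad gt rho"
    using e(2)[OF Ad_mu_nn[OF Z] t] by auto
  \<comment> \<open>\<open>q\<close> compares the contracted \<open>g\<close> with an element of
    \<open>N\<close> that has the same effect on \<open>rho\<close>; the rest of the proof shows
    that \<open>q\<close> is the identity.\<close>
  define q where "q = matrix_inv n ** gt"
  have q_inv: "invertible q" using n gt_inv by (simp add: q_def N_invertible invertible_mult)
  have "Ad q rho = rho" using n(2)[symmetric] gt_inv N_invertible[OF n(1)] by (simp add: q_def Ad_mult)
  then have "rho ** q = q ** rho" using Ad_fixed_iff[OF q_inv] by simp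
  then have fixed: "mu (of_real s) ** q ** mu (- of_real s) = q" for s by (rule commute_rho_mu)
  have "((\<lambda>s. mu (of_real (s + t)) ** g ** mu (- of_real (s + t))) \<longlongrightarrow> mat 1) at_bot"
  proof (rule filterlim_compose[OF lim])
    show "filterlim (\<lambda>s. s + t) at_bot at_bot"
      using filterlim_tendsto_add_at_bot_iff[OF tendsto_const, of t "\<lambda>s. s" at_bot] by (simp add: add.commute filterlim_ident)
  qed
  then have "((\<lambda>s. (mu (of_real s) ** matrix_inv n ** mu (- of_real s)) ** (mu (of_real (s + t)) ** g ** mu (- of_real (s + t))))
      \<longlongrightarrow> mat 1 ** mat 1) at_bot"
    by (intro mult_tendsto mu_N_at_bot N_inv n)
  moreover have "(mu (of_real s) ** matrix_inv n ** mu (- of_real s)) ** (mu (of_real (s + t)) ** g ** mu (- of_real (s + t))) = q" for s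
  proof -
    have e1: "mu (of_real (s + t)) = mu (of_real s) ** mu (of_real t)" by (simp add: mu_add)
    have "- of_real (s + t) = (- of_real t + - of_real s :: complex)" by simp
    then have e2: "mu (- of_real (s + t)) = mu (- of_real t) ** mu (- of_real s)" by (simp only: mu_add)
    have "(mu (of_real s) ** matrix_inv n ** mu (- of_real s)) ** (mu (of_real s) ** (gt ** mu (- of_real s)))
      = mu (of_real s) ** matrix_inv n ** (gt ** mu (- of_real s))"
      by (rule mat_mult_cancel_middle) simp
    also have "\<dots> = q" using fixed[of s] by (simp add: q_def matrix_mul_assoc)
    finally show ?thesis unfolding e1 e2 gt_def by (simp only: matrix_mul_assoc)
  qed
  ultimately have "((\<lambda>s::real. q) \<longlongrightarrow> mat 1) at_bot" by simp
  then have "q = mat 1" by (simp add: tendsto_const_iff)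
  then have "n ** q = n" by simp
  then have "gt = n" using N_invertible[OF n(1)] by (simp add: q_def matrix_mul_assoc)
  then have "mu (- of_real t) ** n ** mu (of_real t) = mu (- of_real t) ** (mu (of_real t) ** g ** mu (- of_real t)) ** mu (of_real t)"
    by (simp add: gt_def)
  also have "\<dots> = (mu (- of_real t) ** mu (of_real t)) ** g ** (mu (- of_real t) ** mu (of_real t))"
    by (simp only: matrix_mul_assoc)
  finally have "mu (- of_real t) ** n ** mu (of_real t) = g" by simp
  then show ?thesis using mu_N_conj[OF n(1), of "- of_real t"] by simp
qed

text \<open>The conjugates of \<open>ex i c\<close> by \<open>x_pos\<close> elements other than \<open>X i\<close> span the part of degree \<open>1\<close> in \<open>\<alpha>\<^sub>i\<close>.\<close>

inductive_set uu_gens :: "'i \<Rightarrow> (complex^'m^'m) set" for i where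
  ex: "ex i c \<in> uu_gens i"
| step: "Z \<in> uu_gens i \<Longrightarrow> k \<noteq> i \<Longrightarrow> Ad (X k t) Z \<in> uu_gens i"

definition uu :: "'i \<Rightarrow> (complex^'m^'m) set" where
  "uu i = span (uu_gens i)"

lemma uu_subspace: "subspace (uu i)"
  by (simp add: uu_def)

lemma linear_uu:
  assumes "linear f" "\<And>Z. Z \<in> uu_gens i \<Longrightarrow> f Z \<in> uu i" "Z \<in> uu i"
  shows "f Z \<in> uu i"
proof -
  have "f ` uu i = span (f ` uu_gens i)" unfolding uu_def by (rule linear_span_image[OF assms(1), symmetric])
  also have "\<dots> \<subseteq> uu i" using assms(2) by (intro span_minimal uu_subspace) auto
  finally show ?thesis using assms(3) by blast
qed

lemma uu_nn: "uu i \<subseteq> nn"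
  unfolding uu_def
proof (rule span_minimal[OF _ nn_subspace], rule subsetI)
  fix Z assume "Z \<in> uu_gens i" then show "Z \<in> nn"
  proof induction
    case (ex c) then show ?case using Ad_ex_nn[OF N_one, of i c] by simp
  next
    case (step Z k t) then show ?case by (intro Ad_N_nn) auto
  qed
qed

lemma Ad_x_uu: "k \<noteq> i \<Longrightarrow> Z \<in> uu i \<Longrightarrow> Ad (X k t) Z \<in> uu i"
proof (erule linear_uu[OF linear_Ad, rotated])
  fix Z assume "k \<noteq> i" "Z \<in> uu_gens i"
  then show "Ad (X k t) Z \<in> uu i" unfolding uu_def by (intro span_base uu_gens.step)
qed

lemma Ad_coroot_uu: "s \<noteq> 0 \<Longrightarrow> Z \<in> uu i \<Longrightarrow> Ad (K k s) Z \<in> uu i"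
proof (erule linear_uu[OF linear_Ad, rotated])
  fix Z assume s: "s \<noteq> 0" and "Z \<in> uu_gens i"
  from this(2) show "Ad (K k s) Z \<in> uu i"
  proof induction
    case (ex c) then show ?case using s by (simp add: Ad_coroot_ex uu_def span_base uu_gens.ex)
  next
    case (step Z l t)
    have "Ad (K k s) (Ad (X l t) Z) = Ad (X l (s powi (A$k$l) * t)) (Ad (K k s) Z)"
      using s by (simp add: Ad_mult[symmetric] coroot_x_pos)
    then show ?case using step by (simp add: Ad_x_uu)
  qed
qed

text \<open>Against \<open>X l\<close> with \<open>l \<noteq> k\<close>, \<open>Y k\<close>
  commutes. Against \<open>X k\<close>, the product is rewritten with \<open>X k\<close>,
  \<open>K k\<close>, \<open>Y k\<close> in this order, which changes the argument of
  \<open>Y k\<close> (hence the generalization over \<open>s\<close>). This fails for one argument,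
  which is covered by continuity since \<open>uu i\<close> is closed.\<close>

lemma Ad_x_neg_uu: "k \<noteq> i \<Longrightarrow> Z \<in> uu i \<Longrightarrow> Ad (Y k s) Z \<in> uu i"
proof (erule linear_uu[OF linear_Ad, rotated])
  fix Z assume k: "k \<noteq> i" and "Z \<in> uu_gens i"
  from this(2) show "Ad (Y k s) Z \<in> uu i"
  proof (induction arbitrary: s)
    case (ex c) then show ?case using k by (simp add: Ad_x_neg_ex uu_def span_base uu_gens.ex)
  next
    case (step Z l t)
    show ?case
    proof (cases "l = k")
      case False
      then have "Ad (Y k s) (Ad (X l t) Z) = Ad (X l t) (Ad (Y k s) Z)"
        by (simp add: Ad_mult[symmetric] x_pos_neg_commute)
      then show ?thesis using step by (simp add: Ad_x_uu)
    next
      case True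
      have gen: "Ad (Y k r) (Ad (X k t) Z) \<in> uu i" if "1 + r * t \<noteq> 0" for r
      proof -
        have "Ad (Y k r) (Ad (X k t) Z) =
            Ad (X k (t / (1 + r*t))) (Ad (K k (inverse (1 + r*t))) (Ad (Y k (r / (1 + r*t))) Z))"
          using that by (simp add: Ad_mult[symmetric] x_neg_x_pos invertible_mult matrix_mul_assoc)
        then show ?thesis using step that k by (simp add: Ad_x_uu Ad_coroot_uu)
      qed
      have "isCont (\<lambda>r. Ad (Y k r) (Ad (X k t) Z)) s"
      proof -
        have "poly_curve (\<lambda>r. Y k r ** Ad (X k t) Z ** Y k ((-1) * r))"
          by (intro poly_curve_mult poly_curve_const poly_curve_x poly_curve_scale[OF poly_curve_x(2)])
        then have "poly_curve (\<lambda>r. Ad (Y k r) (Ad (X k t) Z))" by (simp add: Ad_def)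
        then show ?thesis using poly_curve_continuous continuous_on_eq_continuous_at open_UNIV by blast
      qed
      then have "((\<lambda>r. Ad (Y k r) (Ad (X k t) Z)) \<longlongrightarrow> Ad (Y k s) (Ad (X k t) Z)) (at s)"
        by (simp add: isCont_def)
      moreover have "\<forall>\<^sub>F r in at s. Ad (Y k r) (Ad (X k t) Z) \<in> uu i"
      proof -
        have fin: "finite {r. 1 + r * t = 0}"
          using poly_roots_finite[of "[:1, t:]"] by simp
        have "\<forall>\<^sub>F r in at s. r \<notin> {r. 1 + r * t = 0}"
          using islimpt_finite[OF fin, of s] unfolding islimpt_iff_eventually by simp
        then show ?thesis by (rule eventually_mono) (simp add: gen)
      qed
      moreover have "closed (uu i)" by (rule closed_subspace[OF uu_subspace])
      ultimately have "Ad (Y k s) (Ad (X k t) Z) \<in> uu i"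
        using Lim_in_closed_set[of "uu i" "\<lambda>r. Ad (Y k r) (Ad (X k t) Z)" "at s"] by simp
      with True show ?thesis by simp
    qed
  qed
qed

text \<open>The purpose of \<open>uu i\<close>: unlike \<open>nn\<close>, it is stable under
  \<open>X k\<close> and \<open>Y k\<close> together for each \<open>k \<noteq> i\<close>, hence
  under \<open>S k\<close>, a product of these.\<close>

lemma Ad_s_uu:
  assumes "k \<noteq> i" "Z \<in> uu i" "g = S k \<or> g = S' k" shows "Ad g Z \<in> uu i"
proof -
  have "Ad (X k a ** Y k b ** X k c) Z = Ad (X k a) (Ad (Y k b) (Ad (X k c) Z))" for a b c
    by (simp add: Ad_mult invertible_mult)
  then have "Ad (X k a ** Y k b ** X k c) Z \<in> uu i" for a b c
    using assms by (simp add: Ad_x_uu Ad_x_neg_uu)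
  then show ?thesis using assms(3) s_bar_eq S'_eq by metis
qed

section \<open>Conjugation of a simple root element by a word without that letter\<close>

lemma word_action_Nil [simp]: "word_action A [] \<gamma> = \<gamma>"
  by (simp add: word_action_def)

lemma word_action_Cons [simp]: "word_action A (u # us) \<gamma> = simple_reflection A u (word_action A us \<gamma>)"
  by (simp add: word_action_def)

lemma word_action_append: "word_action A (us @ vs) \<gamma> = word_action A us (word_action A vs \<gamma>)"
  by (induction us) auto

lemma cartan_props: "A$i$i = 2" "i \<noteq> j \<Longrightarrow> A$i$j \<le> 0" "A$i$j = 0 \<Longrightarrow> A$j$i = 0"
proof -
  have *: "(\<forall>i. A$i$i = 2) \<and> (\<forall>i j. i \<noteq> j \<longrightarrow> A$i$j \<le> 0) \<and> (\<forall>i j. A$i$j = 0 \<longrightarrow> A$j$i = 0)"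
    using cartan unfolding cartan_matrix_def by (elim conjE) (intro conjI)
  show "A$i$i = 2" "i \<noteq> j \<Longrightarrow> A$i$j \<le> 0" "A$i$j = 0 \<Longrightarrow> A$j$i = 0"
    using *[THEN conjunct1] *[THEN conjunct2, THEN conjunct1] *[THEN conjunct2, THEN conjunct2] by simp_all
qed

text \<open>A new letter \<open>u\<close> adds a multiple of its root, namely minus the pairing with
  the coroot \<open>u\<close>. As the letters are distinct, only off-diagonal Cartan integers occur
  in it, so the multiple is non-negative. The strict case for neighbours of \<open>j\<close> later
  detects the order of letters in a word.\<close>

lemma word_root:
  assumes "distinct us" "j \<notin> set us"
  shows "\<exists>p :: 'i \<Rightarrow> int. word_action A us (simple_root A j) =
      simple_root A j + (\<Sum>k\<in>set us. p k *s simple_root A k) \<and>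
    (\<forall>k\<in>set us. p k \<ge> 0 \<and> (A$k$j \<noteq> 0 \<longrightarrow> p k > 0))"
  using assms
proof (induction us)
  case (Cons u us)
  then obtain p where p: "word_action A us (simple_root A j) = simple_root A j + (\<Sum>k\<in>set us. p k *s simple_root A k)"
    "\<forall>k\<in>set us. p k \<ge> 0 \<and> (A$k$j \<noteq> 0 \<longrightarrow> p k > 0)" by auto
  let ?\<beta> = "word_action A us (simple_root A j)"
  define m where "m = - (?\<beta> $ u)"
  have "?\<beta> $ u = A$u$j + (\<Sum>k\<in>set us. p k * A$u$k)"
    by (subst p(1)) (simp add: simple_root_def)
  moreover have "(\<Sum>k\<in>set us. p k * A$u$k) \<le> 0"
    using Cons.prems p(2) by (intro sum_nonpos mult_nonneg_nonpos cartan_props(2)) auto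
  moreover have "A$u$j \<le> 0" using Cons.prems cartan_props(2) by auto
  ultimately have m: "m \<ge> 0" "A$u$j \<noteq> 0 \<longrightarrow> m > 0" by (auto simp: m_def)
  have "word_action A (u # us) (simple_root A j) = ?\<beta> + m *s simple_root A u"
    by (simp add: simple_reflection_def m_def vec_eq_iff)
  also have "\<dots> = simple_root A j + (\<Sum>k\<in>set (u # us). (p(u := m)) k *s simple_root A k)"
  proof -
    have "(\<Sum>k\<in>set us. (p(u := m)) k *s simple_root A k) = (\<Sum>k\<in>set us. p k *s simple_root A k)"
      using Cons.prems by (intro sum.cong) auto
    then show ?thesis using Cons.prems by (simp add: p(1) add_ac)
  qed
  finally show ?case using m p(2) Cons.prems by (intro exI[of _ "p(u := m)"]) auto
qed (auto intro: exI[of _ "\<lambda>_. 0"])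

text \<open>The criterion applies to \<open>g = Ad w (X i t)\<close>: it moves \<open>rho\<close> by
  an element of \<open>uu i\<close>, which is stable under the letters of \<open>w\<close>, and the
  contraction scales \<open>t\<close> by a positive power of \<open>exp\<close> because the root
  \<open>w \<alpha>\<close> for the simple root \<open>\<alpha>\<close> of index \<open>i\<close> is
  positive.\<close>

lemma word_conj_in_N:
  assumes us: "distinct us" "i \<notin> set us" and f: "\<And>k. k \<in> set us \<Longrightarrow> f k = S k \<or> f k = S' k"
  shows "Ad (mat_prod (map f us)) (X i t) \<in> N"
proof -
  define w where "w = mat_prod (map f us)"
  have f_inv: "invertible (f k)" if "k \<in> set us" for k using f[OF that] by auto
  have w_inv: "invertible w" unfolding w_def using f_inv by (intro invertible_mat_prod) auto
  \<comment> \<open>\<open>\<kappa>\<close> is the height of the image under \<open>w\<close> of the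
    simple root \<open>i\<close>.\<close>
  define \<kappa> where "\<kappa> = (\<Sum>k\<in>UNIV. coweight k * of_int (word_action A us (simple_root A i) $ k))"
  have \<kappa>: "\<kappa> > 0"
  proof -
    obtain p where p: "word_action A us (simple_root A i) = simple_root A i + (\<Sum>k\<in>set us. p k *s simple_root A k)"
      "\<forall>k\<in>set us. p k \<ge> 0" using word_root[OF us] by blast
    have "\<kappa> = (\<Sum>k\<in>UNIV. coweight k * of_int (A$k$i)) + (\<Sum>k\<in>UNIV. \<Sum>l\<in>set us. of_int (p l) * (coweight k * of_int (A$k$l)))"
      unfolding \<kappa>_def p(1) by (simp add: simple_root_def ring_distribs sum.distrib sum_distrib_left mult_ac)
    also have "(\<Sum>k\<in>UNIV. \<Sum>l\<in>set us. of_int (p l) * (coweight k * of_int (A$k$l))) =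
        (\<Sum>l\<in>set us. of_int (p l) * (\<Sum>k\<in>UNIV. coweight k * of_int (A$k$l)))"
      unfolding sum_distrib_left by (rule sum.swap)
    finally have "\<kappa> = 1 + (\<Sum>l\<in>set us. real_of_int (p l))" by (simp add: coweight)
    then show ?thesis using p(2) by (simp add: add_pos_nonneg sum_nonneg)
  qed
  have scale: "Ad (mu c) (Ad w (X i s)) = Ad w (X i (exp (of_real \<kappa> * c) * s))" for c s
  proof -
    obtain t' where t': "\<forall>i. t' i \<noteq> 0" "mu c ** w = w ** T t'"
      "\<forall>\<gamma>. char t' \<gamma> = char (\<lambda>i. exp (of_real (coweight i) * c)) (word_action A us \<gamma>)"
      unfolding w_def mu_def using torus_word[OF f, of us "\<lambda>i. exp (of_real (coweight i) * c)"] by auto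
    have "char t' (simple_root A i) = exp (of_real \<kappa> * c)"
      using t'(3) by (simp add: char_exp \<kappa>_def)
    then have "Ad (T t') (X i s) = X i (exp (of_real \<kappa> * c) * s)"
      using t'(1) torus_x(1)[OF t'(1), of i s] by (intro Ad_eqI) auto
    then show ?thesis using t' w_inv by (simp add: Ad_mult[symmetric]) (simp add: Ad_mult)
  qed
  define g where "g = Ad w (X i t)"
  have g_inv: "invertible g" using w_inv by (simp add: g_def Ad_def invertible_mult)
  have Ad_hom: "Ad w (a ** b) = Ad w a ** Ad w b" for a b
    unfolding Ad_def using mat_mult_cancel_middle[of "matrix_inv w" w "w ** a" "b ** matrix_inv w"] w_inv
    by (simp add: matrix_mul_assoc)
  have ginv: "matrix_inv g = Ad w (X i (-t))"
    by (rule matrix_inv_eqI) (use w_inv in \<open>simp add: g_def Ad_hom[symmetric] Ad_fixed_iff\<close>)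
  have exuu: "Ad w (ex i c) \<in> uu i" for c
  proof -
    have "set vs \<subseteq> set us \<Longrightarrow> Ad (mat_prod (map f vs)) (ex i c) \<in> uu i" for vs
    proof (induction vs)
      case Nil then show ?case by (simp add: uu_def span_base uu_gens.ex)
    next
      case (Cons k vs)
      have "invertible (f l)" if "l \<in> set (k # vs)" for l using that Cons.prems f_inv by blast
      then have "invertible (f k)" "invertible (mat_prod (map f vs))"
        by (auto intro!: invertible_mat_prod)
      then have "Ad (mat_prod (map f (k # vs))) (ex i c) = Ad (f k) (Ad (mat_prod (map f vs)) (ex i c))"
        by (simp add: Ad_mult)
      moreover have "k \<noteq> i" "k \<in> set us" using Cons.prems us(2) by auto
      ultimately show ?case using Cons Ad_s_uu[OF \<open>k \<noteq> i\<close> _ f] by simp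
    qed
    then show ?thesis unfolding w_def by blast
  qed
  have "g \<in> N"
  proof (rule in_N_criterion[OF g_inv])
    \<comment> \<open>The computation of \<open>Ad_N_rho\<close> with \<open>\<kappa>\<close> as
      weight: conjugating \<open>mu r\<close> by \<open>g\<close> leaves the argument
      \<open>t (1 - exp (\<kappa> r))\<close>, whose derivative at \<open>0\<close> is
      \<open>- \<kappa> t\<close>.\<close>
    have "((\<lambda>t'. X i (t * of_real t')) \<circ> (\<lambda>r. 1 - exp (\<kappa> * r)) has_vector_derivative (- \<kappa>) *\<^sub>R ex i t) (at 0)"
    proof (rule vector_diff_chain_at)
      show "((\<lambda>r. 1 - exp (\<kappa> * r)) has_vector_derivative - \<kappa>) (at 0)"
        unfolding has_real_derivative_iff_has_vector_derivative[symmetric]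
        by (auto intro!: derivative_eq_intros)
    qed (simp add: ex_vder)
    then have d: "((\<lambda>r. Ad w (X i (t * of_real (1 - exp (\<kappa> * r))))) has_vector_derivative Ad w ((- \<kappa>) *\<^sub>R ex i t)) (at 0)"
      by (intro Ad_vder) (simp add: o_def)
    have "((\<lambda>r. Ad w (X i (t * of_real (1 - exp (\<kappa> * r)))) ** mu (of_real r)) has_vector_derivative
        (Ad w (X i (t * of_real (1 - exp (\<kappa> * 0)))) ** rho + Ad w ((- \<kappa>) *\<^sub>R ex i t) ** mu (of_real 0))) (at 0)"
      by (intro mult_vder rho_vder d)
    moreover have "Ad w (X i (t * of_real (1 - exp (\<kappa> * r)))) ** mu (of_real r) = Ad g (mu (of_real r))" for r
    proof -
      have "Ad w (X i (t * of_real (1 - exp (\<kappa> * r)))) = g ** Ad (mu (of_real r)) (matrix_inv g)"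
        by (simp add: ginv scale, simp add: g_def Ad_hom[symmetric] x_pos_add)
          (simp add: exp_of_real[symmetric] algebra_simps)
      then show ?thesis by (simp add: Ad_def matrix_mul_assoc')
    qed
    moreover have "Ad w (X i 0) = mat 1" using w_inv by (simp add: Ad_fixed_iff)
    ultimately have d2: "((\<lambda>r. Ad g (mu (of_real r))) has_vector_derivative rho + Ad w ((- \<kappa>) *\<^sub>R ex i t)) (at 0)"
      by simp
    have "Ad g rho = rho + Ad w ((- \<kappa>) *\<^sub>R ex i t)"
      by (rule vector_derivative_unique_at[OF Ad_vder[OF rho_vder] d2])
    moreover have "Ad w ((- \<kappa>) *\<^sub>R ex i t) \<in> uu i"
      using subspace_scale[OF uu_subspace exuu[of t], of "- \<kappa>"] by (simp only: linear_scale[OF linear_Ad])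
    ultimately show "Ad g rho - rho \<in> nn" using uu_nn by auto
    have "mu (of_real r) ** g ** mu (- of_real r) = Ad w (X i (t * exp (of_real (\<kappa> * r))))" for r
      using scale[of "of_real r" t] by (simp add: Ad_def[of "mu _"] g_def mult.commute)
    moreover have "((\<lambda>r. Ad w (X i (t * exp (of_real (\<kappa> * r))))) \<longlongrightarrow> Ad w (X i (t * 0))) at_bot"
    proof (rule filterlim_compose[of "\<lambda>r. Ad w (X i (t * exp (of_real r)))"])
      show "((\<lambda>r. Ad w (X i (t * exp (of_real r)))) \<longlongrightarrow> Ad w (X i (t * 0))) at_bot"
      proof (rule poly_curve_at_bot)
        show "poly_curve (\<lambda>s. Ad w (X i (t * s)))" unfolding Ad_def
          by (intro poly_curve_mult poly_curve_const poly_curve_scale poly_curve_x)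
      qed
      show "filterlim (\<lambda>r. \<kappa> * r) at_bot at_bot"
        using filterlim_tendsto_pos_mult_at_bot[OF tendsto_const \<kappa> filterlim_ident] by simp
    qed
    ultimately show "((\<lambda>r. mu (of_real r) ** g ** mu (- of_real r)) \<longlongrightarrow> mat 1) at_bot"
      using w_inv by (simp add: Ad_fixed_iff[THEN iffD2])
  qed
  then show ?thesis unfolding g_def w_def .
qed

end

section \<open>The Gauss cell and the generalized minors\<close>

lemma SL2_mult: "g \<in> SL2 \<Longrightarrow> h \<in> SL2 \<Longrightarrow> g ** h \<in> SL2"
  by (simp add: SL2_def det_mul)

lemma Ad_hom: "invertible g \<Longrightarrow> Ad g (a ** b) = Ad g a ** Ad g b"
  unfolding Ad_def using mat_mult_cancel_middle[of "matrix_inv g" g "g ** a" "b ** matrix_inv g"]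
  by (simp add: matrix_mul_assoc)

context chevalley
begin

lemma phi_invertible: "g \<in> SL2 \<Longrightarrow> invertible (\<phi> i g)"
  by (erule SL2_cases) (use phi22_inverse invertible_right_inverse in blast)

lemma phi_matrix_inv:
  assumes "g \<in> SL2" obtains g' where "g' \<in> SL2" "matrix_inv (\<phi> i g) = \<phi> i g'"
proof -
  from assms obtain a b c d where g: "g = mat22 a b c d" "a*d - b*c = 1" by (rule SL2_cases)
  have "matrix_inv (\<phi> i g) = \<phi> i (mat22 d (-b) (-c) a)"
    unfolding g(1) by (rule matrix_inv_eqI) (rule phi22_inverse[OF g(2)])
  moreover have "mat22 d (-b) (-c) a \<in> SL2" using g(2) by (simp add: mult.commute)
  ultimately show ?thesis using that by blast
qed

lemma x_as_phi:
  "X i t = \<phi> i (mat22 1 t 0 1)" "Y i t = \<phi> i (mat22 1 0 t 1)" "S i = \<phi> i (mat22 0 (-1) 1 0)" "S' i = \<phi> i (mat22 0 1 (-1) 0)"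
  by (simp_all add: x_pos_def x_neg_def s_bar_def S'_def)

text \<open>In the two Bruhat cases \<open>Y i\<close> commutes with \<open>X j\<close>,
  \<open>K i\<close> rescales its argument and \<open>X i\<close> lies in \<open>N\<close>. The
  factor \<open>S i\<close> is where \<open>word_conj_in_N\<close> is indispensable.\<close>

lemma phi_conj_x_pos:
  assumes "g \<in> SL2" "i \<noteq> j" shows "Ad (\<phi> i g) (X j u) \<in> N"
proof -
  have Y: "Ad (Y i t) (X j u) = X j u" for t
    using x_pos_neg_commute[of j i u t] assms(2) by (simp add: Ad_fixed_iff)
  have K: "Ad (K i s) (X j u) = X j (s powi (A$i$j) * u)" if "s \<noteq> 0" for s
    using that by (intro Ad_eqI) (simp_all add: coroot_x_pos)
  show ?thesis using assms(1)
  proof (cases rule: SL2_bruhat[of g i])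
    case (big r s t)
    then show ?thesis by (simp add: Ad_mult invertible_mult Y K) (simp add: Ad_def N_mult)
  next
    case (small s t)
    have "Ad (S i) (X j u') \<in> N" for u'
      using word_conj_in_N[of "[i]" j S u'] assms(2) by simp
    then show ?thesis using small by (simp add: Ad_mult invertible_mult Y K)
  qed
qed

text \<open>The unipotent radical of the minimal parabolic subgroup of index \<open>i\<close>,
  described by stability under the \<open>SL2\<close> of index \<open>i\<close> instead of by root
  subgroups.\<close>

definition Nrad :: "'i \<Rightarrow> (complex^'m^'m) set" where
  "Nrad i = {n \<in> N. \<forall>g\<in>SL2. Ad (\<phi> i g) n \<in> N}"

lemma Nrad_N: "m \<in> Nrad i \<Longrightarrow> m \<in> N"
  by (simp add: Nrad_def)

lemma Nrad_one: "mat 1 \<in> Nrad i"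
  by (simp add: Nrad_def Ad_fixed_iff[THEN iffD2] phi_invertible)

lemma Nrad_mult: "m \<in> Nrad i \<Longrightarrow> m' \<in> Nrad i \<Longrightarrow> m ** m' \<in> Nrad i"
  by (simp add: Nrad_def N_mult Ad_hom phi_invertible)

lemma Nrad_conj: "g \<in> SL2 \<Longrightarrow> m \<in> Nrad i \<Longrightarrow> Ad (\<phi> i g) m \<in> Nrad i"
  by (simp add: Nrad_def phi_invertible Ad_mult[symmetric] phi_mult[symmetric] SL2_mult)

lemma Nrad_conj_gens:
  assumes "m \<in> Nrad i"
  shows "Ad (X i t) m \<in> Nrad i" "Ad (Y i t) m \<in> Nrad i" "Ad (S i) m \<in> Nrad i" "Ad (S' i) m \<in> Nrad i"
  unfolding x_as_phi by (rule Nrad_conj; simp add: assms)+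

lemma x_pos_Nrad: "i \<noteq> j \<Longrightarrow> X j u \<in> Nrad i"
  by (simp add: Nrad_def phi_conj_x_pos)

text \<open>Generators of index \<open>i\<close> are absorbed by \<open>X i r\<close>. The others
  are moved past it and land in \<open>Nrad i\<close>, which \<open>X i\<close> normalizes.\<close>

lemma N_decompose: "n \<in> N \<Longrightarrow> \<exists>r m. n = X i r ** m \<and> m \<in> Nrad i"
proof (induction rule: N_induct)
  case one show ?case by (intro exI[of _ 0] exI[of _ "mat 1"]) (simp add: Nrad_one)
next
  case (step j t n)
  then obtain r m where n: "n = X i r ** m" "m \<in> Nrad i" by blast
  show ?case
  proof (cases "j = i")
    case True
    then have "X j t ** n = X i (t + r) ** m" by (simp add: n x_pos_add matrix_mul_assoc)
    with n show ?thesis by blast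
  next
    case False
    have "X j t ** n = X i r ** (Ad (X i (-r)) (X j t) ** m)"
      by (simp add: n Ad_def matrix_mul_assoc)
    moreover have "Ad (X i (-r)) (X j t) ** m \<in> Nrad i"
      using False n by (intro Nrad_mult Nrad_conj_gens x_pos_Nrad) auto
    ultimately show ?thesis by blast
  qed
qed

lemma N_decompose':
  assumes "n \<in> N" shows "\<exists>r m. n = m ** X i r \<and> m \<in> Nrad i"
proof -
  obtain r m where "n = X i r ** m" "m \<in> Nrad i" using N_decompose[OF assms] by blast
  then have "n = Ad (X i r) m ** X i r" by (simp add: Ad_def matrix_mul_assoc')
  then show ?thesis using Nrad_conj_gens(1)[OF \<open>m \<in> Nrad i\<close>] by blast
qed

abbreviation "G0 \<equiv> gauss_cell \<phi>"

lemma gauss_cellI: "n' \<in> N' \<Longrightarrow> h \<in> H \<Longrightarrow> n \<in> N \<Longrightarrow> n' ** h ** n \<in> G0"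
  unfolding gauss_cell_def by blast

lemma gauss_cell_one: "mat 1 \<in> G0"
  using gauss_cellI[OF N'_one H_one N_one] by simp

lemma gauss_cell_x_pos: "g \<in> G0 \<Longrightarrow> g ** X i t \<in> G0"
proof -
  assume "g \<in> G0"
  then obtain n' h n where g: "g = n' ** h ** n" "n' \<in> N'" "h \<in> H" "n \<in> N" unfolding gauss_cell_def by blast
  then have "g ** X i t = n' ** h ** (n ** X i t)" by (simp add: matrix_mul_assoc)
  then show ?thesis using g by (simp add: gauss_cellI N_mult)
qed

text \<open>Write the upper factor as \<open>m ** X i r\<close> with \<open>m\<close> in
  \<open>Nrad i\<close>. The product \<open>X i r ** Y i t\<close> has a Gauss decomposition when
  \<open>1 + r t \<noteq> 0\<close>, and \<open>m\<close> can be moved past its lower factor. So at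
  most one \<open>t\<close> leaves the cell.\<close>

lemma gauss_cell_x_neg: "g \<in> G0 \<Longrightarrow> \<exists>r. \<forall>t. 1 + r * t \<noteq> 0 \<longrightarrow> g ** Y i t \<in> G0"
proof -
  assume "g \<in> G0"
  then obtain n' h n where g: "g = n' ** h ** n" "n' \<in> N'" "h \<in> H" "n \<in> N" unfolding gauss_cell_def by blast
  obtain r m where n: "n = m ** X i r" "m \<in> Nrad i" using N_decompose'[OF g(4)] by blast
  have "g ** Y i t \<in> G0" if d: "1 + r * t \<noteq> 0" for t
  proof -
    let ?d = "1 + r * t"
    let ?y = "Y i (t / ?d)"
    define m1 where "m1 = Ad (matrix_inv ?y) m"
    have m1: "m1 \<in> N" "m ** ?y = ?y ** m1"
      using Nrad_conj_gens(2)[OF n(2), of "- (t / ?d)"] by (simp_all add: m1_def Nrad_N) (simp add: Ad_def matrix_mul_assoc)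
    obtain y' where y': "y' \<in> N'" "h ** ?y = y' ** h" using H_N'[OF g(3) x_in_N'] by blast
    obtain m2 where m2: "m2 \<in> N" "m1 ** K i ?d = K i ?d ** m2" using N_H[OF coroot_in_H[OF d] m1(1)] by blast
    have "g ** Y i t = n' ** h ** m ** (X i r ** Y i t)" by (simp add: g n matrix_mul_assoc)
    also have "\<dots> = n' ** h ** (m ** ?y) ** K i ?d ** X i (r / ?d)"
      using d by (simp add: x_pos_x_neg matrix_mul_assoc)
    also have "\<dots> = n' ** (h ** ?y) ** (m1 ** K i ?d) ** X i (r / ?d)" by (simp add: m1 matrix_mul_assoc)
    also have "\<dots> = (n' ** y') ** (h ** K i ?d) ** (m2 ** X i (r / ?d))" by (simp add: y' m2 matrix_mul_assoc)
    also have "\<dots> \<in> G0" using g y' m2 d by (intro gauss_cellI N'_mult H_mult coroot_in_H N_mult) auto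
    finally show ?thesis .
  qed
  then show ?thesis by blast
qed

lemma G_one: "mat 1 \<in> G" and G_mult: "g \<in> G \<Longrightarrow> h \<in> G \<Longrightarrow> g ** h \<in> G"
  unfolding group_G_def by (rule generate_GL_one, rule generate_GL_mult)

lemma phi_in_G: "g \<in> SL2 \<Longrightarrow> \<phi> i g \<in> G"
  unfolding group_G_def by (rule generate.incl) blast

lemma gens_in_G [simp, intro]: "X i t \<in> G" "Y i t \<in> G" "S i \<in> G" "S' i \<in> G"
  unfolding x_as_phi by (rule phi_in_G; simp)+

lemma coroot_in_G: "s \<noteq> 0 \<Longrightarrow> K i s \<in> G"
  unfolding coroot_def by (rule phi_in_G) simp

lemma N_subset_G: "N \<subseteq> G"
  using N_induct[of _ "\<lambda>n. n \<in> G"] G_one G_mult by blast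

lemma N'_subset_G: "N' \<subseteq> G"
proof
  fix n assume "n \<in> N'"
  then show "n \<in> G"
    using chevalley.N_induct[OF flip_chevalley, of n "\<lambda>n. n \<in> G"] G_one G_mult by simp
qed

lemma torus_in_G: "\<forall>i. t i \<noteq> 0 \<Longrightarrow> T t \<in> G"
proof -
  assume t: "\<forall>i. t i \<noteq> 0"
  have "mat_prod (map (\<lambda>i. K i (t i)) us) \<in> G" for us
    by (induction us) (use t in \<open>auto intro: G_one G_mult coroot_in_G\<close>)
  then show ?thesis unfolding torus_elem_def .
qed

lemma H_subset_G: "H \<subseteq> G"
  by (auto elim!: H_cases intro: torus_in_G)

text \<open>By the Bruhat cases the \<open>X i t\<close> and \<open>Y i t\<close> generate, since
  \<open>S\<close> and \<open>K\<close> are products of them.\<close>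

lemma G_mono_closed:
  assumes "mat 1 \<in> V" "\<And>i t g. g \<in> V \<Longrightarrow> X i t ** g \<in> V" "\<And>i t g. g \<in> V \<Longrightarrow> Y i t ** g \<in> V"
  shows "G \<subseteq> V"
  unfolding group_G_def
proof (rule generate_GL_mono_closed)
  show "\<exists>g'\<in>\<Union>i. \<phi> i ` SL2. g ** g' = mat 1" if g: "g \<in> (\<Union>i. \<phi> i ` SL2)" for g
  proof -
    from g obtain i s where s: "g = \<phi> i s" "s \<in> SL2" by blast
    obtain s' where "s' \<in> SL2" "matrix_inv (\<phi> i s) = \<phi> i s'" using phi_matrix_inv[OF s(2)] by blast
    then show ?thesis using s phi_invertible[OF s(2), of i] by (intro bexI[of _ "\<phi> i s'"]) (auto dest: sym)
  qed
  have SV: "S i ** h \<in> V" if "h \<in> V" for i h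
    using assms(2,3) that by (simp add: s_bar_eq matrix_mul_assoc')
  have KV: "K i s ** h \<in> V" if "h \<in> V" "s \<noteq> 0" for i s h
    using assms(2,3) SV that by (simp add: coroot_product matrix_mul_assoc')
  show "g ** h \<in> V" if g: "g \<in> (\<Union>i. \<phi> i ` SL2)" and h: "h \<in> V" for g h
  proof -
    from g obtain i s where s: "g = \<phi> i s" "s \<in> SL2" by blast
    from s(2) show ?thesis
    proof (cases rule: SL2_bruhat[of s i])
      case (big r c t)
      then show ?thesis using s(1) h assms(2,3) KV by (simp add: matrix_mul_assoc')
    next
      case (small c t)
      then show ?thesis using s(1) h assms(3) KV SV by (simp add: matrix_mul_assoc')
    qed
  qed
qed (rule assms(1))

lemma G_invertible: "g \<in> G \<Longrightarrow> invertible g"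
proof -
  have "G \<subseteq> {g. invertible g}" by (rule G_mono_closed) (auto intro: invertible_mult)
  then show "g \<in> G \<Longrightarrow> invertible g" by blast
qed

lemma G_inv: "g \<in> G \<Longrightarrow> matrix_inv g \<in> G"
proof -
  have "G \<subseteq> {g. invertible g \<and> matrix_inv g \<in> G}"
  proof (rule G_mono_closed)
    fix i t g assume "g \<in> {g. invertible g \<and> matrix_inv g \<in> G}"
    then show "X i t ** g \<in> {g. invertible g \<and> matrix_inv g \<in> G}" "Y i t ** g \<in> {g. invertible g \<and> matrix_inv g \<in> G}"
      by (auto simp: matrix_inv_mult intro: invertible_mult G_mult)
  qed (simp add: G_one)
  then show "g \<in> G \<Longrightarrow> matrix_inv g \<in> G" by blast
qed

lemma gauss_cell_subset_G: "G0 \<subseteq> G"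
  unfolding gauss_cell_def using N_subset_G N'_subset_G H_subset_G by (auto intro!: G_mult)

text \<open>The claim is strengthened to \<open>F (a ** g) = 0\<close> for all \<open>a\<close> in
  the Gauss cell and proved by adding generators to the left of \<open>g\<close>. Multiplying
  \<open>a\<close> by \<open>Y i t\<close> stays in the cell for all but at most one
  \<open>t\<close>, and continuity in \<open>t\<close> covers the exception.\<close>

lemma gauss_cell_dense:
  fixes F :: "complex^'m^'m \<Rightarrow> complex"
  assumes cont: "continuous_on G F" and F: "\<And>x. x \<in> G0 \<Longrightarrow> F x = 0" and "x \<in> G"
  shows "F x = 0"
proof -
  have "G \<subseteq> {g \<in> G. \<forall>a\<in>G0. F (a ** g) = 0}"
  proof (rule G_mono_closed)
    show "mat 1 \<in> {g \<in> G. \<forall>a\<in>G0. F (a ** g) = 0}" using F by (simp add: G_one)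
  next
    fix i t g assume g: "g \<in> {g \<in> G. \<forall>a\<in>G0. F (a ** g) = 0}"
    then show "X i t ** g \<in> {g \<in> G. \<forall>a\<in>G0. F (a ** g) = 0}"
      by (simp add: G_mult matrix_mul_assoc gauss_cell_x_pos)
    have "F (a ** (Y i t ** g)) = 0" if a: "a \<in> G0" for a
    proof -
      obtain r where r: "\<forall>t. 1 + r * t \<noteq> 0 \<longrightarrow> a ** Y i t \<in> G0" using gauss_cell_x_neg[OF a] by blast
      have "(\<lambda>t. F (a ** Y i t ** g)) = (\<lambda>_. 0)"
      proof (rule continuous_eq_off_finite[of _ _ "{t. poly [:1, r:] t = 0}"])
        have "continuous_on UNIV (\<lambda>t. a ** Y i t ** g)"
          by (intro poly_curve_continuous poly_curve_mult poly_curve_const poly_curve_x)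
        then show "continuous_on UNIV (\<lambda>t. F (a ** Y i t ** g))"
          by (rule continuous_on_compose2[OF cont])
            (use a g gauss_cell_subset_G in \<open>auto intro!: G_mult\<close>)
        show "finite {t. poly [:1, r:] t = 0}" by (rule poly_roots_finite) simp
        fix t assume "t \<notin> {t. poly [:1, r:] t = 0}"
        then have "a ** Y i t \<in> G0" using r by (simp add: mult.commute)
        then show "F (a ** Y i t ** g) = 0" using g by simp
      qed simp
      then show ?thesis by (simp add: fun_eq_iff matrix_mul_assoc)
    qed
    then show "Y i t ** g \<in> {g \<in> G. \<forall>a\<in>G0. F (a ** g) = 0}" using g by (simp add: G_mult gens_in_G)
  qed
  then have "\<forall>a\<in>G0. F (a ** x) = 0" using \<open>x \<in> G\<close> by blast
  then have "F (mat 1 ** x) = 0" using gauss_cell_one by blast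
  then show ?thesis by simp
qed

lemma continuous_on_translate:
  fixes F :: "complex^'m^'m \<Rightarrow> complex"
  assumes "continuous_on G F" "a \<in> G" "b \<in> G" shows "continuous_on G (\<lambda>x. F (a ** x ** b))"
proof (rule continuous_on_compose2[OF assms(1)])
  show "continuous_on G (\<lambda>x. a ** x ** b)"
    by (intro mult_continuous_on continuous_on_const continuous_on_id)
  show "(\<lambda>x. a ** x ** b) ` G \<subseteq> G" using assms by (auto intro: G_mult)
qed

lemma torus_coords_torus_elem:
  assumes "\<forall>i. t i \<noteq> 0" shows "torus_coords \<phi> (T t) = t"
  unfolding torus_coords_def
proof (rule the_equality)
  fix t' assume "(\<forall>i. t' i \<noteq> 0) \<and> T t' = T t"
  then show "t' = t" using inj_onD[OF torus_inj, of t' t] assms by simp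
qed (use assms in simp)

lemma char_fund_weight: "char t (fund_weight i) = t i"
proof -
  have "char t (fund_weight i) = (\<Prod>k\<in>UNIV. if k = i then t k else 1)"
    unfolding char_def fund_weight_def by (intro prod.cong) (auto simp: axis_def)
  then show ?thesis by simp
qed

lemma gauss_diag_eq:
  assumes "n' \<in> N'" "h \<in> H" "n \<in> N" shows "gauss_diag \<phi> (n' ** h ** n) = h"
  unfolding gauss_diag_def
proof (rule the_equality)
  fix h' assume "h' \<in> H \<and> (\<exists>n1\<in>N'. \<exists>n2\<in>N. n' ** h ** n = n1 ** h' ** n2)"
  then show "h' = h" using gauss_unique(2) assms by metis
qed (use assms in blast)

lemma weight_char_torus: "\<forall>i. t i \<noteq> 0 \<Longrightarrow> weight_char \<phi> \<gamma> (T t) = char t \<gamma>"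
  by (simp add: weight_char_def torus_coords_torus_elem char_def)

lemma weyl_bar_word:
  assumes "u \<in> weyl_group A"
  obtains us where "reduced_word A u us" "weyl_bar A \<phi> u = mat_prod (map S us)"
proof -
  from assms obtain ws where ws: "word_action A ws = u" unfolding weyl_group_def by blast
  then have "\<exists>k ws. word_action A ws = u \<and> length ws = k" by blast
  then have "\<exists>ws. word_action A ws = u \<and> length ws = weyl_length A u"
    unfolding weyl_length_def by (rule LeastI_ex)
  then have "\<exists>ws. reduced_word A u ws" unfolding reduced_word_def .
  then have "reduced_word A u (SOME ws. reduced_word A u ws)" by (rule someI_ex)
  then show ?thesis using that unfolding weyl_bar_def by blast
qed

lemma reduced_word_action: "reduced_word A u us \<Longrightarrow> word_action A us = u"
  and reduced_word_length: "reduced_word A u us \<Longrightarrow> word_action A ws = u \<Longrightarrow> length us \<le> length ws"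
  unfolding reduced_word_def weyl_length_def by (auto intro: Least_le)

lemma id_weyl: "id \<in> weyl_group A"
  unfolding weyl_group_def by (rule range_eqI[of _ _ "[]"]) (simp add: fun_eq_iff)

lemma weyl_bar_id: "weyl_bar A \<phi> id = mat 1"
proof -
  obtain us where us: "reduced_word A id us" "weyl_bar A \<phi> id = mat_prod (map S us)"
    using weyl_bar_word[OF id_weyl] by blast
  have "length us \<le> length ([] :: 'i list)" by (rule reduced_word_length[OF us(1)]) (simp add: fun_eq_iff)
  then show ?thesis using us(2) by simp
qed

lemma word_in_G: "(\<And>k. k \<in> set us \<Longrightarrow> f k = S k \<or> f k = S' k) \<Longrightarrow> mat_prod (map f us) \<in> G"
proof (induction us)
  case (Cons u us)
  have "f u \<in> G" using Cons.prems[of u] by auto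
  then show ?case using Cons by (simp add: G_mult)
qed (simp add: G_one)

lemma weyl_bar_in_G: "u \<in> weyl_group A \<Longrightarrow> weyl_bar A \<phi> u \<in> G"
  by (erule weyl_bar_word) (simp add: word_in_G)

end

section \<open>Equivariance of the generalized minors\<close>

locale minors = chevalley A \<phi>
  for A :: "'i::{finite,linorder} int_matrix" and \<phi> :: "'i \<Rightarrow> complex^2^2 \<Rightarrow> complex^'m^'m" +
  fixes \<Delta> :: "'i weight \<Rightarrow> 'i weight \<Rightarrow> complex^'m^'m \<Rightarrow> complex"
  assumes gm: "generalized_minors A \<phi> \<Delta>"
begin

abbreviation "f i \<equiv> \<Delta> (fund_weight i) (fund_weight i)"

lemma minor_regular:
  "u \<in> weyl_group A \<Longrightarrow> v \<in> weyl_group A \<Longrightarrow> regular_on G (\<Delta> (u (fund_weight i)) (v (fund_weight i)))"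
  using gm unfolding generalized_minors_def by blast

lemma minor_formula:
  assumes "u \<in> weyl_group A" "v \<in> weyl_group A" "n' \<in> N'" "\<forall>i. t i \<noteq> 0" "n \<in> N"
    and x: "matrix_inv (weyl_bar A \<phi> u) ** x ** weyl_bar A \<phi> v = n' ** T t ** n"
  shows "\<Delta> (u (fund_weight i)) (v (fund_weight i)) x = t i"
proof -
  have "\<Delta> (u (fund_weight i)) (v (fund_weight i)) x =
           weight_char \<phi> (fund_weight i)
             (gauss_diag \<phi> (matrix_inv (weyl_bar A \<phi> u) ** x ** weyl_bar A \<phi> v))"
    using gm assms(1,2) gauss_cellI[OF assms(3) torus_in_H[OF assms(4)] assms(5)] x
    unfolding generalized_minors_def by (metis (no_types))
  also have "\<dots> = t i"
    unfolding x using assms by (simp add: gauss_diag_eq torus_in_H weight_char_torus char_fund_weight)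
  finally show ?thesis .
qed

lemma f_regular: "regular_on G (f i)"
  using minor_regular[OF id_weyl id_weyl] by simp

lemma f_continuous: "continuous_on G (f i)"
  by (rule regular_on_continuous[OF f_regular])

lemma f_gauss: "n' \<in> N' \<Longrightarrow> \<forall>i. t i \<noteq> 0 \<Longrightarrow> n \<in> N \<Longrightarrow> f i (n' ** T t ** n) = t i"
  using minor_formula[OF id_weyl id_weyl, of n' t n "n' ** T t ** n" i] by (simp add: weyl_bar_id)

lemma gauss_cell_cases:
  assumes "x \<in> G0" obtains n' t n where "x = n' ** T t ** n" "n' \<in> N'" "\<forall>i. t i \<noteq> 0" "n \<in> N"
  using assms unfolding gauss_cell_def torus_H_def by blast

lemma eq_on_G:
  fixes F F' :: "complex^'m^'m \<Rightarrow> complex"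
  assumes "continuous_on G F" "continuous_on G F'" "\<And>n' t n. n' \<in> N' \<Longrightarrow> \<forall>i. t i \<noteq> 0 \<Longrightarrow> n \<in> N \<Longrightarrow> F (n' ** T t ** n) = F' (n' ** T t ** n)"
    "x \<in> G"
  shows "F x = F' x"
proof -
  have "F x - F' x = 0"
  proof (rule gauss_cell_dense[of "\<lambda>x. F x - F' x"])
    fix x assume "x \<in> G0"
    then show "F x - F' x = 0" using assms(3) by (auto elim!: gauss_cell_cases)
  qed (use assms in \<open>auto intro: continuous_on_diff\<close>)
  then show ?thesis by simp
qed

text \<open>The defining formula speaks of a translate of the Gauss cell; density carries it to the
  whole group. From here on every minor is a translate of some \<open>f i\<close>.\<close>

lemma minor_eq:
  assumes u: "u \<in> weyl_group A" and v: "v \<in> weyl_group A" and x: "x \<in> G"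
  shows "\<Delta> (u (fund_weight i)) (v (fund_weight i)) x = f i (matrix_inv (weyl_bar A \<phi> u) ** x ** weyl_bar A \<phi> v)"
proof -
  let ?u = "weyl_bar A \<phi> u" and ?v = "weyl_bar A \<phi> v"
  have G: "?u \<in> G" "?v \<in> G" "matrix_inv ?u \<in> G" "matrix_inv ?v \<in> G"
    using u v by (auto intro: weyl_bar_in_G G_inv)
  have inv: "invertible ?u" "invertible ?v" using G G_invertible by auto
  have cancel: "matrix_inv ?u ** (?u ** y ** matrix_inv ?v) ** ?v = y" "?u ** (matrix_inv ?u ** y ** ?v) ** matrix_inv ?v = y" for y
    using inv by (simp_all add: matrix_mul_assoc) (simp_all add: matrix_mul_assoc'[of y])
  have "\<Delta> (u (fund_weight i)) (v (fund_weight i)) (?u ** (matrix_inv ?u ** x ** ?v) ** matrix_inv ?v) =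
      f i (matrix_inv ?u ** x ** ?v)"
  proof (rule eq_on_G[where F = "\<lambda>y. \<Delta> (u (fund_weight i)) (v (fund_weight i)) (?u ** y ** matrix_inv ?v)"])
    show "continuous_on G (\<lambda>y. \<Delta> (u (fund_weight i)) (v (fund_weight i)) (?u ** y ** matrix_inv ?v))"
      by (rule continuous_on_translate[OF regular_on_continuous[OF minor_regular[OF u v]] G(1,4)])
    show "matrix_inv ?u ** x ** ?v \<in> G" using G x by (intro G_mult)
    fix n' n and t :: "'i \<Rightarrow> complex" assume *: "n' \<in> N'" "\<forall>i. t i \<noteq> 0" "n \<in> N"
    show "\<Delta> (u (fund_weight i)) (v (fund_weight i)) (?u ** (n' ** T t ** n) ** matrix_inv ?v) = f i (n' ** T t ** n)"
      using minor_formula[OF u v *, of "?u ** (n' ** T t ** n) ** matrix_inv ?v"] * by (simp add: cancel f_gauss)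
  qed (rule f_continuous)
  then show ?thesis by (simp only: cancel)
qed

lemma f_N_right: "n \<in> N \<Longrightarrow> x \<in> G \<Longrightarrow> f i (x ** n) = f i x"
proof (rule eq_on_G[where F = "\<lambda>x. f i (x ** n)"])
  assume n: "n \<in> N"
  then show "continuous_on G (\<lambda>x. f i (x ** n))"
    using continuous_on_translate[OF f_continuous G_one, of n i] N_subset_G by auto
  fix n' m and t :: "'i \<Rightarrow> complex" assume "n' \<in> N'" "\<forall>i. t i \<noteq> 0" "m \<in> N"
  then show "f i (n' ** T t ** m ** n) = f i (n' ** T t ** m)"
    using n by (simp add: matrix_mul_assoc'[of _ m n] f_gauss N_mult)
qed (rule f_continuous)

lemma f_N'_left: "n \<in> N' \<Longrightarrow> x \<in> G \<Longrightarrow> f i (n ** x) = f i x"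
proof (rule eq_on_G[where F = "\<lambda>x. f i (n ** x)"])
  assume n: "n \<in> N'"
  then show "continuous_on G (\<lambda>x. f i (n ** x))"
    using continuous_on_translate[OF f_continuous _ G_one, of n i] N'_subset_G by auto
  fix n' m and t :: "'i \<Rightarrow> complex" assume "n' \<in> N'" "\<forall>i. t i \<noteq> 0" "m \<in> N"
  then show "f i (n ** (n' ** T t ** m)) = f i (n' ** T t ** m)"
    using n by (simp add: matrix_mul_assoc f_gauss N'_mult)
qed (rule f_continuous)

lemma f_torus_left: "\<forall>i. t i \<noteq> 0 \<Longrightarrow> x \<in> G \<Longrightarrow> f i (T t ** x) = t i * f i x"
proof (rule eq_on_G[where F = "\<lambda>x. f i (T t ** x)"])
  assume t: "\<forall>i. t i \<noteq> 0"
  then show "continuous_on G (\<lambda>x. f i (T t ** x))"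
    using continuous_on_translate[OF f_continuous _ G_one, of "T t" i] torus_in_G by auto
  fix n' m and t' :: "'i \<Rightarrow> complex" assume *: "n' \<in> N'" "\<forall>i. t' i \<noteq> 0" "m \<in> N"
  obtain n1 where n1: "n1 \<in> N'" "T t ** n' = n1 ** T t" using H_N'[OF torus_in_H[OF t] *(1)] by blast
  have "T t ** (n' ** T t' ** m) = (T t ** n') ** T t' ** m" by (simp add: matrix_mul_assoc)
  also have "\<dots> = n1 ** (T t ** T t') ** m" by (simp add: n1 matrix_mul_assoc)
  also have "T t ** T t' = T (\<lambda>i. t i * t' i)" by (rule torus_mult[OF t *(2)])
  finally show "f i (T t ** (n' ** T t' ** m)) = t i * f i (n' ** T t' ** m)"
    using * t n1 f_gauss[OF n1(1), of "\<lambda>i. t i * t' i" m i] by (simp add: f_gauss)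
qed (auto intro: continuous_intros f_continuous)

lemma f_torus_right: "\<forall>i. t i \<noteq> 0 \<Longrightarrow> x \<in> G \<Longrightarrow> f i (x ** T t) = f i x * t i"
proof (rule eq_on_G[where F = "\<lambda>x. f i (x ** T t)"])
  assume t: "\<forall>i. t i \<noteq> 0"
  then show "continuous_on G (\<lambda>x. f i (x ** T t))"
    using continuous_on_translate[OF f_continuous G_one, of "T t" i] torus_in_G by auto
  fix n' m and t' :: "'i \<Rightarrow> complex" assume *: "n' \<in> N'" "\<forall>i. t' i \<noteq> 0" "m \<in> N"
  obtain n1 where n1: "n1 \<in> N" "m ** T t = T t ** n1" using N_H[OF torus_in_H[OF t] *(3)] by blast
  have "(n' ** T t' ** m) ** T t = n' ** T t' ** (m ** T t)" by (simp add: matrix_mul_assoc)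
  also have "\<dots> = n' ** (T t' ** T t) ** n1" by (simp add: n1 matrix_mul_assoc)
  also have "T t' ** T t = T (\<lambda>i. t' i * t i)" by (rule torus_mult[OF *(2) t])
  finally show "f i ((n' ** T t' ** m) ** T t) = f i (n' ** T t' ** m) * t i"
    using * t n1 f_gauss[OF *(1), of "\<lambda>i. t' i * t i" n1 i] by (simp add: f_gauss)
qed (auto intro: continuous_intros f_continuous)

lemma f_one: "f i (mat 1) = 1"
  using f_gauss[OF N'_one _ N_one, of "\<lambda>_. 1" i] by simp

lemma weyl_torus:
  assumes "u \<in> weyl_group A" "\<forall>i. t i \<noteq> 0"
  obtains t' where "\<forall>i. t' i \<noteq> 0" "T t ** weyl_bar A \<phi> u = weyl_bar A \<phi> u ** T t'"
    "\<And>i. t' i = char t (u (fund_weight i))"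
proof -
  obtain us where us: "reduced_word A u us" "weyl_bar A \<phi> u = mat_prod (map S us)" using weyl_bar_word[OF assms(1)] by blast
  obtain t' where t': "\<forall>i. t' i \<noteq> 0" "T t ** mat_prod (map S us) = mat_prod (map S us) ** T t'"
    "\<forall>\<gamma>. char t' \<gamma> = char t (word_action A us \<gamma>)"
    using torus_word[of us S t] assms(2) by auto
  have "t' i = char t (u (fund_weight i))" for i
    using t'(3)[rule_format, of "fund_weight i"] reduced_word_action[OF us(1)] by (simp add: char_fund_weight)
  then show ?thesis using that t' us(2) by simp
qed

lemma minor_torus_left:
  assumes u: "u \<in> weyl_group A" and v: "v \<in> weyl_group A" and t: "\<forall>i. t i \<noteq> 0" and x: "x \<in> G"
  shows "\<Delta> (u (fund_weight i)) (v (fund_weight i)) (T t ** x) =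
    char t (u (fund_weight i)) * \<Delta> (u (fund_weight i)) (v (fund_weight i)) x"
proof -
  let ?u = "weyl_bar A \<phi> u" and ?v = "weyl_bar A \<phi> v"
  obtain t' where t': "\<forall>i. t' i \<noteq> 0" "T t ** ?u = ?u ** T t'" "\<And>i. t' i = char t (u (fund_weight i))"
    using weyl_torus[OF u t] by blast
  have G: "?u \<in> G" "?v \<in> G" "matrix_inv ?u \<in> G"
    using u v by (auto intro: weyl_bar_in_G G_inv)
  have inv: "invertible ?u" using G G_invertible by auto
  have "matrix_inv ?u ** T t = (matrix_inv ?u ** (T t ** ?u)) ** matrix_inv ?u"
    using inv by (simp add: matrix_mul_assoc')
  also have "\<dots> = T t' ** matrix_inv ?u" using inv by (simp add: t'(2)) (simp add: matrix_mul_assoc)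
  finally have "matrix_inv ?u ** (T t ** x) ** ?v = T t' ** (matrix_inv ?u ** x ** ?v)"
    by (simp add: matrix_mul_assoc)
  then show ?thesis
    using u v x t G t' by (simp add: minor_eq torus_in_G G_mult f_torus_left)
qed

lemma minor_torus_right:
  assumes u: "u \<in> weyl_group A" and v: "v \<in> weyl_group A" and t: "\<forall>i. t i \<noteq> 0" and x: "x \<in> G"
  shows "\<Delta> (u (fund_weight i)) (v (fund_weight i)) (x ** T t) =
    \<Delta> (u (fund_weight i)) (v (fund_weight i)) x * char t (v (fund_weight i))"
proof -
  let ?u = "weyl_bar A \<phi> u" and ?v = "weyl_bar A \<phi> v"
  obtain t' where t': "\<forall>i. t' i \<noteq> 0" "T t ** ?v = ?v ** T t'" "\<And>i. t' i = char t (v (fund_weight i))"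
    using weyl_torus[OF v t] by blast
  have G: "?u \<in> G" "?v \<in> G" "matrix_inv ?u \<in> G"
    using u v by (auto intro: weyl_bar_in_G G_inv)
  have "matrix_inv ?u ** (x ** T t) ** ?v = matrix_inv ?u ** x ** (T t ** ?v)"
    by (simp add: matrix_mul_assoc)
  also have "\<dots> = (matrix_inv ?u ** x ** ?v) ** T t'" by (simp add: t'(2) matrix_mul_assoc)
  finally show ?thesis
    using u v x t G t' by (simp add: minor_eq torus_in_G G_mult f_torus_right)
qed

end

section \<open>Words of the Coxeter element\<close>

context chevalley
begin

lemma simple_reflection_involution [simp]: "simple_reflection A u (simple_reflection A u \<gamma>) = \<gamma>"
  using cartan_props(1)[of u] by (simp add: simple_reflection_def simple_root_def vec_eq_iff)

lemma simple_reflection_diff: "simple_reflection A u (\<gamma> - \<delta>) = simple_reflection A u \<gamma> - simple_reflection A u \<delta>"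
  by (simp add: simple_reflection_def vec_eq_iff algebra_simps)

lemma word_action_diff: "word_action A us (\<gamma> - \<delta>) = word_action A us \<gamma> - word_action A us \<delta>"
  by (induction us) (simp_all add: simple_reflection_diff)

lemma simple_reflection_fund: "simple_reflection A u (fund_weight j) = (if u = j then fund_weight j - simple_root A j else fund_weight j)"
  by (simp add: simple_reflection_def fund_weight_def axis_def vec_eq_iff)

lemma word_fund: "x \<notin> set us \<Longrightarrow> word_action A us (fund_weight x) = fund_weight x"
  by (induction us) (auto simp: simple_reflection_fund)

lemma word_fund_split:
  assumes "x \<notin> set bs"
  shows "word_action A (as @ x # bs) (fund_weight x) = word_action A as (fund_weight x) - word_action A as (simple_root A x)"
  using assms by (simp add: word_action_append word_fund simple_reflection_fund word_action_diff)

lemma simple_reflection_commute: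
  assumes "A$u$x = 0" shows "simple_reflection A u (simple_reflection A x \<gamma>) = simple_reflection A x (simple_reflection A u \<gamma>)"
  using assms cartan_props(3)[OF assms] by (simp add: simple_reflection_def simple_root_def vec_eq_iff)

lemma word_rev_cancel [simp]: "word_action A us (word_action A (rev us) \<gamma>) = \<gamma>" "word_action A (rev us) (word_action A us \<gamma>) = \<gamma>"
proof -
  show *: "word_action A us (word_action A (rev us) \<gamma>) = \<gamma>" for us \<gamma>
    by (induction us arbitrary: \<gamma>) (simp_all add: word_action_append)
  show "word_action A (rev us) (word_action A us \<gamma>) = \<gamma>"
    using *[of "rev us"] by simp
qed

text \<open>The coefficient of \<open>\<alpha>\<^sub>u\<close> in \<open>\<omega>\<^sub>x - w \<omega>\<^sub>x\<close> tells whether \<open>u\<close> precedes its neighbour \<open>x\<close> in a word for \<open>w\<close>.\<close>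

lemma root_coefficient_unique:
  fixes p q :: "'i \<Rightarrow> int"
  assumes "(\<Sum>k\<in>UNIV. p k *s simple_root A k) = (\<Sum>k\<in>UNIV. q k *s simple_root A k)"
  shows "p = q"
proof
  fix k
  have "(\<Sum>k\<in>UNIV. (p k - q k) *s simple_root A k) = 0"
    using assms by (simp add: vec_eq_iff left_diff_distrib sum_subtractf)
  then have "p k - q k = 0" by (rule simple_roots_independent[of "\<lambda>k. p k - q k"])
  then show "p k = q k" by simp
qed

lemma word_fund_expansion:
  assumes "distinct (as @ x # bs)"
  obtains p :: "'i \<Rightarrow> int" where "fund_weight x - word_action A (as @ x # bs) (fund_weight x) = (\<Sum>k\<in>UNIV. p k *s simple_root A k)"
    "p x = 1" "\<forall>k\<in>set as. A$k$x \<noteq> 0 \<longrightarrow> p k > 0" "\<forall>k. k \<noteq> x \<longrightarrow> k \<notin> set as \<longrightarrow> p k = 0"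
proof -
  obtain p where p: "word_action A as (simple_root A x) = simple_root A x + (\<Sum>k\<in>set as. p k *s simple_root A k)"
    "\<forall>k\<in>set as. p k \<ge> 0 \<and> (A$k$x \<noteq> 0 \<longrightarrow> p k > 0)" using word_root[of as x] assms by auto
  define p' where "p' k = (if k = x then 1 else if k \<in> set as then p k else 0)" for k
  have "(\<Sum>k\<in>UNIV. p' k *s simple_root A k) = p' x *s simple_root A x + (\<Sum>k\<in>UNIV - {x}. p' k *s simple_root A k)"
    by (rule sum.remove) auto
  also have "(\<Sum>k\<in>UNIV - {x}. p' k *s simple_root A k) = (\<Sum>k\<in>set as. p k *s simple_root A k)"
    by (rule sum.mono_neutral_cong_right) (use assms in \<open>auto simp: p'_def\<close>)
  finally have "(\<Sum>k\<in>UNIV. p' k *s simple_root A k) = word_action A as (simple_root A x)"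
    by (simp add: p p'_def)
  moreover have "fund_weight x - word_action A (as @ x # bs) (fund_weight x) = word_action A as (simple_root A x)"
    using assms by (simp add: word_fund_split word_fund)
  ultimately show ?thesis using that[of p'] p(2) assms by (auto simp: p'_def)
qed

text \<open>The words differ by commutations alone, so no braid relation is involved. If a neighbour
  \<open>x\<close> of the first letter \<open>u\<close> of \<open>us\<close> stood before
  \<open>u\<close> in \<open>vs\<close>, the coefficient of the root \<open>u\<close> in the
  difference of \<open>fund_weight x\<close> and its image would be positive by \<open>us\<close>
  and zero by \<open>vs\<close>. So \<open>u\<close> can be pulled to the front of
  \<open>vs\<close>.\<close>

lemma word_bar_unique:
  assumes "distinct us" "distinct vs" "set us = set vs" "word_action A us = word_action A vs"
  shows "mat_prod (map S us) = mat_prod (map S vs)"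
  using assms
proof (induction us arbitrary: vs)
  case (Cons u us)
  then have "u \<in> set vs" by auto
  then obtain xs ys where vs: "vs = xs @ u # ys" by (auto simp: in_set_conv_decomp)
  have comm: "A$u$x = 0" if x: "x \<in> set xs" for x
  proof (rule ccontr)
    assume nz: "A$u$x \<noteq> 0"
    have "x \<in> set us" using Cons.prems x vs by auto
    then obtain as bs where us: "us = as @ x # bs" by (auto simp: in_set_conv_decomp)
    obtain cs ds where xs: "xs = cs @ x # ds" using x by (auto simp: in_set_conv_decomp)
    have "distinct ((u # as) @ x # bs)" using Cons.prems(1) us by simp
    then obtain p where p: "fund_weight x - word_action A ((u # as) @ x # bs) (fund_weight x) = (\<Sum>k\<in>UNIV. p k *s simple_root A k)"
      "p x = 1" "\<forall>k\<in>set (u # as). A$k$x \<noteq> 0 \<longrightarrow> p k > 0" "\<forall>k. k \<noteq> x \<longrightarrow> k \<notin> set (u # as) \<longrightarrow> p k = 0"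
      by (rule word_fund_expansion)
    have "distinct (cs @ x # (ds @ u # ys))" using Cons.prems(2) vs xs by simp
    then obtain q where q: "fund_weight x - word_action A (cs @ x # (ds @ u # ys)) (fund_weight x) = (\<Sum>k\<in>UNIV. q k *s simple_root A k)"
      "q x = 1" "\<forall>k\<in>set cs. A$k$x \<noteq> 0 \<longrightarrow> q k > 0" "\<forall>k. k \<noteq> x \<longrightarrow> k \<notin> set cs \<longrightarrow> q k = 0"
      by (rule word_fund_expansion)
    have "word_action A ((u # as) @ x # bs) = word_action A (cs @ x # (ds @ u # ys))"
      using Cons.prems(4) us vs xs by (simp only: append_Cons append_assoc)
    then have "p = q" using p(1) q(1) by (intro root_coefficient_unique) (simp only:)
    moreover have "p u > 0" using p(3) nz by simp
    moreover have "q u = 0" using q(4) Cons.prems(2) vs xs by auto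
    ultimately show False by simp
  qed
  have refl_comm: "set zs \<subseteq> set xs \<Longrightarrow> word_action A zs (simple_reflection A u \<gamma>) = simple_reflection A u (word_action A zs \<gamma>)" for zs \<gamma>
    by (induction zs) (auto simp: simple_reflection_commute comm)
  have bar_comm: "set zs \<subseteq> set xs \<Longrightarrow> mat_prod (map S zs) ** S u = S u ** mat_prod (map S zs)" for zs
  proof (induction zs)
    case (Cons z zs)
    have "u \<noteq> z" using Cons.prems \<open>distinct vs\<close> vs by auto
    then have zu: "S z ** S u = S u ** S z" using s_bar_commute[of u z] comm[of z] Cons.prems by auto
    have "mat_prod (map S (z # zs)) ** S u = S z ** (mat_prod (map S zs) ** S u)" by (simp add: matrix_mul_assoc)
    also have "\<dots> = (S z ** S u) ** mat_prod (map S zs)" using Cons by (simp add: matrix_mul_assoc)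
    finally show ?case using zu by (simp add: matrix_mul_assoc)
  qed simp
  have "word_action A us \<gamma> = word_action A (xs @ ys) \<gamma>" for \<gamma>
  proof -
    have "simple_reflection A u (word_action A us \<gamma>) = word_action A vs \<gamma>"
      using Cons.prems(4) by (metis word_action_Cons)
    also have "\<dots> = simple_reflection A u (word_action A (xs @ ys) \<gamma>)"
      by (simp add: vs word_action_append refl_comm)
    finally show ?thesis by (metis simple_reflection_involution)
  qed
  moreover have "set us = set (xs @ ys)"
  proof -
    have "insert u (set us) = insert u (set (xs @ ys))" using Cons.prems(3) vs by simp
    moreover have "u \<notin> set us" "u \<notin> set (xs @ ys)" using Cons.prems(1,2) vs by auto
    ultimately show ?thesis by (metis insert_ident)
  qed
  ultimately have "mat_prod (map S us) = mat_prod (map S (xs @ ys))"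
    using Cons.prems(1,2) vs by (intro Cons.IH) (auto simp: fun_eq_iff)
  then show ?case using bar_comm[of xs] by (simp add: vs matrix_mul_assoc)
qed simp

text \<open>\<open>weyl_bar\<close> takes some reduced word, about which nothing else is known. Each
  letter \<open>x\<close> occurs in it, as the Coxeter element moves \<open>fund_weight x\<close>,
  and the length bound makes each occur just once. So \<open>word_bar_unique\<close>
  applies.\<close>

lemma reduced_coxeter_bar:
  assumes L: "distinct L" "set L = UNIV" and us: "reduced_word A (word_action A L) us"
  shows "mat_prod (map S us) = mat_prod (map S L)"
proof -
  note act = reduced_word_action[OF us]
  have len: "length us \<le> length L" by (rule reduced_word_length[OF us refl])
  have "x \<in> set us" for x
  proof (rule ccontr)
    assume "x \<notin> set us"
    then have fix1: "word_action A L (fund_weight x) = fund_weight x" using word_fund[of x us] act by simp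
    have "x \<in> set L" using L by simp
    then obtain as bs where Ls: "L = as @ x # bs" by (auto simp: in_set_conv_decomp)
    have "distinct (as @ x # bs)" using L(1) Ls by simp
    then obtain p where p: "fund_weight x - word_action A (as @ x # bs) (fund_weight x) = (\<Sum>k\<in>UNIV. p k *s simple_root A k)"
      "p x = 1" "\<forall>k\<in>set as. A$k$x \<noteq> 0 \<longrightarrow> p k > 0" "\<forall>k. k \<noteq> x \<longrightarrow> k \<notin> set as \<longrightarrow> p k = 0"
      by (rule word_fund_expansion)
    have "(\<Sum>k\<in>UNIV. p k *s simple_root A k) = 0" using p(1) fix1 Ls by simp
    then have "p x = 0" by (rule simple_roots_independent)
    with p(2) show False by simp
  qed
  then have set: "set us = UNIV" by blast
  have "length L = card (UNIV :: 'i set)" using L distinct_card by metis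
  then have "card (set us) = length us" using len set card_length[of us] by simp
  then have "distinct us" by (rule card_distinct)
  then show ?thesis using L set act by (intro word_bar_unique) auto
qed

abbreviation "cox \<equiv> index_list :: 'i list"

lemma coxeter_weyl: "coxeter_element A \<in> weyl_group A" "inv_into UNIV (coxeter_element A) \<in> weyl_group A"
  and weyl_bar_coxeter: "weyl_bar A \<phi> (coxeter_element A) = mat_prod (map S cox)"
    "weyl_bar A \<phi> (inv_into UNIV (coxeter_element A)) = mat_prod (map S (rev cox))"
proof -
  show c: "coxeter_element A \<in> weyl_group A" by (simp add: weyl_group_def coxeter_element_def)
  have inv: "inv_into UNIV (coxeter_element A) = word_action A (rev cox)"
    by (rule inv_equality) (simp_all add: coxeter_element_def)
  show c': "inv_into UNIV (coxeter_element A) \<in> weyl_group A" by (simp add: inv weyl_group_def)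
  show "weyl_bar A \<phi> (coxeter_element A) = mat_prod (map S cox)"
    by (rule weyl_bar_word[OF c]) (simp add: coxeter_element_def reduced_coxeter_bar index_list_props)
  show "weyl_bar A \<phi> (inv_into UNIV (coxeter_element A)) = mat_prod (map S (rev cox))"
    by (rule weyl_bar_word[OF c']) (simp add: inv reduced_coxeter_bar index_list_props)
qed

lemma weyl_group_comp: "u \<in> weyl_group A \<Longrightarrow> v \<in> weyl_group A \<Longrightarrow> u \<circ> v \<in> weyl_group A"
proof -
  assume "u \<in> weyl_group A" "v \<in> weyl_group A"
  then obtain us vs where "u = word_action A us" "v = word_action A vs" unfolding weyl_group_def by blast
  then have "u \<circ> v = word_action A (us @ vs)" by (simp add: fun_eq_iff word_action_append)
  then show ?thesis unfolding weyl_group_def by blast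
qed

lemma coxeter_power_weyl: "coxeter_element A ^^ m \<in> weyl_group A"
proof (induction m)
  case 0 then show ?case using id_weyl by (simp only: funpow.simps)
next
  case (Suc m) then show ?case using weyl_group_comp[OF coxeter_weyl(1)] by (simp only: funpow.simps)
qed

section \<open>Factorizations along the Coxeter word\<close>

definition x_prod :: "'i list \<Rightarrow> ('i \<Rightarrow> complex) \<Rightarrow> complex^'m^'m" where
  "x_prod us t = mat_prod (map (\<lambda>i. X i (t i)) us)"

definition y_prod :: "'i list \<Rightarrow> ('i \<Rightarrow> complex) \<Rightarrow> complex^'m^'m" where
  "y_prod us t = mat_prod (map (\<lambda>i. Y i (t i)) us)"

definition xs_prod :: "'i list \<Rightarrow> ('i \<Rightarrow> complex) \<Rightarrow> complex^'m^'m" where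
  "xs_prod us r = mat_prod (map (\<lambda>i. X i (r i) ** S i) us)"

definition sx_prod :: "'i list \<Rightarrow> ('i \<Rightarrow> complex) \<Rightarrow> complex^'m^'m" where
  "sx_prod us r = mat_prod (map (\<lambda>i. S i ** X i (r i)) us)"

definition bar :: "'i list \<Rightarrow> complex^'m^'m" where
  "bar us = mat_prod (map S us)"

lemma prod_simps [simp]:
  "x_prod [] t = mat 1" "x_prod (u # us) t = X u (t u) ** x_prod us t" "x_prod (us @ vs) t = x_prod us t ** x_prod vs t"
  "y_prod [] t = mat 1" "y_prod (u # us) t = Y u (t u) ** y_prod us t" "y_prod (us @ vs) t = y_prod us t ** y_prod vs t"
  "xs_prod [] t = mat 1" "xs_prod (u # us) t = X u (t u) ** S u ** xs_prod us t" "xs_prod (us @ vs) t = xs_prod us t ** xs_prod vs t"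
  "sx_prod [] t = mat 1" "sx_prod (u # us) t = S u ** X u (t u) ** sx_prod us t" "sx_prod (us @ vs) t = sx_prod us t ** sx_prod vs t"
  "bar [] = mat 1" "bar (u # us) = S u ** bar us" "bar (us @ vs) = bar us ** bar vs"
  by (simp_all add: x_prod_def y_prod_def xs_prod_def sx_prod_def bar_def)

lemma prod_cong:
  assumes "\<And>i. i \<in> set us \<Longrightarrow> t i = t' i"
  shows "x_prod us t = x_prod us t'" "y_prod us t = y_prod us t'" "xs_prod us t = xs_prod us t'" "sx_prod us t = sx_prod us t'"
  using assms by (induction us) auto

lemma x_prod_N [simp, intro]: "x_prod us t \<in> N" and y_prod_N' [simp, intro]: "y_prod us t \<in> N'"
  by (induction us) (auto intro: N_mult N'_mult)

lemma bar_invertible [simp]: "invertible (bar us)"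
  unfolding bar_def by (rule invertible_mat_prod) auto

lemma bar_matrix_inv: "matrix_inv (bar us) = mat_prod (map S' (rev us))"
  by (induction us) (simp_all add: matrix_inv_mult)

lemma torus_x_prod: "\<forall>i. a i \<noteq> 0 \<Longrightarrow> T a ** x_prod us t = x_prod us (\<lambda>i. char a (simple_root A i) * t i) ** T a"
proof (induction us)
  case (Cons u us)
  have "T a ** x_prod (u # us) t = (T a ** X u (t u)) ** x_prod us t" by (simp add: matrix_mul_assoc)
  also have "\<dots> = X u (char a (simple_root A u) * t u) ** (T a ** x_prod us t)"
    using Cons.prems by (simp add: torus_x matrix_mul_assoc)
  finally show ?case using Cons by (simp add: matrix_mul_assoc)
qed simp

lemma torus_y_prod: "\<forall>i. a i \<noteq> 0 \<Longrightarrow> T a ** y_prod us t = y_prod us (\<lambda>i. inverse (char a (simple_root A i)) * t i) ** T a"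
proof (induction us)
  case (Cons u us)
  have "T a ** y_prod (u # us) t = (T a ** Y u (t u)) ** y_prod us t" by (simp add: matrix_mul_assoc)
  also have "\<dots> = Y u (inverse (char a (simple_root A u)) * t u) ** (T a ** y_prod us t)"
    using Cons.prems by (simp add: torus_x matrix_mul_assoc)
  finally show ?case using Cons by (simp add: matrix_mul_assoc)
qed simp

lemma char_coroot: "char ((\<lambda>_. 1)(k := s)) \<gamma> = s powi (\<gamma> $ k)"
proof -
  have "char ((\<lambda>_. 1)(k := s)) \<gamma> = (\<Prod>i\<in>UNIV. if i = k then s powi (\<gamma> $ k) else 1)"
    unfolding char_def by (intro prod.cong) auto
  then show ?thesis by simp
qed

lemma coroot_x_prod: "s \<noteq> 0 \<Longrightarrow> K k s ** x_prod us t = x_prod us (\<lambda>i. s powi (A$k$i) * t i) ** K k s"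
  using torus_x_prod[of "(\<lambda>_. 1)(k := s)" us t] by (simp add: coroot_torus char_coroot) (simp add: simple_root_def)

lemma coroot_y_prod: "s \<noteq> 0 \<Longrightarrow> K k s ** y_prod us t = y_prod us (\<lambda>i. s powi (- (A$k$i)) * t i) ** K k s"
  using torus_y_prod[of "(\<lambda>_. 1)(k := s)" us t] by (simp add: coroot_torus char_coroot) (simp add: simple_root_def power_int_minus)

lemma x_pos_y_prod: "k \<notin> set us \<Longrightarrow> X k s ** y_prod us t = y_prod us t ** X k s"
proof (induction us)
  case (Cons u us)
  have "X k s ** y_prod (u # us) t = (X k s ** Y u (t u)) ** y_prod us t" by (simp add: matrix_mul_assoc)
  also have "\<dots> = Y u (t u) ** (X k s ** y_prod us t)"
    using Cons.prems by (simp add: x_pos_neg_commute matrix_mul_assoc)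
  also have "X k s ** y_prod us t = y_prod us t ** X k s" using Cons by simp
  finally show ?case by (simp add: matrix_mul_assoc)
qed simp

lemma y_pos_x_prod: "k \<notin> set us \<Longrightarrow> x_prod us t ** Y k s = Y k s ** x_prod us t"
proof (induction us)
  case (Cons u us)
  have "x_prod (u # us) t ** Y k s = X u (t u) ** (x_prod us t ** Y k s)" by (simp add: matrix_mul_assoc)
  also have "\<dots> = (X u (t u) ** Y k s) ** x_prod us t"
    using Cons by (simp add: matrix_mul_assoc)
  also have "X u (t u) ** Y k s = Y k s ** X u (t u)" using Cons.prems by (intro x_pos_neg_commute) auto
  finally show ?case by (simp add: matrix_mul_assoc)
qed simp

lemma Nrad_s: "m \<in> Nrad i \<Longrightarrow> \<exists>m'\<in>Nrad i. m ** S i = S i ** m'" "m \<in> Nrad i \<Longrightarrow> \<exists>m'\<in>Nrad i. S i ** m = m' ** S i"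
proof -
  assume m: "m \<in> Nrad i"
  show "\<exists>m'\<in>Nrad i. m ** S i = S i ** m'"
    using Nrad_conj_gens(4)[OF m] by (intro bexI[of _ "Ad (S' i) m"]) (simp_all add: Ad_def matrix_mul_assoc)
  show "\<exists>m'\<in>Nrad i. S i ** m = m' ** S i"
    using Nrad_conj_gens(3)[OF m] by (intro bexI[of _ "Ad (S i) m"]) (simp_all add: Ad_def matrix_mul_assoc')
qed

lemma Nrad_coroot: "m \<in> Nrad i \<Longrightarrow> s \<noteq> 0 \<Longrightarrow> \<exists>m'\<in>Nrad i. m ** K i s = K i s ** m'"
proof -
  assume m: "m \<in> Nrad i" and s: "s \<noteq> 0"
  have "matrix_inv (K i s) = K i (inverse s)" using s by (intro matrix_inv_eqI coroot_inverse)
  moreover have "Ad (K i (inverse s)) m \<in> Nrad i"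
    unfolding coroot_def by (rule Nrad_conj) (use s m in auto)
  moreover have "matrix_inv (K i (inverse s)) = K i s" using s by (intro matrix_inv_eqI coroot_inverse)
  ultimately show ?thesis using s
    by (intro bexI[of _ "Ad (K i (inverse s)) m"]) (simp_all add: Ad_def matrix_mul_assoc coroot_inverse)
qed

text \<open>Split \<open>n\<close> as \<open>X u r0\<close> times an element of
  \<open>Nrad u\<close>. The latter passes through \<open>S u\<close> and is the input for the next
  letter.\<close>

lemma N_bar_factor:
  assumes "distinct us" "n \<in> N" shows "\<exists>r n'. n' \<in> N \<and> n ** bar us = xs_prod us r ** n'"
  using assms
proof (induction us arbitrary: n)
  case Nil then show ?case by auto
next
  case (Cons u us)
  obtain r0 m where n: "n = X u r0 ** m" "m \<in> Nrad u" using N_decompose[OF Cons.prems(2)] by blast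
  obtain m' where m': "m' \<in> Nrad u" "m ** S u = S u ** m'" using Nrad_s(1)[OF n(2)] by blast
  obtain r n' where IH: "n' \<in> N" "m' ** bar us = xs_prod us r ** n'"
    using Cons.IH[of m'] Cons.prems(1) Nrad_N[OF m'(1)] by auto
  have "n ** bar (u # us) = X u r0 ** (m ** S u) ** bar us" by (simp add: n matrix_mul_assoc)
  also have "\<dots> = X u r0 ** S u ** (m' ** bar us)" by (simp add: m' matrix_mul_assoc)
  also have "\<dots> = X u r0 ** S u ** xs_prod us r ** n'" by (simp add: IH matrix_mul_assoc)
  also have "xs_prod us r = xs_prod us (r(u := r0))" using Cons.prems(1) by (intro prod_cong) auto
  finally show ?case using IH(1) by (intro exI[of _ "r(u := r0)"] exI[of _ n'] conjI)
      (simp_all only: prod_simps fun_upd_same matrix_mul_assoc matrix_mul_rid)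
qed

lemma bar_N_factor:
  assumes "distinct us" "n \<in> N" shows "\<exists>r n'. n' \<in> N \<and> bar us ** n = n' ** sx_prod us r"
  using assms
proof (induction us arbitrary: n rule: rev_induct)
  case Nil then show ?case by auto
next
  case (snoc u us)
  obtain r0 m where n: "n = m ** X u r0" "m \<in> Nrad u" using N_decompose'[OF snoc.prems(2)] by blast
  obtain m' where m': "m' \<in> Nrad u" "S u ** m = m' ** S u" using Nrad_s(2)[OF n(2)] by blast
  obtain r n' where IH: "n' \<in> N" "bar us ** m' = n' ** sx_prod us r"
    using snoc.IH[of m'] snoc.prems(1) Nrad_N[OF m'(1)] by auto
  have "bar (us @ [u]) ** n = bar us ** (S u ** m) ** X u r0" by (simp add: n matrix_mul_assoc)
  also have "\<dots> = (bar us ** m') ** S u ** X u r0" by (simp add: m' matrix_mul_assoc)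
  also have "\<dots> = n' ** (sx_prod us r ** (S u ** X u r0))" by (simp add: IH matrix_mul_assoc)
  also have "sx_prod us r = sx_prod us (r(u := r0))" using snoc.prems(1) by (intro prod_cong) auto
  finally show ?case using IH(1) by (intro exI[of _ "r(u := r0)"] exI[of _ n'] conjI)
      (simp_all only: prod_simps fun_upd_same matrix_mul_assoc matrix_mul_rid)
qed

lemma Ad_bar_x: "distinct us \<Longrightarrow> i \<notin> set us \<Longrightarrow> Ad (bar us) (X i t) \<in> N"
  unfolding bar_def by (rule word_conj_in_N) auto

lemma Ad_bar_inv_x: "distinct us \<Longrightarrow> i \<notin> set us \<Longrightarrow> Ad (matrix_inv (bar us)) (X i t) \<in> N"
  unfolding bar_matrix_inv by (rule word_conj_in_N) auto

lemma bar_x: "distinct us \<Longrightarrow> i \<notin> set us \<Longrightarrow> \<exists>n\<in>N. bar us ** X i t = n ** bar us"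
  using Ad_bar_x[of us i t] by (intro bexI[of _ "Ad (bar us) (X i t)"]) (simp_all add: Ad_def matrix_mul_assoc')

lemma x_bar: "distinct us \<Longrightarrow> i \<notin> set us \<Longrightarrow> \<exists>n\<in>N. X i t ** bar us = bar us ** n"
  using Ad_bar_inv_x[of us i t] by (intro bexI[of _ "Ad (matrix_inv (bar us)) (X i t)"]) (simp_all add: Ad_def matrix_mul_assoc)

lemma xs_prod_bar: "distinct us \<Longrightarrow> \<exists>n\<in>N. xs_prod us r = n ** bar us"
proof (induction us rule: rev_induct)
  case Nil then show ?case by auto
next
  case (snoc u us)
  then obtain n where n: "n \<in> N" "xs_prod us r = n ** bar us" by auto
  obtain n1 where n1: "n1 \<in> N" "bar us ** X u (r u) = n1 ** bar us" using bar_x[of us u "r u"] snoc.prems by auto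
  have "xs_prod (us @ [u]) r = n ** (bar us ** X u (r u)) ** S u" by (simp add: n matrix_mul_assoc)
  also have "\<dots> = (n ** n1) ** bar (us @ [u])" by (simp add: n1 matrix_mul_assoc)
  finally show ?case using n n1 by (intro bexI[of _ "n ** n1"]) (simp_all add: N_mult)
qed

text \<open>Each \<open>X k (r k) ** S k\<close> splits as a lower, a torus and an upper factor. The
  upper one commutes with the lower factors of the later letters, and the torus factor rescales
  those of index \<open>i\<close> by the power \<open>- (A$k$i)\<close> of \<open>r k\<close>. This
  is why the arguments involve the \<open>k < i\<close>.\<close>

lemma xs_prod_gauss:
  assumes "sorted_wrt (<) us" "\<forall>i. r i \<noteq> 0"
  shows "\<exists>n\<in>N. xs_prod us r =
    y_prod us (\<lambda>i. inverse (r i) * (\<Prod>k\<in>{k \<in> set us. k < i}. r k powi (- (A$k$i)))) **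
    T (\<lambda>i. if i \<in> set us then r i else 1) ** n"
  using assms
proof (induction us)
  case Nil then show ?case by (intro bexI[of _ "mat 1"]) auto
next
  case (Cons k us)
  let ?q = "\<lambda>us i. inverse (r i) * (\<Prod>k\<in>{k \<in> set us. k < i}. r k powi (- (A$k$i)))"
  let ?T = "\<lambda>us. T (\<lambda>i. if i \<in> set us then r i else 1)"
  obtain n where n: "n \<in> N" "xs_prod us r = y_prod us (?q us) ** ?T us ** n"
    using Cons by auto
  have k: "k \<notin> set us" and less: "\<And>j. j \<in> set us \<Longrightarrow> k < j" using Cons.prems(1) by auto
  have r: "r k \<noteq> 0" using Cons.prems(2) by blast
  have Tnz: "\<forall>i. (if i \<in> set us then r i else 1) \<noteq> 0" using Cons.prems(2) by auto
  obtain n2 where n2: "n2 \<in> N" "X k (- inverse (r k)) ** ?T us = ?T us ** n2"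
    using N_H[OF torus_in_H[OF Tnz] x_in_N] by blast
  have "xs_prod (k # us) r = Y k (inverse (r k)) ** K k (r k) ** (X k (- inverse (r k)) ** y_prod us (?q us)) ** ?T us ** n"
    using r by (simp add: x_pos_s_bar n matrix_mul_assoc)
  also have "\<dots> = Y k (inverse (r k)) ** (K k (r k) ** y_prod us (?q us)) ** (X k (- inverse (r k)) ** ?T us) ** n"
    using k by (simp add: x_pos_y_prod matrix_mul_assoc)
  also have "\<dots> = Y k (inverse (r k)) ** y_prod us (\<lambda>i. r k powi (- (A$k$i)) * ?q us i) ** (K k (r k) ** ?T us) ** (n2 ** n)"
    using r by (simp add: coroot_y_prod n2 matrix_mul_assoc)
  also have "K k (r k) ** ?T us = ?T (k # us)"
  proof -
    have "K k (r k) ** ?T us = T (\<lambda>i. ((\<lambda>_. 1)(k := r k)) i * (if i \<in> set us then r i else 1))"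
      unfolding coroot_torus[OF r] using r Tnz by (intro torus_mult) auto
    also have "(\<lambda>i. ((\<lambda>_. 1)(k := r k)) i * (if i \<in> set us then r i else 1)) = (\<lambda>i. if i \<in> set (k # us) then r i else 1)"
      using k by (auto simp: fun_eq_iff)
    finally show ?thesis .
  qed
  also have "y_prod us (\<lambda>i. r k powi (- (A$k$i)) * ?q us i) = y_prod us (?q (k # us))"
  proof (rule prod_cong)
    fix i assume i: "i \<in> set us"
    have "{j \<in> set (k # us). j < i} = insert k {j \<in> set us. j < i}" using less[OF i] by auto
    then show "r k powi (- (A$k$i)) * ?q us i = ?q (k # us) i" using k by simp
  qed
  also have "Y k (inverse (r k)) = Y k (?q (k # us) k)"
  proof -
    have "{j \<in> set (k # us). j < k} = {}" using less by (auto dest: less_asym)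
    then show ?thesis by (simp only: prod.empty mult_1_right)
  qed
  finally show ?case using n n2 by (intro bexI[of _ "n2 ** n"]) (simp_all add: N_mult)
qed

text \<open>The mirror image, with explicit torus part. Applied to \<open>flip \<phi>\<close>, the
  non-vanishing \<open>q\<close> become the coordinates \<open>t\<close> of
  \<open>cell_generic_point\<close>.\<close>

lemma sx_prod_gauss:
  assumes "distinct us" "\<forall>i. r i \<noteq> 0"
  shows "\<exists>n q. n \<in> N \<and> (\<forall>i. q i \<noteq> 0) \<and> sx_prod us r = n ** T (\<lambda>i. if i \<in> set us then inverse (r i) else 1) ** y_prod us q"
  using assms
proof (induction us rule: rev_induct)
  case Nil then show ?case by (intro exI[of _ "mat 1"] exI[of _ "\<lambda>_. 1"]) auto
next
  case (snoc k us)
  let ?T = "\<lambda>us. T (\<lambda>i. if i \<in> set us then inverse (r i) else 1)"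
  obtain n q where n: "n \<in> N" "\<forall>i. q i \<noteq> 0" "sx_prod us r = n ** ?T us ** y_prod us q"
    using snoc by auto
  have k: "k \<notin> set us" using snoc.prems(1) by auto
  have r: "r k \<noteq> 0" "inverse (r k) \<noteq> 0" using snoc.prems(2) by auto
  have Tnz: "\<forall>i. (if i \<in> set us then inverse (r i) else 1) \<noteq> 0" using snoc.prems(2) by auto
  obtain n2 where n2: "n2 \<in> N" "?T us ** X k (- inverse (r k)) = n2 ** ?T us"
    using H_N[OF torus_in_H[OF Tnz] x_in_N] by blast
  define q' where "q' i = (inverse (r k)) powi (A$k$i) * q i" for i
  have q': "\<forall>i. q' i \<noteq> 0" using r n(2) by (simp add: q'_def)
  have "K k (inverse (r k)) ** y_prod us q' = y_prod us q ** K k (inverse (r k))"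
    using r by (simp add: coroot_y_prod q'_def mult.assoc[symmetric] power_int_add[symmetric])
  then have Ky: "y_prod us q ** K k (inverse (r k)) = K k (inverse (r k)) ** y_prod us q'" by simp
  have "sx_prod (us @ [k]) r = n ** ?T us ** (y_prod us q ** X k (- inverse (r k))) ** K k (inverse (r k)) ** Y k (inverse (r k))"
    using r by (simp add: s_bar_x_pos n matrix_mul_assoc)
  also have "y_prod us q ** X k (- inverse (r k)) = X k (- inverse (r k)) ** y_prod us q"
    using k by (simp add: x_pos_y_prod)
  also have "n ** ?T us ** (X k (- inverse (r k)) ** y_prod us q) ** K k (inverse (r k)) ** Y k (inverse (r k))
     = n ** (?T us ** X k (- inverse (r k))) ** (y_prod us q ** K k (inverse (r k))) ** Y k (inverse (r k))"
    by (simp add: matrix_mul_assoc)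
  also have "\<dots> = (n ** n2) ** (?T us ** K k (inverse (r k))) ** (y_prod us q' ** Y k (inverse (r k)))"
    by (simp add: n2 Ky matrix_mul_assoc)
  also have "?T us ** K k (inverse (r k)) = ?T (us @ [k])"
  proof -
    have "?T us ** K k (inverse (r k)) = T (\<lambda>i. (if i \<in> set us then inverse (r i) else 1) * ((\<lambda>_. 1)(k := inverse (r k))) i)"
      unfolding coroot_torus[OF r(2)] using r Tnz by (intro torus_mult) auto
    also have "(\<lambda>i. (if i \<in> set us then inverse (r i) else 1) * ((\<lambda>_. 1)(k := inverse (r k))) i) =
      (\<lambda>i. if i \<in> set (us @ [k]) then inverse (r i) else 1)"
      using k by (auto simp: fun_eq_iff)
    finally show ?thesis .
  qed
  also have "y_prod us q' ** Y k (inverse (r k)) = y_prod (us @ [k]) (q'(k := inverse (r k)))"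
  proof -
    have "y_prod us q' = y_prod us (q'(k := inverse (r k)))" using k by (intro prod_cong) auto
    then show ?thesis by (simp only: prod_simps fun_upd_same matrix_mul_rid)
  qed
  finally have "sx_prod (us @ [k]) r = (n ** n2) ** ?T (us @ [k]) ** y_prod (us @ [k]) (q'(k := inverse (r k)))" .
  moreover have "\<forall>i. (q'(k := inverse (r k))) i \<noteq> 0" using q' r by simp
  ultimately show ?case using N_mult[OF n(1) n2(1)] by blast
qed

lemma s_H:
  assumes "h \<in> H" "g = S i \<or> g = S' i" shows "\<exists>h'\<in>H. g ** h = h' ** g"
proof -
  obtain t where t: "h = T t" "\<forall>i. t i \<noteq> 0" using assms(1) by (rule H_cases)
  obtain g' where g': "g' = S i \<or> g' = S' i" "g ** g' = mat 1" "g' ** g = mat 1" using assms(2) by force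
  obtain t' where t': "\<forall>i. t' i \<noteq> 0" "T t ** g' = g' ** T t'"
    using torus_word[of "[i]" "\<lambda>_. g'" t] g'(1) t(2) by auto
  have "g ** h = g ** (T t ** g') ** g" using g' t by (simp add: matrix_mul_assoc')
  also have "\<dots> = (g ** g') ** T t' ** g" by (simp only: t'(2) matrix_mul_assoc)
  finally show ?thesis using g' t' by (intro bexI[of _ "T t'"]) (simp_all add: torus_in_H)
qed

lemma bar_H: "h \<in> H \<Longrightarrow> \<exists>h'\<in>H. bar us ** h = h' ** bar us"
proof (induction us arbitrary: h rule: rev_induct)
  case (snoc u us)
  obtain h1 where h1: "h1 \<in> H" "S u ** h = h1 ** S u" using s_H[OF snoc.prems] by blast
  obtain h2 where h2: "h2 \<in> H" "bar us ** h1 = h2 ** bar us" using snoc.IH[OF h1(1)] by blast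
  have "bar (us @ [u]) ** h = bar us ** (S u ** h)" by (simp add: matrix_mul_assoc)
  also have "\<dots> = (bar us ** h1) ** S u" by (simp add: h1 matrix_mul_assoc)
  also have "\<dots> = h2 ** bar (us @ [u])" by (simp add: h2 matrix_mul_assoc)
  finally show ?case using h2(1) by blast
qed auto

lemma H_bar: "h \<in> H \<Longrightarrow> \<exists>h'\<in>H. h ** bar us = bar us ** h'"
proof -
  assume "h \<in> H"
  then obtain t where t: "h = T t" "\<forall>i. t i \<noteq> 0" by (rule H_cases)
  then show ?thesis using torus_word[of us S t] unfolding bar_def by (auto intro: torus_in_H)
qed

text \<open>A lower factor with non-zero argument lies in the big cell of its \<open>SL2\<close>.
  Applied to \<open>flip \<phi>\<close>, this puts \<open>cell_point r t\<close> into the double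
  coset of the lower Borel subgroup.\<close>

lemma y_prod_bruhat:
  assumes "distinct us" "\<forall>i. q i \<noteq> 0"
  shows "\<exists>n\<in>N. \<exists>h\<in>H. \<exists>n'\<in>N. y_prod us q = n ** h ** bar us ** n'"
  using assms
proof (induction us rule: rev_induct)
  case Nil then show ?case by (intro bexI[of _ "mat 1"]) (auto simp: H_one)
next
  case (snoc u us)
  then obtain n h n' where IH: "n \<in> N" "h \<in> H" "n' \<in> N" "y_prod us q = n ** h ** bar us ** n'" by auto
  let ?c = "inverse (q u)"
  have c: "?c \<noteq> 0" "q u \<noteq> 0" using snoc.prems(2) by auto
  obtain r m where m: "n' ** X u ?c = X u r ** m" "m \<in> Nrad u"
    using N_decompose[OF N_mult[OF IH(3) x_in_N]] by blast
  obtain m1 where m1: "m1 \<in> Nrad u" "m ** K u ?c = K u ?c ** m1" using Nrad_coroot[OF m(2) c(1)] by blast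
  obtain m2 where m2: "m2 \<in> Nrad u" "m1 ** S u = S u ** m2" using Nrad_s(1)[OF m1(1)] by blast
  obtain n1 where n1: "n1 \<in> N" "bar us ** X u r = n1 ** bar us" using bar_x[of us u r] snoc.prems(1) by auto
  obtain h1 where h1: "h1 \<in> H" "bar us ** K u ?c = h1 ** bar us" using bar_H[OF coroot_in_H[OF c(1)]] by blast
  obtain n2 where n2: "n2 \<in> N" "h ** n1 = n2 ** h" using H_N[OF IH(2) n1(1)] by blast
  have "y_prod (us @ [u]) q = n ** h ** bar us ** (n' ** X u ?c) ** K u ?c ** S u ** X u ?c"
    using c by (simp add: IH x_neg_bruhat matrix_mul_assoc)
  also have "\<dots> = n ** h ** (bar us ** X u r) ** (m ** K u ?c) ** S u ** X u ?c" by (simp add: m matrix_mul_assoc)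
  also have "\<dots> = n ** (h ** n1) ** (bar us ** K u ?c) ** (m1 ** S u) ** X u ?c" by (simp add: n1 m1 matrix_mul_assoc)
  also have "\<dots> = (n ** n2) ** (h ** h1) ** bar (us @ [u]) ** (m2 ** X u ?c)" by (simp add: n2 h1 m2 matrix_mul_assoc)
  finally have *: "y_prod (us @ [u]) q = (n ** n2) ** (h ** h1) ** bar (us @ [u]) ** (m2 ** X u ?c)" .
  show ?case
  proof (intro bexI)
    show "y_prod (us @ [u]) q = (n ** n2) ** (h ** h1) ** bar (us @ [u]) ** (m2 ** X u ?c)" by (rule *)
  qed (use IH n2 h1 m2 in \<open>auto intro: N_mult H_mult Nrad_N\<close>)
qed

text \<open>The arguments are chosen so that the torus part comes out as \<open>\<tau>\<close>. In
  \<open>X k (\<tau> k) ** S k\<close> the torus factor \<open>K k (\<tau> k)\<close> splits off,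
  and moving it left across the remaining \<open>X j\<close> accounts for the power
  \<open>A$k$j\<close> of \<open>\<tau> k\<close>.\<close>

lemma x_prod_bar_gauss:
  assumes "sorted_wrt (<) us" "\<forall>i. \<tau> i \<noteq> 0"
  shows "\<exists>n'\<in>N'. \<exists>n\<in>N. x_prod (rev us) (\<lambda>j. \<tau> j * (\<Prod>i\<in>{i \<in> set us. i < j}. \<tau> i powi (A$i$j))) ** bar us =
    n' ** T (\<lambda>i. if i \<in> set us then \<tau> i else 1) ** n"
  using assms
proof (induction us)
  case Nil then show ?case by (intro bexI[of _ "mat 1"]) auto
next
  case (Cons k us)
  let ?t = "\<lambda>us j. \<tau> j * (\<Prod>i\<in>{i \<in> set us. i < j}. \<tau> i powi (A$i$j))"
  let ?T = "\<lambda>us. T (\<lambda>i. if i \<in> set us then \<tau> i else 1)"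
  obtain n' n where n: "n' \<in> N'" "n \<in> N" "x_prod (rev us) (?t us) ** bar us = n' ** ?T us ** n"
    using Cons by auto
  have k: "k \<notin> set us" "distinct us" and less: "\<And>j. j \<in> set us \<Longrightarrow> k < j"
    using Cons.prems(1) strict_sorted_iff by auto
  have r: "\<tau> k \<noteq> 0" using Cons.prems(2) by blast
  have Tnz: "\<forall>i. (if i \<in> set us then \<tau> i else 1) \<noteq> 0" using Cons.prems(2) by auto
  obtain n2 where n2: "n2 \<in> N" "X k (- inverse (\<tau> k)) ** bar us = bar us ** n2"
    using x_bar[OF k(2,1)] by blast
  have "{j \<in> set (k # us). j < k} = {}" using less by (auto dest: less_asym)
  then have tk: "?t (k # us) k = \<tau> k" by (simp only: prod.empty mult_1_right)
  have shift: "x_prod (rev us) (?t (k # us)) ** K k (\<tau> k) = K k (\<tau> k) ** x_prod (rev us) (?t us)"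
  proof -
    have "x_prod (rev us) (?t (k # us)) = x_prod (rev us) (\<lambda>j. \<tau> k powi (A$k$j) * ?t us j)"
    proof (rule prod_cong)
      fix j assume "j \<in> set (rev us)"
      then have "{i \<in> set (k # us). i < j} = insert k {i \<in> set us. i < j}" using less[of j] by auto
      then show "?t (k # us) j = \<tau> k powi (A$k$j) * ?t us j" using k by simp
    qed
    then show ?thesis using r by (simp only: coroot_x_prod not_False_eq_True)
  qed
  have "x_prod (rev (k # us)) (?t (k # us)) ** bar (k # us) =
    x_prod (rev us) (?t (k # us)) ** (X k (?t (k # us) k) ** S k) ** bar us" by (simp add: matrix_mul_assoc)
  also have "\<dots> = (x_prod (rev us) (?t (k # us)) ** Y k (inverse (\<tau> k))) ** K k (\<tau> k) ** (X k (- inverse (\<tau> k)) ** bar us)"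
    unfolding tk x_pos_s_bar[OF r] by (simp only: matrix_mul_assoc)
  also have "x_prod (rev us) (?t (k # us)) ** Y k (inverse (\<tau> k)) = Y k (inverse (\<tau> k)) ** x_prod (rev us) (?t (k # us))"
    by (rule y_pos_x_prod) (use k in simp)
  also have "Y k (inverse (\<tau> k)) ** x_prod (rev us) (?t (k # us)) ** K k (\<tau> k) ** (X k (- inverse (\<tau> k)) ** bar us)
    = Y k (inverse (\<tau> k)) ** (x_prod (rev us) (?t (k # us)) ** K k (\<tau> k)) ** bar us ** n2"
    by (simp only: n2 matrix_mul_assoc)
  also have "\<dots> = Y k (inverse (\<tau> k)) ** K k (\<tau> k) ** (x_prod (rev us) (?t us) ** bar us) ** n2"
    by (simp only: shift matrix_mul_assoc)
  also have "\<dots> = Y k (inverse (\<tau> k)) ** (K k (\<tau> k) ** n') ** ?T us ** n ** n2"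
    by (simp only: n matrix_mul_assoc)
  finally have *: "x_prod (rev (k # us)) (?t (k # us)) ** bar (k # us) = Y k (inverse (\<tau> k)) ** (K k (\<tau> k) ** n') ** ?T us ** n ** n2" .
  obtain n3 where n3: "n3 \<in> N'" "K k (\<tau> k) ** n' = n3 ** K k (\<tau> k)" using H_N'[OF coroot_in_H[OF r] n(1)] by blast
  have TT: "K k (\<tau> k) ** ?T us = ?T (k # us)"
  proof -
    have "K k (\<tau> k) ** ?T us = T (\<lambda>i. ((\<lambda>_. 1)(k := \<tau> k)) i * (if i \<in> set us then \<tau> i else 1))"
      unfolding coroot_torus[OF r] using r Tnz by (intro torus_mult) auto
    also have "(\<lambda>i. ((\<lambda>_. 1)(k := \<tau> k)) i * (if i \<in> set us then \<tau> i else 1)) = (\<lambda>i. if i \<in> set (k # us) then \<tau> i else 1)"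
      using k by (auto simp: fun_eq_iff)
    finally show ?thesis .
  qed
  have "x_prod (rev (k # us)) (?t (k # us)) ** bar (k # us) = (Y k (inverse (\<tau> k)) ** n3) ** (K k (\<tau> k) ** ?T us) ** (n ** n2)"
    unfolding * n3 by (simp only: matrix_mul_assoc)
  then have "x_prod (rev (k # us)) (?t (k # us)) ** bar (k # us) = (Y k (inverse (\<tau> k)) ** n3) ** ?T (k # us) ** (n ** n2)"
    unfolding TT .
  then show ?case using n n2 n3 by (intro bexI[of _ "Y k (inverse (\<tau> k)) ** n3"] bexI[of _ "n ** n2"]) (auto intro: N_mult N'_mult)
qed

end

section \<open>Coordinates on the reduced double cell\<close>

context minors
begin

lemma flip_bars: "s_bar (flip \<phi>) = S'" "chevalley.S' (flip \<phi>) = S"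
  using chevalley.S'_def[OF flip_chevalley] by (simp_all add: fun_eq_iff s_bar_def S'_def flip_mat22)

definition sy_prod :: "'i list \<Rightarrow> ('i \<Rightarrow> complex) \<Rightarrow> complex^'m^'m" where
  "sy_prod us r = mat_prod (map (\<lambda>i. S' i ** Y i (r i)) us)"

lemma flip_prods:
  "chevalley.x_prod (flip \<phi>) = y_prod" "chevalley.y_prod (flip \<phi>) = x_prod"
  "chevalley.sx_prod (flip \<phi>) = sy_prod" "chevalley.bar (flip \<phi>) us = mat_prod (map S' us)"
proof -
  interpret flip: chevalley A "flip \<phi>" by (rule flip_chevalley)
  show "flip.x_prod = y_prod" "flip.y_prod = x_prod" "flip.sx_prod = sy_prod" "flip.bar us = mat_prod (map S' us)"
    by (simp_all add: fun_eq_iff flip.x_prod_def flip.y_prod_def flip.sx_prod_def flip.bar_def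
        x_prod_def y_prod_def sy_prod_def flip_bars)
qed

lemma bar_flip_bar: "\<exists>h\<in>H. bar us = h ** mat_prod (map S' us)"
proof (induction us)
  case Nil then show ?case by (intro bexI[of _ "mat 1"]) (auto simp: H_one)
next
  case (Cons u us)
  then obtain h where h: "h \<in> H" "bar us = h ** mat_prod (map S' us)" by blast
  have S: "S u = K u (-1) ** S' u" using S'_eq_S(1)[of u] by (simp add: matrix_mul_assoc coroot_mult)
  obtain h' where h': "h' \<in> H" "S' u ** h = h' ** S' u" using s_H[OF h(1), of "S' u" u] by blast
  have "bar (u # us) = K u (-1) ** (S' u ** h) ** mat_prod (map S' us)" by (simp add: S h matrix_mul_assoc)
  also have "\<dots> = (K u (-1) ** h') ** mat_prod (map S' (u # us))" by (simp add: h' matrix_mul_assoc)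
  finally show ?case using h' by (intro bexI[of _ "K u (-1) ** h'"] H_mult coroot_in_H) auto
qed

lemma flip_bar_bar: "\<exists>h\<in>H. mat_prod (map S' us) = h ** bar us"
proof -
  obtain h where h: "h \<in> H" "bar us = h ** mat_prod (map S' us)" using bar_flip_bar by blast
  then have "matrix_inv h ** bar us = mat_prod (map S' us)" by (simp add: matrix_mul_assoc H_invertible)
  then show ?thesis using H_matrix_inv[OF h(1)] by metis
qed

lemma prods_in_G: "xs_prod us r \<in> G" "sy_prod us r \<in> G" "x_prod us t \<in> G" "y_prod us t \<in> G" "bar us \<in> G"
  unfolding xs_prod_def sy_prod_def x_prod_def y_prod_def bar_def
  by (induction us) (auto intro: G_mult G_one)

lemma f_shift_continuous:
  "continuous_on UNIV (\<lambda>e. f i (xs_prod us (\<lambda>k. r k + e)))" "continuous_on UNIV (\<lambda>e. f i (sy_prod us (\<lambda>k. r k + e)))"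
proof -
  have c: "continuous_on UNIV (\<lambda>e. f i (c e))" if "poly_curve c" "\<And>e. c e \<in> G" for c
    by (rule continuous_on_compose2[OF f_continuous poly_curve_continuous[OF that(1)]]) (use that(2) in auto)
  show "continuous_on UNIV (\<lambda>e. f i (xs_prod us (\<lambda>k. r k + e)))"
  proof (rule c)
    show "poly_curve (\<lambda>e. xs_prod us (\<lambda>k. r k + e))"
      by (induction us) (simp_all add: x_pos_add[symmetric] poly_curve_mult poly_curve_const poly_curve_x)
  qed (rule prods_in_G)
  show "continuous_on UNIV (\<lambda>e. f i (sy_prod us (\<lambda>k. r k + e)))"
  proof (rule c)
    show "poly_curve (\<lambda>e. sy_prod us (\<lambda>k. r k + e))" unfolding sy_prod_def
      by (induction us) (simp_all add: x_neg_add[symmetric] poly_curve_mult poly_curve_const poly_curve_x)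
  qed (rule prods_in_G)
qed

text \<open>Shifting all entries of \<open>r\<close> by the same \<open>e\<close> makes them
  non-zero for all but finitely many \<open>e\<close>.\<close>

lemma generic_coordinate:
  fixes F :: "('i \<Rightarrow> complex) \<Rightarrow> complex"
  assumes "\<And>r. \<forall>i. r i \<noteq> 0 \<Longrightarrow> F r = r i" "continuous_on UNIV (\<lambda>e. F (\<lambda>k. r k + e))"
  shows "F r = r i"
proof -
  have "(\<lambda>e. F (\<lambda>k. r k + e)) = (\<lambda>e. r i + e)"
  proof (rule continuous_eq_off_finite[of _ _ "range (\<lambda>k. - r k)"])
    fix e assume "e \<notin> range (\<lambda>k. - r k)"
    then have "\<forall>k. r k + e \<noteq> 0" by (auto simp: add_eq_0_iff)
    then show "F (\<lambda>k. r k + e) = r i + e" using assms(1)[of "\<lambda>k. r k + e"] by simp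
  qed (use assms(2) in \<open>auto intro: continuous_intros\<close>)
  from fun_cong[OF this, of 0] show ?thesis by simp
qed

text \<open>The arguments of the lower factor found in \<open>xs_prod_gauss\<close>, for the full
  Coxeter word.\<close>

definition yq :: "('i \<Rightarrow> complex) \<Rightarrow> 'i \<Rightarrow> complex" where
  "yq r i = inverse (r i) * (\<Prod>k\<in>{..<i}. r k powi (- (A$k$i)))"

lemma xs_prod_cox:
  assumes "\<forall>i. r i \<noteq> 0" obtains n where "n \<in> N" "xs_prod cox r = y_prod cox (yq r) ** T r ** n"
proof -
  have "\<exists>n\<in>N. xs_prod cox r = y_prod cox (yq r) ** T r ** n"
    using xs_prod_gauss[OF index_list_props(3) assms]
    by (simp add: index_list_props yq_def[abs_def] lessThan_def)
  then show ?thesis using that by blast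
qed

lemma f_xs_prod: "n \<in> N \<Longrightarrow> f i (xs_prod cox r ** n) = r i"
proof -
  assume n: "n \<in> N"
  have "f i (xs_prod cox r) = r i"
  proof (rule generic_coordinate[where F = "\<lambda>r. f i (xs_prod cox r)"])
    fix r :: "'i \<Rightarrow> complex" assume r: "\<forall>i. r i \<noteq> 0"
    obtain n where "n \<in> N" "xs_prod cox r = y_prod cox (yq r) ** T r ** n" using xs_prod_cox[OF r] by blast
    then show "f i (xs_prod cox r) = r i" using r by (simp add: f_gauss)
  qed (rule f_shift_continuous)
  then show ?thesis using n by (simp add: f_N_right prods_in_G)
qed

lemma sy_prod_cox:
  assumes "\<forall>i. r i \<noteq> 0" obtains n' q where "n' \<in> N'" "\<forall>i. q i \<noteq> 0" "sy_prod (rev cox) r = n' ** T r ** x_prod (rev cox) q"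
proof -
  have d: "distinct (rev cox)" "set (rev cox) = UNIV" by (simp_all add: index_list_props)
  obtain n' q where n': "n' \<in> N'" "\<forall>i. q i \<noteq> 0" "sy_prod (rev cox) r = n' **
      torus_elem (flip \<phi>) (\<lambda>i. if i \<in> set (rev cox) then inverse (r i) else 1) ** x_prod (rev cox) q"
    using chevalley.sx_prod_gauss[OF flip_chevalley d(1) assms] unfolding flip_prods group_N_flip by blast
  moreover have "torus_elem (flip \<phi>) (\<lambda>i. if i \<in> set (rev cox) then inverse (r i) else 1) = T r"
    using assms unfolding d(2) by (simp add: torus_elem_flip)
  ultimately show ?thesis using that by simp
qed

lemma f_sy_prod: "f i (sy_prod (rev cox) r) = r i"
proof (rule generic_coordinate[where F = "\<lambda>r. f i (sy_prod (rev cox) r)"])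
  fix r :: "'i \<Rightarrow> complex" assume r: "\<forall>i. r i \<noteq> 0"
  obtain n' q where "n' \<in> N'" "sy_prod (rev cox) r = n' ** T r ** x_prod (rev cox) q"
    using sy_prod_cox[OF r] by blast
  then show "f i (sy_prod (rev cox) r) = r i" using r by (simp add: f_gauss)
qed (rule f_shift_continuous)

text \<open>The two inner letters combine to \<open>S' k ** Y k (r k) ** S k = X k (- r k)\<close>,
  which passes through the rest of the word into \<open>N\<close>. So \<open>f j\<close> is
  \<open>1\<close> on this product, and this makes the minors for \<open>fund_weight j\<close> and
  its Coxeter image vanish nowhere on the cell.\<close>

lemma sy_prod_bar_N: "distinct us \<Longrightarrow> sy_prod (rev us) r ** bar us \<in> N"
proof (induction us)
  case (Cons k us)
  obtain n where n: "n \<in> N" "X k (- r k) ** bar us = bar us ** n"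
    using x_bar[of us k] Cons.prems by auto
  have X: "S' k ** Y k (r k) ** S k = X k (- r k)"
    unfolding x_pos_def x_neg_def s_bar_def S'_def by (simp add: phi22_mult)
  have "sy_prod (rev (k # us)) r ** bar (k # us) = sy_prod (rev us) r ** (S' k ** Y k (r k) ** S k) ** bar us"
    by (simp add: sy_prod_def matrix_mul_assoc)
  also have "\<dots> = (sy_prod (rev us) r ** bar us) ** n" by (simp only: X n matrix_mul_assoc'[of _ "X k _"]) (simp only: matrix_mul_assoc)
  finally show ?case using Cons n by (simp add: N_mult)
qed (simp add: sy_prod_def)

abbreviation "L \<equiv> reduced_double_cell A \<phi>"

lemma cell_unfold: "L = {n1 ** bar cox ** n2 | n1 n2. n1 \<in> N \<and> n2 \<in> N} \<inter>
    {b1 ** bar (rev cox) ** b2 | b1 b2. b1 \<in> borel_minus \<phi> \<and> b2 \<in> borel_minus \<phi>}"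
  by (simp add: reduced_double_cell_def weyl_bar_coxeter bar_def)

lemma cell_positive:
  assumes "g \<in> L" obtains r n where "n \<in> N" "g = xs_prod cox r ** n"
proof -
  from assms obtain n1 n2 where n: "n1 \<in> N" "n2 \<in> N" "g = n1 ** bar cox ** n2" unfolding cell_unfold by blast
  obtain r n' where "n' \<in> N" "n1 ** bar cox = xs_prod cox r ** n'"
    using N_bar_factor[OF index_list_props(1) n(1)] by blast
  then show ?thesis using that[of "n' ** n2" r] n by (simp add: matrix_mul_assoc' N_mult)
qed

lemma cell_negative:
  assumes "g \<in> L" obtains n' h h2 r where "n' \<in> N'" "h \<in> H" "h2 \<in> H" "g = n' ** h ** sy_prod (rev cox) r ** h2"
proof -
  from assms obtain h1 n1 h2 n2 where b: "h1 \<in> H" "n1 \<in> N'" "h2 \<in> H" "n2 \<in> N'"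
    "g = (h1 ** n1) ** bar (rev cox) ** (h2 ** n2)" unfolding cell_unfold borel_minus_def by blast
  obtain n2' where n2': "n2' \<in> N'" "h2 ** n2 = n2' ** h2" using H_N'[OF b(3,4)] by blast
  obtain h where h: "h \<in> H" "bar (rev cox) = h ** mat_prod (map S' (rev cox))" using bar_flip_bar by blast
  have d: "distinct (rev cox)" by (simp add: index_list_props)
  obtain r n3 where n3: "n3 \<in> N'" "mat_prod (map S' (rev cox)) ** n2' = n3 ** sy_prod (rev cox) r"
    using chevalley.bar_N_factor[OF flip_chevalley d, of n2'] n2'(1) unfolding flip_prods group_N_flip by blast
  obtain n1' where n1': "n1' \<in> N'" "n1 ** h = h ** n1'" using N'_H[OF h(1) b(2)] by blast
  have "(h1 ** h) \<in> H" using b h by (simp add: H_mult)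
  then obtain n4 where n4: "n4 \<in> N'" "(h1 ** h) ** (n1' ** n3) = n4 ** (h1 ** h)"
    using H_N'[of "h1 ** h" "n1' ** n3"] n1' n3 N'_mult by blast
  have "g = h1 ** (n1 ** h) ** (mat_prod (map S' (rev cox)) ** n2') ** h2"
    unfolding b(5) h(2) n2'(2) by (simp only: matrix_mul_assoc)
  also have "\<dots> = ((h1 ** h) ** (n1' ** n3)) ** sy_prod (rev cox) r ** h2"
    unfolding n1'(2) n3(2) by (simp only: matrix_mul_assoc)
  also have "\<dots> = n4 ** (h1 ** h) ** sy_prod (rev cox) r ** h2" unfolding n4(2) ..
  finally show ?thesis using that[OF n4(1) \<open>h1 ** h \<in> H\<close> b(3)] by blast
qed

lemma cell_subset_G: "L \<subseteq> G"
proof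
  fix g assume "g \<in> L"
  then obtain r n where "n \<in> N" "g = xs_prod cox r ** n" using cell_positive by blast
  then show "g \<in> G" using N_subset_G by (auto intro: G_mult prods_in_G)
qed

lemma f_sandwich:
  assumes "n' \<in> N'" "\<forall>i. a i \<noteq> 0" "\<forall>i. b i \<noteq> 0" "x \<in> G"
  shows "f i (n' ** T a ** x ** T b) = a i * f i x * b i"
proof -
  have "n' ** T a ** x ** T b = n' ** (T a ** (x ** T b))" by (simp only: matrix_mul_assoc)
  then show ?thesis using assms
    by (simp add: f_N'_left f_torus_left f_torus_right torus_in_G G_mult)
qed

lemma minor_cox:
  assumes "g \<in> G"
  shows "\<Delta> (fund_weight j) (coxeter_element A (fund_weight j)) g = f j (g ** bar cox)"
  using minor_eq[OF id_weyl coxeter_weyl(1) assms, of j] by (simp add: weyl_bar_id weyl_bar_coxeter bar_def)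

lemma minor_cox_nonzero:
  assumes "g \<in> L" shows "\<Delta> (fund_weight j) (coxeter_element A (fund_weight j)) g \<noteq> 0"
proof -
  obtain n' h h2 r where g: "n' \<in> N'" "h \<in> H" "h2 \<in> H" "g = n' ** h ** sy_prod (rev cox) r ** h2"
    using cell_negative[OF assms] by blast
  obtain h3 where h3: "h3 \<in> H" "h2 ** bar cox = bar cox ** h3" using H_bar[OF g(3)] by blast
  obtain a b where ab: "h = T a" "\<forall>i. a i \<noteq> 0" "h3 = T b" "\<forall>i. b i \<noteq> 0" using g(2) h3(1) by (auto elim!: H_cases)
  have "g ** bar cox = n' ** T a ** (sy_prod (rev cox) r ** (h2 ** bar cox))" by (simp add: g ab matrix_mul_assoc)
  also have "\<dots> = n' ** T a ** (sy_prod (rev cox) r ** bar cox) ** T b" by (simp add: h3 ab matrix_mul_assoc)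
  finally have "f j (g ** bar cox) = a j * f j (sy_prod (rev cox) r ** bar cox) * b j"
    using f_sandwich[OF g(1) ab(2,4)] prods_in_G G_mult by simp
  also have "f j (sy_prod (rev cox) r ** bar cox) = 1"
    using f_N_right[OF sy_prod_bar_N[OF index_list_props(1)] G_one, of j r] f_one by simp
  finally show ?thesis using ab minor_cox[of g] cell_subset_G assms by auto
qed

text \<open>The lower factor depends on \<open>r\<close> alone. Of the parameters, \<open>r\<close>
  gives the values of the principal minors of the fundamental weights, and \<open>t\<close> is
  free.\<close>

definition cell_point :: "('i \<Rightarrow> complex) \<Rightarrow> ('i \<Rightarrow> complex) \<Rightarrow> complex^'m^'m" where
  "cell_point r t = y_prod cox (yq r) ** T r ** x_prod (rev cox) t"

lemma cell_point_in_G: "\<forall>i. r i \<noteq> 0 \<Longrightarrow> cell_point r t \<in> G"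
  unfolding cell_point_def by (intro G_mult prods_in_G torus_in_G)

lemma f_cell_point: "\<forall>i. r i \<noteq> 0 \<Longrightarrow> f i (cell_point r t) = r i"
  unfolding cell_point_def by (simp add: f_gauss)

lemma char_inverse: "char (\<lambda>i. inverse (a i)) \<gamma> = inverse (char a \<gamma>)"
  unfolding char_def by (simp add: power_int_inverse prod_inversef[symmetric])

lemma char_nonzero: "\<forall>i. a i \<noteq> 0 \<Longrightarrow> char a \<gamma> \<noteq> 0"
  unfolding char_def by simp

lemma x_prod_torus:
  assumes "\<forall>i. a i \<noteq> 0"
  shows "x_prod us t ** T a = T a ** x_prod us (\<lambda>i. inverse (char a (simple_root A i)) * t i)"
  using torus_x_prod[OF assms, of us "\<lambda>i. inverse (char a (simple_root A i)) * t i"] char_nonzero[OF assms]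
  by (simp add: mult.assoc[symmetric])

lemma y_prod_torus:
  assumes "\<forall>i. a i \<noteq> 0"
  shows "y_prod us t ** T a = T a ** y_prod us (\<lambda>i. char a (simple_root A i) * t i)"
  using torus_y_prod[OF assms, of us "\<lambda>i. char a (simple_root A i) * t i"] char_nonzero[OF assms]
  by (simp add: mult.assoc[symmetric])

text \<open>The description of the cell by \<open>N\<close> determines the lower and the torus
  factor, that by the lower Borel subgroup shows the upper factor to be an \<open>x_prod\<close>.
  Uniqueness of the Gauss decomposition combines them.\<close>

lemma cell_generic_point:
  assumes g: "g \<in> L" and nz: "\<forall>i. f i g \<noteq> 0"
  obtains t where "\<forall>i. t i \<noteq> 0" "g = cell_point (\<lambda>i. f i g) t"
proof -
  obtain r n where rn: "n \<in> N" "g = xs_prod cox r ** n" using cell_positive[OF g] by blast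
  have r: "(\<lambda>i. f i g) = r" using f_xs_prod[OF rn(1), of _ r] rn(2) by (simp add: fun_eq_iff)
  with nz have rnz: "\<forall>i. r i \<noteq> 0" by (metis (no_types))
  obtain n0 where n0: "n0 \<in> N" "xs_prod cox r = y_prod cox (yq r) ** T r ** n0" using xs_prod_cox[OF rnz] by blast
  define n1 where "n1 = n0 ** n"
  have n1: "n1 \<in> N" "g = y_prod cox (yq r) ** T r ** n1"
    using n0 rn by (simp_all add: n1_def N_mult matrix_mul_assoc)
  obtain n' h h2 s where neg: "n' \<in> N'" "h \<in> H" "h2 \<in> H" "g = n' ** h ** sy_prod (rev cox) s ** h2"
    using cell_negative[OF g] by blast
  obtain a b where ab: "h = T a" "\<forall>i. a i \<noteq> 0" "h2 = T b" "\<forall>i. b i \<noteq> 0" using neg(2,3) by (auto elim!: H_cases)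
  have "f i g = a i * s i * b i" for i
    unfolding neg(4) ab(1,3) by (simp add: f_sandwich neg(1) ab prods_in_G f_sy_prod)
  then have snz: "\<forall>i. s i \<noteq> 0" using nz by (metis mult_eq_0_iff)
  obtain n3 q where q: "n3 \<in> N'" "\<forall>i. q i \<noteq> 0" "sy_prod (rev cox) s = n3 ** T s ** x_prod (rev cox) q"
    using sy_prod_cox[OF snz] by blast
  define t where "t i = inverse (char b (simple_root A i)) * q i" for i
  have tnz: "\<forall>i. t i \<noteq> 0" using q(2) char_nonzero[OF ab(4)] by (simp add: t_def)
  obtain n4 where n4: "n4 \<in> N'" "h ** n3 = n4 ** h" using H_N'[OF neg(2) q(1)] by blast
  have "g = n' ** (h ** n3) ** T s ** (x_prod (rev cox) q ** T b)" by (simp add: neg(4) q(3) ab(3) matrix_mul_assoc)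
  also have "\<dots> = (n' ** n4) ** (h ** T s ** T b) ** x_prod (rev cox) t"
    by (simp add: n4 x_prod_torus[OF ab(4)] t_def[abs_def] matrix_mul_assoc)
  finally have "y_prod cox (yq r) ** T r ** n1 = (n' ** n4) ** (h ** T s ** T b) ** x_prod (rev cox) t"
    using n1(2) by simp
  then have "n1 = x_prod (rev cox) t"
    by (rule gauss_unique(3)[rotated 6])
      (use n1 neg n4 rnz snz ab in \<open>auto intro: N'_mult H_mult torus_in_H\<close>)
  then have "g = cell_point (\<lambda>i. f i g) t" unfolding r cell_point_def using n1(2) by simp
  with tnz show ?thesis by (rule that)
qed

lemma borel_minus_eq: "b \<in> borel_minus \<phi> \<longleftrightarrow> (\<exists>n\<in>N'. \<exists>h\<in>H. b = n ** h)"
proof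
  assume "b \<in> borel_minus \<phi>"
  then obtain h n where "h \<in> H" "n \<in> N'" "b = h ** n" unfolding borel_minus_def by blast
  then show "\<exists>n\<in>N'. \<exists>h\<in>H. b = n ** h" using H_N' by metis
next
  assume "\<exists>n\<in>N'. \<exists>h\<in>H. b = n ** h"
  then obtain h n where "h \<in> H" "n \<in> N'" "b = n ** h" by blast
  then show "b \<in> borel_minus \<phi>" unfolding borel_minus_def using N'_H[of h n] by blast
qed

lemma cell_point_in_cell:
  assumes "\<forall>i. r i \<noteq> 0" "\<forall>i. t i \<noteq> 0" shows "cell_point r t \<in> L"
  unfolding cell_unfold
proof
  obtain n0 where n0: "n0 \<in> N" "xs_prod cox r = y_prod cox (yq r) ** T r ** n0" using xs_prod_cox[OF assms(1)] by blast
  obtain n where n: "n \<in> N" "xs_prod cox r = n ** bar cox" using xs_prod_bar[OF index_list_props(1)] by blast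
  have "y_prod cox (yq r) ** T r = (xs_prod cox r) ** matrix_inv n0"
    using n0 N_invertible by (simp add: matrix_mul_assoc')
  then have "cell_point r t = n ** bar cox ** (matrix_inv n0 ** x_prod (rev cox) t)"
    by (simp add: cell_point_def n(2) matrix_mul_assoc)
  moreover have "matrix_inv n0 ** x_prod (rev cox) t \<in> N" using n0 by (intro N_mult N_inv) auto
  ultimately show "cell_point r t \<in> {n1 ** bar cox ** n2 | n1 n2. n1 \<in> N \<and> n2 \<in> N}" using n(1) by blast
  have d: "distinct (rev cox)" by (simp add: index_list_props)
  obtain m h m' where m: "m \<in> N'" "h \<in> H" "m' \<in> N'" "x_prod (rev cox) t = m ** h ** mat_prod (map S' (rev cox)) ** m'"
    using chevalley.y_prod_bruhat[OF flip_chevalley d assms(2)] unfolding flip_prods group_N_flip torus_H_flip by blast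
  obtain h' where h': "h' \<in> H" "mat_prod (map S' (rev cox)) = h' ** bar (rev cox)" using flip_bar_bar by blast
  obtain m1 where m1: "m1 \<in> N'" "T r ** m = m1 ** T r" using H_N'[OF torus_in_H[OF assms(1)] m(1)] by blast
  have "cell_point r t = y_prod cox (yq r) ** (T r ** m) ** h ** h' ** bar (rev cox) ** m'"
    by (simp add: cell_point_def m(4) h'(2) matrix_mul_assoc)
  also have "\<dots> = ((y_prod cox (yq r) ** m1) ** (T r ** h ** h')) ** bar (rev cox) ** m'"
    by (simp add: m1(2) matrix_mul_assoc)
  finally have "cell_point r t = ((y_prod cox (yq r) ** m1) ** (T r ** h ** h')) ** bar (rev cox) ** m'" .
  moreover have "(y_prod cox (yq r) ** m1) ** (T r ** h ** h') \<in> borel_minus \<phi>"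
    unfolding borel_minus_eq using m1 m h' assms(1) by (auto intro!: bexI N'_mult H_mult torus_in_H)
  moreover have "m' \<in> borel_minus \<phi>"
    unfolding borel_minus_eq using m(3) H_one by (intro bexI[of _ m'] bexI[of _ "mat 1"]) auto
  ultimately show "cell_point r t \<in> {b1 ** bar (rev cox) ** b2 | b1 b2. b1 \<in> borel_minus \<phi> \<and> b2 \<in> borel_minus \<phi>}" by blast
qed

section \<open>Minors at the points of the cell\<close>

lemma minor_cox_cell_point:
  assumes "\<forall>i. r i \<noteq> 0" "\<forall>i. \<tau> i \<noteq> 0" "\<And>j. t j = \<tau> j * (\<Prod>i\<in>{..<j}. \<tau> i powi (A$i$j))"
  shows "\<Delta> (fund_weight j) (coxeter_element A (fund_weight j)) (cell_point r t) = r j * \<tau> j"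
proof -
  have "t = (\<lambda>j. \<tau> j * (\<Prod>i\<in>{i \<in> set cox. i < j}. \<tau> i powi (A$i$j)))"
    using assms(3) by (simp add: fun_eq_iff index_list_props lessThan_def)
  then obtain n' n where n: "n' \<in> N'" "n \<in> N" "x_prod (rev cox) t ** bar cox = n' ** T \<tau> ** n"
    using x_prod_bar_gauss[OF index_list_props(3) assms(2)] by (auto simp: index_list_props)
  have mG: "n' ** T \<tau> ** n \<in> G"
    using gauss_cell_subset_G gauss_cellI[OF n(1) torus_in_H[OF assms(2)] n(2)] by blast
  have "cell_point r t ** bar cox = y_prod cox (yq r) ** (T r ** (n' ** T \<tau> ** n))"
    by (simp add: cell_point_def n(3)[symmetric] matrix_mul_assoc)
  then have "f j (cell_point r t ** bar cox) = f j (y_prod cox (yq r) ** (T r ** (n' ** T \<tau> ** n)))" by simp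
  also have "\<dots> = f j (T r ** (n' ** T \<tau> ** n))"
    by (rule f_N'_left[OF y_prod_N' G_mult[OF torus_in_G[OF assms(1)] mG]])
  also have "\<dots> = r j * f j (n' ** T \<tau> ** n)" by (rule f_torus_left[OF assms(1) mG])
  also have "f j (n' ** T \<tau> ** n) = \<tau> j" by (rule f_gauss[OF n(1) assms(2) n(2)])
  finally show ?thesis using minor_cox[OF cell_point_in_G[OF assms(1)]] by simp
qed

text \<open>The factor between \<open>t i\<close> and the value of the hatted coefficient
  \<open>i\<close>, see \<open>hat_cell_point\<close>. By \<open>char_yq\<close> it is also the
  argument that the lower factor acquires when the torus factor is moved to the left of it.\<close>

definition hatq :: "('i \<Rightarrow> complex) \<Rightarrow> 'i \<Rightarrow> complex" where
  "hatq r i = r i * (\<Prod>k\<in>{i<..}. r k powi (A$k$i))"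

lemma UNIV_split: "(\<Prod>k\<in>UNIV. g k) = (\<Prod>k\<in>{..<i}. g k) * (g i :: complex) * (\<Prod>k\<in>{i<..}. g k)" for i :: 'i
proof -
  have "UNIV = {..<i} \<union> insert i {i<..}" by auto
  then have "(\<Prod>k\<in>UNIV. g k) = (\<Prod>k\<in>{..<i} \<union> insert i {i<..}. g k)" by simp
  also have "\<dots> = (\<Prod>k\<in>{..<i}. g k) * (\<Prod>k\<in>insert i {i<..}. g k)"
    by (rule prod.union_disjoint) (auto intro: finite_subset[OF subset_UNIV])
  also have "(\<Prod>k\<in>insert i {i<..}. g k) = g i * (\<Prod>k\<in>{i<..}. g k)"
    by (rule prod.insert) (auto intro: finite_subset[OF subset_UNIV])
  finally show ?thesis by (simp add: mult.assoc)
qed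

lemma char_yq: "\<forall>i. r i \<noteq> 0 \<Longrightarrow> char r (simple_root A i) * yq r i = hatq r i"
proof -
  assume r: "\<forall>i. r i \<noteq> 0"
  let ?P = "\<Prod>k\<in>{..<i}. r k powi (A$k$i)"
  have P: "?P \<noteq> 0" using r by simp
  have "char r (simple_root A i) = ?P * (r i)\<^sup>2 * (\<Prod>k\<in>{i<..}. r k powi (A$k$i))"
    unfolding char_simple_root UNIV_split[of _ i] by (simp add: cartan_props(1))
  moreover have "yq r i = inverse (r i) * inverse ?P"
    by (simp add: yq_def power_int_minus prod_inversef[symmetric])
  moreover have "p * (r i)\<^sup>2 * q * (inverse (r i) * inverse p) = r i * q" if "p \<noteq> 0" for p q
    using that r by (simp add: field_simps power2_eq_square)
  ultimately show ?thesis using P by (simp only: hatq_def)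
qed

text \<open>The coweights \<open>m i\<close> are dual to the simple roots; \<open>a\<close> is the
  exponential of the sum of \<open>Ln (q i)\<close> times \<open>m i\<close>.\<close>

lemma torus_roots_surj:
  assumes "\<forall>i. q i \<noteq> (0::complex)" obtains a where "\<forall>i. a i \<noteq> 0" "\<And>i. char a (simple_root A i) = q i"
proof -
  have "\<exists>m :: 'i \<Rightarrow> real. \<forall>j. (\<Sum>k\<in>UNIV. m k * of_int (A$k$j)) = (if j = i then 1 else 0)" for i
    by (rule exists_real_coweight)
  then obtain m :: "'i \<Rightarrow> 'i \<Rightarrow> real" where m: "\<And>i j. (\<Sum>k\<in>UNIV. m i k * of_int (A$k$j)) = (if j = i then 1 else 0)" by metis
  define a where "a k = exp (\<Sum>i\<in>UNIV. of_real (m i k) * Ln (q i))" for k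
  have "char a (simple_root A j) = q j" for j
  proof -
    have "char a (simple_root A j) = (\<Prod>k\<in>UNIV. exp (of_int (A$k$j) * (\<Sum>i\<in>UNIV. of_real (m i k) * Ln (q i))))"
      by (simp add: char_simple_root a_def exp_power_int)
    also have "\<dots> = exp (\<Sum>k\<in>UNIV. of_int (A$k$j) * (\<Sum>i\<in>UNIV. of_real (m i k) * Ln (q i)))"
      by (simp add: exp_sum)
    also have "(\<Sum>k\<in>UNIV. of_int (A$k$j) * (\<Sum>i\<in>UNIV. of_real (m i k) * Ln (q i))) =
        (\<Sum>k\<in>UNIV. \<Sum>i\<in>UNIV. of_real (m i k * of_int (A$k$j)) * Ln (q i))"
      by (simp add: sum_distrib_left mult_ac)
    also have "\<dots> = (\<Sum>i\<in>UNIV. \<Sum>k\<in>UNIV. of_real (m i k * of_int (A$k$j)) * Ln (q i))"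
      by (rule sum.swap)
    also have "\<dots> = (\<Sum>i\<in>UNIV. of_real (\<Sum>k\<in>UNIV. m i k * of_int (A$k$j)) * Ln (q i))"
      by (simp add: sum_distrib_right)
    also have "\<dots> = (\<Sum>i\<in>UNIV. if i = j then Ln (q i) else 0)" unfolding m by (intro sum.cong) auto
    also have "\<dots> = Ln (q j)" by simp
    finally show ?thesis using assms by simp
  qed
  then show ?thesis using that[of a] by (simp add: a_def)
qed

text \<open>The lower arguments are normalized to \<open>1\<close>, so that the remaining variables
  are the hatted coefficients; see \<open>principal_minor_cell_point\<close>.\<close>

definition F_fun :: "'i weight \<Rightarrow> ('i \<Rightarrow> complex) \<Rightarrow> complex" where
  "F_fun \<gamma> s = \<Delta> \<gamma> \<gamma> (y_prod cox (\<lambda>_. 1) ** x_prod (rev cox) s)"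

lemma principal_minor_conj:
  fixes i :: 'i
  assumes u: "u \<in> weyl_group A" and a: "\<forall>i. a i \<noteq> 0" and x: "x \<in> G"
  defines "\<gamma> \<equiv> u (fund_weight i)"
  shows "\<Delta> \<gamma> \<gamma> (T a ** x ** T (\<lambda>i. inverse (a i))) = \<Delta> \<gamma> \<gamma> x"
  unfolding \<gamma>_def using u a x char_nonzero[OF a]
  by (simp add: minor_torus_right minor_torus_left torus_in_G G_mult char_inverse)

text \<open>A principal minor is invariant under conjugation by the torus, the left and right
  characters being inverse to each other. A torus element whose roots take the values
  \<open>hatq r\<close> turns all lower arguments into \<open>1\<close> and multiplies
  \<open>t j\<close> by \<open>hatq r j\<close>.\<close>

lemma principal_minor_cell_point:
  fixes i :: 'i
  assumes u: "u \<in> weyl_group A" and r: "\<forall>i. r i \<noteq> 0"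
  defines "\<gamma> \<equiv> u (fund_weight i)"
  shows "\<Delta> \<gamma> \<gamma> (cell_point r t) = char r \<gamma> * F_fun \<gamma> (\<lambda>j. t j * hatq r j)"
proof -
  have hnz: "\<forall>i. hatq r i \<noteq> 0" using r by (simp add: hatq_def)
  obtain a where a: "\<forall>i. a i \<noteq> 0" "\<And>i. char a (simple_root A i) = hatq r i" using torus_roots_surj[OF hnz] by blast
  let ?x = "y_prod cox (hatq r) ** x_prod (rev cox) t"
  have x: "?x \<in> G" by (intro G_mult prods_in_G)
  have "cell_point r t = T r ** ?x"
    by (simp add: cell_point_def y_prod_torus[OF r] char_yq[OF r] matrix_mul_assoc)
  then have "\<Delta> \<gamma> \<gamma> (cell_point r t) = char r \<gamma> * \<Delta> \<gamma> \<gamma> ?x"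
    unfolding \<gamma>_def by (simp add: minor_torus_left u r x)
  also have "\<Delta> \<gamma> \<gamma> ?x = \<Delta> \<gamma> \<gamma> (T a ** ?x ** T (\<lambda>i. inverse (a i)))"
    unfolding \<gamma>_def by (rule principal_minor_conj[OF u a(1) x, symmetric])
  also have "T a ** ?x ** T (\<lambda>i. inverse (a i)) = y_prod cox (\<lambda>_. 1) ** x_prod (rev cox) (\<lambda>j. t j * hatq r j)"
  proof -
    have "T a ** y_prod cox (hatq r) = y_prod cox (\<lambda>_. 1) ** T a"
      using hnz by (simp add: torus_y_prod[OF a(1)] a(2))
    moreover have "T a ** x_prod (rev cox) t = x_prod (rev cox) (\<lambda>j. t j * hatq r j) ** T a"
      by (simp add: torus_x_prod[OF a(1)] a(2) mult.commute)
    moreover have "T a ** ?x = (T a ** y_prod cox (hatq r)) ** x_prod (rev cox) t"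
      by (simp only: matrix_mul_assoc)
    moreover have "y_prod cox (\<lambda>_. 1) ** T a ** x_prod (rev cox) t = y_prod cox (\<lambda>_. 1) ** (T a ** x_prod (rev cox) t)"
      by (simp only: matrix_mul_assoc)
    ultimately have "T a ** ?x = y_prod cox (\<lambda>_. 1) ** x_prod (rev cox) (\<lambda>j. t j * hatq r j) ** T a"
      by (simp only: matrix_mul_assoc)
    then show ?thesis using a(1) by (simp add: matrix_mul_assoc'[of _ "T a"])
  qed
  finally show ?thesis unfolding F_fun_def .
qed

text \<open>The contraction by \<open>mu\<close> fixes \<open>\<Delta>\<^bsub>\<gamma>,\<gamma>\<^esub>\<close> and moves \<open>y_prod cox (\<lambda>_. 1)\<close> to the identity.\<close>

lemma F_fun_zero:
  assumes u: "u \<in> weyl_group A" shows "F_fun (u (fund_weight i)) (\<lambda>_. 0) = 1"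
proof -
  let ?\<gamma> = "u (fund_weight i)"
  have x0: "x_prod us (\<lambda>_. 0) = mat 1" "y_prod us (\<lambda>_. 0) = mat 1" for us by (induction us) auto
  have "(\<lambda>s. \<Delta> ?\<gamma> ?\<gamma> (y_prod cox (\<lambda>_. s))) = (\<lambda>_. \<Delta> ?\<gamma> ?\<gamma> (y_prod cox (\<lambda>_. 1)))"
  proof (rule continuous_eq_off_finite[of _ _ "{0}"])
    have "poly_curve (\<lambda>s. y_prod us (\<lambda>_. s))" for us
      by (induction us) (simp_all add: poly_curve_const poly_curve_mult poly_curve_x)
    then have c: "continuous_on UNIV (\<lambda>s. y_prod cox (\<lambda>_. s))" by (rule poly_curve_continuous)
    show "continuous_on UNIV (\<lambda>s. \<Delta> ?\<gamma> ?\<gamma> (y_prod cox (\<lambda>_. s)))"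
      by (rule continuous_on_compose2[OF regular_on_continuous[OF minor_regular[OF u u]] c]) (auto intro: prods_in_G)
    fix s :: complex assume "s \<notin> {0}"
    then have s: "s \<noteq> 0" by simp
    obtain a where a: "\<forall>i. a i \<noteq> 0" "\<And>i. char a (simple_root A i) = inverse s"
      using torus_roots_surj[of "\<lambda>_. inverse s"] s by auto
    have "T a ** y_prod cox (\<lambda>_. 1) = y_prod cox (\<lambda>_. s) ** T a"
      by (simp add: torus_y_prod[OF a(1)] a(2))
    then have "T a ** y_prod cox (\<lambda>_. 1) ** T (\<lambda>i. inverse (a i)) = y_prod cox (\<lambda>_. s)"
      using a(1) by (simp add: matrix_mul_assoc')
    then show "\<Delta> ?\<gamma> ?\<gamma> (y_prod cox (\<lambda>_. s)) = \<Delta> ?\<gamma> ?\<gamma> (y_prod cox (\<lambda>_. 1))"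
      using principal_minor_conj[OF u a(1), of "y_prod cox (\<lambda>_. 1)" i] by (simp add: prods_in_G)
  qed auto
  from fun_cong[OF this, of 0] have "\<Delta> ?\<gamma> ?\<gamma> (y_prod cox (\<lambda>_. 1)) = \<Delta> ?\<gamma> ?\<gamma> (mat 1)" by (simp add: x0)
  also have "\<Delta> ?\<gamma> ?\<gamma> (mat 1) = 1"
    using minor_eq[OF u u G_one, of i] G_invertible[OF weyl_bar_in_G[OF u]] by (simp add: f_one)
  finally show ?thesis by (simp add: F_fun_def x0)
qed

end

section \<open>Regular functions on affine space are polynomials\<close>

inductive_set polyf :: "(('i \<Rightarrow> complex) \<Rightarrow> complex) set" where
  const: "(\<lambda>_. a) \<in> polyf"
| var: "(\<lambda>t. t i) \<in> polyf"
| add: "p \<in> polyf \<Longrightarrow> q \<in> polyf \<Longrightarrow> (\<lambda>t. p t + q t) \<in> polyf"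
| mult: "p \<in> polyf \<Longrightarrow> q \<in> polyf \<Longrightarrow> (\<lambda>t. p t * q t) \<in> polyf"

lemma polyf_line: "p \<in> polyf \<Longrightarrow> \<exists>q. \<forall>s. p (\<lambda>j. a j + s * b j) = poly q (s::complex)"
proof (induction rule: polyf.induct)
  case (var i) show ?case by (rule exI[of _ "[:a i, b i:]"]) simp
qed (simp_all add: poly_fun_closed)

text \<open>The point is that \<open>d\<close> does not depend on \<open>t\<close>: interpolation
  can then use the same nodes on every line.\<close>

lemma polyf_slice_degree:
  fixes p :: "('i \<Rightarrow> complex) \<Rightarrow> complex"
  shows "p \<in> polyf \<Longrightarrow> \<exists>d. \<forall>t. \<exists>q. degree q \<le> d \<and> (\<forall>s. p (t(i := s)) = poly q s)"
proof (induction rule: polyf.induct)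
  case (const a)
  then show ?case by (intro exI[of _ 0] allI exI[of _ "[:a:]"]) simp
next
  case (var j)
  have "\<exists>q. degree q \<le> 1 \<and> (\<forall>s. (t(i := s)) j = poly q s)" for t :: "'i \<Rightarrow> complex"
  proof (cases "j = i")
    case True then show ?thesis by (intro exI[of _ "[:0,1:]"]) simp
  next
    case False then show ?thesis by (intro exI[of _ "[:t j:]"]) simp
  qed
  then show ?case by blast
next
  case (add p q)
  then obtain d e where "\<forall>t. \<exists>r. degree r \<le> d \<and> (\<forall>s. p (t(i := s)) = poly r s)"
    "\<forall>t. \<exists>r. degree r \<le> e \<and> (\<forall>s. q (t(i := s)) = poly r s)" by blast
  note de = this
  show ?case
  proof (intro exI[of _ "max d e"] allI)
    fix t :: "'i \<Rightarrow> complex"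
    obtain r r' where r: "degree r \<le> d" "\<forall>s. p (t(i := s)) = poly r s" "degree r' \<le> e" "\<forall>s. q (t(i := s)) = poly r' s"
      using de by meson
    then show "\<exists>r. degree r \<le> max d e \<and> (\<forall>s. p (t(i := s)) + q (t(i := s)) = poly r s)"
      by (intro exI[of _ "r + r'"]) (auto intro: degree_add_le)
  qed
next
  case (mult p q)
  then obtain d e where "\<forall>t. \<exists>r. degree r \<le> d \<and> (\<forall>s. p (t(i := s)) = poly r s)"
    "\<forall>t. \<exists>r. degree r \<le> e \<and> (\<forall>s. q (t(i := s)) = poly r s)" by blast
  note de = this
  show ?case
  proof (intro exI[of _ "d + e"] allI)
    fix t :: "'i \<Rightarrow> complex"
    obtain r r' where r: "degree r \<le> d" "\<forall>s. p (t(i := s)) = poly r s" "degree r' \<le> e" "\<forall>s. q (t(i := s)) = poly r' s"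
      using de by meson
    then have "degree (r * r') \<le> d + e" using degree_mult_le[of r r'] by linarith
    then show "\<exists>r. degree r \<le> d + e \<and> (\<forall>s. p (t(i := s)) * q (t(i := s)) = poly r s)"
      using r by (intro exI[of _ "r * r'"]) auto
  qed
qed

lemma polyf_freeze: "p \<in> polyf \<Longrightarrow> (\<lambda>t. p (t(i := c))) \<in> polyf"
proof (induction rule: polyf.induct)
  case (var j) then show ?case by (cases "j = i") (auto intro: polyf.const polyf.var)
next
  case (add p q) then show ?case by (intro polyf.add)
next
  case (mult p q) then show ?case by (intro polyf.mult)
qed (rule polyf.const)

lemma polyf_sum: "(\<And>k. k \<in> I \<Longrightarrow> f k \<in> polyf) \<Longrightarrow> (\<lambda>t. \<Sum>k\<in>I. f k t) \<in> polyf"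
proof (induction I rule: infinite_finite_induct)
  case (insert x I)
  then have "(\<lambda>t. f x t + (\<Sum>k\<in>I. f k t)) \<in> polyf" by (intro polyf.add) auto
  then show ?case using insert by simp
qed (simp_all add: polyf.const)

lemma polyf_poly: "(\<lambda>t. poly p (t i)) \<in> polyf"
proof (induction p)
  case (pCons a p)
  have "(\<lambda>t. a + t i * poly p (t i)) \<in> polyf" by (intro polyf.add polyf.const polyf.mult polyf.var pCons)
  then show ?case by simp
qed (simp add: polyf.const)

text \<open>Regularity on the whole affine space. That such functions are polynomials is derived
  below by interpolation in one variable at a time, without unique factorization.\<close>

definition locally_rational :: "(('i \<Rightarrow> complex) \<Rightarrow> complex) \<Rightarrow> bool" where
  "locally_rational F \<longleftrightarrow> (\<forall>t. \<exists>p\<in>polyf. \<exists>q\<in>polyf. q t \<noteq> 0 \<and> (\<forall>t'. q t' \<noteq> 0 \<longrightarrow> F t' = p t' / q t'))"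

lemma locally_rationalE:
  assumes "locally_rational F"
  obtains p q where "p \<in> polyf" "q \<in> polyf" "q t \<noteq> 0" "\<forall>t'. q t' \<noteq> 0 \<longrightarrow> F t' = p t' / q t'"
proof -
  from assms have "\<exists>p\<in>polyf. \<exists>q\<in>polyf. q t \<noteq> 0 \<and> (\<forall>t'. q t' \<noteq> 0 \<longrightarrow> F t' = p t' / q t')"
    unfolding locally_rational_def by (rule spec)
  then show ?thesis by (elim bexE conjE) (rule that)
qed

lemma locally_rational_freeze:
  fixes F :: "('i \<Rightarrow> complex) \<Rightarrow> complex"
  assumes "locally_rational F" shows "locally_rational (\<lambda>t. F (t(i := c)))"
  unfolding locally_rational_def
proof
  fix t :: "'i \<Rightarrow> complex"
  obtain p q where pq: "p \<in> polyf" "q \<in> polyf" "q (t(i := c)) \<noteq> 0" "\<forall>t'. q t' \<noteq> 0 \<longrightarrow> F t' = p t' / q t'"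
    by (rule locally_rationalE[OF assms])
  show "\<exists>p\<in>polyf. \<exists>q\<in>polyf. q t \<noteq> 0 \<and> (\<forall>t'. q t' \<noteq> 0 \<longrightarrow> F (t'(i := c)) = p t' / q t')"
  proof (rule bexI[where x = "\<lambda>t. p (t(i := c))"], rule bexI[where x = "\<lambda>t. q (t(i := c))"])
    show "q (t(i := c)) \<noteq> 0 \<and> (\<forall>t'. q (t'(i := c)) \<noteq> 0 \<longrightarrow> F (t'(i := c)) = p (t'(i := c)) / q (t'(i := c)))"
      using pq(3,4) by simp
  qed (rule polyf_freeze[OF pq(2)], rule polyf_freeze[OF pq(1)])
qed

lemma locally_rational_line:
  assumes "locally_rational F" shows "continuous_on UNIV (\<lambda>s. F (\<lambda>j. a j + s * b j))"
  unfolding continuous_on_eq_continuous_at[OF open_UNIV]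
proof
  fix s0 :: complex
  obtain p q where pq: "p \<in> polyf" "q \<in> polyf" "q (\<lambda>j. a j + s0 * b j) \<noteq> 0" "\<forall>t'. q t' \<noteq> 0 \<longrightarrow> F t' = p t' / q t'"
    by (rule locally_rationalE[OF assms])
  obtain P where P: "\<forall>s. p (\<lambda>j. a j + s * b j) = poly P s" using polyf_line[OF pq(1)] by blast
  obtain Q where Q: "\<forall>s. q (\<lambda>j. a j + s * b j) = poly Q s" using polyf_line[OF pq(2)] by blast
  have Q0: "poly Q s0 \<noteq> 0" using pq(3) Q by simp
  have "open {s. poly Q s \<noteq> 0}" by (intro open_Collect_neq continuous_intros)
  then have "\<forall>\<^sub>F s in nhds s0. poly Q s \<noteq> 0" using Q0 by (auto simp: eventually_nhds)
  then have "\<forall>\<^sub>F s in nhds s0. F (\<lambda>j. a j + s * b j) = poly P s / poly Q s"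
    by eventually_elim (use pq(4) P Q in simp)
  from isCont_cong[OF this] show "isCont (\<lambda>s. F (\<lambda>j. a j + s * b j)) s0"
    using isCont_divide[OF poly_isCont poly_isCont Q0] by simp
qed

definition lagrange :: "nat \<Rightarrow> nat \<Rightarrow> complex poly" where
  "lagrange d k = (\<Prod>l\<in>{..d} - {k}. smult (inverse (of_nat k - of_nat l)) [:- of_nat l, 1:])"

lemma lagrange_interpolation:
  assumes "degree p \<le> d" shows "p = (\<Sum>k\<le>d. smult (poly p (of_nat k)) (lagrange d k))"
proof (rule poly_eqI_degree[of "of_nat ` {..d}"])
  have deg: "degree (lagrange d k) \<le> d" if "k \<le> d" for k
  proof -
    have "degree (lagrange d k) \<le> (\<Sum>l\<in>{..d} - {k}. degree (smult (inverse (of_nat k - of_nat l :: complex)) [:- of_nat l, 1:]))"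
      unfolding lagrange_def by (rule degree_prod_sum_le[unfolded o_def]) simp
    also have "\<dots> \<le> (\<Sum>l\<in>{..d} - {k}. 1)" by (intro sum_mono) simp
    also have "\<dots> \<le> d" using that by simp
    finally show ?thesis .
  qed
  have card: "card (of_nat ` {..d} :: complex set) = Suc d"
    by (subst card_image) (auto simp: inj_on_def)
  show "degree p < card (of_nat ` {..d} :: complex set)" using assms card by simp
  have "degree (\<Sum>k\<le>d. smult (poly p (of_nat k)) (lagrange d k)) \<le> d"
    by (intro degree_sum_le order.trans[OF degree_smult_le deg]) auto
  then show "degree (\<Sum>k\<le>d. smult (poly p (of_nat k)) (lagrange d k)) < card (of_nat ` {..d} :: complex set)"
    using card by simp
  fix x :: complex assume "x \<in> of_nat ` {..d}"
  then obtain m where m: "m \<le> d" "x = of_nat m" by blast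
  have one: "poly (lagrange d m) (of_nat m) = 1"
  proof -
    have "poly (smult (inverse (of_nat m - of_nat l)) [:- of_nat l, 1:]) (of_nat m :: complex) = 1" if "l \<noteq> m" for l
    proof -
      have "poly (smult (inverse (of_nat m - of_nat l)) [:- of_nat l, 1:]) (of_nat m :: complex) =
        inverse (of_nat m - of_nat l) * (of_nat m - of_nat l)" by (simp add: algebra_simps)
      then show ?thesis using that by simp
    qed
    then show ?thesis unfolding lagrange_def poly_prod by (intro prod.neutral) auto
  qed
  have zero: "poly (lagrange d k) (of_nat m) = 0" if "k \<noteq> m" for k
    unfolding lagrange_def poly_prod using m that by (intro prod_zero) auto
  have "(\<Sum>k\<le>d. poly p (of_nat k) * poly (lagrange d k) (of_nat m)) = (\<Sum>k\<le>d. if k = m then poly p (of_nat m) else 0)"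
    by (intro sum.cong) (auto simp: one zero)
  then show "poly p x = poly (\<Sum>k\<le>d. smult (poly p (of_nat k)) (lagrange d k)) x"
    using m by (simp add: poly_sum)
qed

text \<open>On a line in direction \<open>i\<close> that is not contained in the zero set of the
  denominator, \<open>F\<close> is continuous and a quotient of polynomials, hence a polynomial of
  degree at most \<open>d\<close>, and so agrees with its interpolant at the nodes up to
  \<open>d\<close>.\<close>

lemma locally_rational_slice:
  assumes F: "locally_rational F"
  obtains d where "\<And>t. F t = (\<Sum>k\<le>d. F (t(i := of_nat k)) * poly (lagrange d k) (t i))"
proof -
  obtain p q where pq: "p \<in> polyf" "q \<in> polyf" "q (\<lambda>_. 0) \<noteq> 0" "\<forall>t'. q t' \<noteq> 0 \<longrightarrow> F t' = p t' / q t'"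
    by (rule locally_rationalE[OF F])
  obtain d where d: "\<forall>t. \<exists>r. degree r \<le> d \<and> (\<forall>s. p (t(i := s)) = poly r s)" using polyf_slice_degree[OF pq(1)] by blast
  have gen: "F t = (\<Sum>k\<le>d. F (t(i := of_nat k)) * poly (lagrange d k) (t i))" if nz: "q (t(i := 0)) \<noteq> 0" for t
  proof -
    obtain P where P: "degree P \<le> d" "\<forall>s. p (t(i := s)) = poly P s" using d by blast
    obtain Q where Q: "\<forall>s. q (t(i := s)) = poly Q s" using polyf_slice_degree[OF pq(2)] by blast
    have Q0: "Q \<noteq> 0" using nz Q by auto
    have line: "t(i := s) = (\<lambda>j. (t(i := 0)) j + s * ((\<lambda>_. 0)(i := 1)) j)" for s by (auto simp: fun_eq_iff)
    have "(\<lambda>s. F (t(i := s))) = (\<lambda>s. F (\<lambda>j. (t(i := 0)) j + s * ((\<lambda>_. 0)(i := 1)) j))"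
      by (intro ext arg_cong[where f = F] line)
    moreover have "continuous_on UNIV (\<lambda>s. F (\<lambda>j. (t(i := 0)) j + s * ((\<lambda>_. 0)(i := 1)) j))"
      by (rule locally_rational_line[OF F])
    ultimately have cont: "continuous_on UNIV (\<lambda>s. F (t(i := s)))" by (simp only:)
    have "(\<lambda>s. F (t(i := s)) * poly Q s) = poly P"
    proof (rule continuous_eq_off_finite[of _ _ "{s. poly Q s = 0}"])
      show "finite {s. poly Q s = 0}" using Q0 by (rule poly_roots_finite)
      show "continuous_on UNIV (\<lambda>s. F (t(i := s)) * poly Q s)" by (intro continuous_intros cont)
      show "continuous_on UNIV (poly P)" by (rule continuous_on_poly[OF continuous_on_id])
      fix s assume "s \<notin> {s. poly Q s = 0}"
      then show "F (t(i := s)) * poly Q s = poly P s" using pq(4) P(2) Q by auto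
    qed
    then have "\<And>s. F (t(i := s)) * poly Q s = poly P s" by (rule fun_cong)
    then obtain r where r: "\<forall>s. F (t(i := s)) = poly r s" "degree r \<le> degree P"
      using poly_quotient_continuous[OF cont _ Q0] by blast
    have "degree r \<le> d" using r(2) P(1) by simp
    have "F t = poly r (t i)" using r(1)[rule_format, of "t i"] by simp
    also have "\<dots> = (\<Sum>k\<le>d. poly r (of_nat k) * poly (lagrange d k) (t i))"
      by (subst lagrange_interpolation[OF \<open>degree r \<le> d\<close>]) (simp add: poly_sum)
    finally show ?thesis using r(1) by simp
  qed
  \<comment> \<open>The condition on \<open>q\<close> is removed along the line from the origin
    through \<open>t\<close>: there \<open>q\<close> does not vanish identically since it is
    non-zero at the origin, and both sides are continuous.\<close>
  have "F t = (\<Sum>k\<le>d. F (t(i := of_nat k)) * poly (lagrange d k) (t i))" for t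
  proof -
    obtain Q where Q: "\<forall>s. q (\<lambda>j. (\<lambda>_. 0) j + s * (t(i := 0)) j) = poly Q s"
      using polyf_line[OF pq(2), of "\<lambda>_. 0" "t(i := 0)"] by blast
    have Q0: "Q \<noteq> 0" using Q[rule_format, of 0] pq(3) by auto
    have "(\<lambda>s. F (\<lambda>j. (\<lambda>_. 0) j + s * t j)) =
      (\<lambda>s. \<Sum>k\<le>d. F (\<lambda>j. ((\<lambda>_. 0)(i := of_nat k)) j + s * (t(i := 0)) j) * poly (lagrange d k) (s * t i))"
    proof (rule continuous_eq_off_finite[of _ _ "{s. poly Q s = 0}"])
      show "finite {s. poly Q s = 0}" using Q0 by (rule poly_roots_finite)
      show "continuous_on UNIV (\<lambda>s. F (\<lambda>j. (\<lambda>_. 0) j + s * t j))" by (rule locally_rational_line[OF F])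
      show "continuous_on UNIV (\<lambda>s. \<Sum>k\<le>d. F (\<lambda>j. ((\<lambda>_. 0)(i := of_nat k)) j + s * (t(i := 0)) j) * poly (lagrange d k) (s * t i))"
        by (intro continuous_on_sum continuous_on_mult locally_rational_line[OF F] continuous_on_poly continuous_on_id continuous_on_const)
      fix s assume "s \<notin> {s. poly Q s = 0}"
      then have "q (\<lambda>j. (\<lambda>_. 0) j + s * (t(i := 0)) j) \<noteq> 0" using Q by simp
      moreover have "(\<lambda>j. (\<lambda>_. 0) j + s * (t(i := 0)) j) = (\<lambda>j. s * t j)(i := 0)" by (auto simp: fun_eq_iff)
      ultimately have "q ((\<lambda>j. s * t j)(i := 0)) \<noteq> 0" by simp
      from gen[OF this] have "F (\<lambda>j. s * t j) = (\<Sum>k\<le>d. F ((\<lambda>j. s * t j)(i := of_nat k)) * poly (lagrange d k) (s * t i))" .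
      moreover have "(\<lambda>j. ((\<lambda>_. 0)(i := of_nat k)) j + s * (t(i := 0)) j) = (\<lambda>j. s * t j)(i := of_nat k)" for k
        by (auto simp: fun_eq_iff)
      ultimately show "F (\<lambda>j. (\<lambda>_. 0) j + s * t j) =
        (\<Sum>k\<le>d. F (\<lambda>j. ((\<lambda>_. 0)(i := of_nat k)) j + s * (t(i := 0)) j) * poly (lagrange d k) (s * t i))"
        by simp
    qed
    from fun_cong[OF this, of 1] have "F t = (\<Sum>k\<le>d. F (\<lambda>j. ((\<lambda>_. 0)(i := of_nat k)) j + (t(i := 0)) j) * poly (lagrange d k) (t i))"
      by simp
    moreover have "(\<lambda>j. ((\<lambda>_. 0)(i := of_nat k)) j + (t(i := 0)) j) = t(i := of_nat k)" for k
      by (auto simp: fun_eq_iff)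
    ultimately show ?thesis by simp
  qed
  then show ?thesis using that by blast
qed

text \<open>Induction on the set of variables on which \<open>F\<close> depends. Interpolation
  expresses \<open>F\<close> through finitely many functions with the variable \<open>i\<close>
  frozen, which depend on one variable less.\<close>

lemma locally_rational_polyf:
  fixes F :: "('i::finite \<Rightarrow> complex) \<Rightarrow> complex"
  assumes "locally_rational F" shows "F \<in> polyf"
proof -
  have main: "finite S \<Longrightarrow> locally_rational F \<Longrightarrow> (\<And>t t'. (\<forall>i\<in>S. t i = t' i) \<Longrightarrow> F t = F t') \<Longrightarrow> F \<in> polyf"
    for S and F :: "('i \<Rightarrow> complex) \<Rightarrow> complex"
  proof (induction S arbitrary: F rule: finite_induct)
    case empty
    have eq: "F = (\<lambda>_. F (\<lambda>_. 0))" by (rule ext, rule empty.prems(2)) simp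
    show ?case by (subst eq) (rule polyf.const)
  next
    case (insert i S)
    obtain d where d: "\<And>t. F t = (\<Sum>k\<le>d. F (t(i := of_nat k)) * poly (lagrange d k) (t i))"
      using locally_rational_slice[OF insert.prems(1)] by blast
    have "(\<lambda>t. F (t(i := of_nat k))) \<in> polyf" for k
    proof (rule insert.IH)
      show "locally_rational (\<lambda>t. F (t(i := of_nat k)))" by (rule locally_rational_freeze[OF insert.prems(1)])
      show "F (t(i := of_nat k)) = F (t'(i := of_nat k))" if "\<forall>j\<in>S. t j = t' j" for t t'
        using that by (intro insert.prems(2)) auto
    qed
    then have poly: "(\<lambda>t. \<Sum>k\<le>d. F (t(i := of_nat k)) * poly (lagrange d k) (t i)) \<in> polyf"
      by (intro polyf_sum polyf.mult polyf_poly)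
    have eq: "F = (\<lambda>t. \<Sum>k\<le>d. F (t(i := of_nat k)) * poly (lagrange d k) (t i))"
      using d by (rule ext)
    show ?case by (subst eq) (rule poly)
  qed
  show ?thesis
  proof (rule main[of UNIV F])
    fix t t' :: "'i \<Rightarrow> complex" assume "\<forall>i\<in>UNIV. t i = t' i"
    then have "t = t'" by (simp add: fun_eq_iff)
    then show "F t = F t'" by simp
  qed (use assms in auto)
qed

section \<open>Polynomial functions as sums of monomials\<close>

definition monom_fun :: "('i::finite \<Rightarrow>\<^sub>0 nat) \<Rightarrow> ('i \<Rightarrow> 'b::comm_semiring_1) \<Rightarrow> 'b" where
  "monom_fun m t = (\<Prod>i\<in>UNIV. t i ^ Poly_Mapping.lookup m i)"

lemma monom_fun_add: "monom_fun (m + m') t = monom_fun m t * monom_fun m' t"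
  by (simp add: monom_fun_def lookup_add power_add prod.distrib)

lemma monom_fun_zero [simp]: "monom_fun 0 t = 1"
  by (simp add: monom_fun_def)

lemma monom_fun_single: "monom_fun (Poly_Mapping.single i 1) t = t i"
proof -
  have "monom_fun (Poly_Mapping.single i 1) t = (\<Prod>k\<in>UNIV. if k = i then t k else 1)"
    unfolding monom_fun_def by (intro prod.cong) (auto simp: lookup_single when_def)
  then show ?thesis by simp
qed

lemma monom_fun_at_zero: "m \<noteq> 0 \<Longrightarrow> monom_fun m (\<lambda>_. 0 :: 'b :: {comm_semiring_1,semiring_no_zero_divisors}) = 0"
proof -
  assume "m \<noteq> 0"
  then obtain i where "Poly_Mapping.lookup m i \<noteq> 0" by (metis lookup_zero poly_mapping_eqI)
  then have "(0::'b) ^ Poly_Mapping.lookup m i = 0" by (simp add: zero_power)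
  then have "\<exists>i\<in>UNIV. (0::'b) ^ Poly_Mapping.lookup m i = 0" by blast
  then show ?thesis unfolding monom_fun_def by (intro prod_zero) simp_all
qed

lemma polyf_list:
  fixes F :: "('i::finite \<Rightarrow> complex) \<Rightarrow> complex"
  assumes "F \<in> polyf" shows "\<exists>xs. \<forall>t. F t = (\<Sum>(c, m)\<leftarrow>xs. c * monom_fun m t)"
  using assms
proof induction
  case (const a) show ?case by (rule exI[of _ "[(a, 0)]"]) simp
next
  case (var i) show ?case by (rule exI[of _ "[(1, Poly_Mapping.single i 1)]"]) (simp add: monom_fun_single del: One_nat_def)
next
  case (add p q)
  then obtain xs ys where "\<forall>t. p t = (\<Sum>(c, m)\<leftarrow>xs. c * monom_fun m t)" "\<forall>t. q t = (\<Sum>(c, m)\<leftarrow>ys. c * monom_fun m t)" by blast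
  then show ?case by (intro exI[of _ "xs @ ys"]) simp
next
  case (mult p q)
  then obtain xs ys where xy: "\<forall>t. p t = (\<Sum>(c, m)\<leftarrow>xs. c * monom_fun m t)" "\<forall>t. q t = (\<Sum>(c, m)\<leftarrow>ys. c * monom_fun m t)" by blast
  have one: "sum_list (map ((\<lambda>(c, m). c * monom_fun m t) \<circ> (\<lambda>(c', m'). (c * c', m + m'))) ys) = c * monom_fun m t * q t" for c m t
    unfolding xy(2)[rule_format] by (induction ys) (auto simp: monom_fun_add algebra_simps)
  have "(\<Sum>(c, m)\<leftarrow>concat (map (\<lambda>(c, m). map (\<lambda>(c', m'). (c * c', m + m')) ys) zs). c * monom_fun m t)
    = (\<Sum>(c, m)\<leftarrow>zs. c * monom_fun m t) * q t" for zs t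
    by (induction zs) (auto simp: one ring_distribs)
  then show ?case using xy(1)
    by (intro exI[of _ "concat (map (\<lambda>(c, m). map (\<lambda>(c', m'). (c * c', m + m')) ys) xs)"]) simp
qed

lemma polyf_expansion:
  fixes F :: "('i::finite \<Rightarrow> complex) \<Rightarrow> complex"
  assumes "F \<in> polyf" obtains c M where "finite M" "\<And>t. F t = (\<Sum>m\<in>M. c m * monom_fun m t)" "F (\<lambda>_. 0) = c 0" "0 \<in> M"
proof -
  obtain xs where xs: "\<forall>t. F t = (\<Sum>(c, m)\<leftarrow>xs. c * monom_fun m t)" using polyf_list[OF assms] by blast
  define c where "c m = (\<Sum>(c, m')\<leftarrow>xs. if m' = m then c else 0)" for m
  \<comment> \<open>\<open>0\<close> is added to \<open>M\<close> so that \<open>c 0\<close> is the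
    constant term even if no constant monomial occurs in the list.\<close>
  define M where "M = insert 0 (snd ` set xs)"
  have "set ys \<subseteq> set xs \<Longrightarrow> (\<Sum>(c, m)\<leftarrow>ys. c * monom_fun m t) = (\<Sum>m\<in>M. (\<Sum>(c, m')\<leftarrow>ys. if m' = m then c else 0) * monom_fun m t)" for ys t
  proof (induction ys)
    case (Cons y ys)
    obtain a m0 where y: "y = (a, m0)" by force
    have m0: "m0 \<in> M" "finite M" using Cons.prems y by (force simp: M_def)+
    have "(\<Sum>m\<in>M. (\<Sum>(c, m')\<leftarrow>y # ys. if m' = m then c else 0) * monom_fun m t) =
      (\<Sum>m\<in>M. (if m = m0 then a * monom_fun m0 t else 0) + (\<Sum>(c, m')\<leftarrow>ys. if m' = m then c else 0) * monom_fun m t)"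
      by (intro sum.cong) (auto simp: y ring_distribs)
    also have "\<dots> = a * monom_fun m0 t + (\<Sum>m\<in>M. (\<Sum>(c, m')\<leftarrow>ys. if m' = m then c else 0) * monom_fun m t)"
      using m0 by (simp add: sum.distrib)
    finally show ?case using Cons y by simp
  qed simp
  then have F: "F t = (\<Sum>m\<in>M. c m * monom_fun m t)" for t using xs c_def by simp
  have fin: "finite M" by (simp add: M_def)
  have "F (\<lambda>_. 0) = (\<Sum>m\<in>M. if m = 0 then c 0 else 0)"
    unfolding F by (intro sum.cong) (auto simp: monom_fun_at_zero)
  also have "\<dots> = c 0" using fin by (simp add: M_def)
  finally show ?thesis using that[OF fin F] by (simp add: M_def)
qed

lemma polynomial_function_polyf:
  assumes "p \<in> polynomial_functions" "\<And>k l. (\<lambda>t. X t $ k $ l) \<in> polyf"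
  shows "(\<lambda>t. p (X t)) \<in> polyf"
  using assms(1)
proof induction
  case (add p q) then show ?case by (intro polyf.add)
next
  case (mult p q) then show ?case by (intro polyf.mult)
qed (simp_all add: assms(2) polyf.const)

lemma polyf_matrix_mult:
  fixes a b :: "('i \<Rightarrow> complex) \<Rightarrow> complex^'m^'m"
  assumes "\<And>k l. (\<lambda>t. a t $ k $ l) \<in> polyf" "\<And>k l. (\<lambda>t. b t $ k $ l) \<in> polyf"
  shows "(\<lambda>t. (a t ** b t) $ k $ l) \<in> polyf"
  unfolding matrix_matrix_mult_def using assms by (simp add: polyf_sum polyf.mult)

lemma regular_on_polyf_curve:
  fixes X :: "('i::finite \<Rightarrow> complex) \<Rightarrow> complex^'m^'m"
  assumes "regular_on S f" "\<And>k l. (\<lambda>t. X t $ k $ l) \<in> polyf" "\<And>t. X t \<in> S"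
  shows "(\<lambda>t. f (X t)) \<in> polyf"
proof (rule locally_rational_polyf)
  show "locally_rational (\<lambda>t. f (X t))"
    unfolding locally_rational_def
  proof
    fix t
    have "\<exists>p\<in>polynomial_functions. \<exists>q\<in>polynomial_functions. q (X t) \<noteq> 0 \<and> (\<forall>y\<in>S. q y \<noteq> 0 \<longrightarrow> f y = p y / q y)"
      using assms(1) assms(3)[of t] unfolding regular_on_def by (rule bspec)
    then obtain p q where pq: "p \<in> polynomial_functions" "q \<in> polynomial_functions" "q (X t) \<noteq> 0"
      "\<forall>y\<in>S. q y \<noteq> 0 \<longrightarrow> f y = p y / q y"
      by (elim bexE conjE)
    have P: "(\<lambda>t. p (X t)) \<in> polyf" by (rule polynomial_function_polyf[OF pq(1)]) (rule assms(2))
    have Q: "(\<lambda>t. q (X t)) \<in> polyf" by (rule polynomial_function_polyf[OF pq(2)]) (rule assms(2))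
    show "\<exists>p\<in>polyf. \<exists>q\<in>polyf. q t \<noteq> 0 \<and> (\<forall>t'. q t' \<noteq> 0 \<longrightarrow> f (X t') = p t' / q t')"
    proof (rule bexI[where x = "\<lambda>t. p (X t)"], rule bexI[where x = "\<lambda>t. q (X t)"])
      show "q (X t) \<noteq> 0 \<and> (\<forall>t'. q (X t') \<noteq> 0 \<longrightarrow> f (X t') = p (X t') / q (X t'))"
        using pq(3,4) assms(3) by simp
    qed (rule Q, rule P)
  qed
qed

context minors
begin

lemma F_fun_polyf:
  assumes u: "u \<in> weyl_group A" shows "F_fun (u (fund_weight i)) \<in> polyf"
proof -
  have X: "(\<lambda>t. X j (t j) $ k $ l) \<in> polyf" for j k l
  proof -
    obtain p where p: "\<And>s. X j s $ k $ l = poly p s" using poly_curve_x(1)[of j] unfolding poly_curve_def by meson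
    show ?thesis unfolding p by (rule polyf_poly)
  qed
  have x: "(\<lambda>t. x_prod us t $ k $ l) \<in> polyf" for us k l
    by (induction us arbitrary: k l) (simp_all add: polyf.const polyf_matrix_mult X)
  have "(\<lambda>t. (y_prod cox (\<lambda>_. 1) ** x_prod (rev cox) t) $ k $ l) \<in> polyf" for k l
    by (intro polyf_matrix_mult x polyf.const)
  then have "(\<lambda>t. \<Delta> (u (fund_weight i)) (u (fund_weight i)) (y_prod cox (\<lambda>_. 1) ** x_prod (rev cox) t)) \<in> polyf"
    by (rule regular_on_polyf_curve[OF minor_regular[OF u u]]) (intro G_mult prods_in_G)
  then show ?thesis unfolding F_fun_def[abs_def] .
qed

end

section \<open>Leading terms of cluster variables\<close>

definition lex_less :: "'i::{finite,linorder} weight \<Rightarrow> 'i weight \<Rightarrow> bool" where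
  "lex_less a b \<longleftrightarrow> (\<exists>k. a $ k < b $ k \<and> (\<forall>j<k. a $ j = b $ j))"

lemma lex_less_irrefl: "\<not> lex_less a a"
  by (simp add: lex_less_def)

lemma lex_less_trans:
  assumes "lex_less a b" "lex_less b c" shows "lex_less a c"
proof -
  obtain k l where k: "a $ k < b $ k" "\<forall>j<k. a $ j = b $ j" and l: "b $ l < c $ l" "\<forall>j<l. b $ j = c $ j"
    using assms unfolding lex_less_def by blast
  show ?thesis
  proof (cases k l rule: linorder_cases)
    case less then show ?thesis unfolding lex_less_def using k l by (intro exI[of _ k]) auto
  next
    case equal then show ?thesis unfolding lex_less_def using k l by (intro exI[of _ k]) auto
  next
    case greater then show ?thesis unfolding lex_less_def using k l by (intro exI[of _ l]) auto
  qed
qed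

lemma lex_less_total: "a \<noteq> b \<Longrightarrow> lex_less a b \<or> lex_less b a"
proof -
  assume "a \<noteq> b"
  then have ne: "{k. a $ k \<noteq> b $ k} \<noteq> {}" by (auto simp: vec_eq_iff)
  define k where "k = Min {k. a $ k \<noteq> b $ k}"
  have k: "a $ k \<noteq> b $ k" using Min_in[OF _ ne] by (auto simp: k_def)
  have "\<forall>j<k. a $ j = b $ j"
  proof (intro allI impI, rule ccontr)
    fix j assume "j < k" "a $ j \<noteq> b $ j"
    then have "k \<le> j" unfolding k_def by (intro Min_le) auto
    with \<open>j < k\<close> show False by simp
  qed
  with k show ?thesis unfolding lex_less_def by (metis linorder_less_linear)
qed

lemma lex_less_add: "lex_less (a + c) (b + c) \<longleftrightarrow> lex_less a b"
  by (simp add: lex_less_def)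

text \<open>Exponents of Laurent monomials: those of the initial cluster, paired with those of the
  coefficients.\<close>

type_synonym 'i expo = "'i weight \<times> 'i weight"

text \<open>A total order compatible with addition, so that the leading term of a product is the
  product of the leading terms.\<close>

definition elt :: "'i::{finite,linorder} expo \<Rightarrow> 'i expo \<Rightarrow> bool" where
  "elt e f \<longleftrightarrow> lex_less (fst e) (fst f) \<or> fst e = fst f \<and> lex_less (snd e) (snd f)"

lemma elt_irrefl: "\<not> elt e e"
  by (simp add: elt_def lex_less_irrefl)

lemma elt_trans: "elt e f \<Longrightarrow> elt f g \<Longrightarrow> elt e g"
  by (auto simp: elt_def intro: lex_less_trans)

lemma elt_total: "e \<noteq> f \<Longrightarrow> elt e f \<or> elt f e"
proof -
  assume "e \<noteq> f"
  then consider "fst e \<noteq> fst f" | "fst e = fst f" "snd e \<noteq> snd f" by (meson prod_eqI)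
  then show ?thesis by cases (use lex_less_total in \<open>auto simp: elt_def\<close>)
qed

lemma elt_add: "elt (e + g) (f + g) \<longleftrightarrow> elt e f" "elt (g + e) (g + f) \<longleftrightarrow> elt e f"
  by (simp_all add: elt_def lex_less_add add.commute[of "fst g"] add.commute[of "snd g"])

lemma elt_add_mono: "elt e f \<Longrightarrow> elt e' f' \<Longrightarrow> elt (e + e') (f + f')"
  using elt_add elt_trans by blast

lemma elt_max:
  assumes "finite I" "I \<noteq> {}" "inj_on h I"
  shows "\<exists>m\<in>I. \<forall>l\<in>I. l \<noteq> m \<longrightarrow> elt (h l) (h m)"
  using assms
proof (induction I rule: finite_ne_induct)
  case (insert i I)
  then obtain m where m: "m \<in> I" "\<forall>l\<in>I. l \<noteq> m \<longrightarrow> elt (h l) (h m)" by auto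
  have "h i \<noteq> h m" using insert.prems insert.hyps m(1) by (auto simp: inj_on_def)
  then consider "elt (h i) (h m)" | "elt (h m) (h i)" using elt_total by blast
  then show ?case
  proof cases
    case 1 then show ?thesis using m by auto
  next
    case 2
    have "elt (h l) (h i)" if "l \<in> insert i I" "l \<noteq> i" for l
    proof (cases "l = m")
      case False
      then have "elt (h l) (h m)" using m(2) that by simp
      then show ?thesis using 2 by (rule elt_trans)
    qed (use 2 in simp)
    then show ?thesis by blast
  qed
qed simp

section \<open>Independence of exponent vectors under mutation\<close>

definition escale :: "int \<Rightarrow> 'i::finite expo \<Rightarrow> 'i expo" where
  "escale n e = (n *s fst e, n *s snd e)"

lemma expo_eqI: "(\<And>l. fst e $ l = fst f $ l) \<Longrightarrow> (\<And>l. snd e $ l = snd f $ l) \<Longrightarrow> e = f" for e f :: "'i::finite expo"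
  by (simp add: prod_eq_iff vec_eq_iff)

lemma escale_add: "escale (m + n) e = escale m e + escale n e"
  by (simp add: escale_def vec_eq_iff distrib_right)

definition indep :: "('i::finite \<Rightarrow> 'i expo) \<Rightarrow> bool" where
  "indep v \<longleftrightarrow> (\<forall>a :: 'i \<Rightarrow> int. (\<Sum>i\<in>UNIV. escale (a i) (v i)) = 0 \<longrightarrow> (\<forall>i. a i = 0))"

lemma fst_sum: "fst (\<Sum>i\<in>I. g i) = (\<Sum>i\<in>I. fst (g i))" for g :: "'k \<Rightarrow> 'i::finite expo"
  by (induction I rule: infinite_finite_induct) auto

lemma snd_sum: "snd (\<Sum>i\<in>I. g i) = (\<Sum>i\<in>I. snd (g i))" for g :: "'k \<Rightarrow> 'i::finite expo"
  by (induction I rule: infinite_finite_induct) auto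

text \<open>The transformation is invertible over the integers. By \<open>hatted_mutation\<close>,
  mutation at \<open>k\<close> acts in this way on the leading exponents of the hatted
  coefficients.\<close>

lemma indep_shear:
  fixes v :: "'i::finite \<Rightarrow> 'i expo"
  assumes "indep v" "\<And>j. j \<noteq> k \<Longrightarrow> w j = v j + escale (m j) (v k)" "w k = - v k"
  shows "indep w"
  unfolding indep_def
proof (intro allI impI)
  fix a i assume a: "(\<Sum>j\<in>UNIV. escale (a j) (w j)) = 0"
  define b where "b j = (if j = k then - a k + (\<Sum>j\<in>UNIV - {k}. a j * m j) else a j)" for j
  have "(\<Sum>j\<in>UNIV. escale (a j) (w j)) = escale (a k) (w k) + (\<Sum>j\<in>UNIV - {k}. escale (a j) (v j + escale (m j) (v k)))"
    by (subst sum.remove[of _ k]) (auto simp: assms(2))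
  also have "\<dots> = escale (- a k + (\<Sum>j\<in>UNIV - {k}. a j * m j)) (v k) + (\<Sum>j\<in>UNIV - {k}. escale (a j) (v j))"
    by (simp add: assms(3) prod_eq_iff escale_def fst_sum snd_sum vec_eq_iff sum.distrib sum_distrib_left sum_distrib_right algebra_simps)
  also have "\<dots> = (\<Sum>j\<in>UNIV. escale (b j) (v j))"
    by (subst (3) sum.remove[of _ k]) (auto simp: b_def)
  finally have b: "\<forall>j. b j = 0" using a assms(1) unfolding indep_def by metis
  then have aj: "a j = 0" if "j \<noteq> k" for j using that b_def[of j] by simp
  have "(\<Sum>j\<in>UNIV - {k}. a j * m j) = 0" using aj by (intro sum.neutral) auto
  then have "a k = 0" using b[rule_format, of k] by (simp add: b_def)
  then show "a i = 0" using aj by (cases "i = k") auto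
qed

lemma indep_nonzero: "indep v \<Longrightarrow> v k \<noteq> 0"
proof
  assume v: "indep v" and k: "v k = 0"
  have "(\<Sum>i\<in>UNIV. escale (if i = k then 1 else 0) (v i)) = 0"
    using k by (intro sum.neutral) (auto simp: escale_def zero_prod_def)
  then have "\<forall>i. (if i = k then 1 else 0 :: int) = 0"
    using v[unfolded indep_def, rule_format, of "\<lambda>i. if i = k then 1 else 0"] by blast
  then have "(if k = k then 1 else 0 :: int) = 0" by (rule spec)
  then show False by simp
qed

lemma axis_combination:
  fixes a :: "'i::finite \<Rightarrow> int"
  shows "(\<Sum>j\<in>UNIV. a j *s axis j 1) = (\<chi> j. a j)"
proof -
  have "(\<Sum>j\<in>UNIV. a j * (axis j 1 :: 'i weight) $ i) = (\<Sum>j\<in>UNIV. if j = i then a j else 0)" for i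
    by (intro sum.cong) (auto simp: axis_def)
  then show ?thesis by (simp add: vec_eq_iff)
qed

lemma indep_axis: "(\<And>j. snd (v j) = axis j 1) \<Longrightarrow> indep v"
  unfolding indep_def
proof (intro allI impI)
  fix a :: "'a \<Rightarrow> int" and i assume v: "\<And>j. snd (v j) = axis j 1" and "(\<Sum>j\<in>UNIV. escale (a j) (v j)) = 0"
  then have "snd (\<Sum>j\<in>UNIV. escale (a j) (v j)) = 0" by simp
  then have "(\<chi> j. a j) = 0" by (simp add: snd_sum escale_def v axis_combination)
  then show "a i = 0" by (simp add: vec_eq_iff)
qed

text \<open>One coordinate of the mutation rule for leading exponents: \<open>G\<close> belongs to
  the cluster, \<open>y\<close> to the coefficients, \<open>r\<close> to the tropical sum of
  \<open>y k\<close> and the unit, which cancels, and \<open>H\<close> to the new variable. The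
  value \<open>1\<close> or \<open>0\<close> of \<open>\<theta>\<close> tells which of the two
  exchange monomials leads; the multiple of the hatted exponent \<open>k\<close> is then the
  positive part of minus the entry, or of the entry.\<close>

lemma hatted_mutation:
  fixes G y :: "'i::finite \<Rightarrow> int"
  assumes "B $ k $ k = 0" and H: "H = (\<Sum>i\<in>UNIV. pos_part (- (B $ i $ k)) * G i)
      + \<theta> * (y k + (\<Sum>i\<in>UNIV. B $ i $ k * G i)) - r - G k"
  shows "j \<noteq> k \<Longrightarrow> y j + pos_part (B $ k $ j) * y k - B $ k $ j * r + (\<Sum>i\<in>UNIV. mutate_B k B $ i $ j * (G(k := H)) i)
      = y j + (\<Sum>i\<in>UNIV. B $ i $ j * G i)
        + (pos_part (B $ k $ j) - \<theta> * B $ k $ j) * (y k + (\<Sum>i\<in>UNIV. B $ i $ k * G i))" (is "_ \<Longrightarrow> ?L = ?R")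
    and "- y k + (\<Sum>i\<in>UNIV. mutate_B k B $ i $ k * (G(k := H)) i) = - (y k + (\<Sum>i\<in>UNIV. B $ i $ k * G i))"
proof -
  define P M s where "P = (\<Sum>i\<in>UNIV - {k}. pos_part (B $ i $ k) * G i)"
    and "M = (\<Sum>i\<in>UNIV - {k}. pos_part (- (B $ i $ k)) * G i)"
    and "s j = (\<Sum>i\<in>UNIV - {k}. B $ i $ j * G i)" for j
  have s: "(\<Sum>i\<in>UNIV. B $ i $ j * G i) = B $ k $ j * G k + s j" for j
    unfolding s_def by (subst sum.remove[of _ k]) auto
  have "pos_part b - pos_part (- b) = b" for b by (simp add: pos_part_def)
  then have PM: "s k = P - M" unfolding s_def P_def M_def sum_subtractf[symmetric]
    by (intro sum.cong) (simp_all add: left_diff_distrib[symmetric])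
  have M: "(\<Sum>i\<in>UNIV. pos_part (- (B $ i $ k)) * G i) = M"
    unfolding M_def by (subst sum.remove[of _ k]) (auto simp: assms(1) pos_part_def)
  have H': "H = M + \<theta> * (y k + s k) - r - G k" unfolding H M s by (simp add: assms(1))
  show "?L = ?R" if "j \<noteq> k"
  proof -
    have "(\<Sum>i\<in>UNIV. mutate_B k B $ i $ j * (G(k := H)) i) = - (B $ k $ j) * H
        + (\<Sum>i\<in>UNIV - {k}. B $ i $ j * G i + pos_part (B $ k $ j) * (pos_part (B $ i $ k) * G i)
             - pos_part (- (B $ k $ j)) * (pos_part (- (B $ i $ k)) * G i))"
      using that by (subst sum.remove[of _ k]) (auto simp: mutate_B_def algebra_simps intro!: sum.cong)
    also have "\<dots> = - (B $ k $ j) * H + s j + pos_part (B $ k $ j) * P - pos_part (- (B $ k $ j)) * M"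
      by (simp add: s_def P_def M_def sum.distrib sum_subtractf sum_distrib_left)
    finally have 1: "(\<Sum>i\<in>UNIV. mutate_B k B $ i $ j * (G(k := H)) i)
        = - (B $ k $ j) * H + s j + pos_part (B $ k $ j) * P - pos_part (- (B $ k $ j)) * M" .
    have "pos_part (- (B $ k $ j)) = pos_part (B $ k $ j) - B $ k $ j" by (simp add: pos_part_def)
    then show ?thesis unfolding 1 s unfolding H' PM assms(1) \<open>pos_part (- (B $ k $ j)) = _\<close> by (simp add: algebra_simps)
  qed
  have "(\<Sum>i\<in>UNIV. mutate_B k B $ i $ k * (G(k := H)) i) = - s k"
    unfolding s_def by (subst sum.remove[of _ k]) (auto simp: mutate_B_def assms(1) sum_negf[symmetric] intro!: sum.cong)
  then show "- y k + (\<Sum>i\<in>UNIV. mutate_B k B $ i $ k * (G(k := H)) i) = - (y k + (\<Sum>i\<in>UNIV. B $ i $ k * G i))"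
    unfolding s by (simp add: assms(1))
qed

text \<open>The ambient field carries no scalar multiplication by complex numbers, so they enter
  through the ring homomorphism \<open>\<kappa>\<close>.\<close>

locale independent_monomials =
  fixes \<kappa> :: "complex \<Rightarrow> 'f::field" and x u :: "'i::{finite,linorder} \<Rightarrow> 'f"
  assumes kappa_add: "\<kappa> (a + b) = \<kappa> a + \<kappa> b" and kappa_mult: "\<kappa> (a * b) = \<kappa> a * \<kappa> b" and kappa_one: "\<kappa> 1 = 1"
    and x_nz: "x i \<noteq> 0" and u_nz: "u i \<noteq> 0"
    and independent: "finite E \<Longrightarrow>
      (\<Sum>e\<in>E. \<kappa> (c e) * ((\<Prod>i\<in>UNIV. x i powi (fst e $ i)) * (\<Prod>i\<in>UNIV. u i powi (snd e $ i)))) = 0 \<Longrightarrow>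
      e \<in> E \<Longrightarrow> c e = 0"
begin

definition mon :: "'i expo \<Rightarrow> 'f" where
  "mon e = (\<Prod>i\<in>UNIV. x i powi (fst e $ i)) * (\<Prod>i\<in>UNIV. u i powi (snd e $ i))"

lemma kappa_zero [simp]: "\<kappa> 0 = 0"
proof -
  have "\<kappa> 0 + \<kappa> 0 = \<kappa> 0 + 0" using kappa_add[of 0 0] by (simp only: add_0_right)
  then show ?thesis by (rule add_left_imp_eq)
qed

lemma kappa_minus: "\<kappa> (- a) = - \<kappa> a"
  using kappa_add[of a "-a"] by (simp add: eq_neg_iff_add_eq_0 add.commute)

lemma kappa_diff: "\<kappa> (a - b) = \<kappa> a - \<kappa> b"
  using kappa_add[of a "-b"] by (simp add: kappa_minus)

lemma kappa_of_nat: "\<kappa> (of_nat n) = of_nat n"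
  by (induction n) (simp_all add: kappa_add kappa_one del: of_nat_Suc add: of_nat_Suc)

lemma kappa_of_int: "\<kappa> (of_int n) = of_int n"
  by (cases n) (simp_all add: kappa_of_nat kappa_minus kappa_diff kappa_one)

lemma mon_zero [simp]: "mon 0 = 1"
  by (simp add: mon_def)

lemma mon_add: "mon (e + f) = mon e * mon f"
  by (simp add: mon_def power_int_add x_nz u_nz prod.distrib)

text \<open>Exponents may repeat in such a sum, which makes closure under sums and products
  immediate; \<open>spn_explicit\<close> collects equal exponents.\<close>

inductive_set spn :: "complex set \<Rightarrow> ('i expo \<Rightarrow> bool) \<Rightarrow> 'f set" for R P where
  zero: "0 \<in> spn R P"
| step: "w \<in> spn R P \<Longrightarrow> P e \<Longrightarrow> a \<in> R \<Longrightarrow> w + \<kappa> a * mon e \<in> spn R P"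

lemma spn_add: "v \<in> spn R P \<Longrightarrow> w \<in> spn R P \<Longrightarrow> w + v \<in> spn R P"
proof (induction v rule: spn.induct)
  case (step v e a)
  then have "(w + v) + \<kappa> a * mon e \<in> spn R P" by (intro spn.step)
  then show ?case by (simp add: add.assoc)
qed simp

lemma spn_mono: "w \<in> spn R P \<Longrightarrow> R \<subseteq> R' \<Longrightarrow> (\<And>e. P e \<Longrightarrow> P' e) \<Longrightarrow> w \<in> spn R' P'"
  by (induction rule: spn.induct) (auto intro: spn.intros)

lemma spn_shift:
  assumes "w \<in> spn R P" "\<And>a b. a \<in> R \<Longrightarrow> b \<in> R \<Longrightarrow> a * b \<in> R" "b \<in> R" "\<And>e. P e \<Longrightarrow> P' (e + f)"
  shows "w * (\<kappa> b * mon f) \<in> spn R P'"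
  using assms(1)
proof induction
  case (step w e a)
  have "w * (\<kappa> b * mon f) + \<kappa> (a * b) * mon (e + f) \<in> spn R P'"
    using step assms by (intro spn.step) auto
  then show ?case by (simp add: kappa_mult mon_add algebra_simps)
qed (simp add: spn.zero)

lemma spn_mult:
  assumes "v \<in> spn R P2" "w \<in> spn R P1" "\<And>a b. a \<in> R \<Longrightarrow> b \<in> R \<Longrightarrow> a * b \<in> R" "\<And>e f. P1 e \<Longrightarrow> P2 f \<Longrightarrow> P' (e + f)"
  shows "w * v \<in> spn R P'"
  using assms(1)
proof induction
  case (step v f b)
  have "w * (\<kappa> b * mon f) \<in> spn R P'"
    by (rule spn_shift[OF assms(2,3)]) (use step assms(4) in auto)
  then have "w * v + w * (\<kappa> b * mon f) \<in> spn R P'" using step by (intro spn_add)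
  then show ?case by (simp add: algebra_simps)
qed (simp add: spn.zero)

lemma spn_uminus: "w \<in> spn R P \<Longrightarrow> (\<And>a. a \<in> R \<Longrightarrow> - a \<in> R) \<Longrightarrow> - w \<in> spn R P"
proof (induction rule: spn.induct)
  case (step w e a)
  then have "- w + \<kappa> (- a) * mon e \<in> spn R P" by (intro spn.step) auto
  then show ?case by (simp add: kappa_minus)
qed (simp add: spn.zero)

lemma spn_explicit:
  "w \<in> spn R P \<Longrightarrow> \<exists>E c. finite E \<and> (\<forall>e\<in>E. P e) \<and> w = (\<Sum>e\<in>E. \<kappa> (c e) * mon e)"
proof (induction rule: spn.induct)
  case zero then show ?case by (intro exI[of _ "{}"]) auto
next
  case (step w e a)
  then obtain E c where E: "finite E" "\<forall>e\<in>E. P e" "w = (\<Sum>e\<in>E. \<kappa> (c e) * mon e)" by blast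
  define c' where "c' f = (if f \<in> E then c f else 0) + (if f = e then a else 0)" for f
  have "(\<Sum>f\<in>insert e E. \<kappa> (c' f) * mon f) = (\<Sum>f\<in>insert e E. \<kappa> (if f \<in> E then c f else 0) * mon f) + (\<Sum>f\<in>insert e E. \<kappa> (if f = e then a else 0) * mon f)"
    by (simp add: c'_def kappa_add ring_distribs sum.distrib)
  also have "(\<Sum>f\<in>insert e E. \<kappa> (if f \<in> E then c f else 0) * mon f) = w"
    unfolding E(3) by (rule sum.mono_neutral_cong_right) (use E in auto)
  also have "(\<Sum>f\<in>insert e E. \<kappa> (if f = e then a else 0) * mon f) = \<kappa> a * mon e"
    using E(1) by (subst sum.mono_neutral_right[of _ "{e}"]) auto
  finally show ?case using E step.hyps by (intro exI[of _ "insert e E"] exI[of _ c']) auto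
qed

lemma coefficient_zero:
  assumes "w \<in> spn UNIV (\<lambda>f. f \<noteq> e)" "\<kappa> a * mon e + w = 0" shows "a = 0"
proof -
  obtain E c where E: "finite E" "\<forall>f\<in>E. f \<noteq> e" "w = (\<Sum>f\<in>E. \<kappa> (c f) * mon f)" using spn_explicit[OF assms(1)] by blast
  have "(\<Sum>f\<in>insert e E. \<kappa> ((c(e := a)) f) * mon f) = \<kappa> a * mon e + (\<Sum>f\<in>E. \<kappa> ((c(e := a)) f) * mon f)"
    using E by (subst sum.insert) auto
  also have "(\<Sum>f\<in>E. \<kappa> ((c(e := a)) f) * mon f) = w" unfolding E(3) using E(2) by (intro sum.cong) auto
  finally have "(\<Sum>f\<in>insert e E. \<kappa> ((c(e := a)) f) * mon f) = 0" using assms(2) by simp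
  then have "(c(e := a)) e = 0"
    unfolding mon_def by (intro independent[of "insert e E" "c(e := a)" e]) (use E in auto)
  then show ?thesis by simp
qed

lemma split_coefficient:
  "v \<in> spn \<int> P \<Longrightarrow> \<exists>a\<in>\<int>. \<exists>v'\<in>spn \<int> (\<lambda>f. f \<noteq> e). v = \<kappa> a * mon e + v'"
proof (induction rule: spn.induct)
  case zero then show ?case by (intro bexI[of _ 0] bexI[of _ 0]) (auto intro: spn.zero)
next
  case (step v f b)
  then obtain a v' where av: "a \<in> \<int>" "v' \<in> spn \<int> (\<lambda>f. f \<noteq> e)" "v = \<kappa> a * mon e + v'" by blast
  show ?case
  proof (cases "f = e")
    case True
    then show ?thesis using av step.hyps by (intro bexI[of _ "a + b"] bexI[of _ v']) (auto simp: kappa_add algebra_simps)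
  next
    case False
    then show ?thesis using av step.hyps
      by (intro bexI[of _ a] bexI[of _ "v' + \<kappa> b * mon f"]) (auto intro: spn.step simp: add.assoc)
  qed
qed

lemma integral_coefficient:
  assumes "w \<in> spn UNIV (\<lambda>f. f \<noteq> e)" "\<kappa> a * mon e + w \<in> spn \<int> P" shows "a \<in> \<int>"
proof -
  obtain b v' where b: "b \<in> \<int>" "v' \<in> spn \<int> (\<lambda>f. f \<noteq> e)" "\<kappa> a * mon e + w = \<kappa> b * mon e + v'"
    using split_coefficient[OF assms(2), of e] by blast
  have "w + - v' \<in> spn UNIV (\<lambda>f. f \<noteq> e)"
    by (intro spn_add spn_uminus assms(1) spn_mono[OF b(2)]) auto
  moreover have "\<kappa> (a - b) * mon e + (w + - v') = 0" using b(3) by (simp add: kappa_diff algebra_simps)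
  ultimately have "a - b = 0" by (rule coefficient_zero)
  then show ?thesis using b(1) by simp
qed

definition monic :: "'i expo \<Rightarrow> 'f \<Rightarrow> bool" where
  "monic e w \<longleftrightarrow> (\<exists>v\<in>spn \<int> (\<lambda>f. elt f e). w = mon e + v)"

lemma monic_nz: "monic e w \<Longrightarrow> w \<noteq> 0"
proof
  assume "monic e w" "w = 0"
  then obtain v where "v \<in> spn \<int> (\<lambda>f. elt f e)" "\<kappa> 1 * mon e + v = 0" unfolding monic_def by (auto simp: kappa_one)
  moreover from this(1) have "v \<in> spn UNIV (\<lambda>f. f \<noteq> e)" by (rule spn_mono) (auto simp: elt_irrefl)
  ultimately have "(1::complex) = 0" by (intro coefficient_zero)
  then show False by simp
qed

lemma monic_mon: "monic e (mon e)"
  unfolding monic_def by (intro bexI[OF _ spn.zero]) simp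

lemma monic_spn: "monic e w \<Longrightarrow> w \<in> spn \<int> (\<lambda>f. f = e \<or> elt f e)"
proof -
  assume "monic e w"
  then obtain v where v: "v \<in> spn \<int> (\<lambda>f. elt f e)" "w = v + \<kappa> 1 * mon e" unfolding monic_def by (auto simp: kappa_one)
  from v(1) have "v \<in> spn \<int> (\<lambda>f. f = e \<or> elt f e)" by (rule spn_mono) auto
  then show ?thesis unfolding v(2) by (intro spn.step) auto
qed

lemma monic_mult:
  assumes "monic e w" "monic f v" shows "monic (e + f) (w * v)"
proof -
  obtain w' v' where w: "w' \<in> spn \<int> (\<lambda>g. elt g e)" "w = mon e + w'" and v: "v' \<in> spn \<int> (\<lambda>g. elt g f)" "v = mon f + v'"
    using assms unfolding monic_def by blast
  let ?P = "\<lambda>g. elt g (e + f)"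
  have "w' * (\<kappa> 1 * mon f) \<in> spn \<int> ?P" by (rule spn_shift[OF w(1)]) (auto simp: elt_add)
  moreover have "v' * (\<kappa> 1 * mon e) \<in> spn \<int> ?P" by (rule spn_shift[OF v(1)]) (auto simp: elt_add add.commute[of _ e])
  moreover have "w' * v' \<in> spn \<int> ?P" by (rule spn_mult[OF v(1) w(1)]) (auto intro: elt_add_mono)
  ultimately have "w' * (\<kappa> 1 * mon f) + v' * (\<kappa> 1 * mon e) + w' * v' \<in> spn \<int> ?P" by (intro spn_add)
  moreover have "w * v = mon (e + f) + (w' * (\<kappa> 1 * mon f) + v' * (\<kappa> 1 * mon e) + w' * v')"
    by (simp add: w v mon_add kappa_one algebra_simps)
  ultimately show ?thesis unfolding monic_def by blast
qed

lemma monic_add: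
  assumes "monic e w" "monic f v" "elt f e" shows "monic e (w + v)"
proof -
  obtain w' where w: "w' \<in> spn \<int> (\<lambda>g. elt g e)" "w = mon e + w'" using assms(1) unfolding monic_def by blast
  have "v \<in> spn \<int> (\<lambda>g. elt g e)"
    by (rule spn_mono[OF monic_spn[OF assms(2)]]) (use assms(3) in \<open>auto elim: elt_trans\<close>)
  then have "w' + v \<in> spn \<int> (\<lambda>g. elt g e)" using w(1) by (intro spn_add)
  then show ?thesis unfolding monic_def w(2) by (intro bexI[of _ "w' + v"]) (auto simp: add.assoc)
qed

text \<open>Quotients are allowed because mutation divides, and no Laurent property is presupposed.
  Leading coefficient \<open>1\<close> above and below is the integrality information that
  survives.\<close>

definition has_lead :: "'f \<Rightarrow> 'i expo \<Rightarrow> bool" where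
  "has_lead z e \<longleftrightarrow> (\<exists>p q P Q. monic p P \<and> monic q Q \<and> z * Q = P \<and> e = p - q)"

lemma has_leadI: "monic p P \<Longrightarrow> monic q Q \<Longrightarrow> z * Q = P \<Longrightarrow> e = p - q \<Longrightarrow> has_lead z e"
  unfolding has_lead_def by blast

lemma has_lead_nz: "has_lead z e \<Longrightarrow> z \<noteq> 0"
  unfolding has_lead_def using monic_nz by fastforce

lemma has_lead_mon: "has_lead (mon e) e"
  by (rule has_leadI[OF monic_mon[of e] monic_mon[of 0]]) simp_all

lemma has_lead_mult: "has_lead z e \<Longrightarrow> has_lead z' e' \<Longrightarrow> has_lead (z * z') (e + e')"
proof -
  assume "has_lead z e" "has_lead z' e'"
  then obtain p q P Q p' q' P' Q' where *: "monic p P" "monic q Q" "z * Q = P" "e = p - q"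
    "monic p' P'" "monic q' Q'" "z' * Q' = P'" "e' = p' - q'" unfolding has_lead_def by blast
  show ?thesis
    by (rule has_leadI[OF monic_mult[OF *(1,5)] monic_mult[OF *(2,6)]]) (use * in \<open>auto simp: algebra_simps\<close>)
qed

lemma has_lead_divide: "has_lead z e \<Longrightarrow> has_lead z' e' \<Longrightarrow> has_lead (z / z') (e - e')"
proof -
  assume z': "has_lead z e" "has_lead z' e'"
  then obtain p q P Q p' q' P' Q' where *: "monic p P" "monic q Q" "z * Q = P" "e = p - q"
    "monic p' P'" "monic q' Q'" "z' * Q' = P'" "e' = p' - q'" unfolding has_lead_def by blast
  show ?thesis
    by (rule has_leadI[OF monic_mult[OF *(1,6)] monic_mult[OF *(2,5)]])
      (use * has_lead_nz[OF z'(2)] in \<open>auto simp: algebra_simps\<close>)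
qed

lemma has_lead_one: "has_lead 1 0"
  using has_lead_mon[of 0] by simp

lemma has_lead_prod: "(\<And>i. i \<in> I \<Longrightarrow> has_lead (z i) (g i)) \<Longrightarrow> has_lead (\<Prod>i\<in>I. z i) (\<Sum>i\<in>I. g i)"
  by (induction I rule: infinite_finite_induct) (simp_all add: has_lead_one has_lead_mult)

lemma has_lead_power: "has_lead z e \<Longrightarrow> n \<ge> 0 \<Longrightarrow> has_lead (z powi n) (escale n e)"
proof -
  assume z: "has_lead z e" and "n \<ge> 0"
  have "has_lead (z ^ k) (escale (int k) e)" for k
  proof (induction k)
    case 0 then show ?case using has_lead_one by (simp add: escale_def zero_prod_def)
  next
    case (Suc k)
    have "escale (int (Suc k)) e = e + escale (int k) e" by (simp add: escale_def prod_eq_iff vec_eq_iff algebra_simps)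
    then show ?case using has_lead_mult[OF z Suc] by simp
  qed
  from this[of "nat n"] \<open>n \<ge> 0\<close> show ?thesis by (simp add: power_int_nonneg_exp)
qed

text \<open>Over the common denominator the two leading terms differ, so the larger one survives
  with coefficient \<open>1\<close>. Equal leads would add up to coefficient
  \<open>2\<close>.\<close>

lemma has_lead_add:
  assumes "has_lead z e" "has_lead z' e'" "e \<noteq> e'" shows "has_lead (z + z') e \<or> has_lead (z + z') e'"
proof -
  obtain p q P Q p' q' P' Q' where *: "monic p P" "monic q Q" "z * Q = P" "e = p - q"
    "monic p' P'" "monic q' Q'" "z' * Q' = P'" "e' = p' - q'" using assms(1,2) unfolding has_lead_def by blast
  have eq: "(z + z') * (Q * Q') = P * Q' + P' * Q" using *(3,7) by (simp add: algebra_simps)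
  have "p + q' \<noteq> p' + q" using assms(3) *(4,8) by (auto simp: algebra_simps)
  then consider "elt (p' + q) (p + q')" | "elt (p + q') (p' + q)" using elt_total by blast
  then show ?thesis
  proof cases
    case 1
    have "has_lead (z + z') e"
      by (rule has_leadI[OF monic_add[OF monic_mult[OF *(1,6)] monic_mult[OF *(5,2)] 1] monic_mult[OF *(2,6)] eq])
        (simp add: *(4))
    then show ?thesis ..
  next
    case 2
    have "has_lead (z + z') e'"
      by (rule has_leadI[OF monic_add[OF monic_mult[OF *(5,2)] monic_mult[OF *(1,6)] 2] monic_mult[OF *(2,6)]])
        (use eq in \<open>simp_all add: *(8) add.commute\<close>)
    then show ?thesis ..
  qed
qed

text \<open>The leading exponent of the hatted coefficient \<open>j\<close> of a seed, when
  \<open>g\<close> gives those of its cluster.\<close>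

definition hat_lead :: "('i \<Rightarrow> 'i weight) \<Rightarrow> 'i int_matrix \<Rightarrow> ('i \<Rightarrow> 'i expo) \<Rightarrow> 'i \<Rightarrow> 'i expo" where
  "hat_lead Y B g j = (0, Y j) + (\<Sum>i\<in>UNIV. escale (B $ i $ j) (g i))"

text \<open>Independence makes each \<open>hat_lead\<close> non-zero and, unlike mere non-vanishing,
  is preserved by mutation. Skew-symmetrizability supplies the zero diagonal of the exchange
  matrix.\<close>

definition seed_inv :: "('i, 'f) seed \<Rightarrow> bool" where
  "seed_inv S \<longleftrightarrow> (case S of (X, Y, B) \<Rightarrow>
     (\<exists>g. (\<forall>i. has_lead (X i) (g i)) \<and> indep (hat_lead Y B g)) \<and>
     (\<exists>d :: 'i \<Rightarrow> real. (\<forall>i. d i > 0) \<and> (\<forall>i j. d i * of_int (B$i$j) = - (d j * of_int (B$j$i)))))"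

lemma skew_mutate:
  fixes B :: "'i int_matrix" and d :: "'i \<Rightarrow> real"
  assumes d: "\<forall>i. d i > 0" and B: "\<forall>i j. d i * of_int (B$i$j) = - (d j * of_int (B$j$i))"
  shows "d i * of_int (mutate_B k B $ i $ j) = - (d j * of_int (mutate_B k B $ j $ i))"
proof (cases "i = k \<or> j = k")
  case True
  then show ?thesis using B[rule_format, of i j] by (auto simp: mutate_B_def)
next
  case False
  have pp: "d a * of_int (pos_part (B$a$b)) = d b * of_int (pos_part (- (B$b$a)))" for a b
  proof -
    have "d a * max (of_int (B$a$b)) 0 = max (d a * of_int (B$a$b)) 0"
      using d[rule_format, of a] by (simp add: max_mult_distrib_left)
    also have "\<dots> = max (d b * of_int (- (B$b$a))) 0" using B[rule_format, of a b] by simp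
    also have "\<dots> = d b * max (of_int (- (B$b$a))) 0"
      using d[rule_format, of b] by (simp add: max_mult_distrib_left)
    finally show ?thesis by (simp add: pos_part_def)
  qed
  define P where "P a b = (of_int (pos_part (B$a$b)) :: real)" for a b
  define M where "M a b = (of_int (pos_part (- (B$a$b))) :: real)" for a b
  have PM: "d a * P a b = d b * M b a" for a b using pp by (simp add: P_def M_def)
  have "d i * (P i k * P k j) = (d i * P i k) * P k j" by simp
  also have "\<dots> = M k i * (d k * P k j)" by (simp add: PM mult.commute)
  also have "\<dots> = d j * (M j k * M k i)" by (simp add: PM[of k j] mult_ac)
  finally have 1: "d i * (P i k * P k j) = d j * (M j k * M k i)" .
  have "d i * (M i k * M k j) = (d i * M i k) * M k j" by simp
  also have "\<dots> = P k i * (d k * M k j)" by (simp add: PM[of k i, symmetric] mult_ac)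
  also have "\<dots> = d j * (P j k * P k i)" by (simp add: PM[of j k, symmetric] mult_ac)
  finally have 2: "d i * (M i k * M k j) = d j * (P j k * P k i)" .
  have m: "real_of_int (mutate_B k B $ a $ b) = of_int (B$a$b) + P a k * P k b - M a k * M k b" if "\<not> (a = k \<or> b = k)" for a b
    using that by (simp add: mutate_B_def P_def M_def)
  show ?thesis using m[of i j] m[of j i] False 1 2 B[rule_format, of i j] by (simp add: ring_distribs)
qed

text \<open>The leads of the two exchange monomials differ by \<open>hat_lead Y B g k\<close>, which
  is non-zero by independence. So their sum has a lead, and \<open>hatted_mutation\<close> shows the
  new exponents to be a shear of the old ones.\<close>

lemma seed_inv_mutate:
  assumes "seed_inv S" shows "seed_inv (mutate u k S)"
proof -
  obtain X Y B where S: "S = (X, Y, B)" by (cases S)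
  obtain g d where g: "\<forall>i. has_lead (X i) (g i)" "indep (hat_lead Y B g)"
    and d: "\<forall>i. d i > (0::real)" "\<forall>i j. d i * of_int (B$i$j) = - (d j * of_int (B$j$i))"
    using assms unfolding seed_inv_def S by auto
  have "d k * of_int (B$k$k) = 0" using d(2)[rule_format, of k k] by linarith
  moreover have "d k \<noteq> 0" using d(1)[rule_format, of k] by simp
  ultimately have Bkk: "B$k$k = 0" by simp
  let ?l = "\<lambda>s. \<Sum>i\<in>UNIV. escale (pos_part (s * B$i$k)) (g i)"
  have tev: "trop_eval u b = mon (0, b)" for b by (simp add: trop_eval_def mon_def)
  have lead: "has_lead (\<Prod>i\<in>UNIV. X i powi pos_part (s * B$i$k)) (?l s)" for s
    using g(1) by (intro has_lead_prod has_lead_power) (auto simp: pos_part_def)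
  let ?v1 = "trop_eval u (Y k) * (\<Prod>i\<in>UNIV. X i powi pos_part (B$i$k))"
  let ?v2 = "\<Prod>i\<in>UNIV. X i powi pos_part (- (B$i$k))"
  have l1: "has_lead ?v1 ((0, Y k) + ?l 1)"
    unfolding tev using has_lead_mult[OF has_lead_mon lead[of 1]] by simp
  have l2: "has_lead ?v2 (?l (-1))" using lead[of "-1"] by simp
  have pp: "pos_part (1 * b) = pos_part (-1 * b) + b" for b by (simp add: pos_part_def)
  have "escale (pos_part (1 * b)) e = escale (pos_part (-1 * b)) e + escale b e" for b and e :: "'i expo"
    unfolding pp by (rule escale_add)
  then have "?l 1 = ?l (-1) + (\<Sum>i\<in>UNIV. escale (B$i$k) (g i))" by (simp only: sum.distrib[symmetric])
  then have diff: "(0, Y k) + ?l 1 = ?l (-1) + hat_lead Y B g k" by (simp only: hat_lead_def ac_simps)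
  have "(0, Y k) + ?l 1 \<noteq> ?l (-1)" using indep_nonzero[OF g(2), of k] unfolding diff by simp
  \<comment> \<open>\<open>\<theta>\<close> is \<open>1\<close> if the monomial with the coefficient
    leads and \<open>0\<close> otherwise, which unifies the two cases below.\<close>
  from has_lead_add[OF l1 l2 this] obtain \<theta> where th: "has_lead (?v1 + ?v2) (?l (-1) + escale \<theta> (hat_lead Y B g k))"
  proof
    assume "has_lead (?v1 + ?v2) ((0, Y k) + ?l 1)"
    then show ?thesis unfolding diff by (intro that[of 1]) (simp add: escale_def)
  next
    assume "has_lead (?v1 + ?v2) (?l (-1))"
    then show ?thesis by (intro that[of 0]) (simp add: escale_def zero_prod_def[symmetric])
  qed
  let ?r = "trop_add (Y k) 0"
  define h where "h = ?l (-1) + escale \<theta> (hat_lead Y B g k) - ((0, ?r) + g k)"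
  let ?X = "mutate_x u k B Y X" and ?Y = "mutate_y k B Y" and ?B = "mutate_B k B"
  have "has_lead (?X k) h"
    unfolding mutate_x_def h_def
    using has_lead_divide[OF th has_lead_mult[OF has_lead_mon[of "(0, ?r)"] g(1)[rule_format, of k]]]
    by (simp add: tev)
  then have leads: "\<forall>i. has_lead (?X i) ((g(k := h)) i)" using g(1) by (auto simp: mutate_x_def)
  have hat_fst: "fst (hat_lead Y' B' g' j) $ l = 0 + (\<Sum>i\<in>UNIV. B'$i$j * fst (g' i) $ l)"
    and hat_snd: "snd (hat_lead Y' B' g' j) $ l = Y' j $ l + (\<Sum>i\<in>UNIV. B'$i$j * snd (g' i) $ l)" for Y' B' g' j l
    by (simp_all add: hat_lead_def fst_sum snd_sum escale_def)
  have upd: "fst ((g(k := h)) i) $ l = ((\<lambda>i. fst (g i) $ l)(k := fst h $ l)) i"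
    "snd ((g(k := h)) i) $ l = ((\<lambda>i. snd (g i) $ l)(k := snd h $ l)) i" for i l by simp_all
  have h1: "fst h $ l = (\<Sum>i\<in>UNIV. pos_part (- (B $ i $ k)) * fst (g i) $ l)
      + \<theta> * (0 + (\<Sum>i\<in>UNIV. B $ i $ k * fst (g i) $ l)) - 0 - fst (g k) $ l" for l
    unfolding h_def by (simp add: fst_sum escale_def hat_fst)
  have h2: "snd h $ l = (\<Sum>i\<in>UNIV. pos_part (- (B $ i $ k)) * snd (g i) $ l)
      + \<theta> * (Y k $ l + (\<Sum>i\<in>UNIV. B $ i $ k * snd (g i) $ l)) - ?r $ l - snd (g k) $ l" for l
    unfolding h_def by (simp add: snd_sum escale_def hat_snd)
  note m1 = hatted_mutation[where y = "\<lambda>_. 0", OF Bkk h1]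
  note m2 = hatted_mutation[where y = "\<lambda>i. Y i $ _", OF Bkk h2]
  have "indep (hat_lead ?Y ?B (g(k := h)))"
  proof (rule indep_shear[OF g(2), of k _ "\<lambda>j. pos_part (B$k$j) - \<theta> * B$k$j"])
    fix j assume j: "j \<noteq> k"
    show "hat_lead ?Y ?B (g(k := h)) j = hat_lead Y B g j + escale (pos_part (B$k$j) - \<theta> * B$k$j) (hat_lead Y B g k)"
    proof (rule expo_eqI)
      fix l
      show "fst (hat_lead ?Y ?B (g(k := h)) j) $ l
          = fst (hat_lead Y B g j + escale (pos_part (B$k$j) - \<theta> * B$k$j) (hat_lead Y B g k)) $ l"
        using m1(1)[OF j, of l] unfolding fst_add vector_add_component escale_def fst_conv vector_smult_component hat_fst upd by simp
    next
      fix l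
      have y: "?Y j $ l = Y j $ l + pos_part (B$k$j) * Y k $ l - B$k$j * ?r $ l" using j by (simp add: mutate_y_def)
      show "snd (hat_lead ?Y ?B (g(k := h)) j) $ l
          = snd (hat_lead Y B g j + escale (pos_part (B$k$j) - \<theta> * B$k$j) (hat_lead Y B g k)) $ l"
        using m2(1)[OF j, of l] unfolding snd_add vector_add_component escale_def snd_conv vector_smult_component hat_snd upd y by simp
    qed
  next
    show "hat_lead ?Y ?B (g(k := h)) k = - hat_lead Y B g k"
    proof (rule expo_eqI)
      fix l
      show "fst (hat_lead ?Y ?B (g(k := h)) k) $ l = fst (- hat_lead Y B g k) $ l"
        using m1(2)[of l] unfolding fst_uminus vector_uminus_component hat_fst upd by simp
    next
      fix l
      have y: "?Y k $ l = - Y k $ l" by (simp add: mutate_y_def)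
      show "snd (hat_lead ?Y ?B (g(k := h)) k) $ l = snd (- hat_lead Y B g k) $ l"
        using m2(2)[of l] unfolding snd_uminus vector_uminus_component hat_snd upd y by simp
    qed
  qed
  with leads have "\<exists>g. (\<forall>i. has_lead (?X i) (g i)) \<and> indep (hat_lead ?Y ?B g)" by (intro exI[of _ "g(k := h)"] conjI)
  moreover have "\<exists>d :: 'i \<Rightarrow> real. (\<forall>i. d i > 0) \<and> (\<forall>i j. d i * of_int (?B$i$j) = - (d j * of_int (?B$j$i)))"
    using skew_mutate[OF d] d(1) by (intro exI[of _ d]) blast
  ultimately show ?thesis unfolding seed_inv_def S mutate_def by simp
qed

lemma cluster_variable_lead:
  fixes d :: "'i \<Rightarrow> real"
  assumes d: "\<forall>i. d i > 0" "\<forall>i j. d i * of_int (B$i$j) = - (d j * of_int (B$j$i))"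
    and z: "z \<in> cluster_variables u (principal_seed x B)"
  shows "\<exists>e. has_lead z e"
proof -
  have "seed_inv S" if "S \<in> reachable_seeds u (principal_seed x B)" for S
    using that
  proof induction
    case initial
    have x: "x i = mon (axis i 1, 0)" for i
    proof -
      have "(\<Prod>j\<in>UNIV. x j powi (axis i 1 $ j)) = (\<Prod>j\<in>UNIV. if j = i then x j else 1)"
        by (intro prod.cong) (auto simp: axis_def)
      then show ?thesis by (simp add: mon_def)
    qed
    have "has_lead (x i) (axis i 1, 0)" for i by (subst x) (rule has_lead_mon)
    \<comment> \<open>Principal coefficients enter here: the second components of the initial hatted
      exponents are the unit vectors.\<close>
    moreover have "indep (hat_lead (\<lambda>j. axis j 1) B (\<lambda>i. (axis i 1, 0)))"
      by (rule indep_axis) (simp add: hat_lead_def snd_sum escale_def)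
    ultimately have "\<exists>g. (\<forall>i. has_lead (x i) (g i)) \<and> indep (hat_lead (\<lambda>j. axis j 1) B g)"
      by (intro exI[of _ "\<lambda>i. (axis i 1, 0)"]) auto
    then show ?case using d unfolding seed_inv_def principal_seed_def by auto
  next
    case (mutation S k) then show ?case by (intro seed_inv_mutate)
  qed
  moreover obtain X Y C i where "(X, Y, C) \<in> reachable_seeds u (principal_seed x B)" "z = X i"
    using z unfolding cluster_variables_def by blast
  ultimately show ?thesis unfolding seed_inv_def by fastforce
qed

text \<open>The exponent of \<open>x\<close> to the power \<open>g\<close> times the monomial
  \<open>m\<close> in the hatted coefficients. Its second component is \<open>m\<close> itself, so
  different \<open>m\<close> give different exponents even for different \<open>g\<close>.\<close>

definition hat_expo :: "'i int_matrix \<Rightarrow> 'i weight \<Rightarrow> ('i \<Rightarrow>\<^sub>0 nat) \<Rightarrow> 'i expo" where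
  "hat_expo B g m = (g, 0) + (\<Sum>j\<in>UNIV. escale (int (Poly_Mapping.lookup m j)) (\<chi> i. B $ i $ j, axis j 1))"

lemma snd_hat_expo: "snd (hat_expo B g m) = (\<chi> j. int (Poly_Mapping.lookup m j))"
  by (simp add: hat_expo_def snd_sum escale_def axis_combination)

lemma hat_expo_inj: "hat_expo B g m = hat_expo B g' m' \<Longrightarrow> m = m'"
proof (rule poly_mapping_eqI)
  fix j assume "hat_expo B g m = hat_expo B g' m'"
  then have "snd (hat_expo B g m) $ j = snd (hat_expo B g' m') $ j" by simp
  then show "Poly_Mapping.lookup m j = Poly_Mapping.lookup m' j" by (simp add: snd_hat_expo)
qed

lemma hat_expo_zero: "hat_expo B g 0 = (g, 0)"
  by (simp add: hat_expo_def escale_def zero_prod_def[symmetric])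

lemma mon_escale: "mon (escale (int n) e) = mon e ^ n"
proof (induction n)
  case 0 then show ?case by (simp add: escale_def zero_prod_def[symmetric])
next
  case (Suc n)
  have "escale (int (Suc n)) e = e + escale (int n) e" by (simp add: escale_def prod_eq_iff vec_eq_iff algebra_simps)
  then show ?case using Suc by (simp add: mon_add)
qed

lemma mon_sum: "mon (\<Sum>i\<in>I. e i) = (\<Prod>i\<in>I. mon (e i))"
  by (induction I rule: infinite_finite_induct) (simp_all add: mon_add)

lemma mon_hat_expo: "mon (hat_expo B g m) = (\<Prod>i\<in>UNIV. x i powi (g $ i)) * monom_fun m (y_hat x u B)"
proof -
  have "y_hat x u B j = mon (\<chi> i. B $ i $ j, axis j 1)" for j
  proof -
    have "(\<Prod>i\<in>UNIV. u i powi (axis j 1 $ i)) = (\<Prod>i\<in>UNIV. if i = j then u i else 1)"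
      by (intro prod.cong) (auto simp: axis_def)
    then show ?thesis by (simp add: mon_def y_hat_def)
  qed
  then have "monom_fun m (y_hat x u B) = mon (\<Sum>j\<in>UNIV. escale (int (Poly_Mapping.lookup m j)) (\<chi> i. B $ i $ j, axis j 1))"
    by (simp add: monom_fun_def mon_sum mon_escale)
  moreover have "mon (g, 0) = (\<Prod>i\<in>UNIV. x i powi (g $ i))" by (simp add: mon_def)
  ultimately show ?thesis by (simp only: hat_expo_def mon_add)
qed

lemma spn_sum: "finite M \<Longrightarrow> (\<And>m. m \<in> M \<Longrightarrow> c m \<in> R \<and> P (e m)) \<Longrightarrow> (\<Sum>m\<in>M. \<kappa> (c m) * mon (e m)) \<in> spn R P"
proof (induction rule: finite_induct)
  case (insert m M)
  then have "(\<Sum>m\<in>M. \<kappa> (c m) * mon (e m)) + \<kappa> (c m) * mon (e m) \<in> spn R P" by (intro spn.step) auto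
  then show ?case using insert.hyps by (simp add: add.commute)
qed (simp add: spn.zero)

text \<open>The top non-integral term would survive in the product with a denominator with leading coefficient \<open>1\<close>.\<close>

lemma integral_coefficients:
  assumes z: "has_lead z f" "z = (\<Sum>m\<in>M. \<kappa> (c m) * mon (e m))" and M: "finite M" "inj_on e M"
  shows "m \<in> M \<Longrightarrow> c m \<in> \<int>"
proof (rule ccontr)
  assume m0: "m \<in> M" "c m \<notin> \<int>"
  define N where "N = {m\<in>M. c m \<notin> \<int>}"
  have "finite N" "N \<noteq> {}" "inj_on e N" using M m0 by (auto simp: N_def inj_on_def)
  then obtain m where m: "m \<in> N" "\<forall>l\<in>N. l \<noteq> m \<longrightarrow> elt (e l) (e m)" using elt_max by blast
  obtain p q P Q where PQ: "monic p P" "monic q Q" "z * Q = P" using z(1) unfolding has_lead_def by blast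
  obtain Q' where Q': "Q' \<in> spn \<int> (\<lambda>g. elt g q)" "Q = mon q + Q'" using PQ(2) unfolding monic_def by blast
  have Z: "w \<in> spn \<int> (\<lambda>_. True)" if "w \<in> spn \<int> R" for w R using that by (rule spn_mono) auto
  define G where "G = (\<Sum>m\<in>M - N. \<kappa> (c m) * mon (e m))"
  define R where "R = (\<Sum>l\<in>N - {m}. \<kappa> (c l) * mon (e l))"
  have "z = G + (\<Sum>m\<in>N. \<kappa> (c m) * mon (e m))"
    unfolding z(2) G_def by (rule sum.subset_diff) (auto simp: N_def M)
  also have "(\<Sum>m\<in>N. \<kappa> (c m) * mon (e m)) = \<kappa> (c m) * mon (e m) + R"
    unfolding R_def using \<open>finite N\<close> m(1) by (rule sum.remove)
  finally have zs: "z = G + (\<kappa> (c m) * mon (e m) + R)" .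
  have G: "G \<in> spn \<int> (\<lambda>_. True)" unfolding G_def using M by (intro spn_sum) (auto simp: N_def)
  have R: "R \<in> spn UNIV (\<lambda>g. elt g (e m))" unfolding R_def using \<open>finite N\<close> m(2) by (intro spn_sum) auto
  let ?P = "\<lambda>g. elt g (e m + q)"
  have Q'': "Q' \<in> spn UNIV (\<lambda>g. elt g q)" using Q'(1) by (rule spn_mono) auto
  have "R * (\<kappa> 1 * mon q) \<in> spn UNIV ?P" by (rule spn_shift[OF R]) (auto simp: elt_add)
  moreover have "Q' * (\<kappa> (c m) * mon (e m)) \<in> spn UNIV ?P"
    by (rule spn_shift[OF Q'']) (auto simp: elt_add add.commute[of _ "e m"])
  moreover have "R * Q' \<in> spn UNIV ?P" by (rule spn_mult[OF Q'' R]) (auto intro: elt_add_mono)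
  ultimately have "R * (\<kappa> 1 * mon q) + Q' * (\<kappa> (c m) * mon (e m)) + R * Q' \<in> spn UNIV ?P" by (intro spn_add)
  then have low: "R * (\<kappa> 1 * mon q) + Q' * (\<kappa> (c m) * mon (e m)) + R * Q' \<in> spn UNIV (\<lambda>g. g \<noteq> e m + q)"
    by (rule spn_mono) (auto simp: elt_irrefl)
  \<comment> \<open>Taking the integral part \<open>G\<close> of \<open>z\<close> away from
    \<open>z * Q = P\<close> leaves an integral element, in which the exponent
    \<open>e m + q\<close> has coefficient \<open>c m\<close>.\<close>
  have "G * Q \<in> spn \<int> (\<lambda>_. True)" by (rule spn_mult[OF Z[OF monic_spn[OF PQ(2)]] G]) auto
  then have "- (G * Q) \<in> spn \<int> (\<lambda>_. True)" by (rule spn_uminus) auto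
  then have "P + - (G * Q) \<in> spn \<int> (\<lambda>_. True)" by (rule spn_add) (rule Z[OF monic_spn[OF PQ(1)]])
  moreover have "P + - (G * Q) = \<kappa> (c m) * mon (e m + q) + (R * (\<kappa> 1 * mon q) + Q' * (\<kappa> (c m) * mon (e m)) + R * Q')"
    unfolding PQ(3)[symmetric] zs Q'(2) by (simp add: kappa_one mon_add algebra_simps)
  ultimately have "c m \<in> \<int>" using integral_coefficient[OF low] by simp
  then show False using m(1) by (simp add: N_def)
qed

section \<open>Uniqueness of the expansion and the \<open>F\<close>-polynomial\<close>

lemma kappa_sum: "\<kappa> (\<Sum>i\<in>I. c i) = (\<Sum>i\<in>I. \<kappa> (c i))"
  by (induction I rule: infinite_finite_induct) (simp_all add: kappa_add)

lemma eval_expansion: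
  "(\<Prod>i\<in>UNIV. x i powi (g $ i)) * mpoly_eval (y_hat x u B) F
     = (\<Sum>m\<in>Poly_Mapping.keys F. \<kappa> (of_int (Poly_Mapping.lookup F m)) * mon (hat_expo B g m))"
  unfolding mpoly_eval_def mon_hat_expo kappa_of_int monom_fun_def sum_distrib_left by (intro sum.cong) (simp_all add: mult_ac)

definition expo_coeff :: "'i int_matrix \<Rightarrow> 'i weight \<Rightarrow> 'i int_mpoly \<Rightarrow> 'i expo \<Rightarrow> complex" where
  "expo_coeff B g F e = (\<Sum>m\<in>Poly_Mapping.keys F. if hat_expo B g m = e then of_int (Poly_Mapping.lookup F m) else 0)"

lemma expo_coeff_hat_expo: "expo_coeff B g F (hat_expo B g m) = of_int (Poly_Mapping.lookup F m)"
proof -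
  have "expo_coeff B g F (hat_expo B g m)
      = (\<Sum>l\<in>Poly_Mapping.keys F. if l = m then of_int (Poly_Mapping.lookup F l) else 0)"
    unfolding expo_coeff_def using hat_expo_inj by (intro sum.cong) auto
  then show ?thesis by (simp add: in_keys_iff)
qed

text \<open>As \<open>F\<close> has a non-zero constant term, the exponent \<open>(g, 0)\<close>
  occurs on the left, hence on the right. There its second component forces the monomial
  \<open>0\<close>, so \<open>g' = g\<close>, and the coefficients can be compared one by
  one.\<close>

lemma F_expansion_unique:
  assumes eq: "(\<Prod>i\<in>UNIV. x i powi (g $ i)) * mpoly_eval (y_hat x u B) F
      = (\<Prod>i\<in>UNIV. x i powi (g' $ i)) * mpoly_eval (y_hat x u B) F'"
    and F: "Poly_Mapping.lookup F 0 \<noteq> 0"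
  shows "F' = F"
proof -
  define E where "E = hat_expo B g ` Poly_Mapping.keys F \<union> hat_expo B g' ` Poly_Mapping.keys F'"
  have E: "finite E" by (simp add: E_def)
  have *: "(\<Prod>i\<in>UNIV. x i powi (h $ i)) * mpoly_eval (y_hat x u B) H = (\<Sum>e\<in>E. \<kappa> (expo_coeff B h H e) * mon e)"
    if "hat_expo B h ` Poly_Mapping.keys H \<subseteq> E" for h H
  proof -
    have "(\<Sum>e\<in>E. \<kappa> (expo_coeff B h H e) * mon e)
        = (\<Sum>e\<in>E. \<Sum>m\<in>Poly_Mapping.keys H. if hat_expo B h m = e then \<kappa> (of_int (Poly_Mapping.lookup H m)) * mon (hat_expo B h m) else 0)"
      unfolding expo_coeff_def kappa_sum sum_distrib_right by (intro sum.cong refl) auto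
    also have "\<dots> = (\<Sum>m\<in>Poly_Mapping.keys H. \<Sum>e\<in>E. if hat_expo B h m = e then \<kappa> (of_int (Poly_Mapping.lookup H m)) * mon (hat_expo B h m) else 0)"
      by (rule sum.swap)
    also have "\<dots> = (\<Sum>m\<in>Poly_Mapping.keys H. \<kappa> (of_int (Poly_Mapping.lookup H m)) * mon (hat_expo B h m))"
      using that E by (intro sum.cong refl) (auto simp: sum.delta)
    finally show ?thesis by (simp only: eval_expansion)
  qed
  have "(\<Sum>e\<in>E. \<kappa> (expo_coeff B g F e) * mon e) = (\<Sum>e\<in>E. \<kappa> (expo_coeff B g' F' e) * mon e)"
    using eq *[of g F] *[of g' F'] by (simp add: E_def)
  then have "(\<Sum>e\<in>E. \<kappa> (expo_coeff B g F e - expo_coeff B g' F' e) * mon e) = 0"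
    by (simp add: kappa_diff left_diff_distrib sum_subtractf)
  then have c: "expo_coeff B g F e = expo_coeff B g' F' e" if "e \<in> E" for e
    using independent[OF E, of "\<lambda>e. expo_coeff B g F e - expo_coeff B g' F' e" e] that unfolding mon_def by simp
  have "hat_expo B g 0 \<in> E" using F by (auto simp: E_def in_keys_iff)
  from c[OF this] have "expo_coeff B g' F' (hat_expo B g 0) = of_int (Poly_Mapping.lookup F 0)" unfolding expo_coeff_hat_expo by (rule sym)
  then have "expo_coeff B g' F' (hat_expo B g 0) \<noteq> 0" using F by simp
  then obtain m where "(if hat_expo B g' m = hat_expo B g 0 then complex_of_int (Poly_Mapping.lookup F' m) else 0) \<noteq> 0"
    unfolding expo_coeff_def by (rule sum.not_neutral_contains_not_neutral)
  then have m: "hat_expo B g' m = hat_expo B g 0" by (simp split: if_splits)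
  then have "m = 0" by (rule hat_expo_inj)
  with m have g: "g' = g" by (simp add: hat_expo_zero)
  have "Poly_Mapping.lookup F' m = Poly_Mapping.lookup F m" for m
  proof (cases "hat_expo B g m \<in> E")
    case True
    have "(of_int (Poly_Mapping.lookup F' m) :: complex) = of_int (Poly_Mapping.lookup F m)"
      using c[OF True] unfolding g expo_coeff_hat_expo by (rule sym)
    then show ?thesis by (simp only: of_int_eq_iff)
  next
    case False
    then have "m \<notin> Poly_Mapping.keys F" "m \<notin> Poly_Mapping.keys F'" by (auto simp: E_def g)
    then show ?thesis by (simp add: in_keys_iff)
  qed
  then show ?thesis by (rule poly_mapping_eqI)
qed

text \<open>Constant term \<open>1\<close> does double duty: it excludes divisibility by a variable,
  as required of the \<open>F\<close>-polynomial, and it is the non-vanishing that uniqueness asks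
  for.\<close>

lemma constant_term_F_polynomial:
  fixes d :: "'i \<Rightarrow> real"
  assumes d: "\<forall>i. d i > 0" "\<forall>i j. d i * of_int (B$i$j) = - (d j * of_int (B$j$i))"
    and z: "z \<in> cluster_variables u (principal_seed x B)"
      "z = (\<Prod>i\<in>UNIV. x i powi (g $ i)) * (\<Sum>m\<in>M. \<kappa> (c m) * monom_fun m (y_hat x u B))"
    and M: "finite M" "0 \<in> M" and c: "c 0 = 1"
  shows "constant_term (F_polynomial x u B z) = 1"
proof -
  have zs: "z = (\<Sum>m\<in>M. \<kappa> (c m) * mon (hat_expo B g m))"
    unfolding z(2) mon_hat_expo sum_distrib_left by (intro sum.cong) (simp_all add: mult_ac)
  obtain f where f: "has_lead z f" using cluster_variable_lead[OF d z(1)] by blast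
  have "\<exists>n. c m = of_int n" if "m \<in> M" for m
    using integral_coefficients[OF f zs M(1) _ that] hat_expo_inj[of B g _ g] by (auto simp: inj_on_def elim: Ints_cases)
  then obtain n where n: "c m = of_int (n m)" if "m \<in> M" for m by metis
  define F :: "'i int_mpoly" where "F = (\<Sum>m\<in>M. Poly_Mapping.single m (n m))"
  have F: "Poly_Mapping.lookup F m = (if m \<in> M then n m else 0)" for m
    unfolding F_def using M(1) by (simp add: lookup_sum lookup_single when_def)
  have "n 0 = 1" using n[OF M(2)] c by simp
  then have F0: "Poly_Mapping.lookup F 0 = 1" using F[of 0] M(2) by simp
  have "mpoly_eval (y_hat x u B) F = (\<Sum>m\<in>M. \<kappa> (c m) * monom_fun m (y_hat x u B))"
    unfolding mpoly_eval_def monom_fun_def[symmetric]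
    by (rule sum.mono_neutral_cong_left) (use M(1) in \<open>auto simp: F n kappa_of_int in_keys_iff split: if_splits\<close>)
  then have zF: "z = (\<Prod>i\<in>UNIV. x i powi (g $ i)) * mpoly_eval (y_hat x u B) F" using z(2) by simp
  have "\<not> mpoly_var i dvd F" for i
  proof
    assume "mpoly_var i dvd F"
    then obtain H where "F = mpoly_var i * H" ..
    moreover have "Poly_Mapping.single i 1 + q \<noteq> 0" for q :: "'i \<Rightarrow>\<^sub>0 nat"
    proof
      assume "Poly_Mapping.single i 1 + q = 0"
      then have "Poly_Mapping.lookup (Poly_Mapping.single i 1 + q) i = 0" by simp
      then show False by (simp add: lookup_add)
    qed
    then have "Poly_Mapping.lookup (mpoly_var i) l * (\<Sum>q. Poly_Mapping.lookup H q when 0 = l + q) = 0" for l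
      by (cases "l = Poly_Mapping.single i 1") (auto simp: mpoly_var_def lookup_single when_def eq_commute[of 0])
    then have "Poly_Mapping.lookup (mpoly_var i * H) 0 = 0" by (simp only: lookup_mult) simp
    ultimately have "Poly_Mapping.lookup F 0 = 0" by simp
    with F0 show False by simp
  qed
  then have "F_polynomial x u B z = F"
    unfolding F_polynomial_def using zF F0 F_expansion_unique[of g B F]
    by (intro the_equality) (auto)
  then show ?thesis by (simp add: constant_term_def F0)
qed

end

section \<open>Comparison of the function field with values at points\<close>

lemma regular_onE:
  assumes "regular_on S f" "x \<in> S"
  obtains p q where "p \<in> polynomial_functions" "q \<in> polynomial_functions" "q x \<noteq> 0"
    "\<forall>y\<in>S. q y \<noteq> 0 \<longrightarrow> f y = p y / q y"
proof -
  have "\<exists>p\<in>polynomial_functions. \<exists>q\<in>polynomial_functions. q x \<noteq> 0 \<and> (\<forall>y\<in>S. q y \<noteq> 0 \<longrightarrow> f y = p y / q y)"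
    using assms(1)[unfolded regular_on_def] assms(2) by (rule bspec)
  then show ?thesis by (elim bexE conjE) (rule that)
qed

lemma regular_on_const: "regular_on S (\<lambda>_. a)"
  unfolding regular_on_def
  by (intro ballI bexI[where x = "\<lambda>_. a"] bexI[where x = "\<lambda>_. 1"]) (auto intro: polynomial_functions.const)

lemma regular_on_combine:
  fixes f g :: "complex^'n^'m \<Rightarrow> complex" and comb :: "_ \<Rightarrow> _ \<Rightarrow> _ \<Rightarrow> _ \<Rightarrow> complex^'n^'m \<Rightarrow> complex"
  assumes f: "regular_on S f" and g: "regular_on S g"
    and a: "\<And>p q p' q'. {p, q, p', q'} \<subseteq> polynomial_functions \<Longrightarrow> comb p q p' q' \<in> polynomial_functions"
    and c: "\<And>p q p' q' x. q x \<noteq> 0 \<Longrightarrow> q' x \<noteq> 0 \<Longrightarrow> c (p x / q x) (p' x / q' x) = comb p q p' q' x / (q x * q' x)"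
  shows "regular_on S (\<lambda>x. c (f x) (g x))"
  unfolding regular_on_def
proof
  fix x assume x: "x \<in> S"
  obtain p q where pq: "p \<in> polynomial_functions" "q \<in> polynomial_functions" "q x \<noteq> 0"
    "\<forall>y\<in>S. q y \<noteq> 0 \<longrightarrow> f y = p y / q y" using f x by (rule regular_onE)
  obtain p' q' where pq': "p' \<in> polynomial_functions" "q' \<in> polynomial_functions" "q' x \<noteq> 0"
    "\<forall>y\<in>S. q' y \<noteq> 0 \<longrightarrow> g y = p' y / q' y" using g x by (rule regular_onE)
  show "\<exists>p\<in>polynomial_functions. \<exists>q\<in>polynomial_functions.
     q x \<noteq> 0 \<and> (\<forall>y\<in>S. q y \<noteq> 0 \<longrightarrow> c (f y) (g y) = p y / q y)"
  proof (rule bexI[where x = "comb p q p' q'"], rule bexI[where x = "\<lambda>x. q x * q' x"], rule conjI, rule_tac [2] ballI, rule_tac [2] impI)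
    show "q x * q' x \<noteq> 0" using pq(3) pq'(3) by simp
    show "c (f y) (g y) = comb p q p' q' y / (q y * q' y)" if "y \<in> S" "q y * q' y \<noteq> 0" for y
    proof -
      have "q y \<noteq> 0" "q' y \<noteq> 0" using that(2) by auto
      then show ?thesis using pq(4) pq'(4) that(1) c[of q y q' p p'] by simp
    qed
    show "(\<lambda>x. q x * q' x) \<in> polynomial_functions" using pq(2) pq'(2) by (rule polynomial_functions.mult)
    show "comb p q p' q' \<in> polynomial_functions" using pq(1,2) pq'(1,2) by (intro a) simp
  qed
qed

lemma regular_on_add:
  assumes "regular_on S f" "regular_on S g" shows "regular_on S (\<lambda>x. f x + g x)"
proof (rule regular_on_combine[OF assms, where comb = "\<lambda>p q p' q' x. p x * q' x + p' x * q x"])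
  fix p q p' q' :: "complex^'a^'b \<Rightarrow> complex" assume "{p, q, p', q'} \<subseteq> polynomial_functions"
  then have "p \<in> polynomial_functions" "q \<in> polynomial_functions" "p' \<in> polynomial_functions" "q' \<in> polynomial_functions" by simp_all
  then show "(\<lambda>x. p x * q' x + p' x * q x) \<in> polynomial_functions"
    by (intro polynomial_functions.add polynomial_functions.mult)
qed (simp add: add_frac_eq)

lemma regular_on_mult:
  assumes "regular_on S f" "regular_on S g" shows "regular_on S (\<lambda>x. f x * g x)"
proof (rule regular_on_combine[OF assms, where comb = "\<lambda>p q p' q' x. p x * p' x"])
  fix p q p' q' :: "complex^'a^'b \<Rightarrow> complex" assume "{p, q, p', q'} \<subseteq> polynomial_functions"
  then have "p \<in> polynomial_functions" "p' \<in> polynomial_functions" by simp_all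
  then show "(\<lambda>x. p x * p' x) \<in> polynomial_functions" by (rule polynomial_functions.mult)
qed simp

lemma regular_on_subset:
  assumes "regular_on S f" "S' \<subseteq> S" shows "regular_on S' f"
  unfolding regular_on_def
proof
  fix x assume "x \<in> S'"
  then have "x \<in> S" using assms(2) by blast
  with assms(1) obtain p q where "p \<in> polynomial_functions" "q \<in> polynomial_functions" "q x \<noteq> 0"
    "\<forall>y\<in>S. q y \<noteq> 0 \<longrightarrow> f y = p y / q y" by (rule regular_onE)
  then show "\<exists>p\<in>polynomial_functions. \<exists>q\<in>polynomial_functions. q x \<noteq> 0 \<and> (\<forall>y\<in>S'. q y \<noteq> 0 \<longrightarrow> f y = p y / q y)"
    using assms(2) by (intro bexI[where x = p] bexI[where x = q]) auto
qed

lemma regular_on_inverse: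
  assumes f: "regular_on S f" and nz: "\<And>x. x \<in> S \<Longrightarrow> f x \<noteq> 0"
  shows "regular_on S (\<lambda>x. inverse (f x))"
  unfolding regular_on_def
proof
  fix x assume x: "x \<in> S"
  obtain p q where pq: "p \<in> polynomial_functions" "q \<in> polynomial_functions" "q x \<noteq> 0"
    "\<forall>y\<in>S. q y \<noteq> 0 \<longrightarrow> f y = p y / q y" using f x by (rule regular_onE)
  have "p x \<noteq> 0" using pq(3,4) x nz[OF x] by auto
  show "\<exists>p\<in>polynomial_functions. \<exists>q\<in>polynomial_functions.
     q x \<noteq> 0 \<and> (\<forall>y\<in>S. q y \<noteq> 0 \<longrightarrow> inverse (f y) = p y / q y)"
  proof (rule bexI[where x = "\<lambda>x. q x * q x"], rule bexI[where x = "\<lambda>x. p x * q x"], rule conjI, rule_tac [2] ballI, rule_tac [2] impI)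
    show "p x * q x \<noteq> 0" using \<open>p x \<noteq> 0\<close> pq(3) by simp
    show "inverse (f y) = q y * q y / (p y * q y)" if "y \<in> S" "p y * q y \<noteq> 0" for y
      using pq(4) that by auto
  qed (rule polynomial_functions.mult, (rule pq)+)+
qed

lemma regular_on_prod: "(\<And>i. i \<in> I \<Longrightarrow> regular_on S (f i)) \<Longrightarrow> regular_on S (\<lambda>x. \<Prod>i\<in>I. f i x)"
  by (induction I rule: infinite_finite_induct) (simp_all add: regular_on_const regular_on_mult)

lemma regular_on_power: "regular_on S f \<Longrightarrow> regular_on S (\<lambda>x. f x ^ n)"
  by (induction n) (simp_all add: regular_on_const regular_on_mult)

lemma regular_on_powi:
  assumes f: "regular_on S f" and nz: "\<And>x. x \<in> S \<Longrightarrow> f x \<noteq> 0"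
  shows "regular_on S (\<lambda>x. f x powi n)"
  unfolding power_int_def using regular_on_power[OF f] regular_on_power[OF regular_on_inverse[OF f nz]] by (cases "n \<ge> 0") simp_all

text \<open>\<open>D\<close> is the denominator to be inverted: field elements of the form
  \<open>\<iota> g\<close> over a power of \<open>\<iota> D\<close> are compared with functions on
  the locus \<open>D \<noteq> 0\<close>.\<close>

locale function_field =
  fixes S :: "(complex^'n^'m) set" and \<iota> :: "(complex^'n^'m \<Rightarrow> complex) \<Rightarrow> 'f::field" and D
  assumes ff: "is_function_field S \<iota>" and D_regular: "regular_on S D" and D_nonzero: "\<exists>p\<in>S. D p \<noteq> 0"
begin

lemma iota_simps:
  "\<iota> (\<lambda>_. 1) = 1"
  "regular_on S f \<Longrightarrow> regular_on S g \<Longrightarrow> \<iota> (\<lambda>x. f x + g x) = \<iota> f + \<iota> g"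
  "regular_on S f \<Longrightarrow> regular_on S g \<Longrightarrow> \<iota> (\<lambda>x. f x * g x) = \<iota> f * \<iota> g"
  "regular_on S f \<Longrightarrow> \<iota> f = 0 \<longleftrightarrow> (\<forall>x\<in>S. f x = 0)"
  using ff unfolding is_function_field_def by blast+

lemma iota_power: "regular_on S f \<Longrightarrow> \<iota> (\<lambda>x. f x ^ n) = \<iota> f ^ n"
  by (induction n) (simp_all add: iota_simps regular_on_power)

lemma iota_eqI:
  assumes f: "regular_on S f" and g: "regular_on S g" and eq: "\<And>x. x \<in> S \<Longrightarrow> f x = g x"
  shows "\<iota> f = \<iota> g"
proof -
  have m: "regular_on S (\<lambda>x. -1 * g x)" by (intro regular_on_mult regular_on_const g)
  have "\<iota> (\<lambda>x. f x + -1 * g x) = 0" "\<iota> (\<lambda>x. g x + -1 * g x) = 0"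
    using eq iota_simps(4)[OF regular_on_add[OF f m]] iota_simps(4)[OF regular_on_add[OF g m]] by simp_all
  then have "\<iota> f + \<iota> (\<lambda>x. -1 * g x) = \<iota> g + \<iota> (\<lambda>x. -1 * g x)"
    unfolding iota_simps(2)[OF f m] iota_simps(2)[OF g m] by simp
  then show ?thesis by (rule add_right_imp_eq)
qed

lemma iota_D: "\<iota> D \<noteq> 0"
  using iota_simps(4)[OF D_regular] D_nonzero by blast

text \<open>\<open>h\<close> is the function on the locus \<open>D \<noteq> 0\<close> that
  \<open>v\<close> defines. Clearing denominators in both places avoids evaluating field elements at
  points.\<close>

definition repr :: "'f \<Rightarrow> (complex^'n^'m \<Rightarrow> complex) \<Rightarrow> bool" where
  "repr v h \<longleftrightarrow> (\<exists>k g. regular_on S g \<and> v * \<iota> D ^ k = \<iota> g \<and> (\<forall>p\<in>S. D p \<noteq> 0 \<longrightarrow> h p * D p ^ k = g p))"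

lemma reprI: "regular_on S g \<Longrightarrow> v * \<iota> D ^ k = \<iota> g \<Longrightarrow> (\<And>p. p \<in> S \<Longrightarrow> D p \<noteq> 0 \<Longrightarrow> h p * D p ^ k = g p) \<Longrightarrow> repr v h"
  unfolding repr_def by blast

lemma reprE:
  assumes "repr v h"
  obtains k g where "regular_on S g" "v * \<iota> D ^ k = \<iota> g" "\<And>p. p \<in> S \<Longrightarrow> D p \<noteq> 0 \<Longrightarrow> h p * D p ^ k = g p"
proof -
  from assms obtain k g where "regular_on S g" "v * \<iota> D ^ k = \<iota> g" "\<forall>p\<in>S. D p \<noteq> 0 \<longrightarrow> h p * D p ^ k = g p"
    unfolding repr_def by (elim exE conjE)
  then show thesis by (intro that[of g k]) auto
qed

lemma repr_iota: "regular_on S g \<Longrightarrow> repr (\<iota> g) g"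
  by (rule reprI[of g _ 0]) simp_all

lemma repr_mult: "repr v h \<Longrightarrow> repr w h' \<Longrightarrow> repr (v * w) (\<lambda>p. h p * h' p)"
proof (elim reprE)
  fix k l g g' assume g: "regular_on S g" "v * \<iota> D ^ k = \<iota> g" "\<And>p. p \<in> S \<Longrightarrow> D p \<noteq> 0 \<Longrightarrow> h p * D p ^ k = g p"
    and g': "regular_on S g'" "w * \<iota> D ^ l = \<iota> g'" "\<And>p. p \<in> S \<Longrightarrow> D p \<noteq> 0 \<Longrightarrow> h' p * D p ^ l = g' p"
  show ?thesis
  proof (rule reprI[OF regular_on_mult[OF g(1) g'(1)], of _ "k + l"])
    show "v * w * \<iota> D ^ (k + l) = \<iota> (\<lambda>x. g x * g' x)"
      unfolding iota_simps(3)[OF g(1) g'(1)] g(2)[symmetric] g'(2)[symmetric] by (simp add: power_add)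
  qed (simp add: g(3)[symmetric] g'(3)[symmetric] power_add)
qed

lemma repr_add: "repr v h \<Longrightarrow> repr w h' \<Longrightarrow> repr (v + w) (\<lambda>p. h p + h' p)"
proof (elim reprE)
  fix k l g g' assume g: "regular_on S g" "v * \<iota> D ^ k = \<iota> g" "\<And>p. p \<in> S \<Longrightarrow> D p \<noteq> 0 \<Longrightarrow> h p * D p ^ k = g p"
    and g': "regular_on S g'" "w * \<iota> D ^ l = \<iota> g'" "\<And>p. p \<in> S \<Longrightarrow> D p \<noteq> 0 \<Longrightarrow> h' p * D p ^ l = g' p"
  have r: "regular_on S (\<lambda>p. g p * D p ^ l)" "regular_on S (\<lambda>p. g' p * D p ^ k)"
    using g(1) g'(1) D_regular by (intro regular_on_mult regular_on_power; simp)+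
  show ?thesis
  proof (rule reprI[OF regular_on_add[OF r], of _ "k + l"])
    show "(v + w) * \<iota> D ^ (k + l) = \<iota> (\<lambda>p. g p * D p ^ l + g' p * D p ^ k)"
      unfolding iota_simps(2)[OF r] iota_simps(3)[OF g(1) regular_on_power[OF D_regular]]
        iota_simps(3)[OF g'(1) regular_on_power[OF D_regular]] iota_power[OF D_regular] g(2)[symmetric] g'(2)[symmetric]
      by (simp add: power_add algebra_simps)
  qed (simp add: g(3)[symmetric] g'(3)[symmetric] power_add algebra_simps)
qed

lemma repr_unique:
  assumes "repr v h" "repr w h'" "\<And>p. p \<in> S \<Longrightarrow> D p \<noteq> 0 \<Longrightarrow> h p = h' p" shows "v = w"
proof -
  obtain k g where g: "regular_on S g" "v * \<iota> D ^ k = \<iota> g" "\<And>p. p \<in> S \<Longrightarrow> D p \<noteq> 0 \<Longrightarrow> h p * D p ^ k = g p"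
    using assms(1) by (rule reprE) (rule that)
  obtain l g' where g': "regular_on S g'" "w * \<iota> D ^ l = \<iota> g'" "\<And>p. p \<in> S \<Longrightarrow> D p \<noteq> 0 \<Longrightarrow> h' p * D p ^ l = g' p"
    using assms(2) by (rule reprE) (rule that)
  note R = regular_on_power[OF D_regular]
  \<comment> \<open>One factor \<open>D\<close> more than needed for the common denominator makes
    both sides vanish where \<open>D\<close> does, so the equality holds on all of
    \<open>S\<close>.\<close>
  have "\<iota> (\<lambda>p. g p * D p ^ Suc l) = \<iota> (\<lambda>p. g' p * D p ^ Suc k)"
  proof (rule iota_eqI)
    fix p assume p: "p \<in> S"
    show "g p * D p ^ Suc l = g' p * D p ^ Suc k"
    proof (cases "D p = 0")
      case False
      then show ?thesis using g(3)[OF p False, symmetric] g'(3)[OF p False, symmetric] assms(3)[OF p False] by simp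
    qed simp
  qed (intro regular_on_mult R g(1) g'(1))+
  then have "v * \<iota> D ^ k * \<iota> D ^ Suc l = w * \<iota> D ^ l * \<iota> D ^ Suc k"
    unfolding iota_simps(3)[OF g(1) R] iota_simps(3)[OF g'(1) R] iota_power[OF D_regular] g(2) g'(2) .
  then have "v * \<iota> D ^ (k + Suc l) = w * \<iota> D ^ (k + Suc l)" by (simp add: power_add mult_ac)
  then show ?thesis using iota_D by simp
qed

lemma repr_zero: "repr 0 h \<Longrightarrow> p \<in> S \<Longrightarrow> D p \<noteq> 0 \<Longrightarrow> h p = 0"
proof (elim reprE)
  fix k g assume p: "p \<in> S" "D p \<noteq> 0" and g: "regular_on S g" "0 * \<iota> D ^ k = \<iota> g" "\<And>p. p \<in> S \<Longrightarrow> D p \<noteq> 0 \<Longrightarrow> h p * D p ^ k = g p"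
  have "\<iota> g = 0" using g(2) by simp
  then have "g p = 0" using iota_simps(4)[OF g(1)] p(1) by blast
  then show "h p = 0" using g(3)[OF p] p(2) by simp
qed

definition \<kappa> :: "complex \<Rightarrow> 'f" where "\<kappa> a = \<iota> (\<lambda>_. a)"

lemma kappa_simps: "\<kappa> (a + b) = \<kappa> a + \<kappa> b" "\<kappa> (a * b) = \<kappa> a * \<kappa> b" "\<kappa> 1 = 1"
proof -
  have r: "regular_on S (\<lambda>_. c)" for c by (rule regular_on_const)
  show "\<kappa> (a + b) = \<kappa> a + \<kappa> b" "\<kappa> (a * b) = \<kappa> a * \<kappa> b" "\<kappa> 1 = 1"
    using iota_simps(2)[OF r[of a] r[of b]] iota_simps(3)[OF r[of a] r[of b]] iota_simps(1) by (simp_all only: \<kappa>_def)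
qed

lemma repr_const: "repr (\<kappa> a) (\<lambda>_. a)"
  unfolding \<kappa>_def by (intro repr_iota regular_on_const)

lemma repr_one: "repr 1 (\<lambda>_. 1)" and repr_0: "repr 0 (\<lambda>_. 0)"
proof -
  show "repr 1 (\<lambda>_. 1)" using repr_const[of 1] by (simp add: kappa_simps)
  have "\<iota> (\<lambda>_. 0) = 0" using iota_simps(4)[OF regular_on_const, of 0] by simp
  then show "repr 0 (\<lambda>_. 0)" using repr_iota[OF regular_on_const, of 0] by simp
qed

lemma repr_inverse:
  assumes "repr v h" "repr w (\<lambda>p. inverse (h p))" "\<And>p. p \<in> S \<Longrightarrow> D p \<noteq> 0 \<Longrightarrow> h p \<noteq> 0"
  shows "v \<noteq> 0" "repr (inverse v) (\<lambda>p. inverse (h p))"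
proof -
  have "v * w = 1" by (rule repr_unique[OF repr_mult[OF assms(1,2)] repr_one]) (use assms(3) in simp)
  then show "v \<noteq> 0" "repr (inverse v) (\<lambda>p. inverse (h p))" using assms(2) inverse_unique[of v w] by auto
qed

lemma repr_prod: "(\<And>i. i \<in> I \<Longrightarrow> repr (v i) (h i)) \<Longrightarrow> repr (\<Prod>i\<in>I. v i) (\<lambda>p. \<Prod>i\<in>I. h i p)"
  by (induction I rule: infinite_finite_induct) (simp_all add: repr_one repr_mult)

lemma repr_sum: "(\<And>i. i \<in> I \<Longrightarrow> repr (v i) (h i)) \<Longrightarrow> repr (\<Sum>i\<in>I. v i) (\<lambda>p. \<Sum>i\<in>I. h i p)"
  by (induction I rule: infinite_finite_induct) (simp_all add: repr_0 repr_add)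

lemma repr_power: "repr v h \<Longrightarrow> repr (v ^ n) (\<lambda>p. h p ^ n)"
  by (induction n) (simp_all add: repr_one repr_mult)

lemma repr_powi: "repr v h \<Longrightarrow> repr (inverse v) (\<lambda>p. inverse (h p)) \<Longrightarrow> repr (v powi n) (\<lambda>p. h p powi n)"
  unfolding power_int_def using repr_power[of v h] repr_power[of "inverse v" "\<lambda>p. inverse (h p)"] by (cases "n \<ge> 0") simp_all

end

text \<open>Dedekind's argument: subtracting \<open>ch e0 a\<close> times the relation at
  \<open>b\<close> from the relation at \<open>m a b\<close> removes the term \<open>e0\<close>. By
  induction all other coefficients vanish, since some \<open>a\<close> separates \<open>e\<close>
  from \<open>e0\<close>.\<close>

lemma dedekind_independent_characters:
  fixes ch :: "'e \<Rightarrow> 'a \<Rightarrow> 'f::field"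
  assumes "finite E" "\<And>a b. a \<in> P \<Longrightarrow> b \<in> P \<Longrightarrow> m a b \<in> P"
    and "\<And>e a b. a \<in> P \<Longrightarrow> b \<in> P \<Longrightarrow> ch e (m a b) = ch e a * ch e b"
    and "\<And>e a. a \<in> P \<Longrightarrow> ch e a \<noteq> 0" and "w \<in> P"
    and dist: "\<And>e e'. e \<noteq> e' \<Longrightarrow> \<exists>a\<in>P. ch e a \<noteq> ch e' a"
    and "\<And>a. a \<in> P \<Longrightarrow> (\<Sum>e\<in>E. c e * ch e a) = 0"
  shows "\<forall>e\<in>E. c e = 0"
  using assms(1,7)
proof (induction E arbitrary: c rule: finite_induct)
  case (insert e0 E)
  have s: "(\<Sum>e\<in>E. c e * ch e a) = - (c e0 * ch e0 a)" if "a \<in> P" for a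
    using insert.prems[OF that] insert.hyps by (simp add: add_eq_0_iff2)
  have E: "c e * (ch e a - ch e0 a) = 0" if a: "a \<in> P" and e: "e \<in> E" for a e
  proof -
    have "\<forall>e\<in>E. c e * (ch e a - ch e0 a) = 0"
    proof (rule insert.IH)
      fix b assume b: "b \<in> P"
      have "(\<Sum>e\<in>E. c e * (ch e a - ch e0 a) * ch e b) = (\<Sum>e\<in>E. c e * ch e (m a b)) - ch e0 a * (\<Sum>e\<in>E. c e * ch e b)"
        unfolding sum_distrib_left sum_subtractf[symmetric]
        by (intro sum.cong) (simp_all add: assms(3)[OF a b] algebra_simps)
      also have "\<dots> = 0" using s[OF assms(2)[OF a b]] s[OF b] by (simp add: assms(3)[OF a b])
      finally show "(\<Sum>e\<in>E. c e * (ch e a - ch e0 a) * ch e b) = 0" .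
    qed
    then show ?thesis using e by blast
  qed
  have z: "c e = 0" if "e \<in> E" for e
  proof -
    have "e \<noteq> e0" using that insert.hyps by auto
    then obtain a where "a \<in> P" "ch e a \<noteq> ch e0 a" using dist by blast
    then show ?thesis using E[OF _ that, of a] by simp
  qed
  have "c e0 * ch e0 w = 0" using s[OF assms(5)] z by simp
  then show ?case using z assms(4)[OF assms(5), of e0] by simp
qed simp

text \<open>Laurent monomials are characters of the torus of pairs \<open>(r, s)\<close>. Two
  different exponents are separated at a point with one entry \<open>2\<close> and all others
  \<open>1\<close>.\<close>

lemma laurent_monomials_independent:
  fixes c :: "'i::finite expo \<Rightarrow> complex"
  assumes "finite E" "e \<in> E"
    and z: "\<And>r s. \<forall>i. r i \<noteq> 0 \<Longrightarrow> \<forall>i. s i \<noteq> 0 \<Longrightarrow>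
      (\<Sum>e\<in>E. c e * ((\<Prod>i\<in>UNIV. r i powi (fst e $ i)) * (\<Prod>i\<in>UNIV. s i powi (snd e $ i)))) = 0"
  shows "c e = 0"
proof -
  define ch :: "'i expo \<Rightarrow> ('i \<Rightarrow> complex) \<times> ('i \<Rightarrow> complex) \<Rightarrow> complex" where
    "ch e a = (\<Prod>i\<in>UNIV. fst a i powi (fst e $ i)) * (\<Prod>i\<in>UNIV. snd a i powi (snd e $ i))" for e a
  define P where "P = {a :: ('i \<Rightarrow> complex) \<times> ('i \<Rightarrow> complex). \<forall>i. fst a i \<noteq> 0 \<and> snd a i \<noteq> 0}"
  have two: "(2::complex) powi m = 2 powi n \<Longrightarrow> m = n" for m n
  proof -
    assume "(2::complex) powi m = 2 powi n"
    then have "norm ((2::complex) powi m) = norm ((2::complex) powi n)" by simp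
    then have "(2::real) powi m = 2 powi n" by (simp add: norm_power_int)
    then show "m = n"
      using power_int_strict_increasing[of m n "2::real"] power_int_strict_increasing[of n m "2::real"] by (cases m n rule: linorder_cases) auto
  qed
  have pr: "(\<Prod>i\<in>UNIV. (if i = k then 2 else 1 :: complex) powi (g $ i)) = 2 powi (g $ k)" for k and g :: "'i weight"
  proof -
    have "(\<Prod>i\<in>UNIV. (if i = k then 2 else 1 :: complex) powi (g $ i)) = (\<Prod>i\<in>UNIV. if i = k then 2 powi (g $ i) else 1)"
      by (intro prod.cong) auto
    then show ?thesis by simp
  qed
  have "\<forall>e\<in>E. c e = 0"
  proof (rule dedekind_independent_characters[where P = P and ch = ch and m = "\<lambda>a b. (\<lambda>i. fst a i * fst b i, \<lambda>i. snd a i * snd b i)"])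
    show "\<exists>a\<in>P. ch e a \<noteq> ch e' a" if ne: "e \<noteq> e'" for e e'
    proof (cases "fst e = fst e'")
      case False
      then obtain k where "fst e $ k \<noteq> fst e' $ k" by (auto simp: vec_eq_iff)
      then show ?thesis by (intro bexI[of _ "(\<lambda>i. if i = k then 2 else 1, \<lambda>_. 1)"]) (auto simp: P_def ch_def pr dest: two)
    next
      case True
      then have "snd e \<noteq> snd e'" using ne by (auto simp: prod_eq_iff)
      then obtain k where "snd e $ k \<noteq> snd e' $ k" by (auto simp: vec_eq_iff)
      then show ?thesis by (intro bexI[of _ "(\<lambda>_. 1, \<lambda>i. if i = k then 2 else 1)"]) (auto simp: P_def ch_def pr dest: two)
    qed
    show "(\<lambda>_. 1, \<lambda>_. 1) \<in> P" by (simp add: P_def)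
    show "(\<Sum>e\<in>E. c e * ch e a) = 0" if "a \<in> P" for a using z[of "fst a" "snd a"] that by (simp add: ch_def P_def)
  qed (use assms(1) in \<open>auto simp: P_def ch_def power_int_mult_distrib prod.distrib\<close>)
  then show ?thesis using assms(2) by blast
qed

text \<open>The equation for index \<open>j\<close> contains, besides \<open>\<tau> j\<close>,
  entries of smaller index alone, so well-founded recursion solves it.\<close>

lemma triangular_solution:
  fixes a :: "'i::{finite,linorder} \<Rightarrow> 'i \<Rightarrow> int" and s :: "'i \<Rightarrow> complex"
  assumes s: "\<forall>j. s j \<noteq> 0"
  obtains \<tau> where "\<forall>j. \<tau> j \<noteq> 0" "\<And>j. s j = \<tau> j * (\<Prod>i\<in>{..<j}. \<tau> i powi a i j)"
proof -
  let ?P = "\<lambda>f x r. r \<noteq> 0 \<and> s x = r * (\<Prod>i\<in>{..<x}. f i powi a i x)"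
  have "\<exists>f. \<forall>x. ?P f x (f x)"
  proof (rule dependent_wf_choice[of "{(i, j). i < j}"])
    have "acyclic {(i :: 'i, j). i < j}" 
      unfolding acyclic_def by (subst trancl_id) (auto intro!: transI)
    then show "wf {(i :: 'i, j). i < j}" by (intro finite_acyclic_wf) auto
    show "?P f x r = ?P g x r" if "\<And>z. (z, x) \<in> {(i, j). i < j} \<Longrightarrow> f z = g z" for f g x r
    proof -
      have "(\<Prod>i\<in>{..<x}. f i powi a i x) = (\<Prod>i\<in>{..<x}. g i powi a i x)" using that by (intro prod.cong) auto
      then show ?thesis by simp
    qed
    show "\<exists>r. ?P f x r" if f: "\<And>y. (y, x) \<in> {(i, j). i < j} \<Longrightarrow> ?P f y (f y)" for x f
    proof -
      have "(\<Prod>i\<in>{..<x}. f i powi a i x) \<noteq> 0" using f by (auto simp: prod_zero_iff finite_subset[OF subset_UNIV])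
      then show ?thesis using s by (intro exI[of _ "s x / (\<Prod>i\<in>{..<x}. f i powi a i x)"]) simp
    qed
  qed
  then obtain \<tau> where "\<forall>x. ?P \<tau> x (\<tau> x)" ..
  then show thesis by (intro that[of \<tau>]) auto
qed

section \<open>Cluster variables of the reduced double cell\<close>

context minors begin

definition y_fun :: "'i \<Rightarrow> complex^'m^'m \<Rightarrow> complex" where
  "y_fun j g = \<Delta> (fund_weight j) (coxeter_element A (fund_weight j)) g *
     (\<Prod>i\<in>{i. prec A i j}. \<Delta> (fund_weight i) (coxeter_element A (fund_weight i)) g powi (A $ i $ j))"

lemma cell_regular:
  "u \<in> weyl_group A \<Longrightarrow> v \<in> weyl_group A \<Longrightarrow> regular_on L (\<Delta> (u (fund_weight i)) (v (fund_weight i)))"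
  by (rule regular_on_subset[OF minor_regular cell_subset_G])

lemma f_cell_regular: "regular_on L (f i)"
  using cell_regular[OF id_weyl id_weyl] by simp

lemma y_fun_regular: "regular_on L (y_fun j)"
proof -
  have "regular_on L (\<Delta> (fund_weight i) (coxeter_element A (fund_weight i)))" for i
    using cell_regular[OF id_weyl coxeter_weyl(1)] by simp
  then have "regular_on L (\<lambda>g. \<Delta> (fund_weight j) (coxeter_element A (fund_weight j)) g *
     (\<Prod>i\<in>{i. prec A i j}. \<Delta> (fund_weight i) (coxeter_element A (fund_weight i)) g powi (A $ i $ j)))"
    by (intro regular_on_mult regular_on_prod regular_on_powi minor_cox_nonzero)
  then show ?thesis unfolding y_fun_def .
qed

lemma y_fun_nonzero: "g \<in> L \<Longrightarrow> y_fun j g \<noteq> 0"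
  unfolding y_fun_def using minor_cox_nonzero by simp

lemma y_fun_cell_point:
  assumes r: "\<forall>i. r i \<noteq> 0" and t: "\<forall>i. t i \<noteq> 0"
  shows "y_fun j (cell_point r t) = t j * (r j * (\<Prod>i\<in>{..<j}. r i powi (A$i$j)))"
proof -
  obtain \<tau> where tau: "\<forall>j. \<tau> j \<noteq> 0" "\<And>j. t j = \<tau> j * (\<Prod>i\<in>{..<j}. \<tau> i powi (A$i$j))"
    using triangular_solution[OF t, of "\<lambda>i j. A$i$j"] by blast
  note D = minor_cox_cell_point[OF r tau]
  have "y_fun j (cell_point r t) = r j * \<tau> j * (\<Prod>i\<in>{i. prec A i j}. (r i * \<tau> i) powi (A$i$j))"
    unfolding y_fun_def D ..
  also have "(\<Prod>i\<in>{i. prec A i j}. (r i * \<tau> i) powi (A$i$j)) = (\<Prod>i\<in>{..<j}. (r i * \<tau> i) powi (A$i$j))"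
    by (rule prod.mono_neutral_left) (auto simp: prec_def finite_subset[OF subset_UNIV])
  finally show ?thesis by (simp add: tau(2)[of j] power_int_mult_distrib prod.distrib)
qed

text \<open>Where it is non-zero, the coordinates of \<open>cell_generic_point\<close> are
  available.\<close>

definition cell_D :: "complex^'m^'m \<Rightarrow> complex" where
  "cell_D g = (\<Prod>i\<in>UNIV. f i g)"

lemma cell_D_nonzero: "cell_D g \<noteq> 0 \<longleftrightarrow> (\<forall>i. f i g \<noteq> 0)"
  by (simp add: cell_D_def)

lemma cell_values:
  assumes r: "\<forall>i. r i \<noteq> 0" and s: "\<forall>i. s i \<noteq> 0"
  obtains g where "g \<in> L" "cell_D g \<noteq> 0" "\<And>i. f i g = r i" "\<And>i. y_fun i g = s i"
proof -
  define q where "q j = r j * (\<Prod>i\<in>{..<j}. r i powi (A$i$j))" for j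
  have q: "q j \<noteq> 0" for j using r by (simp add: q_def finite_subset[OF subset_UNIV])
  define t where "t j = s j / q j" for j
  have t: "\<forall>i. t i \<noteq> 0" using s q by (simp add: t_def)
  show thesis
  proof (rule that[of "cell_point r t"])
    show "cell_point r t \<in> L" by (rule cell_point_in_cell[OF r t])
    show "f i (cell_point r t) = r i" for i by (rule f_cell_point[OF r])
    then show "cell_D (cell_point r t) \<noteq> 0" using r by (simp add: cell_D_nonzero)
    show "y_fun i (cell_point r t) = s i" for i
      unfolding y_fun_cell_point[OF r t] q_def[symmetric] using q by (simp add: t_def)
  qed
qed

lemma B_matrix_entry: "B_matrix A $ i $ j = (if i < j then - (A$i$j) else if j < i then A$i$j else 0)"
  using cartan_props(3)[of i j] cartan_props(3)[of j i] by (auto simp: B_matrix_def prec_def)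

lemma B_matrix_skew:
  obtains d :: "'i \<Rightarrow> real" where "\<forall>i. d i > 0" "\<forall>i j. d i * of_int (B_matrix A $ i $ j) = - (d j * of_int (B_matrix A $ j $ i))"
proof -
  have "cartan_matrix A" using scs unfolding simply_connected_semisimple_def by (rule conjunct1)
  then obtain d :: "'i \<Rightarrow> real" where "\<forall>i. d i > 0" "\<forall>i j. d i * of_int (A $ i $ j) = d j * of_int (A $ j $ i)"
    unfolding cartan_matrix_def by (elim conjE exE)
  then show thesis by (intro that[of d]) (auto simp: B_matrix_entry)
qed

text \<open>For \<open>i < j\<close> the entry of the exchange matrix is \<open>- (A$i$j)\<close>,
  which cancels the product in the value of \<open>y_fun\<close>. What remains are the
  \<open>i > j\<close>, with exponents \<open>A$i$j\<close>, as in \<open>hatq\<close>.\<close>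

lemma hat_cell_point:
  assumes r: "\<forall>i. r i \<noteq> 0" and t: "\<forall>i. t i \<noteq> 0"
  shows "y_hat r (\<lambda>j. y_fun j (cell_point r t)) (B_matrix A) j = t j * hatq r j"
proof -
  have "(\<Prod>i\<in>UNIV. r i powi (B_matrix A $ i $ j))
      = (\<Prod>i\<in>{..<j}. r i powi (B_matrix A $ i $ j)) * r j powi (B_matrix A $ j $ j) * (\<Prod>i\<in>{j<..}. r i powi (B_matrix A $ i $ j))"
    by (rule UNIV_split)
  also have "(\<Prod>i\<in>{..<j}. r i powi (B_matrix A $ i $ j)) = inverse (\<Prod>i\<in>{..<j}. r i powi (A$i$j))"
    unfolding prod_inversef[symmetric, unfolded o_def] by (intro prod.cong) (auto simp: B_matrix_entry power_int_minus)
  also have "(\<Prod>i\<in>{j<..}. r i powi (B_matrix A $ i $ j)) = (\<Prod>i\<in>{j<..}. r i powi (A$i$j))"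
    by (intro prod.cong) (auto simp: B_matrix_entry)
  finally show ?thesis
    unfolding y_hat_def y_fun_cell_point[OF r t] hatq_def
    using r by (simp add: B_matrix_entry finite_subset[OF subset_UNIV])
qed

text \<open>The expansion of the minor in the hatted coefficients holds at every point of the locus
  \<open>cell_D \<noteq> 0\<close>, since all of these are cell points. \<open>repr_unique\<close>
  turns it into an identity in the field, and the realization of all non-zero values
  (\<open>cell_values\<close>) gives the independence of Laurent monomials.\<close>

lemma constant_term_principal_minor:
  fixes \<iota> :: "(complex^'m^'m \<Rightarrow> complex) \<Rightarrow> 'f::field" and i :: 'i
  assumes ff: "is_function_field L \<iota>" and u: "u \<in> weyl_group A"
  defines "x \<equiv> (\<lambda>i. x_elem \<iota> \<Delta> (fund_weight i))" and "y \<equiv> y_elem A \<iota> \<Delta>"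
    and "z \<equiv> x_elem \<iota> \<Delta> (u (fund_weight i))"
  assumes z: "z \<in> cluster_variables y (principal_seed x (B_matrix A))"
  shows "constant_term (F_polynomial x y (B_matrix A) z) = 1"
proof -
  interpret F: function_field L \<iota> cell_D
  proof
    have "regular_on L (\<lambda>g. \<Prod>i\<in>UNIV. f i g)" by (intro regular_on_prod f_cell_regular)
    then show "regular_on L cell_D" unfolding cell_D_def .
    obtain g where "g \<in> L" "cell_D g \<noteq> 0" by (rule cell_values[of "\<lambda>_. 1" "\<lambda>_. 1"]) simp_all
    then show "\<exists>p\<in>L. cell_D p \<noteq> 0" ..
  qed (rule ff)
  let ?\<gamma> = "u (fund_weight i)" and ?B = "B_matrix A"
  have x: "F.repr (x j) (f j)" for j
    unfolding x_def x_elem_def by (rule F.repr_iota[OF f_cell_regular])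
  \<comment> \<open>The inverse of \<open>f j\<close> has the product of the other minors over
    \<open>cell_D\<close> as representative, so that all inverses share one denominator.\<close>
  have xi: "F.repr (\<iota> (\<lambda>g. \<Prod>k\<in>UNIV - {j}. f k g) / \<iota> cell_D) (\<lambda>p. inverse (f j p))" for j
  proof (rule F.reprI[of "\<lambda>g. \<Prod>k\<in>UNIV - {j}. f k g" _ 1])
    show "regular_on L (\<lambda>g. \<Prod>k\<in>UNIV - {j}. f k g)" by (intro regular_on_prod f_cell_regular)
    fix p assume "cell_D p \<noteq> 0"
    then have "f j p \<noteq> 0" by (simp add: cell_D_nonzero)
    then show "inverse (f j p) * cell_D p ^ 1 = (\<Prod>k\<in>UNIV - {j}. f k p)"
      unfolding cell_D_def by (subst prod.remove[of _ j]) auto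
  qed (use F.iota_D in simp)
  have y: "F.repr (y j) (y_fun j)" for j
  proof -
    have "y j = \<iota> (y_fun j)" unfolding y_def y_elem_def y_fun_def ..
    then show ?thesis using F.repr_iota[OF y_fun_regular] by simp
  qed
  have yi: "F.repr (\<iota> (\<lambda>g. inverse (y_fun j g))) (\<lambda>g. inverse (y_fun j g))" for j
    by (intro F.repr_iota regular_on_inverse y_fun_regular y_fun_nonzero)
  note X = F.repr_inverse[OF x xi] and Y = F.repr_inverse[OF y yi y_fun_nonzero]
  have xp: "F.repr (x j powi n) (\<lambda>p. f j p powi n)" for j n
    by (rule F.repr_powi[OF x X(2)]) (simp add: cell_D_nonzero)
  have yp: "F.repr (y j powi n) (\<lambda>p. y_fun j p powi n)" for j n
    by (rule F.repr_powi[OF y Y(2)])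
  have indep: "independent_monomials F.\<kappa> x y"
  proof (rule independent_monomials.intro)
    show "F.\<kappa> (a + b) = F.\<kappa> a + F.\<kappa> b" "F.\<kappa> (a * b) = F.\<kappa> a * F.\<kappa> b" "F.\<kappa> 1 = 1" for a b
      by (rule F.kappa_simps)+
    show "x i \<noteq> 0" for i by (rule X(1)) (simp add: cell_D_nonzero)
    show "y i \<noteq> 0" for i by (rule Y(1))
    fix E :: "'i expo set" and c e
    assume E: "finite E" "e \<in> E"
      and "(\<Sum>e\<in>E. F.\<kappa> (c e) * ((\<Prod>i\<in>UNIV. x i powi (fst e $ i)) * (\<Prod>i\<in>UNIV. y i powi (snd e $ i)))) = 0"
    moreover have "F.repr (\<Sum>e\<in>E. F.\<kappa> (c e) * ((\<Prod>i\<in>UNIV. x i powi (fst e $ i)) * (\<Prod>i\<in>UNIV. y i powi (snd e $ i))))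
      (\<lambda>p. \<Sum>e\<in>E. c e * ((\<Prod>i\<in>UNIV. f i p powi (fst e $ i)) * (\<Prod>i\<in>UNIV. y_fun i p powi (snd e $ i))))"
      by (intro F.repr_sum F.repr_mult F.repr_prod F.repr_const xp yp)
    ultimately have R: "F.repr 0 (\<lambda>p. \<Sum>e\<in>E. c e * ((\<Prod>i\<in>UNIV. f i p powi (fst e $ i)) * (\<Prod>i\<in>UNIV. y_fun i p powi (snd e $ i))))"
      by simp
    show "c e = 0"
    proof (rule laurent_monomials_independent[OF E])
      fix r s :: "'i \<Rightarrow> complex" assume "\<forall>i. r i \<noteq> 0" "\<forall>i. s i \<noteq> 0"
      then obtain g where g: "g \<in> L" "cell_D g \<noteq> 0" "\<And>i. f i g = r i" "\<And>i. y_fun i g = s i" by (rule cell_values) (rule that)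
      show "(\<Sum>e\<in>E. c e * ((\<Prod>i\<in>UNIV. r i powi (fst e $ i)) * (\<Prod>i\<in>UNIV. s i powi (snd e $ i)))) = 0"
        using F.repr_zero[OF R g(1,2)] unfolding g(3,4) .
    qed
  qed
  obtain c M where M: "finite M" "\<And>t. F_fun ?\<gamma> t = (\<Sum>m\<in>M. c m * monom_fun m t)" "F_fun ?\<gamma> (\<lambda>_. 0) = c 0" "0 \<in> M"
    by (rule polyf_expansion[OF F_fun_polyf[OF u, of i]]) (rule that)
  have hat: "F.repr (y_hat x y ?B j) (\<lambda>p. y_hat (\<lambda>i. f i p) (\<lambda>i. y_fun i p) ?B j)" for j
    unfolding y_hat_def by (intro F.repr_mult F.repr_prod y xp)
  have "F.repr (\<Sum>m\<in>M. F.\<kappa> (c m) * monom_fun m (y_hat x y ?B))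
      (\<lambda>p. \<Sum>m\<in>M. c m * monom_fun m (y_hat (\<lambda>i. f i p) (\<lambda>i. y_fun i p) ?B))"
    unfolding monom_fun_def by (intro F.repr_sum F.repr_mult F.repr_const F.repr_prod F.repr_power hat)
  then have rhs: "F.repr ((\<Prod>i\<in>UNIV. x i powi (?\<gamma> $ i)) * (\<Sum>m\<in>M. F.\<kappa> (c m) * monom_fun m (y_hat x y ?B)))
      (\<lambda>p. (\<Prod>i\<in>UNIV. f i p powi (?\<gamma> $ i)) * (\<Sum>m\<in>M. c m * monom_fun m (y_hat (\<lambda>i. f i p) (\<lambda>i. y_fun i p) ?B)))"
    by (intro F.repr_mult F.repr_prod xp)
  have lhs: "F.repr z (\<Delta> ?\<gamma> ?\<gamma>)"
    unfolding z_def x_elem_def by (rule F.repr_iota[OF cell_regular[OF u u]])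
  have "z = (\<Prod>i\<in>UNIV. x i powi (?\<gamma> $ i)) * (\<Sum>m\<in>M. F.\<kappa> (c m) * monom_fun m (y_hat x y ?B))"
  proof (rule F.repr_unique[OF lhs rhs])
    fix p assume p: "p \<in> L" "cell_D p \<noteq> 0"
    define r where "r j = f j p" for j
    have r: "\<forall>j. r j \<noteq> 0" using p(2) by (simp add: r_def cell_D_nonzero)
    then obtain t where t: "\<forall>j. t j \<noteq> 0" "p = cell_point r t"
      using cell_generic_point[OF p(1)] unfolding r_def by metis
    have h: "y_hat (\<lambda>i. f i p) (\<lambda>i. y_fun i p) ?B = (\<lambda>j. t j * hatq r j)"
      unfolding r_def[symmetric] using hat_cell_point[OF r t(1)] t(2) by (simp add: fun_eq_iff)
    show "\<Delta> ?\<gamma> ?\<gamma> p = (\<Prod>i\<in>UNIV. f i p powi (?\<gamma> $ i)) * (\<Sum>m\<in>M. c m * monom_fun m (y_hat (\<lambda>i. f i p) (\<lambda>i. y_fun i p) ?B))"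
      unfolding h M(2)[symmetric] unfolding r_def[symmetric] char_def[symmetric]
      using principal_minor_cell_point[OF u r, of i t] t(2) by simp
  qed
  moreover obtain d :: "'i \<Rightarrow> real" where "\<forall>i. d i > 0" "\<forall>i j. d i * of_int (?B $ i $ j) = - (d j * of_int (?B $ j $ i))"
    by (rule B_matrix_skew)
  moreover have "c 0 = 1" using M(3) F_fun_zero[OF u, of i] by simp
  ultimately show ?thesis using z M(1,4) by (intro independent_monomials.constant_term_F_polynomial[OF indep])
qed

end

theorem corollary1p13:
  fixes A :: "'i::{finite,linorder} int_matrix"
    and \<phi> :: "'i \<Rightarrow> complex^2^2 \<Rightarrow> complex^'m^'m"
    and \<Delta> :: "'i weight \<Rightarrow> 'i weight \<Rightarrow> complex^'m^'m \<Rightarrow> complex"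
    and \<iota> :: "(complex^'m^'m \<Rightarrow> complex) \<Rightarrow> 'f::field"
    and x y :: "'i \<Rightarrow> 'f"
    and \<gamma> :: "'i weight"
    and z :: 'f
  assumes "simply_connected_semisimple A \<phi>"
    and "generalized_minors A \<phi> \<Delta>"
    and "is_function_field (reduced_double_cell A \<phi>) \<iota>"
    and "x = (\<lambda>i. x_elem \<iota> \<Delta> (fund_weight i))"
    and "y = y_elem A \<iota> \<Delta>"
    and "\<gamma> \<in> Pi_c A"
    and "z \<in> cluster_variables y (principal_seed x (B_matrix A))"
    and "z = x_elem \<iota> \<Delta> \<gamma>"
  shows "constant_term (F_polynomial x y (B_matrix A) z) = 1"
proof -
  interpret minors A \<phi> \<Delta> by unfold_locales (rule assms)+
  obtain i m where \<gamma>: "\<gamma> = (coxeter_element A ^^ m) (fund_weight i)"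
    using assms(6) unfolding Pi_c_def by blast
  show ?thesis
    using constant_term_principal_minor[OF assms(3) coxeter_power_weyl[of m], of i] assms(7)
    unfolding assms(4,5,8) \<gamma> by blast
qed

end
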